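(* Let $\{Y_t\}_{t\ge0}$ be the stationary Lévy-driven Ornstein-Uhlenbeck process described in the context, with $\mu=\mathbb{E}L_1$, $\sigma^2=\mathrm{Var}(L_1)$ and $\lambda>0$, and let $d\ge0$ be fixed. Assume that there exists $\delta>0$ such that $\mathbb{E}|Y_0|^{4+\delta}<\infty$. Let $$\hat\theta_n=(\hat\mu_n,\hat\sigma_n^2,\hat\lambda_{2,n})^T,\qquad \theta_o=(\mu,\sigma^2,\lambda)^T,$$ with the estimators $\hat\mu_n,\hat\sigma^2_n,\hat\lambda_{2,n}$, the map $H$ and the matrix $\Sigma$ defined in the context. Then, as $n\to\infty$, $$\sqrt n\,(\hat\theta_n-\theta_o)\stackrel{\mathfrak D}{\longrightarrow}\left[\frac{\partial H(\mu,\gamma^T)}{\partial(\mu,\gamma^T)}\right]N(0,\Sigma),$$ where $\stackrel{\mathfrak D}{\to}$ is convergence in distribution, $N(0,\Sigma)$ is the multivariate normal distribution with mean $0$ and variance-covariance matrix $\Sigma$, and the bracket is the Jacobian matrix of $H$ at $(\mu,\gamma^T)=(\mu,\gamma(0),\dots,\gamma(d))$.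
   Context: Setting: $\{L_t\}_{t\ge0}$ is a one-dimensional càdlàg Lévy process whose Lévy measure $F_L$ satisfies, for some constant $M>0$, $\int_{|x|>1}e^{vx}F_L(dx)<\infty$ for every real $|v|\le M$. Put $\mu=\mathbb{E}L_1$, $\sigma^2=\mathrm{Var}(L_1)$. For $\lambda>0$, the process $Y$ is $$Y_t=e^{-\lambda t}Y_0+e^{-\lambda t}\int_0^{\lambda t}e^{s}\,dL_s,\qquad t\ge0,$$ where $Y_0$ is independent of $\{L_t\}_{t\ge0}$ and has the same distribution as $\int_0^\infty e^{-s}dL_s$ (so $Y$ is strictly stationary). Theoretical quantities: for integers $h\ge0$, $\gamma(h)=\mathrm{cov}(Y_{t+h},Y_t)=\frac{\sigma^2}{2}e^{-\lambda h}$; $\gamma=(\gamma(0),\dots,\gamma(d))^T$; $\sigma_Y^2=\gamma(0)=\mathrm{Var}(Y_0)=\sigma^2/2$. Estimators, from the observations $Y_1,\dots,Y_n$ at integer times: $\hat\mu_n=\frac1n\sum_{i=1}^nY_i$; for $h\in\{0,\dots,d\}$, $\hat\gamma_n(h)=\frac1n\sum_{i=1}^{n-h}(Y_{i+h}-\hat\mu_n)(Y_i-\hat\mu_n)$ and $\hat\rho_n(h)=\hat\gamma_n(h)/\hat\gamma_n(0)$; $\hat\sigma_n^2=\frac2n\sum_{i=1}^n(Y_i-\hat\mu_n)^2$; $\hat\lambda_{2,n}=\operatorname{argmin}_{\lambda}\sum_{h=1}^d(\hat\rho_n(h)-e^{-\lambda h})^2$, the estimator being defined to be $0$ if this minimization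 gives a negative value. Maps: $G:\mathbb{R}\times[0,\infty)^2\to\mathbb{R}\times[0,\infty)^2$ is given by $G(\mu,\sigma_Y^2,\lambda)=(\mu,2\sigma_Y^2,\lambda)$ if $\lambda>0$ and $G(\mu,\sigma_Y^2,\lambda)=(\mu,2\sigma_Y^2,0)$ if $\lambda\le0$. With $\mathbb{R}_+$ the nonnegative half-line, $F:\mathbb{R}_+^{d+1}\to\mathbb{R}_+$ is given by $F(\rho)=\operatorname{argmin}_{\lambda}\sum_{h=0}^d(\rho(h)-e^{-\lambda h})^2$ for $\rho=(\rho(0),\dots,\rho(d))$, so that $F(\hat\rho_n)=\hat\lambda_{2,n}$ for $\hat\rho_n=(\hat\rho_n(0),\dots,\hat\rho_n(d))$ (the $h=0$ term vanishes there). Finally $H:\mathbb{R}^{d+2}\to\mathbb{R}\times[0,\infty)^2$ is given by $H(\mu,\gamma^T)=G(\mu,\sigma_Y^2,F(\rho))$, where $\sigma_Y^2=\gamma(0)$ and $\rho(h)=\gamma(h)/\gamma(0)$ for $h=0,\dots,d$. Matrix $\Sigma$: let $Z_i=\bigl(Y_i,(Y_i-\mu)^2,(Y_{i+1}-\mu)(Y_i-\mu),\dots,(Y_{i+d}-\mu)(Y_i-\mu)\bigr)^T$, with $k$-th component $Z_i^k$. Then $\Sigma=[\sigma_{k,l}]_{k,l=1}^{d+2}$ with $$\sigma_{k,l}=\mathrm{cov}(Z_1^k,Z_1^l)+2\sum_{i=1}^\infty\mathrm{cov}(Z_1^k,Z_{i+1}^l).$$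
   Formalization: d≥1 is assumed, since for d=0 the argmin defining the estimator of λ is of an empty sum; σ²>0 is assumed, since otherwise ρ=0/0; Σ as printed need not be symmetric, so N(0,Σ) means the Gaussian law with characteristic function exp(-aᵀΣa/2), i.e. covariance the symmetric part of Σ. *)

theory Defs
  imports "HOL-Probability.Probability"
begin

section \<open>Levy processes and integrals driven by them\<close>

text \<open>Stochastic continuity need not be required separately: it follows from right-continuity of
  the paths together with stationarity of the increments.\<close>

definition levy_process :: "'a measure \<Rightarrow> (real \<Rightarrow> 'a \<Rightarrow> real) \<Rightarrow> bool" where
  "levy_process M L \<longleftrightarrow>
     (\<forall>t\<ge>0. L t \<in> borel_measurable M) \<and>
     (AE \<omega> in M. L 0 \<omega> = 0) \<and>
     (\<forall>n t. 0 \<le> t 0 \<and> (\<forall>i<n. t i \<le> t (Suc i)) \<longrightarrow>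
        prob_space.indep_vars M (\<lambda>_. borel) (\<lambda>i \<omega>. L (t (Suc i)) \<omega> - L (t i) \<omega>) {..<n::nat}) \<and>
     (\<forall>s\<ge>0. \<forall>t\<ge>0. distr M borel (\<lambda>\<omega>. L (s + t) \<omega> - L s \<omega>) = distr M borel (L t)) \<and>
     (AE \<omega> in M.
        (\<forall>t\<ge>0. ((\<lambda>s. L s \<omega>) \<longlongrightarrow> L t \<omega>) (at_right t)) \<and>
        (\<forall>t>0. \<exists>l. ((\<lambda>s. L s \<omega>) \<longlongrightarrow> l) (at_left t)))"

text \<open>The Levy-Khintchine exponent with drift \<open>b\<close>, Gaussian variance \<open>c\<close> and Levy measure
  \<open>F\<close>, for the truncation function \<open>x \<mapsto> x 1(|x| \<le> 1)\<close>.\<close>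

definition levy_exponent :: "real \<Rightarrow> real \<Rightarrow> real measure \<Rightarrow> real \<Rightarrow> complex" where
  "levy_exponent b c F u =
     \<i> * complex_of_real (b * u) - complex_of_real (c * u\<^sup>2 / 2)
     + (CLINT x|F. iexp (u * x) - 1 - \<i> * complex_of_real (u * x * indicator {-1..1} x))"

definition has_levy_triplet ::
  "'a measure \<Rightarrow> (real \<Rightarrow> 'a \<Rightarrow> real) \<Rightarrow> real \<Rightarrow> real \<Rightarrow> real measure \<Rightarrow> bool" where
  "has_levy_triplet M L b c F \<longleftrightarrow>
     0 \<le> c \<and> sets F = sets borel \<and> emeasure F {0} = 0 \<and> integrable F (\<lambda>x. min 1 (x\<^sup>2)) \<and>
     (\<forall>t\<ge>0. \<forall>u. char (distr M borel (L t)) u = exp (complex_of_real t * levy_exponent b c F u))"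

text \<open>\<open>X\<close> is the stochastic integral of the deterministic continuous integrand \<open>f\<close> against \<open>L\<close> over
  \<open>[a, b]\<close>: the limit in probability of the left-endpoint Riemann sums
  as the mesh of the partition tends to \<open>0\<close>.\<close>

definition has_levy_integral ::
  "'a measure \<Rightarrow> (real \<Rightarrow> 'a \<Rightarrow> real) \<Rightarrow> (real \<Rightarrow> real) \<Rightarrow> real \<Rightarrow> real \<Rightarrow> ('a \<Rightarrow> real) \<Rightarrow> bool" where
  "has_levy_integral M L f a b X \<longleftrightarrow>
     X \<in> borel_measurable M \<and>
     (\<forall>\<epsilon>>0. \<exists>\<eta>>0. \<forall>(n::nat) t.
        t 0 = a \<and> t n = b \<and> (\<forall>i<n. t i \<le> t (Suc i) \<and> t (Suc i) - t i < \<eta>) \<longrightarrow>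
        measure M {\<omega> \<in> space M.
          \<bar>(\<Sum>i<n. f (t i) * (L (t (Suc i)) \<omega> - L (t i) \<omega>)) - X \<omega>\<bar> > \<epsilon>} < \<epsilon>)"

definition has_levy_integral_inf ::
  "'a measure \<Rightarrow> (real \<Rightarrow> 'a \<Rightarrow> real) \<Rightarrow> (real \<Rightarrow> real) \<Rightarrow> real \<Rightarrow> ('a \<Rightarrow> real) \<Rightarrow> bool" where
  "has_levy_integral_inf M L f a X \<longleftrightarrow>
     X \<in> borel_measurable M \<and>
     (\<exists>I. (\<forall>T\<ge>a. has_levy_integral M L f a T (I T)) \<and>
       (\<forall>\<epsilon>>0. ((\<lambda>T. measure M {\<omega> \<in> space M. \<bar>I T \<omega> - X \<omega>\<bar> > \<epsilon>}) \<longlongrightarrow> 0) at_top))"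

definition stationary_levy_OU ::
  "'a measure \<Rightarrow> (real \<Rightarrow> 'a \<Rightarrow> real) \<Rightarrow> real \<Rightarrow> (real \<Rightarrow> 'a \<Rightarrow> real) \<Rightarrow> bool" where
  "stationary_levy_OU M L lam Y \<longleftrightarrow>
     (\<forall>t\<ge>0. Y t \<in> borel_measurable M) \<and>
     prob_space.indep_set M
       (sets (vimage_algebra (space M) (Y 0) borel))
       (sets (vimage_algebra (space M) (\<lambda>\<omega>. \<lambda>t\<in>{0..}. L t \<omega>) (Pi\<^sub>M {0..} (\<lambda>_. borel)))) \<and>
     (\<exists>X. has_levy_integral_inf M L (\<lambda>s. exp (- s)) 0 X \<and>
          distr M borel (Y 0) = distr M borel X) \<and>
     (\<forall>t\<ge>0. \<exists>I. has_levy_integral M L exp 0 (lam * t) I \<and>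
        (AE \<omega> in M. Y t \<omega> = exp (- lam * t) * Y 0 \<omega> + exp (- lam * t) * I \<omega>))"

section \<open>Moments, Gaussian vectors, convergence in distribution\<close>

definition mean :: "'a measure \<Rightarrow> ('a \<Rightarrow> real) \<Rightarrow> real" where
  "mean M X = (\<integral>\<omega>. X \<omega> \<partial>M)"

definition cov :: "'a measure \<Rightarrow> ('a \<Rightarrow> real) \<Rightarrow> ('a \<Rightarrow> real) \<Rightarrow> real" where
  "cov M X Y = (\<integral>\<omega>. (X \<omega> - mean M X) * (Y \<omega> - mean M Y) \<partial>M)"

text \<open>\<open>N\<close> is the law \<open>N(m, S)\<close> of a Gaussian vector indexed by the finite set \<open>I\<close>, given
  by its characteristic function \<open>a \<mapsto> exp (i a\<^sup>Tm - a\<^sup>TSa / 2)\<close>. Singular \<open>S\<close> is allowed. Only the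
  symmetric part of \<open>S\<close> enters; for symmetric \<open>S\<close> this is the normal law with covariance matrix \<open>S\<close>.\<close>

definition multivariate_normal ::
  "nat set \<Rightarrow> (nat \<Rightarrow> real) \<Rightarrow> (nat \<Rightarrow> nat \<Rightarrow> real) \<Rightarrow> (nat \<Rightarrow> real) measure \<Rightarrow> bool" where
  "multivariate_normal I m S N \<longleftrightarrow>
     prob_space N \<and> sets N = sets (Pi\<^sub>M I (\<lambda>_. borel)) \<and>
     (\<forall>a. (CLINT x|N. iexp (\<Sum>k\<in>I. a k * x k)) =
        exp (\<i> * complex_of_real (\<Sum>k\<in>I. a k * m k)
             - complex_of_real ((\<Sum>k\<in>I. \<Sum>l\<in>I. a k * S k l * a l) / 2)))"

text \<open>The library's \<open>weak_conv_m\<close> covers only laws on the real line.\<close>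

definition weak_converges :: "(nat \<Rightarrow> 'b::topological_space measure) \<Rightarrow> 'b measure \<Rightarrow> bool" where
  "weak_converges P Q \<longleftrightarrow>
     (\<forall>g :: 'b \<Rightarrow> real. continuous_on UNIV g \<and> bounded (range g) \<longrightarrow>
        (\<lambda>n. \<integral>x. g x \<partial>P n) \<longlonglongrightarrow> (\<integral>x. g x \<partial>Q))"

text \<open>\<open>J\<close> is the \<open>3 \<times> n\<close> matrix of partial derivatives at \<open>p\<close> of a function of \<open>n\<close> variables.\<close>

definition has_jacobian ::
  "nat \<Rightarrow> ((nat \<Rightarrow> real) \<Rightarrow> real^3) \<Rightarrow> (nat \<Rightarrow> real) \<Rightarrow> (3 \<Rightarrow> nat \<Rightarrow> real) \<Rightarrow> bool" where
  "has_jacobian n H p J \<longleftrightarrow>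
     (\<forall>j. \<forall>k<n. ((\<lambda>t. H (p(k := t)) $ j) has_real_derivative J j k) (at (p k)))"

section \<open>Estimators\<close>

definition mu_hat :: "(real \<Rightarrow> 'a \<Rightarrow> real) \<Rightarrow> nat \<Rightarrow> 'a \<Rightarrow> real" where
  "mu_hat Y n \<omega> = (1 / real n) * (\<Sum>i=1..n. Y (real i) \<omega>)"

definition gamma_hat :: "(real \<Rightarrow> 'a \<Rightarrow> real) \<Rightarrow> nat \<Rightarrow> nat \<Rightarrow> 'a \<Rightarrow> real" where
  "gamma_hat Y n h \<omega> = (1 / real n) *
     (\<Sum>i=1..n-h. (Y (real (i + h)) \<omega> - mu_hat Y n \<omega>) * (Y (real i) \<omega> - mu_hat Y n \<omega>))"

definition rho_hat :: "(real \<Rightarrow> 'a \<Rightarrow> real) \<Rightarrow> nat \<Rightarrow> nat \<Rightarrow> 'a \<Rightarrow> real" where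
  "rho_hat Y n h \<omega> = gamma_hat Y n h \<omega> / gamma_hat Y n 0 \<omega>"

definition sigma2_hat :: "(real \<Rightarrow> 'a \<Rightarrow> real) \<Rightarrow> nat \<Rightarrow> 'a \<Rightarrow> real" where
  "sigma2_hat Y n \<omega> = (2 / real n) * (\<Sum>i=1..n. (Y (real i) \<omega> - mu_hat Y n \<omega>)\<^sup>2)"

text \<open>For some samples the least-squares criterion has several minimizers, or none (its infimum may
  be approached only as \<open>l \<rightarrow> \<infinity>\<close>). A least-squares estimator is therefore any choice of random
  variables whose value is a minimizer, replaced by \<open>0\<close> if negative, whenever a minimizer exists.\<close>

definition is_lambda2_hat ::
  "'a measure \<Rightarrow> (real \<Rightarrow> 'a \<Rightarrow> real) \<Rightarrow> nat \<Rightarrow> (nat \<Rightarrow> 'a \<Rightarrow> real) \<Rightarrow> bool" where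
  "is_lambda2_hat M Y d lamhat \<longleftrightarrow>
     (\<forall>n. lamhat n \<in> borel_measurable M) \<and>
     (\<forall>n. \<forall>\<omega>\<in>space M.
        let Q = (\<lambda>l. \<Sum>h=1..d. (rho_hat Y n h \<omega> - exp (- l * real h))\<^sup>2) in
        (\<exists>l. is_arg_min Q (\<lambda>_. True) l) \<longrightarrow>
        (\<exists>l. is_arg_min Q (\<lambda>_. True) l \<and> lamhat n \<omega> = (if l < 0 then 0 else l)))"

section \<open>The maps \<open>G\<close>, \<open>F\<close>, \<open>H\<close> and the matrix \<open>\<Sigma>\<close>\<close>

definition G_map :: "real \<Rightarrow> real \<Rightarrow> real \<Rightarrow> real^3" where
  "G_map m s l = (if l > 0 then vector [m, 2 * s, l] else vector [m, 2 * s, 0])"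

text \<open>Like the estimator, \<open>F\<close> replaces a negative minimizer by \<open>0\<close>.\<close>

definition F_map :: "nat \<Rightarrow> (nat \<Rightarrow> real) \<Rightarrow> real" where
  "F_map d \<rho> =
     (let l = (ARG_MIN (\<lambda>l. \<Sum>h=0..d. (\<rho> h - exp (- l * real h))\<^sup>2) l. True)
      in if l < 0 then 0 else l)"

text \<open>Points of \<open>\<real>\<^sup>d\<^sup>+\<^sup>2\<close> are functions on \<open>{..<d+2}\<close>: component \<open>0\<close> is the mean and
  component \<open>Suc h\<close> belongs to lag \<open>h\<close>.\<close>

definition H_map :: "nat \<Rightarrow> (nat \<Rightarrow> real) \<Rightarrow> real^3" where
  "H_map d x = G_map (x 0) (x 1) (F_map d (\<lambda>h. x (Suc h) / x 1))"

definition OU_point :: "'a measure \<Rightarrow> (real \<Rightarrow> 'a \<Rightarrow> real) \<Rightarrow> real \<Rightarrow> nat \<Rightarrow> real" where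
  "OU_point M Y \<mu> k = (case k of 0 \<Rightarrow> \<mu> | Suc h \<Rightarrow> cov M (Y (real h)) (Y 0))"

definition Z_vec :: "(real \<Rightarrow> 'a \<Rightarrow> real) \<Rightarrow> real \<Rightarrow> nat \<Rightarrow> nat \<Rightarrow> 'a \<Rightarrow> real" where
  "Z_vec Y \<mu> i k \<omega> =
     (case k of 0 \<Rightarrow> Y (real i) \<omega>
      | Suc h \<Rightarrow> (Y (real (i + h)) \<omega> - \<mu>) * (Y (real i) \<omega> - \<mu>))"

text \<open>This matrix need not be symmetric (entries \<open>(0,1)\<close> and \<open>(1,0)\<close> differ if the third cumulant of
  \<open>L\<close> is nonzero). Its symmetric part, the only part \<open>multivariate_normal\<close> depends on, is
  the long-run covariance matrix of \<open>Z\<close>.\<close>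

definition Sigma_mat :: "'a measure \<Rightarrow> (real \<Rightarrow> 'a \<Rightarrow> real) \<Rightarrow> real \<Rightarrow> nat \<Rightarrow> nat \<Rightarrow> real" where
  "Sigma_mat M Y \<mu> k l =
     cov M (Z_vec Y \<mu> 1 k) (Z_vec Y \<mu> 1 l)
     + 2 * (\<Sum>i. cov M (Z_vec Y \<mu> 1 k) (Z_vec Y \<mu> (Suc i + 1) l))"

end

theory Submission
  imports Defs
begin

text \<open>
  Sampled at integer times, \<open>Y - \<mu>\<close> is a stationary autoregression \<open>y\<^sub>k\<^sub>+\<^sub>1 = a y\<^sub>k + x\<^sub>k\<close> with
  \<open>a = exp (-\<lambda>)\<close> and innovations that are iid and independent of \<open>y\<^sub>0\<close>: independence survives the
  limit in probability of Riemann sums over a uniform mesh, and the law of \<open>Y\<^sub>0\<close> is invariant because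
  its characteristic function factors as \<open>\<Phi>(u) = \<Psi>(u) \<Phi>(a u)\<close>, where \<open>\<Psi>\<close> belongs to an
  innovation; the two reverse the order of integration, \<open>exp s\<close> against \<open>exp (-s)\<close>, which is
  invisible in law. Up to a telescoping term of bounded variance, every linear combination of the
  centred \<open>Z\<close> is a martingale difference, linear in \<open>x\<^sub>k\<close>, \<open>x\<^sub>k\<^sup>2\<close> and the products of \<open>x\<^sub>k\<close> with
  the last \<open>d + 1\<close> values of \<open>y\<close>; its conditional variance is asymptotically uncorrelated with the
  past because polynomials of degree two in \<open>y\<close> are contracted by powers of \<open>a\<close>. This gives the
  central limit theorem on the level of characteristic functions. For the delta method no uniqueness
  of the least-squares minimizer is needed: any minimizer is close to \<open>\<lambda>\<close> since the lag-one term
  bounds the criterion from below, and then the first-order condition fixes it up to a quadratic error.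
\<close>

section \<open>Smallness and boundedness in probability\<close>

text \<open>The integrals against \<open>L\<close> are limits in probability, which gives no
  isometry and no convergence of moments. Laws are therefore compared through characteristic
  functions, and the mean and variance of \<open>Y 0\<close> come from a second-order expansion of
  the Levy exponent at 0. A product of two values of \<open>Y\<close> has moments of order 2 +
  \<delta>/2. This is what the Lyapunov-type remainder of the central limit theorem consumes, and it
  is where the order 4 + \<delta> enters. The variance of the martingale is not compared with
  \<open>Sigma_mat\<close> entry by entry. It and the quadratic form of \<open>Sigma_mat\<close> are
  both the growth rate of the variance of the same partial sums, hence equal; this also shows that
  the form is nonnegative, so that the normal law exists. \<open>F_map\<close> returns an
  unspecified minimizer. It is differentiable at the true point because all minimizers for nearby
  data share one first-order expansion, with constants uniform in the data. That expansion is used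
  twice: along curves for the Jacobian, and at the sample autocorrelations for the
  estimator.\<close>

context prob_space
begin

text \<open>Convergence to 0 in probability. Measurability is built in, so that the closure rules
  below carry it along.\<close>

definition small_in_prob :: "(nat \<Rightarrow> 'a \<Rightarrow> real) \<Rightarrow> bool" where
  "small_in_prob X \<longleftrightarrow> (\<forall>n. X n \<in> borel_measurable M) \<and>
     (\<forall>\<epsilon>>0. (\<lambda>n. prob {\<omega> \<in> space M. \<epsilon> < \<bar>X n \<omega>\<bar>}) \<longlonglongrightarrow> 0)"

text \<open>Tightness, asked only of large \<open>n\<close>: initial terms are irrelevant to limits,
  and a sequence that is small in probability is then tight with any radius.\<close>

definition bounded_in_prob :: "(nat \<Rightarrow> 'a \<Rightarrow> real) \<Rightarrow> bool" where
  "bounded_in_prob X \<longleftrightarrow> (\<forall>n. X n \<in> borel_measurable M) \<and>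
     (\<forall>\<eta>>0. \<exists>R>0. \<forall>\<^sub>F n in sequentially. prob {\<omega> \<in> space M. R < \<bar>X n \<omega>\<bar>} \<le> \<eta>)"

lemma small_in_probI:
  assumes "\<And>n. X n \<in> borel_measurable M"
    and "\<And>\<epsilon> \<eta>. \<epsilon> > 0 \<Longrightarrow> \<eta> > 0 \<Longrightarrow> \<forall>\<^sub>F n in sequentially. prob {\<omega> \<in> space M. \<epsilon> < \<bar>X n \<omega>\<bar>} \<le> \<eta>"
  shows "small_in_prob X"
  unfolding small_in_prob_def
proof (intro conjI allI impI)
  fix \<epsilon> :: real assume "\<epsilon> > 0"
  show "(\<lambda>n. prob {\<omega> \<in> space M. \<epsilon> < \<bar>X n \<omega>\<bar>}) \<longlonglongrightarrow> 0"
  proof (rule tendstoI)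
    fix r :: real assume "r > 0"
    have "\<forall>\<^sub>F n in sequentially. prob {\<omega> \<in> space M. \<epsilon> < \<bar>X n \<omega>\<bar>} \<le> r/2"
      by (rule assms(2)) (use \<open>\<epsilon> > 0\<close> \<open>r > 0\<close> in auto)
    then show "\<forall>\<^sub>F n in sequentially. dist (prob {\<omega> \<in> space M. \<epsilon> < \<bar>X n \<omega>\<bar>}) 0 < r"
      by eventually_elim (use \<open>r > 0\<close> in auto)
  qed
qed (use assms in auto)

lemma small_in_probD:
  assumes "small_in_prob X" "\<epsilon> > 0" "\<eta> > 0"
  shows "\<forall>\<^sub>F n in sequentially. prob {\<omega> \<in> space M. \<epsilon> < \<bar>X n \<omega>\<bar>} \<le> \<eta>"
proof -
  have "(\<lambda>n. prob {\<omega> \<in> space M. \<epsilon> < \<bar>X n \<omega>\<bar>}) \<longlonglongrightarrow> 0"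
    using assms by (auto simp: small_in_prob_def)
  from order_tendstoD(2)[OF this, of \<eta>] show ?thesis
    using assms by (auto elim: eventually_mono)
qed

lemma small_in_prob_measurable: "small_in_prob X \<Longrightarrow> X n \<in> borel_measurable M"
  by (auto simp: small_in_prob_def)

lemma bounded_in_prob_measurable: "bounded_in_prob X \<Longrightarrow> X n \<in> borel_measurable M"
  by (auto simp: bounded_in_prob_def)

lemma prob_Collect_le_add:
  assumes "{\<omega> \<in> space M. Q \<omega>} \<in> events" "{\<omega> \<in> space M. R \<omega>} \<in> events"
    and "\<And>\<omega>. \<omega> \<in> space M \<Longrightarrow> P \<omega> \<Longrightarrow> Q \<omega> \<or> R \<omega>"
  shows "prob {\<omega> \<in> space M. P \<omega>} \<le> prob {\<omega> \<in> space M. Q \<omega>} + prob {\<omega> \<in> space M. R \<omega>}"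
proof -
  have "prob {\<omega> \<in> space M. P \<omega>} \<le> prob ({\<omega> \<in> space M. Q \<omega>} \<union> {\<omega> \<in> space M. R \<omega>})"
    by (rule finite_measure_mono) (use assms in auto)
  also have "\<dots> \<le> prob {\<omega> \<in> space M. Q \<omega>} + prob {\<omega> \<in> space M. R \<omega>}"
    by (rule measure_Un_le) (use assms in auto)
  finally show ?thesis .
qed

text \<open>The bound on \<open>Y\<close> is needed only where \<open>U\<close> is small, and the
  complement has vanishing probability. Expansions valid merely near the true parameter can thus be
  used for random arguments.\<close>

lemma small_in_prob_dominated:
  assumes X: "small_in_prob X" and U: "small_in_prob U" and "r > 0"
    and m: "\<And>n. Y n \<in> borel_measurable M"
    and le: "\<And>n \<omega>. n \<ge> n0 \<Longrightarrow> \<omega> \<in> space M \<Longrightarrow> \<bar>U n \<omega>\<bar> \<le> r \<Longrightarrow> \<bar>Y n \<omega>\<bar> \<le> \<bar>X n \<omega>\<bar>"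
  shows "small_in_prob Y"
proof (rule small_in_probI[OF m])
  fix \<epsilon> \<eta> :: real assume *: "\<epsilon> > 0" "\<eta> > 0"
  have [measurable]: "X n \<in> borel_measurable M" "U n \<in> borel_measurable M" for n
    using X U by (auto intro: small_in_prob_measurable)
  have "\<forall>\<^sub>F n in sequentially. prob {\<omega> \<in> space M. \<epsilon> < \<bar>X n \<omega>\<bar>} \<le> \<eta>/2"
    "\<forall>\<^sub>F n in sequentially. prob {\<omega> \<in> space M. r < \<bar>U n \<omega>\<bar>} \<le> \<eta>/2"
    using * \<open>r > 0\<close> by (intro small_in_probD X U; simp)+
  with eventually_ge_at_top[of n0]
  show "\<forall>\<^sub>F n in sequentially. prob {\<omega> \<in> space M. \<epsilon> < \<bar>Y n \<omega>\<bar>} \<le> \<eta>"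
  proof eventually_elim
    case (elim n)
    have "prob {\<omega> \<in> space M. \<epsilon> < \<bar>Y n \<omega>\<bar>} \<le>
       prob {\<omega> \<in> space M. \<epsilon> < \<bar>X n \<omega>\<bar>} + prob {\<omega> \<in> space M. r < \<bar>U n \<omega>\<bar>}"
    proof (rule prob_Collect_le_add)
      fix \<omega> assume "\<omega> \<in> space M" "\<epsilon> < \<bar>Y n \<omega>\<bar>"
      then show "\<epsilon> < \<bar>X n \<omega>\<bar> \<or> r < \<bar>U n \<omega>\<bar>"
        using le[OF elim(1), of \<omega>] by linarith
    qed simp_all
    with elim show ?case by auto
  qed
qed

lemma small_in_prob_zero: "small_in_prob (\<lambda>n \<omega>. 0)"
  by (rule small_in_probI) auto

lemma small_in_prob_mono:
  assumes X: "small_in_prob X" and m: "\<And>n. Y n \<in> borel_measurable M"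
    and le: "\<And>n \<omega>. n \<ge> n0 \<Longrightarrow> \<omega> \<in> space M \<Longrightarrow> \<bar>Y n \<omega>\<bar> \<le> \<bar>X n \<omega>\<bar>"
  shows "small_in_prob Y"
  by (rule small_in_prob_dominated[OF X small_in_prob_zero, of 1]) (use m le in auto)

lemma small_in_prob_add:
  assumes X: "small_in_prob X" and Y: "small_in_prob Y"
  shows "small_in_prob (\<lambda>n \<omega>. X n \<omega> + Y n \<omega>)"
proof (rule small_in_probI)
  have [measurable]: "X n \<in> borel_measurable M" "Y n \<in> borel_measurable M" for n
    using X Y by (auto intro: small_in_prob_measurable)
  show "(\<lambda>\<omega>. X n \<omega> + Y n \<omega>) \<in> borel_measurable M" for n by measurable
  fix \<epsilon> \<eta> :: real assume *: "\<epsilon> > 0" "\<eta> > 0"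
  have "\<forall>\<^sub>F n in sequentially. prob {\<omega> \<in> space M. \<epsilon>/2 < \<bar>X n \<omega>\<bar>} \<le> \<eta>/2"
    "\<forall>\<^sub>F n in sequentially. prob {\<omega> \<in> space M. \<epsilon>/2 < \<bar>Y n \<omega>\<bar>} \<le> \<eta>/2"
    using * by (intro small_in_probD X Y; simp)+
  then show "\<forall>\<^sub>F n in sequentially. prob {\<omega> \<in> space M. \<epsilon> < \<bar>X n \<omega> + Y n \<omega>\<bar>} \<le> \<eta>"
  proof eventually_elim
    case (elim n)
    have "prob {\<omega> \<in> space M. \<epsilon> < \<bar>X n \<omega> + Y n \<omega>\<bar>} \<le>
       prob {\<omega> \<in> space M. \<epsilon>/2 < \<bar>X n \<omega>\<bar>} + prob {\<omega> \<in> space M. \<epsilon>/2 < \<bar>Y n \<omega>\<bar>}"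
      by (rule prob_Collect_le_add) (simp, simp, linarith)
    with elim show ?case by auto
  qed
qed

lemma bounded_in_prob_add:
  assumes X: "bounded_in_prob X" and Y: "bounded_in_prob Y"
  shows "bounded_in_prob (\<lambda>n \<omega>. X n \<omega> + Y n \<omega>)"
  unfolding bounded_in_prob_def
proof (intro conjI allI impI)
  have [measurable]: "X n \<in> borel_measurable M" "Y n \<in> borel_measurable M" for n
    using X Y by (auto intro: bounded_in_prob_measurable)
  show "(\<lambda>\<omega>. X n \<omega> + Y n \<omega>) \<in> borel_measurable M" for n by measurable
  fix \<eta> :: real assume *: "\<eta> > 0"
  obtain R S where RS: "R > 0" "S > 0"
    "\<forall>\<^sub>F n in sequentially. prob {\<omega> \<in> space M. R < \<bar>X n \<omega>\<bar>} \<le> \<eta>/2"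
    "\<forall>\<^sub>F n in sequentially. prob {\<omega> \<in> space M. S < \<bar>Y n \<omega>\<bar>} \<le> \<eta>/2"
    using X Y * unfolding bounded_in_prob_def by (meson half_gt_zero)
  have "\<forall>\<^sub>F n in sequentially. prob {\<omega> \<in> space M. R + S < \<bar>X n \<omega> + Y n \<omega>\<bar>} \<le> \<eta>"
    using RS(3,4)
  proof eventually_elim
    case (elim n)
    have "prob {\<omega> \<in> space M. R + S < \<bar>X n \<omega> + Y n \<omega>\<bar>} \<le>
       prob {\<omega> \<in> space M. R < \<bar>X n \<omega>\<bar>} + prob {\<omega> \<in> space M. S < \<bar>Y n \<omega>\<bar>}"
      by (rule prob_Collect_le_add) (simp, simp, linarith)
    with elim show ?case by auto
  qed
  then show "\<exists>R>0. \<forall>\<^sub>F n in sequentially. prob {\<omega> \<in> space M. R < \<bar>X n \<omega> + Y n \<omega>\<bar>} \<le> \<eta>"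
    using RS by (intro exI[of _ "R + S"]) auto
qed

lemma bounded_in_prob_mult:
  assumes X: "bounded_in_prob X" and Y: "bounded_in_prob Y"
  shows "bounded_in_prob (\<lambda>n \<omega>. X n \<omega> * Y n \<omega>)"
  unfolding bounded_in_prob_def
proof (intro conjI allI impI)
  have [measurable]: "X n \<in> borel_measurable M" "Y n \<in> borel_measurable M" for n
    using X Y by (auto intro: bounded_in_prob_measurable)
  show "(\<lambda>\<omega>. X n \<omega> * Y n \<omega>) \<in> borel_measurable M" for n by measurable
  fix \<eta> :: real assume *: "\<eta> > 0"
  obtain R S where RS: "R > 0" "S > 0"
    "\<forall>\<^sub>F n in sequentially. prob {\<omega> \<in> space M. R < \<bar>X n \<omega>\<bar>} \<le> \<eta>/2"
    "\<forall>\<^sub>F n in sequentially. prob {\<omega> \<in> space M. S < \<bar>Y n \<omega>\<bar>} \<le> \<eta>/2"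
    using X Y * unfolding bounded_in_prob_def by (meson half_gt_zero)
  have "\<forall>\<^sub>F n in sequentially. prob {\<omega> \<in> space M. R * S < \<bar>X n \<omega> * Y n \<omega>\<bar>} \<le> \<eta>"
    using RS(3,4)
  proof eventually_elim
    case (elim n)
    have "prob {\<omega> \<in> space M. R * S < \<bar>X n \<omega> * Y n \<omega>\<bar>} \<le>
       prob {\<omega> \<in> space M. R < \<bar>X n \<omega>\<bar>} + prob {\<omega> \<in> space M. S < \<bar>Y n \<omega>\<bar>}"
    proof (rule prob_Collect_le_add)
      fix \<omega> assume *: "R * S < \<bar>X n \<omega> * Y n \<omega>\<bar>"
      have "\<bar>X n \<omega>\<bar> * \<bar>Y n \<omega>\<bar> \<le> R * S" if "\<bar>X n \<omega>\<bar> \<le> R" "\<bar>Y n \<omega>\<bar> \<le> S"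
        using that RS(1,2) by (intro mult_mono) auto
      then show "R < \<bar>X n \<omega>\<bar> \<or> S < \<bar>Y n \<omega>\<bar>"
        using * by (auto simp: abs_mult simp flip: not_less)
    qed auto
    with elim show ?case by auto
  qed
  then show "\<exists>R>0. \<forall>\<^sub>F n in sequentially. prob {\<omega> \<in> space M. R < \<bar>X n \<omega> * Y n \<omega>\<bar>} \<le> \<eta>"
    using RS by (intro exI[of _ "R * S"]) auto
qed

lemma small_in_prob_mult:
  assumes X: "small_in_prob X" and Y: "bounded_in_prob Y"
  shows "small_in_prob (\<lambda>n \<omega>. X n \<omega> * Y n \<omega>)"
proof (rule small_in_probI)
  have [measurable]: "X n \<in> borel_measurable M" "Y n \<in> borel_measurable M" for n
    using X Y by (auto intro: bounded_in_prob_measurable small_in_prob_measurable)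
  show "(\<lambda>\<omega>. X n \<omega> * Y n \<omega>) \<in> borel_measurable M" for n by measurable
  fix \<epsilon> \<eta> :: real assume *: "\<epsilon> > 0" "\<eta> > 0"
  obtain S where S: "S > 0" "\<forall>\<^sub>F n in sequentially. prob {\<omega> \<in> space M. S < \<bar>Y n \<omega>\<bar>} \<le> \<eta>/2"
    using Y * unfolding bounded_in_prob_def by (meson half_gt_zero)
  have "\<forall>\<^sub>F n in sequentially. prob {\<omega> \<in> space M. \<epsilon>/S < \<bar>X n \<omega>\<bar>} \<le> \<eta>/2"
    using * S by (intro small_in_probD X; simp)
  with S(2) show "\<forall>\<^sub>F n in sequentially. prob {\<omega> \<in> space M. \<epsilon> < \<bar>X n \<omega> * Y n \<omega>\<bar>} \<le> \<eta>"
  proof eventually_elim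
    case (elim n)
    have "prob {\<omega> \<in> space M. \<epsilon> < \<bar>X n \<omega> * Y n \<omega>\<bar>} \<le>
       prob {\<omega> \<in> space M. \<epsilon>/S < \<bar>X n \<omega>\<bar>} + prob {\<omega> \<in> space M. S < \<bar>Y n \<omega>\<bar>}"
    proof (rule prob_Collect_le_add)
      fix \<omega> assume *: "\<epsilon> < \<bar>X n \<omega> * Y n \<omega>\<bar>"
      have "\<bar>X n \<omega>\<bar> * \<bar>Y n \<omega>\<bar> \<le> \<epsilon> / S * S"
        if "\<bar>X n \<omega>\<bar> \<le> \<epsilon> / S" "\<bar>Y n \<omega>\<bar> \<le> S"
        using that \<open>\<epsilon> > 0\<close> S(1) by (intro mult_mono) auto
      then show "\<epsilon>/S < \<bar>X n \<omega>\<bar> \<or> S < \<bar>Y n \<omega>\<bar>"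
        using * S(1) by (auto simp: abs_mult simp flip: not_less)
    qed auto
    with elim show ?case by auto
  qed
qed

lemma bounded_in_prob_const: "bounded_in_prob (\<lambda>n \<omega>. c)"
  unfolding bounded_in_prob_def
proof (intro conjI allI impI)
  fix \<eta> :: real assume "\<eta> > 0"
  then show "\<exists>R>0. \<forall>\<^sub>F n in sequentially. prob {\<omega> \<in> space M. R < \<bar>c\<bar>} \<le> \<eta>"
    by (intro exI[of _ "\<bar>c\<bar> + 1"]) auto
qed auto

lemma small_imp_bounded_in_prob: "small_in_prob X \<Longrightarrow> bounded_in_prob X"
  unfolding bounded_in_prob_def
  by (auto intro!: exI[of _ 1] small_in_probD intro: small_in_prob_measurable)

lemma small_in_prob_cmult: "small_in_prob X \<Longrightarrow> small_in_prob (\<lambda>n \<omega>. c * X n \<omega>)"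
  using small_in_prob_mult[OF _ bounded_in_prob_const, of X c] by (simp add: mult.commute)

lemma small_in_prob_diff:
  "small_in_prob X \<Longrightarrow> small_in_prob Y \<Longrightarrow> small_in_prob (\<lambda>n \<omega>. X n \<omega> - Y n \<omega>)"
  using small_in_prob_add[OF _ small_in_prob_cmult, of X Y "-1"] by simp

lemma small_in_prob_sum:
  "(\<And>i. i \<in> I \<Longrightarrow> small_in_prob (X i)) \<Longrightarrow> small_in_prob (\<lambda>n \<omega>. \<Sum>i\<in>I. X i n \<omega>)"
  by (induction I rule: infinite_finite_induct) (auto intro: small_in_prob_zero small_in_prob_add)

lemma bounded_in_prob_sum:
  "(\<And>i. i \<in> I \<Longrightarrow> bounded_in_prob (X i)) \<Longrightarrow> bounded_in_prob (\<lambda>n \<omega>. \<Sum>i\<in>I. X i n \<omega>)"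
  by (induction I rule: infinite_finite_induct) (auto intro: bounded_in_prob_const bounded_in_prob_add)

lemma small_in_prob_scale:
  assumes "bounded_in_prob X" "c \<longlonglongrightarrow> 0"
  shows "small_in_prob (\<lambda>n \<omega>. c n * X n \<omega>)"
proof (rule small_in_prob_mult[OF _ assms(1)])
  show "small_in_prob (\<lambda>n \<omega>. c n)"
  proof (rule small_in_probI)
    fix \<epsilon> \<eta> :: real assume *: "\<epsilon> > 0" "\<eta> > 0"
    have "\<forall>\<^sub>F n in sequentially. \<bar>c n\<bar> < \<epsilon>"
      using tendstoD[OF assms(2) *(1)] by simp
    then show "\<forall>\<^sub>F n in sequentially. prob {\<omega> \<in> space M. \<epsilon> < \<bar>c n\<bar>} \<le> \<eta>"
      by eventually_elim (use * in simp)
  qed auto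
qed

lemma bounded_in_prob_L2:
  assumes "\<And>n. X n \<in> borel_measurable M" "\<And>n. integrable M (\<lambda>\<omega>. (X n \<omega>)\<^sup>2)"
    and "\<And>n. expectation (\<lambda>\<omega>. (X n \<omega>)\<^sup>2) \<le> C"
  shows "bounded_in_prob X"
  unfolding bounded_in_prob_def
proof (intro conjI allI impI)
  fix \<eta> :: real assume *: "\<eta> > 0"
  \<comment> \<open>Chosen so that the Chebyshev bound
    \<open>(\<bar>C\<bar> + 1) / R\<^sup>2\<close> equals \<open>\<eta>\<close>; the added 1 keeps
    \<open>R\<close> positive when \<open>C\<close> is 0.\<close>
  define R where "R = sqrt ((\<bar>C\<bar> + 1) / \<eta>)"
  have R: "R > 0" "R\<^sup>2 = (\<bar>C\<bar> + 1) / \<eta>" using * by (auto simp: R_def)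
  have "prob {\<omega> \<in> space M. R < \<bar>X n \<omega>\<bar>} \<le> \<eta>" for n
  proof -
    note [measurable] = assms(1)
    have "prob {\<omega> \<in> space M. R < \<bar>X n \<omega>\<bar>} \<le> prob {\<omega> \<in> space M. \<bar>X n \<omega>\<bar> \<ge> R}"
      by (rule finite_measure_mono) auto
    also have "\<dots> \<le> expectation (\<lambda>\<omega>. (X n \<omega>)\<^sup>2) / R\<^sup>2"
      using second_moment_method[OF assms(1) assms(2) R(1)] by simp
    also have "\<dots> \<le> (\<bar>C\<bar> + 1) / R\<^sup>2"
      using assms(3)[of n] by (intro divide_right_mono) auto
    also have "\<dots> = \<eta>" using * R by (simp add: field_simps)
    finally show ?thesis .
  qed
  then show "\<exists>R>0. \<forall>\<^sub>F n in sequentially. prob {\<omega> \<in> space M. R < \<bar>X n \<omega>\<bar>} \<le> \<eta>"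
    using R(1) by auto
qed (use assms in auto)

text \<open>On the event that \<open>X\<close> is within \<open>c / 2\<close> of \<open>c\<close>
  the values stay above \<open>c / 2\<close>, where the reciprocal is controlled by the factor
  \<open>2 / c\<^sup>2\<close>.\<close>

lemma small_in_prob_inverse:
  assumes X: "small_in_prob (\<lambda>n \<omega>. X n \<omega> - c)" and c: "c > 0"
  shows "small_in_prob (\<lambda>n \<omega>. 1 / X n \<omega> - 1 / c)"
proof (rule small_in_prob_dominated[OF small_in_prob_cmult[OF X, of "2 / c\<^sup>2"] X, of "c/2" _ 0])
  fix n \<omega> assume le: "\<bar>X n \<omega> - c\<bar> \<le> c / 2"
  then have X: "X n \<omega> \<ge> c / 2" by (auto simp: abs_if field_simps split: if_splits)
  then have p: "X n \<omega> > 0" using c by simp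
  have "\<bar>1 / X n \<omega> - 1 / c\<bar> = \<bar>X n \<omega> - c\<bar> / (X n \<omega> * c)"
  proof -
    have "1 / X n \<omega> - 1 / c = (c - X n \<omega>) / (X n \<omega> * c)"
      using p c by (simp add: diff_frac_eq)
    then show ?thesis using p c by (simp add: abs_mult abs_minus_commute)
  qed
  also have "\<dots> \<le> \<bar>X n \<omega> - c\<bar> / (c / 2 * c)"
    using p c X by (intro divide_left_mono mult_right_mono mult_pos_pos) auto
  also have "\<dots> = \<bar>2 / c\<^sup>2 * (X n \<omega> - c)\<bar>"
    by (subst abs_mult) (use c in \<open>simp add: power2_eq_square\<close>)
  finally show "\<bar>1 / X n \<omega> - 1 / c\<bar> \<le> \<bar>2 / c\<^sup>2 * (X n \<omega> - c)\<bar>" .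
next
  fix n
  have [measurable]: "(\<lambda>\<omega>. X n \<omega> - c) \<in> borel_measurable M"
    by (rule small_in_prob_measurable[OF X])
  have "(\<lambda>\<omega>. 1 / ((X n \<omega> - c) + c) - 1 / c) \<in> borel_measurable M" by measurable
  then show "(\<lambda>\<omega>. 1 / X n \<omega> - 1 / c) \<in> borel_measurable M" by simp
qed (use c in auto)

end

section \<open>Weak convergence in Euclidean space\<close>

text \<open>The linear span of the real and imaginary parts of characters, that is, the functions
  whose integrals are determined by the characteristic function. It is an algebra by the
  product-to-sum formulas, which is what Stone-Weierstrass asks for.\<close>

inductive trig_fun :: "('b::real_inner \<Rightarrow> real) \<Rightarrow> bool" where
  trig_cos: "trig_fun (\<lambda>x. cos (u \<bullet> x))"
| trig_sin: "trig_fun (\<lambda>x. sin (u \<bullet> x))"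
| trig_add: "trig_fun f \<Longrightarrow> trig_fun g \<Longrightarrow> trig_fun (\<lambda>x. f x + g x)"
| trig_cmult: "trig_fun f \<Longrightarrow> trig_fun (\<lambda>x. c * f x)"

lemma trig_const: "trig_fun (\<lambda>x. c)"
  using trig_cmult[OF trig_cos[of 0], of c] by simp

lemma trig_diff: "trig_fun f \<Longrightarrow> trig_fun g \<Longrightarrow> trig_fun (\<lambda>x. f x - g x)"
  using trig_add[OF _ trig_cmult, of f g "-1"] by simp

lemma trig_cos_mult: "trig_fun g \<Longrightarrow> trig_fun (\<lambda>x. cos (u \<bullet> x) * g x)"
proof (induction rule: trig_fun.induct)
  case (trig_cos v)
  have "trig_fun (\<lambda>x. (1/2) * (cos ((u - v) \<bullet> x) + cos ((u + v) \<bullet> x)))"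
    by (intro trig_fun.intros)
  then show ?case by (simp add: cos_times_cos inner_diff_left inner_add_left)
next
  case (trig_sin v)
  have "trig_fun (\<lambda>x. (1/2) * (sin ((u + v) \<bullet> x) - sin ((u - v) \<bullet> x)))"
    by (intro trig_fun.trig_cmult trig_diff trig_fun.intros)
  then show ?case by (simp add: cos_times_sin inner_diff_left inner_add_left)
next
  case (trig_add f g)
  then show ?case using trig_fun.trig_add[OF trig_add.IH] by (simp add: distrib_left)
next
  case (trig_cmult f c)
  then show ?case using trig_fun.trig_cmult[OF trig_cmult.IH, of c] by (simp add: mult.left_commute)
qed

lemma trig_sin_mult: "trig_fun g \<Longrightarrow> trig_fun (\<lambda>x. sin (u \<bullet> x) * g x)"
proof (induction rule: trig_fun.induct)
  case (trig_cos v)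
  show ?case using trig_cos_mult[OF trig_fun.trig_sin[of u], of v] by (simp add: mult.commute)
next
  case (trig_sin v)
  have "trig_fun (\<lambda>x. (1/2) * (cos ((u - v) \<bullet> x) - cos ((u + v) \<bullet> x)))"
    by (intro trig_fun.trig_cmult trig_diff trig_fun.intros)
  then show ?case by (simp add: sin_times_sin inner_diff_left inner_add_left)
next
  case (trig_add f g)
  then show ?case using trig_fun.trig_add[OF trig_add.IH] by (simp add: distrib_left)
next
  case (trig_cmult f c)
  then show ?case using trig_fun.trig_cmult[OF trig_cmult.IH, of c] by (simp add: mult.left_commute)
qed

lemma trig_mult: "trig_fun f \<Longrightarrow> trig_fun g \<Longrightarrow> trig_fun (\<lambda>x. f x * g x)"
proof (induction rule: trig_fun.induct)
  case (trig_add f1 f2)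
  then show ?case using trig_fun.trig_add[OF trig_add.IH] by (simp add: distrib_right)
next
  case (trig_cmult f c)
  then show ?case using trig_fun.trig_cmult[OF trig_cmult.IH, of c] by (simp add: mult.assoc)
qed (auto intro: trig_cos_mult trig_sin_mult)

lemma trig_continuous: "trig_fun f \<Longrightarrow> continuous_on UNIV f"
  by (induction rule: trig_fun.induct) (auto intro!: continuous_intros)

lemma trig_bounded: "trig_fun f \<Longrightarrow> \<exists>B. \<forall>x. \<bar>f x\<bar> \<le> B"
proof (induction rule: trig_fun.induct)
  case (trig_add f g)
  then obtain A B where AB: "\<And>x. \<bar>f x\<bar> \<le> A" "\<And>x. \<bar>g x\<bar> \<le> B" by auto
  have "\<bar>f x + g x\<bar> \<le> A + B" for x using AB[of x] by linarith
  then show ?case by blast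
next
  case (trig_cmult f c)
  then obtain A where A: "\<And>x. \<bar>f x\<bar> \<le> A" by auto
  have "\<bar>c * f x\<bar> \<le> \<bar>c\<bar> * A" for x using A[of x] by (simp add: abs_mult mult_left_mono)
  then show ?case by blast
qed (auto intro!: exI[of _ 1])

text \<open>Needed to truncate without leaving the algebra: the truncation function is replaced by a
  polynomial.\<close>

lemma trig_polynomial_compose:
  fixes p :: "real \<Rightarrow> real"
  assumes "real_polynomial_function p" "trig_fun f"
  shows "trig_fun (\<lambda>x. p (f x))"
  using assms(1)
proof (induction rule: real_polynomial_function.induct)
  case (linear h)
  then interpret bounded_linear h .
  have "h t = h 1 * t" for t using scaleR[of t 1] by simp
  then have "(\<lambda>x. h (f x)) = (\<lambda>x. h 1 * f x)" by (rule ext)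
  then show ?case using trig_cmult[OF assms(2)] by simp
qed (auto intro: trig_const trig_fun.intros trig_mult)

lemma trig_dense:
  fixes g :: "'b::euclidean_space \<Rightarrow> real"
  assumes "compact S" "continuous_on S g" "e > 0"
  obtains f where "trig_fun f" "\<And>x. x \<in> S \<Longrightarrow> \<bar>g x - f x\<bar> < e"
proof -
  interpret R: function_ring_on "{f. trig_fun f}" S
  proof
    fix x y :: 'b assume "x \<in> S" "y \<in> S" "x \<noteq> y"
    \<comment> \<open>Scaled so that the phases of \<open>x\<close> and \<open>y\<close> differ by
      exactly 1. Equality of both cosine and sine would force \<open>cos 1 = 1\<close>.\<close>
    define u where "u = (1 / (norm (x - y))\<^sup>2) *\<^sub>R (x - y)"
    have "u \<bullet> x - u \<bullet> y = u \<bullet> (x - y)" by (simp only: inner_diff_right)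
    also have "\<dots> = 1"
      using \<open>x \<noteq> y\<close> unfolding u_def inner_scaleR_left power2_norm_eq_inner by simp
    finally have u: "u \<bullet> x - u \<bullet> y = 1" .
    have *: "(cos (u \<bullet> x) = cos (u \<bullet> y) \<and> sin (u \<bullet> x) = sin (u \<bullet> y)) \<Longrightarrow> False"
    proof -
      assume "cos (u \<bullet> x) = cos (u \<bullet> y) \<and> sin (u \<bullet> x) = sin (u \<bullet> y)"
      then have "cos (u \<bullet> x - u \<bullet> y) = 1"
        by (simp add: cos_diff sin_cos_squared_add3)
      then have "cos (1::real) = cos 0" using u by simp
      then show False using cos_monotone_0_pi[of 0 1] pi_gt3 by simp
    qed
    show "\<exists>f\<in>{f. trig_fun f}. f x \<noteq> f y"
    proof (cases "cos (u \<bullet> x) = cos (u \<bullet> y)")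
      case True
      then show ?thesis
        using * by (intro bexI[of _ "\<lambda>x. sin (u \<bullet> x)"]) (auto intro: trig_sin)
    next
      case False
      then show ?thesis by (intro bexI[of _ "\<lambda>x. cos (u \<bullet> x)"]) (auto intro: trig_cos)
    qed
  qed (use assms in \<open>auto intro: trig_const trig_fun.intros trig_mult
         intro: continuous_on_subset[OF trig_continuous]\<close>)
  from R.Stone_Weierstrass_basic[OF assms(2,3)] that show thesis by auto
qed

text \<open>A trigonometric approximation of \<open>g\<close> on a large ball is uncontrolled
  outside it. Truncating it at the bound of \<open>g\<close> by means of a polynomial makes the
  error bounded everywhere, and tightness makes the outside negligible.\<close>

lemma weak_converges_trig:
  fixes P :: "nat \<Rightarrow> 'b::euclidean_space measure"
  assumes P: "\<And>n. prob_space (P n)" "\<And>n. sets (P n) = sets borel"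
    and Q: "prob_space Q" "sets Q = sets borel"
    and c: "\<And>u. (\<lambda>n. \<integral>x. cos (u \<bullet> x) \<partial>P n) \<longlonglongrightarrow> (\<integral>x. cos (u \<bullet> x) \<partial>Q)"
    and s: "\<And>u. (\<lambda>n. \<integral>x. sin (u \<bullet> x) \<partial>P n) \<longlonglongrightarrow> (\<integral>x. sin (u \<bullet> x) \<partial>Q)"
    and tight: "\<And>\<eta>. \<eta> > 0 \<Longrightarrow> \<exists>R. \<forall>\<^sub>F n in sequentially. measure (P n) {x. R < norm x} \<le> \<eta>"
  shows "weak_converges P Q"
  unfolding weak_converges_def
proof (intro allI impI)
  have int: "integrable N f"
    if "prob_space N" "sets N = sets borel" "continuous_on UNIV f" "\<And>x. \<bar>f x\<bar> \<le> B"
    for N :: "'b measure" and f :: "'b \<Rightarrow> real" and B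
  proof -
    interpret prob_space N by fact
    have "f \<in> borel_measurable N"
      using borel_measurable_continuous_onI[OF that(3)] that(2) measurable_cong_sets by blast
    then show ?thesis using that(4) by (intro integrable_const_bound[of _ B]) auto
  qed
  have int_trig: "integrable N f" if "prob_space N" "sets N = sets borel" "trig_fun f"
    for N :: "'b measure" and f
    using trig_bounded[OF that(3)] int[OF that(1,2) trig_continuous[OF that(3)]] by blast
  have conv: "trig_fun f \<Longrightarrow> (\<lambda>n. \<integral>x. f x \<partial>P n) \<longlonglongrightarrow> (\<integral>x. f x \<partial>Q)" for f
  proof (induction rule: trig_fun.induct)
    case (trig_add f g)
    then show ?case using int_trig[OF P] int_trig[OF Q] by (simp add: tendsto_add)
  qed (auto intro: c s tendsto_mult)
  have diff: "\<bar>(\<integral>x. g x \<partial>N) - (\<integral>x. q x \<partial>N)\<bar> \<le> a + b * measure N {x. R < norm x}"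
    if N: "prob_space N" "sets N = sets borel" and "integrable N g" "integrable N q"
      and le: "\<And>x. \<bar>g x - q x\<bar> \<le> a + b * indicator {x. R < norm x} x"
    for N :: "'b measure" and g q :: "'b \<Rightarrow> real" and a b R
  proof -
    interpret prob_space N by fact
    have "{x::'b. R < norm x} \<in> sets borel" by measurable
    then have [measurable]: "{x::'b. R < norm x} \<in> sets N" using N by simp
    have "\<bar>(\<integral>x. g x \<partial>N) - (\<integral>x. q x \<partial>N)\<bar> = \<bar>\<integral>x. g x - q x \<partial>N\<bar>"
      using that by simp
    also have "\<dots> \<le> (\<integral>x. \<bar>g x - q x\<bar> \<partial>N)" by (rule integral_abs_bound)
    also have "\<dots> \<le> (\<integral>x. a + b * indicator {x. R < norm x} x \<partial>N)"
      by (intro integral_mono) (use that in \<open>auto simp: integrable_real_indicator emeasure_eq_measure\<close>)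
    also have "\<dots> = a + b * measure N {x. R < norm x}"
      by (simp add: prob_space emeasure_eq_measure)
    finally show ?thesis .
  qed
  fix g :: "'b \<Rightarrow> real" assume "continuous_on UNIV g \<and> bounded (range g)"
  then obtain B where g: "continuous_on UNIV g" and B: "B > 0" "\<And>x. \<bar>g x\<bar> \<le> B"
    by (auto simp: bounded_pos)
  show "(\<lambda>n. \<integral>x. g x \<partial>P n) \<longlonglongrightarrow> (\<integral>x. g x \<partial>Q)"
  proof (rule tendstoI)
    fix r :: real assume r: "r > 0"
    \<comment> \<open>The total error consists of the approximation error, once under
      \<open>P n\<close> and once under \<open>Q\<close>, and one \<open>e\<close> for the
      convergence of the trigonometric integral.\<close>
    define e where "e = min 1 (r / (4 * (2 * B + 4)))"
    have e: "0 < e" "e \<le> 1" "2 * (2 * e + (2 * B + e) * e) + e < r"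
    proof -
      show e0: "0 < e" "e \<le> 1" using r B by (auto simp: e_def)
      have "e \<le> r / (4 * (2 * B + 4))" by (simp add: e_def)
      then have "16 * e + 8 * (e * B) \<le> r" using B by (simp add: field_simps)
      moreover have "e * e \<le> e" using e0 by (simp add: mult_left_le)
      moreover have "2 * (2 * e + (2 * B + e) * e) + e = 5 * e + 2 * (e * e) + 4 * (e * B)"
        by (simp add: algebra_simps)
      ultimately show "2 * (2 * e + (2 * B + e) * e) + e < r"
        using e0 mult_pos_pos[OF e0(1) B(1)] by linarith
    qed
    obtain R1 where R1: "\<forall>\<^sub>F n in sequentially. measure (P n) {x. R1 < norm x} \<le> e"
      using tight[OF e(1)] by auto
    interpret Q: prob_space Q by fact
    have "(\<lambda>i. measure Q {x. real i < norm x}) \<longlonglongrightarrow> measure Q (\<Inter>i. {x. real i < norm x})"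
    proof (rule Q.finite_Lim_measure_decseq)
      have "{x::'b. real i < norm x} \<in> sets borel" for i by measurable
      then show "range (\<lambda>i. {x. real i < norm x}) \<subseteq> sets Q" using Q(2) by (simp add: image_subset_iff)
      show "decseq (\<lambda>i. {x::'b. real i < norm x})"
        by (auto simp: decseq_def intro: le_less_trans)
    qed
    moreover have "(\<Inter>i. {x::'b. real i < norm x}) = {}"
    proof -
      have "\<exists>i. \<not> real i < norm x" for x :: 'b by (meson reals_Archimedean2 less_asym)
      then show ?thesis by auto
    qed
    ultimately have "(\<lambda>i. measure Q {x. real i < norm x}) \<longlonglongrightarrow> 0" by simp
    from order_tendstoD(2)[OF this e(1)] obtain R2 where R2: "measure Q {x. R2 < norm x} \<le> e"
      by (meson eventually_happens' less_imp_le sequentially_bot)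
    define R where "R = max R1 R2"
    have tail: "measure N {x. R < norm x} \<le> e" if "prob_space N" "sets N = sets borel"
      "measure N {x. R' < norm x} \<le> e" "R' \<le> R" for N :: "'b measure" and R'
    proof -
      interpret N: prob_space N by fact
      have "{x::'b. R' < norm x} \<in> sets borel" by measurable
      then have "measure N {x. R < norm x} \<le> measure N {x. R' < norm x}"
        using that by (intro N.finite_measure_mono) auto
      then show ?thesis using that by simp
    qed
    obtain f where f: "trig_fun f" "\<And>x. x \<in> cball 0 R \<Longrightarrow> \<bar>g x - f x\<bar> < e"
      using trig_dense[OF compact_cball continuous_on_subset[OF g] e(1)] by blast
    obtain C where C: "\<And>x. \<bar>f x\<bar> \<le> C" using trig_bounded[OF f(1)] by auto
    \<comment> \<open>Truncation to \<open>[-B, B]\<close> is nonexpansive and fixes the values of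
      \<open>g\<close>, so it keeps the accuracy on the ball while bounding the approximant
      outside.\<close>
    define clip where "clip t = max (-B) (min B t)" for t :: real
    have "continuous_on {-C..C} clip" unfolding clip_def by (intro continuous_intros)
    then obtain p where p: "real_polynomial_function p" "\<And>t. t \<in> {-C..C} \<Longrightarrow> \<bar>clip t - p t\<bar> < e"
      using Stone_Weierstrass_real_polynomial_function[of "{-C..C}" clip e] e(1) by auto
    define q where "q x = p (f x)" for x
    have q: "trig_fun q" unfolding q_def by (rule trig_polynomial_compose[OF p(1) f(1)])
    have qc: "\<bar>clip (f x) - q x\<bar> < e" for x
      unfolding q_def by (rule p(2)) (use C[of x] in auto)
    have le: "\<bar>g x - q x\<bar> \<le> 2 * e + (2 * B + e) * indicator {x. R < norm x} x" for x
    proof (cases "R < norm x")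
      case True
      then show ?thesis using B(1) B(2)[of x] qc[of x] e(1)
        unfolding clip_def by (auto simp: abs_if min_def max_def split: if_splits)
    next
      case False
      then have "\<bar>g x - f x\<bar> < e" by (intro f(2)) auto
      then show ?thesis using False B(1) B(2)[of x] qc[of x] e(1)
        unfolding clip_def by (auto simp: abs_if min_def max_def split: if_splits)
    qed
    have "\<forall>\<^sub>F n in sequentially. dist (\<integral>x. q x \<partial>P n) (\<integral>x. q x \<partial>Q) < e"
      by (rule tendstoD[OF conv[OF q] e(1)])
    with R1 show "\<forall>\<^sub>F n in sequentially. dist (\<integral>x. g x \<partial>P n) (\<integral>x. g x \<partial>Q) < r"
    proof eventually_elim
      case (elim n)
      have b: "2 * e + (2 * B + e) * t \<le> 2 * e + (2 * B + e) * e" if "t \<le> e" for t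
        using that B e by (intro add_left_mono mult_left_mono) auto
      have "\<bar>(\<integral>x. g x \<partial>P n) - (\<integral>x. q x \<partial>P n)\<bar> \<le> 2 * e + (2 * B + e) * e"
        by (rule order.trans[OF diff[OF P int[OF P g B(2)] int_trig[OF P q] le] b])
           (rule tail[OF P elim(1)], simp add: R_def)
      moreover have "\<bar>(\<integral>x. g x \<partial>Q) - (\<integral>x. q x \<partial>Q)\<bar> \<le> 2 * e + (2 * B + e) * e"
        by (rule order.trans[OF diff[OF Q int[OF Q g B(2)] int_trig[OF Q q] le] b])
           (rule tail[OF Q R2], simp add: R_def)
      moreover have "\<bar>a - c\<bar> < r"
        if "\<bar>a - b\<bar> \<le> K" "\<bar>c - d\<bar> \<le> K" "\<bar>b - d\<bar> < e" "2 * K + e < r" for a b c d K :: real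
        using that by linarith
      ultimately show ?case using elim(2) e(3) unfolding dist_real_def by blast
    qed
  qed
qed

lemma integral_iexp_Re_Im:
  assumes "finite_measure N" "f \<in> borel_measurable N"
  shows "Re (CLINT x|N. iexp (f x)) = (\<integral>x. cos (f x) \<partial>N)"
    and "Im (CLINT x|N. iexp (f x)) = (\<integral>x. sin (f x) \<partial>N)"
proof -
  interpret finite_measure N by fact
  have "integrable N (\<lambda>x. iexp (f x))"
    using assms(2) by (intro integrable_const_bound[of _ 1]) auto
  then show "Re (CLINT x|N. iexp (f x)) = (\<integral>x. cos (f x) \<partial>N)"
    "Im (CLINT x|N. iexp (f x)) = (\<integral>x. sin (f x) \<partial>N)"
    by (auto simp: integral_Re[symmetric] integral_Im[symmetric] Re_exp Im_exp simp del: integral_Re integral_Im)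
qed

lemma weak_converges_char:
  fixes P :: "nat \<Rightarrow> 'b::euclidean_space measure"
  assumes P: "\<And>n. prob_space (P n)" "\<And>n. sets (P n) = sets borel"
    and Q: "prob_space Q" "sets Q = sets borel"
    and c: "\<And>u. (\<lambda>n. CLINT x|P n. iexp (u \<bullet> x)) \<longlonglongrightarrow> (CLINT x|Q. iexp (u \<bullet> x))"
    and tight: "\<And>\<eta>. \<eta> > 0 \<Longrightarrow> \<exists>R. \<forall>\<^sub>F n in sequentially. measure (P n) {x. R < norm x} \<le> \<eta>"
  shows "weak_converges P Q"
proof (rule weak_converges_trig[OF P Q _ _ tight])
  have m: "(\<lambda>x. u \<bullet> x) \<in> borel_measurable N" if "sets N = sets borel" for u :: 'b and N
  proof -
    have "(\<lambda>x. u \<bullet> x) \<in> borel_measurable borel" by measurable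
    then show ?thesis using that measurable_cong_sets by blast
  qed
  note fin = prob_space.finite_measure
  show "(\<lambda>n. \<integral>x. cos (u \<bullet> x) \<partial>P n) \<longlonglongrightarrow> (\<integral>x. cos (u \<bullet> x) \<partial>Q)" for u
    using tendsto_Re[OF c[of u]]
    by (simp add: integral_iexp_Re_Im[OF fin[OF P(1)] m[OF P(2)]] integral_iexp_Re_Im[OF fin[OF Q(1)] m[OF Q(2)]])
  show "(\<lambda>n. \<integral>x. sin (u \<bullet> x) \<partial>P n) \<longlonglongrightarrow> (\<integral>x. sin (u \<bullet> x) \<partial>Q)" for u
    using tendsto_Im[OF c[of u]]
    by (simp add: integral_iexp_Re_Im[OF fin[OF P(1)] m[OF P(2)]] integral_iexp_Re_Im[OF fin[OF Q(1)] m[OF Q(2)]])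
qed

lemma norm_iexp_diff: "norm (iexp a - iexp b) \<le> min 2 \<bar>a - b\<bar>"
proof -
  have 1: "norm (iexp (a - b) - 1) \<le> \<bar>a - b\<bar>"
    using iexp_approx1[of "a - b" 0] by simp
  have "iexp a = iexp b * iexp (a - b)"
    by (simp add: exp_add[symmetric] algebra_simps)
  then have "iexp a - iexp b = iexp b * (iexp (a - b) - 1)" by (simp add: algebra_simps)
  then have "norm (iexp a - iexp b) = norm (iexp (a - b) - 1)" by (simp only: norm_mult norm_exp_i_times mult_1)
  moreover have "norm (iexp a - iexp b) \<le> 2" using norm_triangle_ineq4[of "iexp a" "iexp b"] by simp
  ultimately show ?thesis using 1 by simp
qed

context prob_space
begin

text \<open>The cap 2 replaces uniform integrability: beyond the level \<open>r / 4\<close> the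
  integrand is at most 2 on an event of small probability.\<close>

lemma expectation_truncated_tendsto_0:
  fixes D :: "nat \<Rightarrow> 'a \<Rightarrow> real"
  assumes D: "small_in_prob D" and "f \<in> borel_measurable borel"
    and f: "\<And>x. 0 \<le> f x" "\<And>x. f x \<le> min 2 \<bar>x\<bar>"
  shows "(\<lambda>n. expectation (\<lambda>\<omega>. f (D n \<omega>))) \<longlonglongrightarrow> 0"
proof (rule tendstoI)
  fix r :: real assume r: "r > 0"
  note [measurable] = small_in_prob_measurable[OF D] assms(2)
  have "\<forall>\<^sub>F n in sequentially. prob {\<omega> \<in> space M. r/4 < \<bar>D n \<omega>\<bar>} \<le> r/4"
    by (rule small_in_probD[OF D]) (use r in auto)
  then show "\<forall>\<^sub>F n in sequentially. dist (expectation (\<lambda>\<omega>. f (D n \<omega>))) 0 < r"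
  proof eventually_elim
    case (elim n)
    have "expectation (\<lambda>\<omega>. f (D n \<omega>)) \<le>
        expectation (\<lambda>\<omega>. r/4 + 2 * indicator {\<omega> \<in> space M. r/4 < \<bar>D n \<omega>\<bar>} \<omega>)"
    proof (rule integral_mono)
      show "integrable M (\<lambda>\<omega>. f (D n \<omega>))"
        using f by (intro integrable_const_bound[of _ 2]) (auto intro: order.trans[OF f(2)])
      fix \<omega> assume "\<omega> \<in> space M"
      then show "f (D n \<omega>) \<le> r/4 + 2 * indicator {\<omega> \<in> space M. r/4 < \<bar>D n \<omega>\<bar>} \<omega>"
        using f(2)[of "D n \<omega>"] r by (auto simp: indicator_def)
    qed (auto intro!: integrable_add integrable_mult_right integrable_real_indicator simp: emeasure_eq_measure)
    also have "\<dots> = r/4 + 2 * prob {\<omega> \<in> space M. r/4 < \<bar>D n \<omega>\<bar>}"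
      by (subst Bochner_Integration.integral_add)
         (auto intro!: integrable_mult_right integrable_real_indicator simp: emeasure_eq_measure prob_space)
    also have "\<dots> < r" using elim r by simp
    finally show ?case using f(1) by (simp add: integral_nonneg)
  qed
qed

lemma char_small_perturb:
  assumes m: "\<And>n. Y n \<in> borel_measurable M" and D: "small_in_prob (\<lambda>n \<omega>. Y' n \<omega> - Y n \<omega>)"
  shows "(\<lambda>n. (CLINT \<omega>|M. iexp (Y' n \<omega>)) - (CLINT \<omega>|M. iexp (Y n \<omega>))) \<longlonglongrightarrow> 0"
proof (rule tendsto_0_le[where K = 1])
  show "(\<lambda>n. expectation (\<lambda>\<omega>. min 2 \<bar>Y' n \<omega> - Y n \<omega>\<bar>)) \<longlonglongrightarrow> 0"
    by (rule expectation_truncated_tendsto_0[OF D, of "\<lambda>x. min 2 \<bar>x\<bar>"]) auto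
  have m': "Y' n \<in> borel_measurable M" for n
  proof -
    have "(\<lambda>\<omega>. (Y' n \<omega> - Y n \<omega>) + Y n \<omega>) \<in> borel_measurable M"
      by (intro borel_measurable_add small_in_prob_measurable[OF D] m)
    then show ?thesis by simp
  qed
  note [measurable] = m m'
  show "\<forall>\<^sub>F n in sequentially. norm ((CLINT \<omega>|M. iexp (Y' n \<omega>)) - (CLINT \<omega>|M. iexp (Y n \<omega>)))
     \<le> norm (expectation (\<lambda>\<omega>. min 2 \<bar>Y' n \<omega> - Y n \<omega>\<bar>)) * 1"
  proof (rule always_eventually, rule allI)
    fix n
    have i: "integrable M (\<lambda>\<omega>. iexp (Z \<omega>))" if [measurable]: "Z \<in> borel_measurable M" for Z
      by (rule integrable_const_bound[of _ 1]) auto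
    have "(CLINT \<omega>|M. iexp (Y' n \<omega>)) - (CLINT \<omega>|M. iexp (Y n \<omega>)) =
        (CLINT \<omega>|M. iexp (Y' n \<omega>) - iexp (Y n \<omega>))"
      by (rule Bochner_Integration.integral_diff[symmetric]) (auto intro!: i)
    also have "norm \<dots> \<le> expectation (\<lambda>\<omega>. norm (iexp (Y' n \<omega>) - iexp (Y n \<omega>)))"
      by (rule integral_norm_bound)
    also have "\<dots> \<le> expectation (\<lambda>\<omega>. min 2 \<bar>Y' n \<omega> - Y n \<omega>\<bar>)"
    proof (rule integral_mono)
      show "integrable M (\<lambda>\<omega>. norm (iexp (Y' n \<omega>) - iexp (Y n \<omega>)))"
        by (intro integrable_norm Bochner_Integration.integrable_diff i) auto
      show "integrable M (\<lambda>\<omega>. min 2 \<bar>Y' n \<omega> - Y n \<omega>\<bar>)"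
        by (rule integrable_const_bound[of _ 2]) auto
    qed (rule norm_iexp_diff)
    finally show "norm ((CLINT \<omega>|M. iexp (Y' n \<omega>)) - (CLINT \<omega>|M. iexp (Y n \<omega>)))
     \<le> norm (expectation (\<lambda>\<omega>. min 2 \<bar>Y' n \<omega> - Y n \<omega>\<bar>)) * 1" by simp
  qed
qed

text \<open>Slutsky's lemma in the form needed later: \<open>X\<close> is the linearized statistic,
  whose characteristic functions are known, and \<open>X'\<close> the actual one. Tightness of
  \<open>X'\<close> follows from that of \<open>X\<close> and the smallness of the
  difference.\<close>

lemma weak_converges_distr:
  fixes X X' :: "nat \<Rightarrow> 'a \<Rightarrow> 'b::euclidean_space"
  assumes X[measurable]: "\<And>n. X n \<in> borel_measurable M" "\<And>n. X' n \<in> borel_measurable M"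
    and Q: "prob_space Q" "sets Q = sets borel"
    and b: "bounded_in_prob (\<lambda>n \<omega>. norm (X n \<omega>))"
    and s: "small_in_prob (\<lambda>n \<omega>. norm (X' n \<omega> - X n \<omega>))"
    and c: "\<And>u. (\<lambda>n. CLINT \<omega>|M. iexp (u \<bullet> X n \<omega>)) \<longlonglongrightarrow> (CLINT x|Q. iexp (u \<bullet> x))"
  shows "weak_converges (\<lambda>n. distr M borel (X' n)) Q"
proof (rule weak_converges_char[OF prob_space_distr _ Q])
  fix u :: 'b
  have "small_in_prob (\<lambda>n \<omega>. u \<bullet> X' n \<omega> - u \<bullet> X n \<omega>)"
  proof (rule small_in_prob_mono[OF small_in_prob_cmult[OF s, of "norm u"], of _ 0])
    show "\<bar>u \<bullet> X' n \<omega> - u \<bullet> X n \<omega>\<bar> \<le> \<bar>norm u * norm (X' n \<omega> - X n \<omega>)\<bar>" for n \<omega>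
      using Cauchy_Schwarz_ineq2[of u "X' n \<omega> - X n \<omega>"] by (simp add: inner_diff_right)
  qed measurable
  from char_small_perturb[OF _ this] have
    "(\<lambda>n. (CLINT \<omega>|M. iexp (u \<bullet> X' n \<omega>)) - (CLINT \<omega>|M. iexp (u \<bullet> X n \<omega>))) \<longlonglongrightarrow> 0"
    by simp
  from tendsto_add[OF this c[of u]]
  show "(\<lambda>n. CLINT x|distr M borel (X' n). iexp (u \<bullet> x)) \<longlonglongrightarrow> (CLINT x|Q. iexp (u \<bullet> x))"
    by (simp add: integral_distr)
next
  fix \<eta> :: real assume "\<eta> > 0"
  have "bounded_in_prob (\<lambda>n \<omega>. norm (X n \<omega>) + norm (X' n \<omega> - X n \<omega>))"
    by (intro bounded_in_prob_add b small_imp_bounded_in_prob s)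
  then obtain R where R: "\<forall>\<^sub>F n in sequentially. prob {\<omega> \<in> space M. R < \<bar>norm (X n \<omega>) + norm (X' n \<omega> - X n \<omega>)\<bar>} \<le> \<eta>"
    unfolding bounded_in_prob_def using \<open>\<eta> > 0\<close> by blast
  show "\<exists>R. \<forall>\<^sub>F n in sequentially. measure (distr M borel (X' n)) {x. R < norm x} \<le> \<eta>"
  proof (rule exI[of _ R], rule eventually_mono[OF R])
    fix n assume le: "prob {\<omega> \<in> space M. R < \<bar>norm (X n \<omega>) + norm (X' n \<omega> - X n \<omega>)\<bar>} \<le> \<eta>"
    have "measure (distr M borel (X' n)) {x. R < norm x} = prob {\<omega> \<in> space M. R < norm (X' n \<omega>)}"
      by (subst measure_distr) (auto intro!: arg_cong[where f = prob])
    also have "\<dots> \<le> prob {\<omega> \<in> space M. R < \<bar>norm (X n \<omega>) + norm (X' n \<omega> - X n \<omega>)\<bar>}"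
    proof (rule finite_measure_mono)
      have "norm (X' n \<omega>) \<le> \<bar>norm (X n \<omega>) + norm (X' n \<omega> - X n \<omega>)\<bar>" for \<omega>
        using norm_triangle_sub[of "X' n \<omega>" "X n \<omega>"] by simp
      then show "{\<omega> \<in> space M. R < norm (X' n \<omega>)} \<subseteq> {\<omega> \<in> space M. R < \<bar>norm (X n \<omega>) + norm (X' n \<omega> - X n \<omega>)\<bar>}"
        by (auto intro: less_le_trans)
    qed measurable
    finally show "measure (distr M borel (X' n)) {x. R < norm x} \<le> \<eta>" using le by simp
  qed
qed (use X in auto)

end

section \<open>Gaussian vectors with a prescribed, possibly singular covariance\<close>

text \<open>Cholesky factorization by induction on the index set: the pivot \<open>i\<close> is
  eliminated and the Schur complement is again nonnegative. A zero pivot needs no separate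
  recursion, since its row vanishes and division by 0 yields 0.\<close>

lemma psd_factorization:
  fixes S :: "'i \<Rightarrow> 'i \<Rightarrow> real"
  assumes "finite I" "\<And>k l. S k l = S l k"
    and "\<And>a. 0 \<le> (\<Sum>k\<in>I. \<Sum>l\<in>I. a k * S k l * a l)"
  shows "\<exists>A. \<forall>k\<in>I. \<forall>l\<in>I. S k l = (\<Sum>m\<in>I. A k m * A l m)"
  using assms
proof (induction I arbitrary: S rule: finite_induct)
  case (insert i I)
  have quad: "(\<Sum>k\<in>insert i I. \<Sum>l\<in>insert i I. a k * S k l * a l) =
      S i i * (a i)\<^sup>2 + 2 * a i * (\<Sum>k\<in>I. S i k * a k) + (\<Sum>k\<in>I. \<Sum>l\<in>I. a k * S k l * a l)" for a
  proof -
    have "(\<Sum>k\<in>I. a k * S k i * a i) = a i * (\<Sum>k\<in>I. S i k * a k)"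
      "(\<Sum>k\<in>I. a i * S i k * a k) = a i * (\<Sum>k\<in>I. S i k * a k)"
      using insert.prems(1)[of _ i] by (simp_all add: sum_distrib_left mult_ac)
    then show ?thesis using insert.hyps
      by (simp add: sum.distrib power2_eq_square algebra_simps)
  qed
  have Sii: "S i i \<ge> 0"
    using insert.prems(2)[of "\<lambda>k. if k = i then 1 else 0"] insert.hyps
    unfolding quad by (simp add: sum.neutral if_distrib cong: if_cong)
  have S0: "S i k = 0" if "S i i = 0" "k \<in> I" for k
  proof (rule ccontr)
    assume "S i k \<noteq> 0"
    \<comment> \<open>With a zero pivot the form at \<open>t\<close> times the \<open>i\<close>-th
      unit vector plus the \<open>k\<close>-th one is linear in \<open>t\<close>; this
      \<open>t\<close> gives it the value -1.\<close>
    define t where "t = - (S k k + 1) / (2 * S i k)"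
    have ki: "k \<noteq> i" using that insert.hyps by auto
    have d: "(\<Sum>x\<in>I. f x * (if x = i then t else if x = k then 1 else 0)) = f k" for f :: "'i \<Rightarrow> real"
    proof -
      have "(\<Sum>x\<in>I. f x * (if x = i then t else if x = k then 1 else 0)) = (\<Sum>x\<in>I. if x = k then f k else 0)"
        using insert.hyps ki by (intro sum.cong) auto
      then show ?thesis using insert.hyps that by simp
    qed
    have "0 \<le> 2 * t * S i k + (\<Sum>x\<in>I. (if x = i then t else if x = k then 1 else 0) * S x k)"
      using insert.prems(2)[of "\<lambda>x. if x = i then t else if x = k then 1 else 0"] that
      unfolding quad d by (simp add: mult.assoc)
    also have "(\<Sum>x\<in>I. (if x = i then t else if x = k then 1 else 0) * S x k) = S k k"
      using d[of "\<lambda>x. S x k"] by (simp add: mult.commute)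
    also have "2 * t * S i k = - (S k k + 1)" using \<open>S i k \<noteq> 0\<close> by (simp add: t_def)
    finally show False by simp
  qed
  \<comment> \<open>The Schur complement of the pivot; for \<open>S i i = 0\<close> the subtracted
    term is 0.\<close>
  define S' where "S' k l = S k l - S i k * S i l / S i i" for k l
  have "\<exists>A. \<forall>k\<in>I. \<forall>l\<in>I. S' k l = (\<Sum>m\<in>I. A k m * A l m)"
  proof (rule insert.IH)
    show "S' k l = S' l k" for k l using insert.prems(1)[of k l] by (simp add: S'_def mult.commute)
    fix a :: "'i \<Rightarrow> real"
    define s where "s = (\<Sum>k\<in>I. S i k * a k)"
    \<comment> \<open>The coordinate at \<open>i\<close> that completes the square, so the form of
      \<open>S\<close> at \<open>a'\<close> is the form of \<open>S'\<close> at
      \<open>a\<close>.\<close>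
    define a' where "a' = a(i := - s / S i i)"
    have eq: "(\<Sum>k\<in>I. S i k * a' k) = s" "(\<Sum>k\<in>I. \<Sum>l\<in>I. a' k * S k l * a' l) = (\<Sum>k\<in>I. \<Sum>l\<in>I. a k * S k l * a l)"
      unfolding s_def a'_def using insert.hyps by (auto intro!: sum.cong)
    have "(\<Sum>k\<in>I. \<Sum>l\<in>I. a k * S' k l * a l) = (\<Sum>k\<in>I. \<Sum>l\<in>I. a k * S k l * a l) - s * s / S i i"
      unfolding S'_def s_def sum_product sum_divide_distrib sum_subtractf[symmetric]
      by (intro sum.cong refl) (simp add: algebra_simps)
    also have "\<dots> = (\<Sum>k\<in>insert i I. \<Sum>l\<in>insert i I. a' k * S k l * a' l)"
      unfolding quad eq by (cases "S i i = 0") (simp_all add: a'_def power2_eq_square field_simps)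
    finally show "0 \<le> (\<Sum>k\<in>I. \<Sum>l\<in>I. a k * S' k l * a l)" using insert.prems(2)[of a'] by simp
  qed
  then obtain A where A: "\<And>k l. k \<in> I \<Longrightarrow> l \<in> I \<Longrightarrow> S' k l = (\<Sum>m\<in>I. A k m * A l m)" by blast
  \<comment> \<open>Column \<open>i\<close> carries the rank-one part split off with the pivot; the
    remaining columns are the factor of \<open>S'\<close>, extended by a zero row.\<close>
  define B where "B k m = (if m = i then S i k / sqrt (S i i) else if k = i then 0 else A k m)" for k m
  have r: "sqrt (S i i) * sqrt (S i i) = S i i" using Sii by simp
  have B: "(\<Sum>m\<in>insert i I. B k m * B l m) =
     S i k * S i l / S i i + (if k = i \<or> l = i then 0 else (\<Sum>m\<in>I. A k m * A l m))" for k l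
  proof -
    have "(\<Sum>m\<in>I. B k m * B l m) = (if k = i \<or> l = i then 0 else (\<Sum>m\<in>I. A k m * A l m))"
      using insert.hyps by (auto simp: B_def intro!: sum.cong sum.neutral)
    then show ?thesis using insert.hyps r by (simp add: B_def)
  qed
  have "S k l = (\<Sum>m\<in>insert i I. B k m * B l m)" if kl: "k \<in> insert i I" "l \<in> insert i I" for k l
  proof (cases "k = i \<or> l = i")
    case True
    then show ?thesis unfolding B using S0 kl insert.prems(1)[of k i]
      by (cases "S i i = 0") auto
  next
    case False
    then show ?thesis unfolding B using A[of k l] kl by (simp add: S'_def)
  qed
  then show ?case by blast
qed auto

text \<open>\<open>S\<close> itself need not be symmetric, so its symmetric part is factored as
  \<open>A\<close> times its transpose. The law is then the image under \<open>A\<close> of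
  independent standard normal variables.\<close>

lemma multivariate_normal_exists:
  assumes I: "finite I" and psd: "\<And>a. 0 \<le> (\<Sum>k\<in>I. \<Sum>l\<in>I. a k * S k l * a l)"
  shows "\<exists>N. multivariate_normal I (\<lambda>_. 0) S N"
proof -
  define T where "T k l = (S k l + S l k) / 2" for k l
  have quad: "(\<Sum>k\<in>I. \<Sum>l\<in>I. a k * T k l * a l) = (\<Sum>k\<in>I. \<Sum>l\<in>I. a k * S k l * a l)" for a
  proof -
    have "(\<Sum>k\<in>I. \<Sum>l\<in>I. a k * T k l * a l) =
      ((\<Sum>k\<in>I. \<Sum>l\<in>I. a k * S k l * a l) + (\<Sum>k\<in>I. \<Sum>l\<in>I. a k * S l k * a l)) / 2"
      unfolding T_def sum.distrib[symmetric] sum_divide_distrib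
      by (intro sum.cong refl) (simp add: field_simps)
    also have "(\<Sum>k\<in>I. \<Sum>l\<in>I. a k * S l k * a l) = (\<Sum>k\<in>I. \<Sum>l\<in>I. a k * S k l * a l)"
      by (subst sum.swap) (simp add: mult_ac)
    finally show ?thesis by simp
  qed
  have "\<exists>A. \<forall>k\<in>I. \<forall>l\<in>I. T k l = (\<Sum>m\<in>I. A k m * A l m)"
    using psd unfolding quad[symmetric] by (intro psd_factorization[OF I]) (auto simp: T_def)
  then obtain A where A: "\<And>k l. k \<in> I \<Longrightarrow> l \<in> I \<Longrightarrow> T k l = (\<Sum>m\<in>I. A k m * A l m)" by blast
  interpret n: prob_space std_normal_distribution
    using real_dist_normal_dist by (simp add: real_distribution_def)
  interpret P: product_prob_space "\<lambda>_. std_normal_distribution" I ..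
  define f where "f x = (\<lambda>k\<in>I. \<Sum>m\<in>I. A k m * x m)" for x :: "nat \<Rightarrow> real"
  have comp[measurable]: "(\<lambda>x. x m) \<in> borel_measurable (Pi\<^sub>M I (\<lambda>_. std_normal_distribution))" if "m \<in> I" for m
    using measurable_component_singleton[OF that, of "\<lambda>_. std_normal_distribution"] by simp
  have f[measurable]: "f \<in> measurable (Pi\<^sub>M I (\<lambda>_. std_normal_distribution)) (Pi\<^sub>M I (\<lambda>_. borel))"
    unfolding f_def by (rule measurable_restrict) (auto intro!: borel_measurable_sum borel_measurable_times comp)
  define N where "N = distr (Pi\<^sub>M I (\<lambda>_. std_normal_distribution)) (Pi\<^sub>M I (\<lambda>_. borel)) f"
  have "(CLINT x|N. iexp (\<Sum>k\<in>I. a k * x k)) =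
        exp (\<i> * complex_of_real (\<Sum>k\<in>I. a k * 0)
             - complex_of_real ((\<Sum>k\<in>I. \<Sum>l\<in>I. a k * S k l * a l) / 2))" for a
  proof -
    define c where "c m = (\<Sum>k\<in>I. a k * A k m)" for m
    have lin: "(\<Sum>k\<in>I. a k * f x k) = (\<Sum>m\<in>I. c m * x m)" for x
      unfolding c_def sum_distrib_right f_def
      by (subst sum.swap) (auto simp: sum_distrib_left mult_ac intro!: sum.cong)
    have "(CLINT x|N. iexp (\<Sum>k\<in>I. a k * x k)) =
       (CLINT x|Pi\<^sub>M I (\<lambda>_. std_normal_distribution). iexp (\<Sum>k\<in>I. a k * f x k))"
      unfolding N_def
    proof (rule integral_distr[OF f])
      have "(\<lambda>x::nat \<Rightarrow> real. \<Sum>k\<in>I. a k * x k) \<in> borel_measurable (Pi\<^sub>M I (\<lambda>_. borel))"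
        by (intro borel_measurable_sum borel_measurable_times) auto
      then show "(\<lambda>x. iexp (\<Sum>k\<in>I. a k * x k)) \<in> borel_measurable (Pi\<^sub>M I (\<lambda>_. borel))"
        by measurable
    qed
    also have "\<dots> = (CLINT x|Pi\<^sub>M I (\<lambda>_. std_normal_distribution). \<Prod>m\<in>I. iexp (c m * x m))"
      unfolding lin by (simp add: exp_sum[OF I] sum_distrib_left)
    also have "\<dots> = (\<Prod>m\<in>I. CLINT x|std_normal_distribution. iexp (c m * x))"
      by (rule P.product_integral_prod[OF I]) (rule n.integrable_const_bound[of _ 1], auto)
    also have "\<dots> = (\<Prod>m\<in>I. exp (- (complex_of_real ((c m)\<^sup>2) / 2)))"
    proof (rule prod.cong[OF refl])
      fix m
      show "(CLINT x|std_normal_distribution. iexp (c m * x)) = exp (- (complex_of_real ((c m)\<^sup>2) / 2))"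
        using fun_cong[OF char_std_normal_distribution, of "c m"]
        by (simp add: char_def flip: exp_of_real)
    qed
    also have "\<dots> = exp (- complex_of_real ((\<Sum>m\<in>I. (c m)\<^sup>2) / 2))"
      by (simp add: exp_sum[OF I, symmetric] sum_negf sum_divide_distrib)
    also have "(\<Sum>m\<in>I. (c m)\<^sup>2) = (\<Sum>k\<in>I. \<Sum>l\<in>I. a k * T k l * a l)"
    proof -
      have "(\<Sum>m\<in>I. (c m)\<^sup>2) = (\<Sum>m\<in>I. \<Sum>k\<in>I. \<Sum>l\<in>I. (a k * A k m) * (a l * A l m))"
        unfolding c_def power2_eq_square sum_product ..
      also have "\<dots> = (\<Sum>k\<in>I. \<Sum>l\<in>I. \<Sum>m\<in>I. (a k * A k m) * (a l * A l m))"
        by (subst sum.swap) (rule sum.cong[OF refl sum.swap])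
      also have "\<dots> = (\<Sum>k\<in>I. \<Sum>l\<in>I. a k * T k l * a l)"
        by (intro sum.cong refl) (simp add: A sum_distrib_left sum_distrib_right mult_ac)
      finally show ?thesis .
    qed
    finally show ?thesis unfolding quad by simp
  qed
  moreover have "prob_space N" unfolding N_def by (rule P.prob_space_distr[OF f])
  ultimately show ?thesis unfolding multivariate_normal_def by (intro exI[of _ N]) (auto simp: N_def)
qed

section \<open>The least-squares criterion\<close>

lemma exp_second_order:
  fixes x :: real assumes "\<bar>x\<bar> \<le> 1" shows "\<bar>exp x - 1 - x\<bar> \<le> x\<^sup>2"
proof -
  have "exp x \<le> 1 + x + x\<^sup>2"
  proof (cases "x \<ge> 0")
    case True then show ?thesis using exp_bound[of x] assms by simp
  next
    case False
    define y where "y = - x"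
    have y: "0 < y" "y \<le> 1" using False assms by (auto simp: y_def)
    have "exp x = 1 / exp y" by (simp add: y_def exp_minus divide_inverse)
    also have "\<dots> \<le> 1 / (1 + y)" using y exp_ge_add_one_self[of y] by (intro divide_left_mono) auto
    \<comment> \<open>The product of \<open>1 - y + y\<^sup>2\<close> and \<open>1 + y\<close> is
      \<open>1 + y^3\<close>.\<close>
    also have "\<dots> \<le> 1 - y + y\<^sup>2"
    proof -
      have "1 \<le> 1 + y * y * y" using y by simp
      also have "\<dots> = (1 - y + y\<^sup>2) * (1 + y)" by (simp add: algebra_simps power2_eq_square)
      finally show ?thesis using y by (simp add: divide_le_eq)
    qed
    finally show ?thesis by (simp add: y_def)
  qed
  then show ?thesis using exp_ge_add_one_self[of x] zero_le_power2[of x] by linarith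
qed

lemma exp_first_order:
  fixes x :: real assumes "\<bar>x\<bar> \<le> 1" shows "\<bar>exp x - 1\<bar> \<le> 2 * \<bar>x\<bar>"
proof -
  have "\<bar>x\<bar> * \<bar>x\<bar> \<le> \<bar>x\<bar> * 1" using assms by (intro mult_left_mono) auto
  then have "x\<^sup>2 \<le> \<bar>x\<bar>" by (simp add: power2_eq_square)
  then show ?thesis using exp_second_order[OF assms] by linarith
qed

text \<open>The gradient of the minimizer with respect to the lag-\<open>h\<close> autocorrelation
  at the true model, as the implicit function theorem predicts from the linearized first-order
  condition.\<close>

definition acf_weight :: "real \<Rightarrow> nat \<Rightarrow> nat \<Rightarrow> real" where
  "acf_weight lam d h =
     - (real h * exp (- lam * real h)) / (\<Sum>k=1..d. (real k * exp (- lam * real k))\<^sup>2)"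

definition acf_error :: "nat \<Rightarrow> (nat \<Rightarrow> real) \<Rightarrow> real \<Rightarrow> real" where
  "acf_error d \<rho> l = (\<Sum>h=1..d. (\<rho> h - exp (- l * real h))\<^sup>2)"

text \<open>The radius \<open>r\<close> and the constant \<open>C\<close> do not depend on the data,
  and every minimizer is covered. The statement therefore applies both to deterministic curves and
  to random autocorrelations, whatever minimizer is selected.\<close>

lemma acf_error_argmin_expansion:
  fixes lam :: real and d :: nat
  assumes "lam > 0" "d \<ge> 1"
  shows "\<exists>r>0. \<exists>C\<ge>0. \<forall>\<rho> \<eta>. (\<forall>h\<in>{1..d}. \<bar>\<rho> h - exp (- lam * real h)\<bar> \<le> \<eta>) \<longrightarrow> \<eta> \<le> r \<longrightarrow>
    (\<exists>l. is_arg_min (acf_error d \<rho>) (\<lambda>_. True) l) \<and>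
    (\<forall>l. is_arg_min (acf_error d \<rho>) (\<lambda>_. True) l \<longrightarrow> l > 0 \<and>
       \<bar>l - lam - (\<Sum>h=1..d. acf_weight lam d h * (\<rho> h - exp (- lam * real h)))\<bar> \<le> C * \<eta>\<^sup>2)"
proof -
  \<comment> \<open>The bound \<open>lam / 2\<close> keeps minimizers positive, \<open>1/2\<close>
    makes the linear term of \<open>exp (- t) - 1\<close> dominate, and \<open>1 / real d\<close>
    keeps \<open>t * real h\<close> within the range of \<open>exp_second_order\<close> for every
    lag.\<close>
  define \<tau> where "\<tau> = min (lam / 2) (min (1/2) (1 / real d))"
  have \<tau>: "0 < \<tau>" "\<tau> < lam" "\<tau> \<le> 1/2" "\<tau> \<le> 1 / real d" using assms by (auto simp: \<tau>_def)
  define u where "u h = exp (- lam * real h)" for h :: nat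
  have u: "0 < u h" "u h \<le> 1" for h using assms by (auto simp: u_def)
  define S where "S = (\<Sum>k=1..d. (real k * u k)\<^sup>2)"
  have S: "S > 0" unfolding S_def using assms u(1) by (intro sum_pos) (auto simp: less_imp_neq[THEN not_sym])
  \<comment> \<open>Factor \<open>real d + 1\<close> from comparing the lag-one terms,
    \<open>exp lam\<close> from pulling out \<open>exp (- lam)\<close>, and 2 from inverting the
    exponential near 0.\<close>
  define K where "K = 2 * (real d + 1) * exp lam"
  \<comment> \<open>Makes \<open>(real d + 1) * r\<close> half the distance between
    \<open>exp (- lam)\<close> and \<open>exp (- (lam + \<tau>))\<close>, so that no minimizer can
    lie beyond \<open>\<tau>\<close>.\<close>
  define r where "r = exp (- lam) * (1 - exp (- \<tau>)) / (2 * (real d + 1))"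
  define C where "C = (\<Sum>h=1..d. 2 * (real h)^2 * K + 5 * (real h)^3 * K\<^sup>2) / S"
  have r: "r > 0" using \<tau> by (simp add: r_def)
  have K: "K > 0" by (simp add: K_def add_pos_nonneg)
  have C: "C \<ge> 0" unfolding C_def using S K by (intro divide_nonneg_pos sum_nonneg) auto
  have main: "(\<exists>l. is_arg_min (acf_error d \<rho>) (\<lambda>_. True) l) \<and>
    (\<forall>l. is_arg_min (acf_error d \<rho>) (\<lambda>_. True) l \<longrightarrow> l > 0 \<and>
       \<bar>l - lam - (\<Sum>h=1..d. acf_weight lam d h * (\<rho> h - exp (- lam * real h)))\<bar> \<le> C * \<eta>\<^sup>2)"
    if \<rho>: "\<forall>h\<in>{1..d}. \<bar>\<rho> h - exp (- lam * real h)\<bar> \<le> \<eta>" and "\<eta> \<le> r" for \<rho> \<eta>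
  proof -
    let ?Q = "acf_error d \<rho>"
    have \<eta>: "\<eta> \<ge> 0" using \<rho> assms by (meson abs_ge_zero atLeastAtMost_iff le_refl order.trans)
    \<comment> \<open>The bound \<open>real d * \<eta>\<^sup>2\<close> is weakened to a perfect
      square so that its root involves no square root of \<open>d\<close>.\<close>
    have Qlam: "?Q lam \<le> (real d * \<eta>)\<^sup>2"
    proof -
      have "?Q lam \<le> (\<Sum>h=1..d. \<eta>\<^sup>2)"
        unfolding acf_error_def using \<rho> \<eta> by (intro sum_mono) (auto simp flip: abs_le_square_iff)
      also have "\<dots> = real d * \<eta>\<^sup>2" by simp
      also have "\<dots> \<le> (real d)\<^sup>2 * \<eta>\<^sup>2"
        using assms by (intro mult_right_mono) (auto simp: power2_eq_square)
      finally show ?thesis by (simp add: power_mult_distrib)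
    qed
    have close: "\<bar>exp (- l) - exp (- lam)\<bar> \<le> (real d + 1) * \<eta>" if "?Q l \<le> ?Q lam" for l
    proof -
      have "(\<rho> 1 - exp (- l * real 1))\<^sup>2 \<le> ?Q l"
        unfolding acf_error_def by (rule member_le_sum[of 1]) (use assms in auto)
      also have "\<dots> \<le> (real d * \<eta>)\<^sup>2" using that Qlam by simp
      finally have "\<bar>\<rho> 1 - exp (- l)\<bar> \<le> real d * \<eta>"
        using \<eta> by (simp flip: abs_le_square_iff)
      moreover have "\<bar>\<rho> 1 - exp (- lam)\<bar> \<le> \<eta>" using \<rho> assms by (metis atLeastAtMost_iff le_refl mult.right_neutral of_nat_1)
      ultimately show ?thesis by (simp add: algebra_simps)
    qed
    have near: "\<bar>l - lam\<bar> \<le> \<tau>" if "?Q l \<le> ?Q lam" for l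
    proof (rule ccontr)
      assume n: "\<not> \<bar>l - lam\<bar> \<le> \<tau>"
      have "exp (- lam) * (1 - exp (- \<tau>)) \<le> \<bar>exp (- l) - exp (- lam)\<bar>"
      proof (cases "l > lam")
        case True
        then have "l > lam + \<tau>" using n by auto
        then have "exp (- l) \<le> exp (- lam) * exp (- \<tau>)" by (simp flip: exp_add)
        then show ?thesis by (simp add: algebra_simps)
      next
        case False
        then have "l < lam - \<tau>" using n by auto
        then have 1: "exp (- lam) * exp \<tau> \<le> exp (- l)" by (simp flip: exp_add)
        \<comment> \<open>Convexity: the gap of the exponential to the left of \<open>lam\<close> is
          at least the gap to the right, so one threshold serves both sides.\<close>
        have "2 \<le> exp \<tau> + exp (- \<tau>)"
          using exp_ge_add_one_self[of \<tau>] exp_ge_add_one_self[of "- \<tau>"] by linarith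
        then have "exp (- lam) * 2 \<le> exp (- lam) * (exp \<tau> + exp (- \<tau>))" by (intro mult_left_mono) auto
        then show ?thesis using 1 by (simp add: algebra_simps)
      qed
      also have "\<dots> \<le> (real d + 1) * r"
        by (rule order.trans[OF close[OF that]]) (use \<open>\<eta> \<le> r\<close> in \<open>intro mult_left_mono; simp\<close>)
      also have "\<dots> = exp (- lam) * (1 - exp (- \<tau>)) / 2"
        unfolding r_def using assms by (simp add: field_simps)
      finally have "exp (- lam) * (1 - exp (- \<tau>)) \<le> 0" by linarith
      moreover have "0 < exp (- lam) * (1 - exp (- \<tau>))" using \<tau> by simp
      ultimately show False by linarith
    qed
    have cont: "continuous_on A ?Q" for A unfolding acf_error_def by (intro continuous_intros)
    \<comment> \<open>A minimizer over the compact interval is global: by \<open>near\<close>, any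
      point at least as good as \<open>lam\<close> lies in the interval.\<close>
    obtain l0 where l0: "l0 \<in> {lam - \<tau>..lam + \<tau>}" "\<And>l. l \<in> {lam - \<tau>..lam + \<tau>} \<Longrightarrow> ?Q l0 \<le> ?Q l"
      using continuous_attains_inf[of "{lam - \<tau>..lam + \<tau>}" ?Q] cont \<tau> by auto
    have "?Q l0 \<le> ?Q l" for l
    proof (cases "?Q l \<le> ?Q lam")
      case True
      then show ?thesis using near[OF True] by (intro l0(2)) (auto simp: abs_le_iff)
    next
      case False
      then show ?thesis using l0(2)[of lam] \<tau> by auto
    qed
    then have ex: "is_arg_min ?Q (\<lambda>_. True) l0" by (auto simp: is_arg_min_def not_less)
    have "l > 0 \<and> \<bar>l - lam - (\<Sum>h=1..d. acf_weight lam d h * (\<rho> h - exp (- lam * real h)))\<bar> \<le> C * \<eta>\<^sup>2"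
      if l: "is_arg_min ?Q (\<lambda>_. True) l" for l
    proof -
      have min: "?Q l \<le> ?Q l'" for l' using l by (auto simp: is_arg_min_def not_less)
      define t where "t = l - lam"
      have t: "\<bar>t\<bar> \<le> \<tau>" using near[OF min] by (simp add: t_def)
      define p where "p h = exp (- t * real h)" for h :: nat
      have up: "exp (- l * real h) = u h * p h" for h
        by (simp add: u_def p_def t_def algebra_simps flip: exp_add)
      define \<Delta> where "\<Delta> h = \<rho> h - u h" for h
      have \<Delta>: "\<bar>\<Delta> h\<bar> \<le> \<eta>" if "h \<in> {1..d}" for h using \<rho> that by (simp add: \<Delta>_def u_def)
      have "l > 0" using t \<tau> by (simp add: t_def)
      \<comment> \<open>Since \<open>t\<close> is at most 1/2 in absolute value, the quadratic error
        is at most half the linear term, so \<open>exp (- t) - 1\<close> is at least half of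
        \<open>t\<close> in size.\<close>
      have tK: "\<bar>t\<bar> \<le> K * \<eta>"
      proof -
        have t1: "\<bar>- t\<bar> \<le> 1" using t \<tau> by simp
        have "t\<^sup>2 \<le> \<bar>t\<bar> / 2"
          using t \<tau> mult_left_mono[of "\<bar>t\<bar>" "1/2" "\<bar>t\<bar>"] by (simp add: power2_eq_square)
        then have "\<bar>t\<bar> / 2 \<le> \<bar>exp (- t) - 1\<bar>"
          using exp_second_order[OF t1] abs_triangle_ineq4[of "exp (- t) - 1 + t" "exp (- t) - 1"] by simp
        also have "\<dots> = exp lam * \<bar>exp (- l) - exp (- lam)\<bar>"
        proof -
          have "exp (- t) - 1 = exp lam * (exp (- l) - exp (- lam))"
            by (simp add: t_def right_diff_distrib flip: exp_add)
          then show ?thesis by (simp add: abs_mult)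
        qed
        also have "\<dots> \<le> exp lam * ((real d + 1) * \<eta>)" by (intro mult_left_mono close min) auto
        finally show ?thesis by (simp add: K_def algebra_simps)
      qed
      have "(?Q has_real_derivative (\<Sum>h=1..d. 2 * (\<rho> h - exp (- l * real h)) * (real h * exp (- l * real h)))) (at l)"
        unfolding acf_error_def
        by (rule DERIV_sum) (auto intro!: derivative_eq_intros)
      then have "(\<Sum>h=1..d. 2 * (\<rho> h - exp (- l * real h)) * (real h * exp (- l * real h))) = 0"
        by (rule DERIV_local_min[where d = 1]) (use min in auto)
      then have "0 = (\<Sum>h=1..d. 2 * (real h * u h * p h * (\<Delta> h - u h * (p h - 1))))"
        unfolding up \<Delta>_def by (simp add: algebra_simps)
      then have foc: "(\<Sum>h=1..d. real h * u h * p h * (\<Delta> h - u h * (p h - 1))) = 0"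
        by (simp flip: sum_distrib_left)
      \<comment> \<open>The linearized first-order condition minus the exact one, which is 0. What
        remains has only terms of second order: a product of \<open>\<Delta> h\<close> with
        \<open>p h - 1\<close>, a Taylor remainder, and a square.\<close>
      have "\<bar>S * t + (\<Sum>h=1..d. real h * u h * \<Delta> h)\<bar> =
        \<bar>(\<Sum>h=1..d. real h * u h * (\<Delta> h + real h * u h * t)) - (\<Sum>h=1..d. real h * u h * p h * (\<Delta> h - u h * (p h - 1)))\<bar>"
        unfolding foc S_def sum_distrib_right sum.distrib[symmetric] diff_0_right
        by (intro arg_cong[where f = abs] sum.cong refl) (simp add: algebra_simps power2_eq_square)
      also have "\<dots> = \<bar>\<Sum>h=1..d. real h * u h * (\<Delta> h * (1 - p h) + u h * (p h - 1 - (- t * real h)) + u h * (p h - 1)\<^sup>2)\<bar>"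
        unfolding sum_subtractf[symmetric] by (simp add: algebra_simps power2_eq_square)
      also have "\<dots> \<le> (\<Sum>h=1..d. \<bar>real h * u h * (\<Delta> h * (1 - p h) + u h * (p h - 1 - (- t * real h)) + u h * (p h - 1)\<^sup>2)\<bar>)"
        by (rule sum_abs)
      \<comment> \<open>The first of the three terms contributes the coefficient
        \<open>2 * K\<close>; the 5 is 1 from the Taylor remainder plus 4 from the square of
        \<open>2 * real h * (K * \<eta>)\<close>.\<close>
      also have "\<dots> \<le> (\<Sum>h=1..d. (2 * (real h)^2 * K + 5 * (real h)^3 * K\<^sup>2) * \<eta>\<^sup>2)"
      proof (rule sum_mono)
        fix h assume h: "h \<in> {1..d}"
        have th: "\<bar>- t * real h\<bar> \<le> 1"
        proof -
          have "\<bar>t\<bar> * real h \<le> 1 / real d * real d" using t \<tau> h by (intro mult_mono) auto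
          then show ?thesis using assms by (simp add: abs_mult)
        qed
        have p1: "\<bar>p h - 1\<bar> \<le> 2 * real h * (K * \<eta>)"
        proof -
          have "\<bar>p h - 1\<bar> \<le> 2 * (\<bar>t\<bar> * real h)"
            using exp_first_order[OF th] by (simp add: p_def abs_mult)
          also have "\<dots> \<le> 2 * (K * \<eta> * real h)" using tK by (intro mult_left_mono mult_right_mono) auto
          finally show ?thesis by (simp add: mult_ac)
        qed
        have p2: "\<bar>p h - 1 - (- t * real h)\<bar> \<le> (real h)\<^sup>2 * (K * \<eta>)\<^sup>2"
        proof -
          have "\<bar>p h - 1 - (- t * real h)\<bar> \<le> t\<^sup>2 * (real h)\<^sup>2"
            using exp_second_order[OF th] by (simp add: p_def power_mult_distrib)
          also have "\<dots> \<le> (K * \<eta>)\<^sup>2 * (real h)\<^sup>2"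
            using tK K \<eta> by (intro mult_right_mono) (auto simp flip: abs_le_square_iff)
          finally show ?thesis by (simp add: mult_ac)
        qed
        have p3: "(p h - 1)\<^sup>2 \<le> (2 * real h * (K * \<eta>))\<^sup>2"
          using p1 K \<eta> by (simp flip: abs_le_square_iff)
        have a: "\<bar>\<Delta> h * (1 - p h)\<bar> \<le> \<eta> * (2 * real h * (K * \<eta>))"
          unfolding abs_mult using \<Delta>[OF h] p1 \<eta> by (intro mult_mono) (auto simp: abs_minus_commute)
        have b: "\<bar>u h * (p h - 1 - (- t * real h))\<bar> \<le> 1 * ((real h)\<^sup>2 * (K * \<eta>)\<^sup>2)"
          unfolding abs_mult using u[of h] p2 by (intro mult_mono) auto
        have c: "\<bar>u h * (p h - 1)\<^sup>2\<bar> \<le> 1 * (2 * real h * (K * \<eta>))\<^sup>2"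
          unfolding abs_mult using u[of h] p3 by (intro mult_mono) auto
        have "\<bar>real h * u h * (\<Delta> h * (1 - p h) + u h * (p h - 1 - (- t * real h)) + u h * (p h - 1)\<^sup>2)\<bar>
          \<le> (real h * 1) * (\<eta> * (2 * real h * (K * \<eta>)) + 1 * ((real h)\<^sup>2 * (K * \<eta>)\<^sup>2) + 1 * (2 * real h * (K * \<eta>))\<^sup>2)"
          unfolding abs_mult[of "real h * u h"]
        proof (rule mult_mono)
          show "\<bar>real h * u h\<bar> \<le> real h * 1" using u[of h] by (auto simp: abs_mult mult_left_le)
          show "\<bar>\<Delta> h * (1 - p h) + u h * (p h - 1 - (- t * real h)) + u h * (p h - 1)\<^sup>2\<bar> \<le>
            \<eta> * (2 * real h * (K * \<eta>)) + 1 * ((real h)\<^sup>2 * (K * \<eta>)\<^sup>2) + 1 * (2 * real h * (K * \<eta>))\<^sup>2"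
            using a b c by linarith
        qed auto
        also have "\<dots> = (2 * (real h)^2 * K + 5 * (real h)^3 * K\<^sup>2) * \<eta>\<^sup>2"
          by (simp add: algebra_simps power2_eq_square power3_eq_cube)
        finally show "\<bar>real h * u h * (\<Delta> h * (1 - p h) + u h * (p h - 1 - (- t * real h)) + u h * (p h - 1)\<^sup>2)\<bar>
          \<le> (2 * (real h)^2 * K + 5 * (real h)^3 * K\<^sup>2) * \<eta>\<^sup>2" .
      qed
      also have "\<dots> = S * (C * \<eta>\<^sup>2)"
        using S by (simp add: C_def sum_distrib_right[symmetric])
      finally have bound: "\<bar>S * t + (\<Sum>h=1..d. real h * u h * \<Delta> h)\<bar> \<le> S * (C * \<eta>\<^sup>2)" .
      have "(\<Sum>h=1..d. acf_weight lam d h * (\<rho> h - exp (- lam * real h))) = - (\<Sum>h=1..d. real h * u h * \<Delta> h) / S"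
        unfolding acf_weight_def u_def[symmetric] S_def[symmetric] \<Delta>_def[symmetric]
        by (simp add: sum_divide_distrib sum_negf[symmetric])
      then have "l - lam - (\<Sum>h=1..d. acf_weight lam d h * (\<rho> h - exp (- lam * real h))) =
        (S * t + (\<Sum>h=1..d. real h * u h * \<Delta> h)) / S"
        using S by (simp add: t_def field_simps)
      then have "\<bar>l - lam - (\<Sum>h=1..d. acf_weight lam d h * (\<rho> h - exp (- lam * real h)))\<bar> \<le> C * \<eta>\<^sup>2"
        using bound S by (simp add: abs_divide divide_le_eq mult.commute)
      then show ?thesis using \<open>l > 0\<close> by simp
    qed
    then show ?thesis using ex by blast
  qed
  show ?thesis using r C main by blast
qed

text \<open>The lag-zero term does not involve \<open>l\<close>, so it shifts the criterion by a
  constant. Existence is assumed because \<open>ARG_MIN\<close> is an arbitrary value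
  otherwise.\<close>

lemma F_map_argmin:
  assumes "\<exists>l. is_arg_min (acf_error d \<rho>) (\<lambda>_. True) l"
  shows "\<exists>l. is_arg_min (acf_error d \<rho>) (\<lambda>_. True) l \<and> F_map d \<rho> = (if l < 0 then 0 else l)"
proof -
  have eq: "(\<Sum>h=0..d. (\<rho> h - exp (- l * real h))\<^sup>2) = (\<rho> 0 - 1)\<^sup>2 + acf_error d \<rho> l" for l
    unfolding acf_error_def by (subst sum.atLeast_Suc_atMost) auto
  have "is_arg_min (\<lambda>l. \<Sum>h=0..d. (\<rho> h - exp (- l * real h))\<^sup>2) (\<lambda>_. True) l \<longleftrightarrow>
      is_arg_min (acf_error d \<rho>) (\<lambda>_. True) l" for l
    unfolding eq by (simp add: is_arg_min_def)
  then have "is_arg_min (acf_error d \<rho>) (\<lambda>_. True) (ARG_MIN (\<lambda>l. \<Sum>h=0..d. (\<rho> h - exp (- l * real h))\<^sup>2) l. True)"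
    using assms by (auto simp: arg_min_def intro: someI2_ex)
  then show ?thesis unfolding F_map_def Let_def by blast
qed

text \<open>At the base point the deviation is 0 and the expansion forces the value
  \<open>lam\<close>. Nearby the remainder is quadratic in a deviation of order
  \<open>\<bar>t - s\<bar>\<close>, hence vanishes in the difference quotient, however the
  minimizers are chosen.\<close>

lemma F_map_has_derivative:
  fixes \<rho> :: "real \<Rightarrow> nat \<Rightarrow> real"
  assumes lam: "lam > 0" "d \<ge> 1" and \<rho>0: "\<And>h. h \<in> {1..d} \<Longrightarrow> \<rho> s h = exp (- lam * real h)"
    and D: "\<And>h. h \<in> {1..d} \<Longrightarrow> ((\<lambda>t. \<rho> t h) has_real_derivative D h) (at s)"
  shows "((\<lambda>t. F_map d (\<rho> t)) has_real_derivative (\<Sum>h=1..d. acf_weight lam d h * D h)) (at s)"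
proof -
  obtain r C where r: "r > 0" and C: "C \<ge> 0" and
    exp': "\<forall>\<rho> \<eta>. (\<forall>h\<in>{1..d}. \<bar>\<rho> h - exp (- lam * real h)\<bar> \<le> \<eta>) \<longrightarrow> \<eta> \<le> r \<longrightarrow>
    (\<exists>l. is_arg_min (acf_error d \<rho>) (\<lambda>_. True) l) \<and>
    (\<forall>l. is_arg_min (acf_error d \<rho>) (\<lambda>_. True) l \<longrightarrow> l > 0 \<and>
       \<bar>l - lam - (\<Sum>h=1..d. acf_weight lam d h * (\<rho> h - exp (- lam * real h)))\<bar> \<le> C * \<eta>\<^sup>2)"
    using acf_error_argmin_expansion[OF lam] by (elim exE conjE) (rule that)
  note exp = exp'[THEN spec, THEN spec, THEN mp, THEN mp]
  \<comment> \<open>A sum rather than a maximum: it still dominates every lag, and its difference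
    quotient has an evident limit.\<close>
  define \<eta> where "\<eta> t = (\<Sum>h=1..d. \<bar>\<rho> t h - \<rho> s h\<bar>)" for t
  have bnd: "\<bar>F_map d (\<rho> t) - lam - (\<Sum>h=1..d. acf_weight lam d h * (\<rho> t h - \<rho> s h))\<bar> \<le> C * (\<eta> t)\<^sup>2"
    if "\<eta> t \<le> r" for t
  proof -
    have *: "\<forall>h\<in>{1..d}. \<bar>\<rho> t h - exp (- lam * real h)\<bar> \<le> \<eta> t"
    proof
      fix h assume h: "h \<in> {1..d}"
      show "\<bar>\<rho> t h - exp (- lam * real h)\<bar> \<le> \<eta> t"
        unfolding \<eta>_def \<rho>0[OF h, symmetric]
        by (rule member_le_sum[of h _ "\<lambda>h. \<bar>\<rho> t h - \<rho> s h\<bar>"]) (use h in auto)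
    qed
    note e = exp[OF * that]
    obtain l where l: "is_arg_min (acf_error d (\<rho> t)) (\<lambda>_. True) l" "F_map d (\<rho> t) = (if l < 0 then 0 else l)"
      using F_map_argmin e by blast
    have "F_map d (\<rho> t) = l" using e l by force
    then show ?thesis using e l by (simp add: \<rho>0)
  qed
  have F0: "F_map d (\<rho> s) = lam" using bnd[of s] r by (simp add: \<eta>_def)
  have cont: "((\<lambda>t. \<rho> t h) \<longlongrightarrow> \<rho> s h) (at s)" if "h \<in> {1..d}" for h
    using DERIV_isCont[OF D[OF that]] by (simp add: isCont_def)
  have quot: "((\<lambda>t. (\<rho> t h - \<rho> s h) / (t - s)) \<longlongrightarrow> D h) (at s)" if "h \<in> {1..d}" for h
    using D[OF that] by (simp add: has_field_derivative_iff)
  have \<eta>0: "(\<eta> \<longlongrightarrow> 0) (at s)"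
  proof -
    have "((\<lambda>t. \<Sum>h=1..d. \<bar>\<rho> t h - \<rho> s h\<bar>) \<longlongrightarrow> (\<Sum>h=1..d. \<bar>\<rho> s h - \<rho> s h\<bar>)) (at s)"
      by (intro tendsto_intros cont)
    then show ?thesis by (simp add: \<eta>_def[abs_def])
  qed
  have \<eta>1: "((\<lambda>t. \<eta> t / \<bar>t - s\<bar>) \<longlongrightarrow> (\<Sum>h=1..d. \<bar>D h\<bar>)) (at s)"
  proof -
    have "((\<lambda>t. \<Sum>h=1..d. \<bar>(\<rho> t h - \<rho> s h) / (t - s)\<bar>) \<longlongrightarrow> (\<Sum>h=1..d. \<bar>D h\<bar>)) (at s)"
      by (intro tendsto_intros quot)
    then show ?thesis by (simp add: \<eta>_def sum_divide_distrib)
  qed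
  have rem: "((\<lambda>t. (F_map d (\<rho> t) - lam - (\<Sum>h=1..d. acf_weight lam d h * (\<rho> t h - \<rho> s h))) / (t - s)) \<longlongrightarrow> 0) (at s)"
  proof (rule Lim_null_comparison)
    show "((\<lambda>t. C * \<eta> t * (\<eta> t / \<bar>t - s\<bar>)) \<longlongrightarrow> 0) (at s)"
      using tendsto_mult[OF tendsto_mult[OF tendsto_const \<eta>0] \<eta>1, of C] by simp
    have "\<forall>\<^sub>F t in at s. \<eta> t < r" using order_tendstoD(2)[OF \<eta>0 r] .
    then show "\<forall>\<^sub>F t in at s. norm ((F_map d (\<rho> t) - lam - (\<Sum>h=1..d. acf_weight lam d h * (\<rho> t h - \<rho> s h))) / (t - s)) \<le> C * \<eta> t * (\<eta> t / \<bar>t - s\<bar>)"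
    proof eventually_elim
      case (elim t)
      then have "\<bar>F_map d (\<rho> t) - lam - (\<Sum>h=1..d. acf_weight lam d h * (\<rho> t h - \<rho> s h))\<bar> / \<bar>t - s\<bar> \<le> C * (\<eta> t)\<^sup>2 / \<bar>t - s\<bar>"
        by (intro divide_right_mono bnd) auto
      then show ?case by (simp add: abs_divide power2_eq_square mult.assoc)
    qed
  qed
  have lin: "((\<lambda>t. \<Sum>h=1..d. acf_weight lam d h * ((\<rho> t h - \<rho> s h) / (t - s))) \<longlongrightarrow> (\<Sum>h=1..d. acf_weight lam d h * D h)) (at s)"
    by (intro tendsto_intros quot)
  show ?thesis unfolding has_field_derivative_iff F0
  proof (rule Lim_transform_eventually[OF tendsto_add[OF rem lin, unfolded add_0]])
    show "\<forall>\<^sub>F t in at s. (F_map d (\<rho> t) - lam - (\<Sum>h=1..d. acf_weight lam d h * (\<rho> t h - \<rho> s h))) / (t - s) +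
        (\<Sum>h=1..d. acf_weight lam d h * ((\<rho> t h - \<rho> s h) / (t - s))) = (F_map d (\<rho> t) - lam) / (t - s)"
      by (rule always_eventually)
        (simp add: sum_divide_distrib[symmetric] add_divide_distrib[symmetric])
  qed
qed

text \<open>Row 3 is the chain rule for the ratios of lag \<open>h\<close> to lag 0: the column of
  lag 0 (index 1) collects a contribution from every ratio, while the column \<open>k\<close> beyond
  it meets only lag \<open>k - 1\<close>.\<close>

definition H_jacobian :: "real \<Rightarrow> nat \<Rightarrow> real \<Rightarrow> 3 \<Rightarrow> nat \<Rightarrow> real" where
  "H_jacobian lam d g j k =
     (if j = 1 then (if k = 0 then 1 else 0)
      else if j = 2 then (if k = 1 then 2 else 0)
      else if k = 0 then 0
      else if k = 1 then - (\<Sum>h=1..d. acf_weight lam d h * exp (- lam * real h)) / g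
      else acf_weight lam d (k - 1) / g)"

text \<open>The case distinction in \<open>G_map\<close> disappears because \<open>F_map\<close> is
  never negative: where it is not positive, it is 0.\<close>

lemma H_map_component:
  "H_map d x $ 1 = x 0" "H_map d x $ 2 = 2 * x 1"
  "H_map d x $ 3 = F_map d (\<lambda>h. x (Suc h) / x 1)"
  by (auto simp: H_map_def G_map_def F_map_def Let_def)

text \<open>Partial derivatives are derivatives along the coordinate curves
  \<open>p(k := t)\<close>, each of which passes through the true autocorrelations at
  \<open>p k\<close>. This is the setting of \<open>F_map_has_derivative\<close>.\<close>

lemma H_map_has_jacobian:
  assumes lam: "lam > 0" "d \<ge> 1" and "g > 0" and p: "\<And>h. p (Suc h) = g * exp (- lam * real h)"
  shows "has_jacobian (d + 2) (H_map d) p (H_jacobian lam d g)"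
  unfolding has_jacobian_def
proof (intro allI impI)
  fix j :: 3 and k assume k: "k < d + 2"
  have p1: "p 1 = g" using p[of 0] by simp
  consider "j = 1" | "j = 2" | "j = 3" using exhaust_3[of j] by blast
  then show "((\<lambda>t. H_map d (p(k := t)) $ j) has_real_derivative H_jacobian lam d g j k) (at (p k))"
  proof cases
    case 1
    then show ?thesis by (auto simp: H_map_component H_jacobian_def)
  next
    case 2
    have "((\<lambda>t. 2 * t) has_real_derivative 2) (at x)" for x :: real
      by (auto intro!: derivative_eq_intros)
    then show ?thesis using 2 by (auto simp: H_map_component H_jacobian_def)
  next
    case 3
    define \<rho> where "\<rho> t h = (p(k := t)) (Suc h) / (p(k := t)) 1" for t h
    \<comment> \<open>The derivative of the ratio of lag \<open>h\<close> to lag 0 in direction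
      \<open>k\<close>. For \<open>h\<close> at least 1 the cases \<open>k = 1\<close> and
      \<open>k = Suc h\<close> are distinct.\<close>
    define D where "D h = (if k = 0 then 0 else if k = 1 then - exp (- lam * real h) / g
       else if k = Suc h then 1 / g else 0)" for h
    have "((\<lambda>t. F_map d (\<rho> t)) has_real_derivative (\<Sum>h=1..d. acf_weight lam d h * D h)) (at (p k))"
    proof (rule F_map_has_derivative[OF lam])
      fix h assume h: "h \<in> {1..d}"
      show "\<rho> (p k) h = exp (- lam * real h)" using \<open>g > 0\<close> p1 by (simp add: \<rho>_def p)
      consider "k = 0" | "k = 1" | "k = Suc h" | "k \<noteq> 0" "k \<noteq> 1" "k \<noteq> Suc h" by blast
      then show "((\<lambda>t. \<rho> t h) has_real_derivative D h) (at (p k))"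
      proof cases
        case 2
        have "((\<lambda>t. p (Suc h) / t) has_real_derivative - p (Suc h) / g\<^sup>2) (at g)"
          using \<open>g > 0\<close> by (auto intro!: derivative_eq_intros simp: power2_eq_square)
        then show ?thesis using 2 h p1 \<open>g > 0\<close> by (simp add: \<rho>_def D_def p power2_eq_square)
      next
        case 3
        have "((\<lambda>t. t / g) has_real_derivative 1 / g) (at x)" for x
          using \<open>g > 0\<close> by (auto intro!: derivative_eq_intros)
        then show ?thesis using 3 h p1 by (simp add: \<rho>_def D_def)
      qed (auto simp: \<rho>_def D_def)
    qed
    moreover have "(\<Sum>h=1..d. acf_weight lam d h * D h) = H_jacobian lam d g 3 k"
    proof -
      consider "k = 0" | "k = 1" | "k \<ge> 2" by linarith
      then show ?thesis
      proof cases
        case 2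
        then show ?thesis by (simp add: D_def H_jacobian_def sum_divide_distrib sum_negf)
      next
        case 3
        then have "(\<Sum>h=1..d. acf_weight lam d h * D h) = (\<Sum>h=1..d. if h = k - 1 then acf_weight lam d h / g else 0)"
          by (intro sum.cong) (auto simp: D_def)
        also have "\<dots> = acf_weight lam d (k - 1) / g" using 3 k by (subst sum.delta) auto
        finally show ?thesis using 3 by (simp add: H_jacobian_def)
      qed (simp add: D_def H_jacobian_def)
    qed
    ultimately show ?thesis using 3 by (simp add: H_map_component \<rho>_def[abs_def])
  qed
qed

section \<open>A central limit theorem for martingale differences\<close>

lemma abs_powr_add_le:
  fixes x y :: real assumes "q > 0"
  shows "\<bar>x + y\<bar> powr q \<le> 2 powr q * (\<bar>x\<bar> powr q + \<bar>y\<bar> powr q)"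
proof -
  have "\<bar>x + y\<bar> powr q \<le> (2 * max \<bar>x\<bar> \<bar>y\<bar>) powr q"
    using assms by (intro powr_mono2) auto
  also have "\<dots> = 2 powr q * (max \<bar>x\<bar> \<bar>y\<bar>) powr q" by (simp add: powr_mult)
  also have "\<dots> \<le> 2 powr q * (\<bar>x\<bar> powr q + \<bar>y\<bar> powr q)"
    by (intro mult_left_mono) (auto simp: max_def)
  finally show ?thesis .
qed

lemma abs_powr_mult_le:
  fixes x y :: real
  shows "\<bar>x * y\<bar> powr q \<le> \<bar>x\<bar> powr (2 * q) + \<bar>y\<bar> powr (2 * q)"
proof -
  have sq: "\<bar>z\<bar> powr (2 * q) = (\<bar>z\<bar> powr q)\<^sup>2" for z :: real
    by (simp only: mult_2 powr_add power2_eq_square)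
  have "\<bar>x * y\<bar> powr q = \<bar>x\<bar> powr q * \<bar>y\<bar> powr q" by (simp add: abs_mult powr_mult)
  also have "\<dots> \<le> (\<bar>x\<bar> powr q)\<^sup>2 + (\<bar>y\<bar> powr q)\<^sup>2"
    using sum_squares_bound[of "\<bar>x\<bar> powr q" "\<bar>y\<bar> powr q"]
      zero_le_power2[of "\<bar>x\<bar> powr q"] zero_le_power2[of "\<bar>y\<bar> powr q"] by linarith
  finally show ?thesis by (simp add: sq)
qed

lemma abs_powr_le_one_plus:
  fixes x :: real assumes "0 < q" "q \<le> p"
  shows "\<bar>x\<bar> powr q \<le> 1 + \<bar>x\<bar> powr p"
proof (cases "\<bar>x\<bar> \<le> 1")
  case True
  then have "\<bar>x\<bar> powr q \<le> 1 powr q" using assms by (intro powr_mono2) auto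
  then show ?thesis by (simp add: add_increasing2)
next
  case False
  then have "\<bar>x\<bar> powr q \<le> \<bar>x\<bar> powr p" using assms by (intro powr_mono) auto
  then show ?thesis by simp
qed

section \<open>Uniformly bounded moments\<close>

context prob_space
begin

text \<open>Boundedness in \<open>L^q\<close>, uniform in the index. Real exponents are essential:
  for the martingale differences \<open>q\<close> will lie strictly above 2 by an unspecified
  amount.\<close>

definition bounded_moment :: "real \<Rightarrow> (nat \<Rightarrow> 'a \<Rightarrow> real) \<Rightarrow> bool" where
  "bounded_moment q X \<longleftrightarrow> (\<forall>i. X i \<in> borel_measurable M) \<and>
     (\<exists>C. \<forall>i. integrable M (\<lambda>\<omega>. \<bar>X i \<omega>\<bar> powr q) \<and> expectation (\<lambda>\<omega>. \<bar>X i \<omega>\<bar> powr q) \<le> C)"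

lemma bounded_moment_measurable: "bounded_moment q X \<Longrightarrow> X i \<in> borel_measurable M"
  by (auto simp: bounded_moment_def)

lemma bounded_momentI:
  assumes m: "\<And>i. X i \<in> borel_measurable M"
    and G: "\<And>i. integrable M (G i)" "\<And>i. expectation (G i) \<le> C"
    and le: "\<And>i \<omega>. \<omega> \<in> space M \<Longrightarrow> \<bar>X i \<omega>\<bar> powr q \<le> G i \<omega>"
  shows "bounded_moment q X"
  unfolding bounded_moment_def
proof (intro conjI allI exI[of _ C])
  fix i
  note [measurable] = m
  show i: "integrable M (\<lambda>\<omega>. \<bar>X i \<omega>\<bar> powr q)"
  proof (rule Bochner_Integration.integrable_bound[OF G(1)[of i]])
    show "AE \<omega> in M. norm (\<bar>X i \<omega>\<bar> powr q) \<le> norm (G i \<omega>)"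
      by (rule AE_I2) (simp add: order.trans[OF le abs_ge_self])
  qed measurable
  have "expectation (\<lambda>\<omega>. \<bar>X i \<omega>\<bar> powr q) \<le> expectation (G i)"
    by (rule integral_mono[OF i G(1)]) (rule le)
  then show "expectation (\<lambda>\<omega>. \<bar>X i \<omega>\<bar> powr q) \<le> C" using G(2)[of i] by simp
qed (rule m)

lemma bounded_momentE:
  assumes "bounded_moment q X"
  obtains C where "C \<ge> 0" "\<And>i. integrable M (\<lambda>\<omega>. \<bar>X i \<omega>\<bar> powr q)"
    "\<And>i. expectation (\<lambda>\<omega>. \<bar>X i \<omega>\<bar> powr q) \<le> C"
proof -
  from assms obtain C where C: "\<And>i. integrable M (\<lambda>\<omega>. \<bar>X i \<omega>\<bar> powr q)"
    "\<And>i. expectation (\<lambda>\<omega>. \<bar>X i \<omega>\<bar> powr q) \<le> C" by (auto simp: bounded_moment_def)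
  have "0 \<le> expectation (\<lambda>\<omega>. \<bar>X 0 \<omega>\<bar> powr q)" by (intro integral_nonneg_AE) auto
  then have "C \<ge> 0" using C(2)[of 0] by (rule order.trans)
  then show thesis using C that by blast
qed

lemma bounded_moment_add:
  assumes "q > 0" and X: "bounded_moment q X" and Y: "bounded_moment q Y"
  shows "bounded_moment q (\<lambda>i \<omega>. X i \<omega> + Y i \<omega>)"
proof -
  obtain C where "C \<ge> 0" and C: "\<And>i. integrable M (\<lambda>\<omega>. \<bar>X i \<omega>\<bar> powr q)" "\<And>i. expectation (\<lambda>\<omega>. \<bar>X i \<omega>\<bar> powr q) \<le> C"
    by (rule bounded_momentE[OF X], rule that; simp)
  obtain D where "D \<ge> 0" and D: "\<And>i. integrable M (\<lambda>\<omega>. \<bar>Y i \<omega>\<bar> powr q)" "\<And>i. expectation (\<lambda>\<omega>. \<bar>Y i \<omega>\<bar> powr q) \<le> D"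
    by (rule bounded_momentE[OF Y], rule that; simp)
  note [measurable] = bounded_moment_measurable[OF X] bounded_moment_measurable[OF Y]
  show ?thesis
  proof (rule bounded_momentI[where G = "\<lambda>i \<omega>. 2 powr q * (\<bar>X i \<omega>\<bar> powr q + \<bar>Y i \<omega>\<bar> powr q)" and C = "2 powr q * (C + D)"])
    show "expectation (\<lambda>\<omega>. 2 powr q * (\<bar>X i \<omega>\<bar> powr q + \<bar>Y i \<omega>\<bar> powr q)) \<le> 2 powr q * (C + D)" for i
      using C(1)[of i] D(1)[of i] add_mono[OF C(2)[of i] D(2)[of i]] by simp
    show "integrable M (\<lambda>\<omega>. 2 powr q * (\<bar>X i \<omega>\<bar> powr q + \<bar>Y i \<omega>\<bar> powr q))" for i
      by (intro integrable_mult_right Bochner_Integration.integrable_add C D)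
  qed (measurable, rule abs_powr_add_le[OF \<open>q > 0\<close>])
qed

lemma bounded_moment_cmult:
  assumes X: "bounded_moment q X"
  shows "bounded_moment q (\<lambda>i \<omega>. c * X i \<omega>)"
proof -
  obtain C where "C \<ge> 0" and C: "\<And>i. integrable M (\<lambda>\<omega>. \<bar>X i \<omega>\<bar> powr q)" "\<And>i. expectation (\<lambda>\<omega>. \<bar>X i \<omega>\<bar> powr q) \<le> C"
    by (rule bounded_momentE[OF X], rule that; simp)
  note [measurable] = bounded_moment_measurable[OF X]
  show ?thesis
  proof (rule bounded_momentI[where G = "\<lambda>i \<omega>. \<bar>c\<bar> powr q * \<bar>X i \<omega>\<bar> powr q" and C = "\<bar>c\<bar> powr q * C"])
    show "expectation (\<lambda>\<omega>. \<bar>c\<bar> powr q * \<bar>X i \<omega>\<bar> powr q) \<le> \<bar>c\<bar> powr q * C" for i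
      using C(2)[of i] by (simp add: mult_left_mono)
    show "integrable M (\<lambda>\<omega>. \<bar>c\<bar> powr q * \<bar>X i \<omega>\<bar> powr q)" for i
      by (intro integrable_mult_right C)
  qed (measurable, simp add: abs_mult powr_mult)
qed

lemma bounded_moment_const: "bounded_moment q (\<lambda>i \<omega>. c)"
  by (rule bounded_momentI[where G = "\<lambda>i \<omega>. \<bar>c\<bar> powr q" and C = "\<bar>c\<bar> powr q"]) (auto simp: prob_space)

lemma bounded_moment_diff:
  "q > 0 \<Longrightarrow> bounded_moment q X \<Longrightarrow> bounded_moment q Y \<Longrightarrow> bounded_moment q (\<lambda>i \<omega>. X i \<omega> - Y i \<omega>)"
  using bounded_moment_add[OF _ _ bounded_moment_cmult, of q X Y "-1"] by simp

lemma bounded_moment_sum: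
  assumes "q > 0" "\<And>k. k \<in> K \<Longrightarrow> bounded_moment q (X k)"
  shows "bounded_moment q (\<lambda>i \<omega>. \<Sum>k\<in>K. X k i \<omega>)"
  using assms(2)
  by (induction K rule: infinite_finite_induct) (auto intro: bounded_moment_const bounded_moment_add[OF assms(1)])

text \<open>A product costs half of the exponent. More than four moments of the process thus leave
  more than two for the products entering the sample autocovariances.\<close>

lemma bounded_moment_mult:
  assumes "q > 0" and X: "bounded_moment (2 * q) X" and Y: "bounded_moment (2 * q) Y"
  shows "bounded_moment q (\<lambda>i \<omega>. X i \<omega> * Y i \<omega>)"
proof -
  obtain C where "C \<ge> 0" and C: "\<And>i. integrable M (\<lambda>\<omega>. \<bar>X i \<omega>\<bar> powr (2 * q))" "\<And>i. expectation (\<lambda>\<omega>. \<bar>X i \<omega>\<bar> powr (2 * q)) \<le> C"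
    by (rule bounded_momentE[OF X], rule that; simp)
  obtain D where "D \<ge> 0" and D: "\<And>i. integrable M (\<lambda>\<omega>. \<bar>Y i \<omega>\<bar> powr (2 * q))" "\<And>i. expectation (\<lambda>\<omega>. \<bar>Y i \<omega>\<bar> powr (2 * q)) \<le> D"
    by (rule bounded_momentE[OF Y], rule that; simp)
  note [measurable] = bounded_moment_measurable[OF X] bounded_moment_measurable[OF Y]
  show ?thesis
  proof (rule bounded_momentI[where G = "\<lambda>i \<omega>. \<bar>X i \<omega>\<bar> powr (2 * q) + \<bar>Y i \<omega>\<bar> powr (2 * q)" and C = "C + D"])
    show "expectation (\<lambda>\<omega>. \<bar>X i \<omega>\<bar> powr (2 * q) + \<bar>Y i \<omega>\<bar> powr (2 * q)) \<le> C + D" for i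
      using C(1)[of i] D(1)[of i] add_mono[OF C(2)[of i] D(2)[of i]] by simp
    show "integrable M (\<lambda>\<omega>. \<bar>X i \<omega>\<bar> powr (2 * q) + \<bar>Y i \<omega>\<bar> powr (2 * q))" for i
      by (intro Bochner_Integration.integrable_add C D)
  qed (measurable, rule abs_powr_mult_le)
qed

lemma bounded_moment_mono:
  assumes "0 < q" "q \<le> p" and X: "bounded_moment p X"
  shows "bounded_moment q X"
proof -
  obtain C where "C \<ge> 0" and C: "\<And>i. integrable M (\<lambda>\<omega>. \<bar>X i \<omega>\<bar> powr p)" "\<And>i. expectation (\<lambda>\<omega>. \<bar>X i \<omega>\<bar> powr p) \<le> C"
    by (rule bounded_momentE[OF X], rule that; simp)
  note [measurable] = bounded_moment_measurable[OF X]
  show ?thesis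
  proof (rule bounded_momentI[where G = "\<lambda>i \<omega>. 1 + \<bar>X i \<omega>\<bar> powr p" and C = "1 + C"])
    show "expectation (\<lambda>\<omega>. 1 + \<bar>X i \<omega>\<bar> powr p) \<le> 1 + C" for i
      using C(1)[of i] C(2)[of i] by (simp add: prob_space)
    show "integrable M (\<lambda>\<omega>. 1 + \<bar>X i \<omega>\<bar> powr p)" for i
      by (intro Bochner_Integration.integrable_add C) simp
  qed (measurable, rule abs_powr_le_one_plus[OF assms(1,2)])
qed

lemma bounded_moment_shift: "bounded_moment q X \<Longrightarrow> bounded_moment q (\<lambda>i. X (f i))"
  by (auto simp: bounded_moment_def)

lemma bounded_moment_2D:
  assumes "bounded_moment 2 X"
  shows "\<exists>C\<ge>0. \<forall>i. integrable M (\<lambda>\<omega>. (X i \<omega>)\<^sup>2) \<and> expectation (\<lambda>\<omega>. (X i \<omega>)\<^sup>2) \<le> C"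
  using bounded_momentE[OF assms] by simp meson

lemma bounded_moment_1D:
  assumes "bounded_moment 1 X"
  shows "integrable M (X i)" "\<exists>C\<ge>0. \<forall>i. expectation (\<lambda>\<omega>. \<bar>X i \<omega>\<bar>) \<le> C"
proof -
  obtain C where C: "C \<ge> 0" "\<And>i. integrable M (\<lambda>\<omega>. \<bar>X i \<omega>\<bar> powr 1)"
    "\<And>i. expectation (\<lambda>\<omega>. \<bar>X i \<omega>\<bar> powr 1) \<le> C" by (rule bounded_momentE[OF assms], rule that; simp)
  show "integrable M (X i)" using C(2)[of i] bounded_moment_measurable[OF assms]
    by (simp add: integrable_abs_iff)
  show "\<exists>C\<ge>0. \<forall>i. expectation (\<lambda>\<omega>. \<bar>X i \<omega>\<bar>) \<le> C" using C(1,3) by (intro exI[of _ C]) simp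
qed

lemma bounded_moment_integrable: "q \<ge> 1 \<Longrightarrow> bounded_moment q X \<Longrightarrow> integrable M (X i)"
  by (rule bounded_moment_1D(1)[OF bounded_moment_mono]) auto

lemma bounded_moment_integrable_mult:
  assumes "bounded_moment 2 X" "bounded_moment 2 Y"
  shows "integrable M (\<lambda>\<omega>. X i \<omega> * Y j \<omega>)"
proof -
  have "bounded_moment 1 (\<lambda>k \<omega>. X i \<omega> * Y j \<omega>)"
    by (rule bounded_moment_mult) (use assms in \<open>auto intro: bounded_moment_shift[where f = "\<lambda>_. i"] bounded_moment_shift[where f = "\<lambda>_. j"]\<close>)
  from bounded_moment_1D(1)[OF this] show ?thesis by simp
qed

lemma bounded_moment_integrable_power2:
  assumes "bounded_moment 2 X" shows "integrable M (\<lambda>\<omega>. (X i \<omega>)\<^sup>2)"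
  using bounded_moment_integrable_mult[OF assms assms, of i i] by (simp add: power2_eq_square)

lemma integrable_bounded_mult:
  fixes X :: "'a \<Rightarrow> real"
  assumes "P \<in> borel_measurable M" "\<And>\<omega>. \<bar>P \<omega>\<bar> \<le> 1" "integrable M X"
  shows "integrable M (\<lambda>\<omega>. P \<omega> * X \<omega>)"
proof (rule Bochner_Integration.integrable_bound[OF assms(3)])
  show "AE \<omega> in M. norm (P \<omega> * X \<omega>) \<le> norm (X \<omega>)"
    using assms(2) by (auto simp: abs_mult mult_left_le_one_le)
  show "(\<lambda>\<omega>. P \<omega> * X \<omega>) \<in> borel_measurable M" using assms by (intro borel_measurable_times) auto
qed

lemma expectation_bounded_mult_le:
  fixes X :: "'a \<Rightarrow> real"
  assumes "P \<in> borel_measurable M" "\<And>\<omega>. \<bar>P \<omega>\<bar> \<le> 1" "integrable M X"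
  shows "\<bar>expectation (\<lambda>\<omega>. P \<omega> * X \<omega>)\<bar> \<le> expectation (\<lambda>\<omega>. \<bar>X \<omega>\<bar>)"
proof -
  have "\<bar>expectation (\<lambda>\<omega>. P \<omega> * X \<omega>)\<bar> \<le> expectation (\<lambda>\<omega>. \<bar>P \<omega> * X \<omega>\<bar>)" by (rule integral_abs_bound)
  also have "\<dots> \<le> expectation (\<lambda>\<omega>. \<bar>X \<omega>\<bar>)"
    by (intro integral_mono integrable_abs integrable_bounded_mult assms)
       (auto simp: abs_mult mult_left_le_one_le assms)
  finally show ?thesis .
qed

lemma integral_iexp_mult:
  fixes X S :: "'a \<Rightarrow> real"
  assumes [measurable]: "S \<in> borel_measurable M" and X: "integrable M X"
  shows "(CLINT \<omega>|M. iexp (S \<omega>) * complex_of_real (X \<omega>)) =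
    Complex (expectation (\<lambda>\<omega>. cos (S \<omega>) * X \<omega>)) (expectation (\<lambda>\<omega>. sin (S \<omega>) * X \<omega>))"
    and "integrable M (\<lambda>\<omega>. iexp (S \<omega>) * complex_of_real (X \<omega>))"
proof -
  show i: "integrable M (\<lambda>\<omega>. iexp (S \<omega>) * complex_of_real (X \<omega>))"
  proof (rule Bochner_Integration.integrable_bound[OF X])
    have [measurable]: "X \<in> borel_measurable M" using X by auto
    show "(\<lambda>\<omega>. iexp (S \<omega>) * complex_of_real (X \<omega>)) \<in> borel_measurable M" by measurable
  qed (auto simp: norm_mult)
  show "(CLINT \<omega>|M. iexp (S \<omega>) * complex_of_real (X \<omega>)) =
    Complex (expectation (\<lambda>\<omega>. cos (S \<omega>) * X \<omega>)) (expectation (\<lambda>\<omega>. sin (S \<omega>) * X \<omega>))"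
  proof (rule complex_eqI)
    show "Re (CLINT \<omega>|M. iexp (S \<omega>) * complex_of_real (X \<omega>)) = Re (Complex (expectation (\<lambda>\<omega>. cos (S \<omega>) * X \<omega>)) (expectation (\<lambda>\<omega>. sin (S \<omega>) * X \<omega>)))"
      unfolding integral_Re[OF i, symmetric] by (simp add: Re_exp Im_exp)
    show "Im (CLINT \<omega>|M. iexp (S \<omega>) * complex_of_real (X \<omega>)) = Im (Complex (expectation (\<lambda>\<omega>. cos (S \<omega>) * X \<omega>)) (expectation (\<lambda>\<omega>. sin (S \<omega>) * X \<omega>)))"
      unfolding integral_Im[OF i, symmetric] by (simp add: Re_exp Im_exp)
  qed
qed

text \<open>Interpolates between the two Taylor bounds, cubic for small \<open>x\<close> and
  quadratic for large \<open>x\<close>, so that a moment of any order above 2 controls the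
  remainder.\<close>

lemma iexp_taylor2:
  fixes x q :: real assumes "2 \<le> q" "q \<le> 3"
  shows "norm (iexp x - (1 + \<i> * x - x\<^sup>2 / 2)) \<le> \<bar>x\<bar> powr q"
proof -
  have eq: "(\<Sum>k\<le>2. (\<i> * complex_of_real x)^k / fact k) = 1 + \<i> * x - x\<^sup>2 / 2"
    by (simp add: numeral_2_eq_2 power2_eq_square fact_numeral algebra_simps)
  show ?thesis
  proof (cases "\<bar>x\<bar> \<le> 1")
    case True
    have "norm (iexp x - (1 + \<i> * x - x\<^sup>2 / 2)) \<le> \<bar>x\<bar>^Suc 2 / fact (Suc 2)"
      using iexp_approx1[of x 2] unfolding eq .
    also have "\<dots> = \<bar>x\<bar>^3 / 6" by (simp add: fact_numeral numeral_3_eq_3)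
    also have "\<dots> \<le> \<bar>x\<bar>^3" using zero_le_power[of "\<bar>x\<bar>" 3] by linarith
    also have "\<bar>x\<bar>^3 = \<bar>x\<bar> powr 3" by simp
    also have "\<dots> \<le> \<bar>x\<bar> powr q" using True assms by (intro powr_mono') auto
    finally show ?thesis .
  next
    case False
    have "norm (iexp x - (1 + \<i> * x - x\<^sup>2 / 2)) \<le> \<bar>x\<bar>^2"
      using iexp_approx2[of x 2] unfolding eq by (simp add: fact_numeral)
    also have "\<bar>x\<bar>^2 = \<bar>x\<bar> powr 2" by simp
    also have "\<dots> \<le> \<bar>x\<bar> powr q" using False assms by (intro powr_mono) auto
    finally show ?thesis .
  qed
qed

text \<open>The hypothesis on \<open>D\<^sup>2\<close> says that the conditional variances average out to \<open>V\<close>.\<close>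

lemma martingale_difference_CLT:
  fixes D :: "nat \<Rightarrow> 'a \<Rightarrow> real" and V :: real
  defines "S \<equiv> (\<lambda>n \<omega>. \<Sum>i<n. D i \<omega>)"
  assumes q: "2 < q" "q \<le> 3" and D: "bounded_moment q D" and V: "V \<ge> 0"
    and cos1: "\<And>s k. expectation (\<lambda>\<omega>. cos (s * S k \<omega>) * D k \<omega>) = 0"
    and sin1: "\<And>s k. expectation (\<lambda>\<omega>. sin (s * S k \<omega>) * D k \<omega>) = 0"
    and sq: "\<And>\<eta>. \<eta> > 0 \<Longrightarrow> \<exists>\<delta>>0. \<forall>s k. \<bar>s\<bar> < \<delta> \<longrightarrow>
      \<bar>expectation (\<lambda>\<omega>. cos (s * S k \<omega>) * (D k \<omega>)\<^sup>2) - V * expectation (\<lambda>\<omega>. cos (s * S k \<omega>))\<bar> \<le> \<eta> \<and>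
      \<bar>expectation (\<lambda>\<omega>. sin (s * S k \<omega>) * (D k \<omega>)\<^sup>2) - V * expectation (\<lambda>\<omega>. sin (s * S k \<omega>))\<bar> \<le> \<eta>"
  shows "(\<lambda>n. CLINT \<omega>|M. iexp (t * (S n \<omega> / sqrt n))) \<longlonglongrightarrow> complex_of_real (exp (- (V * t\<^sup>2 / 2)))"
proof -
  have Dm[measurable]: "D i \<in> borel_measurable M" for i by (rule bounded_moment_measurable[OF D])
  have Sm[measurable]: "S i \<in> borel_measurable M" for i unfolding S_def by measurable
  have D2: "bounded_moment 2 D" by (rule bounded_moment_mono[OF _ _ D]) (use q in auto)
  have iD: "integrable M (D k)" "integrable M (\<lambda>\<omega>. (D k \<omega>)\<^sup>2)" for k
    using bounded_moment_integrable[OF _ D2] bounded_moment_integrable_power2[OF D2] by auto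
  obtain C where C: "C \<ge> 0" "\<And>i. integrable M (\<lambda>\<omega>. \<bar>D i \<omega>\<bar> powr q)"
    "\<And>i. expectation (\<lambda>\<omega>. \<bar>D i \<omega>\<bar> powr q) \<le> C" by (rule bounded_momentE[OF D], rule that; simp)
  define \<phi> where "\<phi> s k = (CLINT \<omega>|M. iexp (s * S k \<omega>))" for s k
  have i1: "integrable M (\<lambda>\<omega>. iexp (f \<omega>))" if [measurable]: "f \<in> borel_measurable M" for f
    by (rule integrable_const_bound[of _ 1]) auto
  \<comment> \<open>The characteristic function of the sums nearly obeys a linear recursion. The
    first-order term vanishes by \<open>cos1\<close> and \<open>sin1\<close>, the second-order term
    is \<open>V\<close> times the old value up to \<open>\<eta>\<close> in the real and in the
    imaginary part, and the rest is the Taylor remainder.\<close>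
  have step: "norm (\<phi> s (Suc k) - (1 - s\<^sup>2 * V / 2) * \<phi> s k) \<le> s\<^sup>2 * \<eta> + \<bar>s\<bar> powr q * C"
    if \<eta>: "\<eta> \<ge> 0" "\<bar>expectation (\<lambda>\<omega>. cos (s * S k \<omega>) * (D k \<omega>)\<^sup>2) - V * expectation (\<lambda>\<omega>. cos (s * S k \<omega>))\<bar> \<le> \<eta>"
      "\<bar>expectation (\<lambda>\<omega>. sin (s * S k \<omega>) * (D k \<omega>)\<^sup>2) - V * expectation (\<lambda>\<omega>. sin (s * S k \<omega>))\<bar> \<le> \<eta>" for s k \<eta>
  proof -
    define R where "R \<omega> = iexp (s * D k \<omega>) - (1 + \<i> * (s * D k \<omega>) - (s * D k \<omega>)\<^sup>2 / 2)" for \<omega>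
    have [measurable]: "R \<in> borel_measurable M" unfolding R_def by measurable
    have Rle: "norm (R \<omega>) \<le> \<bar>s\<bar> powr q * \<bar>D k \<omega>\<bar> powr q" for \<omega>
    proof -
      have "norm (R \<omega>) \<le> \<bar>s * D k \<omega>\<bar> powr q" unfolding R_def
        using iexp_taylor2[of q "s * D k \<omega>"] q by simp
      then show ?thesis by (simp add: abs_mult powr_mult)
    qed
    have iR: "integrable M (\<lambda>\<omega>. iexp (s * S k \<omega>) * R \<omega>)"
    proof (rule Bochner_Integration.integrable_bound)
      show "integrable M (\<lambda>\<omega>. \<bar>s\<bar> powr q * \<bar>D k \<omega>\<bar> powr q)" using C(2) by simp
      show "AE \<omega> in M. norm (iexp (s * S k \<omega>) * R \<omega>) \<le> norm (\<bar>s\<bar> powr q * \<bar>D k \<omega>\<bar> powr q)"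
        using Rle by (auto simp: norm_mult)
    qed measurable
    have nR: "norm (CLINT \<omega>|M. iexp (s * S k \<omega>) * R \<omega>) \<le> \<bar>s\<bar> powr q * C"
    proof -
      have "norm (CLINT \<omega>|M. iexp (s * S k \<omega>) * R \<omega>) \<le> expectation (\<lambda>\<omega>. \<bar>s\<bar> powr q * \<bar>D k \<omega>\<bar> powr q)"
        by (rule order.trans[OF integral_norm_bound integral_mono])
           (use C(2) Rle iR in \<open>auto simp: norm_mult dest: integrable_norm\<close>)
      also have "\<dots> \<le> \<bar>s\<bar> powr q * C" using C(3)[of k] by (simp add: mult_left_mono)
      finally show ?thesis .
    qed
    define A where "A = (CLINT \<omega>|M. iexp (s * S k \<omega>) * complex_of_real (D k \<omega>))"
    define B where "B = (CLINT \<omega>|M. iexp (s * S k \<omega>) * complex_of_real ((D k \<omega>)\<^sup>2))"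
    have A0: "A = 0" unfolding A_def using integral_iexp_mult(1)[OF _ iD(1)[of k], of "\<lambda>\<omega>. s * S k \<omega>"]
      by (simp add: cos1 sin1 complex_eq_iff)
    have "\<phi> s (Suc k) = (CLINT \<omega>|M. iexp (s * S k \<omega>) + (\<i> * s) * (iexp (s * S k \<omega>) * complex_of_real (D k \<omega>))
       - (s\<^sup>2 / 2) * (iexp (s * S k \<omega>) * complex_of_real ((D k \<omega>)\<^sup>2)) + iexp (s * S k \<omega>) * R \<omega>)"
      unfolding \<phi>_def
    proof (rule Bochner_Integration.integral_cong[OF refl])
      fix \<omega>
      have "iexp (s * S (Suc k) \<omega>) = iexp (s * S k \<omega>) * iexp (s * D k \<omega>)"
        by (simp add: S_def algebra_simps flip: exp_add)
      also have "iexp (s * D k \<omega>) = 1 + \<i> * (s * D k \<omega>) - (s * D k \<omega>)\<^sup>2 / 2 + R \<omega>" by (simp add: R_def)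
      finally show "iexp (s * S (Suc k) \<omega>) = iexp (s * S k \<omega>) + (\<i> * s) * (iexp (s * S k \<omega>) * complex_of_real (D k \<omega>))
       - (s\<^sup>2 / 2) * (iexp (s * S k \<omega>) * complex_of_real ((D k \<omega>)\<^sup>2)) + iexp (s * S k \<omega>) * R \<omega>"
        by (simp add: algebra_simps power_mult_distrib)
    qed
    also have "\<dots> = \<phi> s k + (\<i> * s) * A - (s\<^sup>2 / 2) * B + (CLINT \<omega>|M. iexp (s * S k \<omega>) * R \<omega>)"
    proof -
      note i = i1[of "\<lambda>\<omega>. s * S k \<omega>"] integral_iexp_mult(2)[OF _ iD(1), of "\<lambda>\<omega>. s * S k \<omega>" k]
        integral_iexp_mult(2)[OF _ iD(2), of "\<lambda>\<omega>. s * S k \<omega>" k] iR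
      show ?thesis unfolding A_def B_def \<phi>_def
        by (subst Bochner_Integration.integral_add, (intro Bochner_Integration.integrable_add Bochner_Integration.integrable_diff integrable_mult_right i; measurable)+,
            subst Bochner_Integration.integral_diff, (intro Bochner_Integration.integrable_add Bochner_Integration.integrable_diff integrable_mult_right i; measurable)+,
            subst Bochner_Integration.integral_add, (intro Bochner_Integration.integrable_add Bochner_Integration.integrable_diff integrable_mult_right i; measurable)+, simp)
    qed
    finally have "\<phi> s (Suc k) - (1 - s\<^sup>2 * V / 2) * \<phi> s k =
        - (s\<^sup>2 / 2) * (B - V * \<phi> s k) + (CLINT \<omega>|M. iexp (s * S k \<omega>) * R \<omega>)"
      using A0 by (simp add: algebra_simps diff_divide_distrib)
    also have "norm \<dots> \<le> norm (- (s\<^sup>2 / 2) * (B - V * \<phi> s k)) + norm (CLINT \<omega>|M. iexp (s * S k \<omega>) * R \<omega>)"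
      by (rule norm_triangle_ineq)
    also have "norm (- (s\<^sup>2 / 2) * (B - V * \<phi> s k)) \<le> s\<^sup>2 / 2 * (\<eta> + \<eta>)"
    proof -
      have \<phi>: "\<phi> s k = Complex (expectation (\<lambda>\<omega>. cos (s * S k \<omega>))) (expectation (\<lambda>\<omega>. sin (s * S k \<omega>)))"
        unfolding \<phi>_def using integral_iexp_mult(1)[of "\<lambda>\<omega>. s * S k \<omega>" "\<lambda>_. 1"] by simp
      have "norm (B - V * \<phi> s k) \<le> \<bar>Re (B - V * \<phi> s k)\<bar> + \<bar>Im (B - V * \<phi> s k)\<bar>" by (rule cmod_le)
      also have "\<dots> \<le> \<eta> + \<eta>"
        using \<eta> integral_iexp_mult(1)[OF _ iD(2)[of k], of "\<lambda>\<omega>. s * S k \<omega>"]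
        unfolding B_def \<phi> by (intro add_mono) simp_all
      finally have "s\<^sup>2 / 2 * norm (B - V * \<phi> s k) \<le> s\<^sup>2 / 2 * (\<eta> + \<eta>)" by (intro mult_left_mono) auto
      then show ?thesis by (simp add: norm_mult norm_divide norm_power)
    qed
    finally show ?thesis using nR by simp
  qed
  have small: "\<forall>\<^sub>F n in sequentially. \<bar>t / sqrt n\<bar> < \<delta>" if "\<delta> > 0" for \<delta>
  proof -
    have "(\<lambda>n. t / sqrt (real n)) \<longlonglongrightarrow> 0"
      by (intro tendsto_divide_0[OF tendsto_const] filterlim_at_top_imp_at_infinity
          filterlim_compose[OF sqrt_at_top] filterlim_real_sequentially)
    from tendstoD[OF this that] show ?thesis by simp
  qed
  have main: "(\<lambda>n. \<phi> (t / sqrt n) n - (1 - (t / sqrt n)\<^sup>2 * V / 2) ^ n) \<longlonglongrightarrow> 0"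
  proof (rule tendstoI)
    fix r :: real assume r: "r > 0"
    \<comment> \<open>Over \<open>n\<close> steps with \<open>s = t / sqrt n\<close> the errors
      \<open>s\<^sup>2 * \<eta>\<close> add up to \<open>t\<^sup>2 * \<eta>\<close>, which has to
      stay below \<open>r / 2\<close>.\<close>
    define \<eta> where "\<eta> = r / (2 * (t\<^sup>2 + 1))"
    have "t\<^sup>2 + 1 > 0" by (simp add: add_nonneg_pos)
    then have \<eta>: "\<eta> > 0" "t\<^sup>2 * \<eta> < r / 2"
      using r by (auto simp: \<eta>_def field_simps)
    obtain \<delta> where \<delta>: "\<delta> > 0" "\<And>s k. \<bar>s\<bar> < \<delta> \<Longrightarrow>
      \<bar>expectation (\<lambda>\<omega>. cos (s * S k \<omega>) * (D k \<omega>)\<^sup>2) - V * expectation (\<lambda>\<omega>. cos (s * S k \<omega>))\<bar> \<le> \<eta> \<and>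
      \<bar>expectation (\<lambda>\<omega>. sin (s * S k \<omega>) * (D k \<omega>)\<^sup>2) - V * expectation (\<lambda>\<omega>. sin (s * S k \<omega>))\<bar> \<le> \<eta>"
      using sq[OF \<eta>(1)] by blast
    \<comment> \<open>The Taylor remainders of all \<open>n\<close> steps together; here
      \<open>q > 2\<close> is decisive.\<close>
    have "(\<lambda>n. \<bar>t\<bar> powr q * C * real n powr (1 - q / 2)) \<longlonglongrightarrow> 0"
      by (intro tendsto_mult_right_zero tendsto_neg_powr filterlim_real_sequentially) (use q in auto)
    from order_tendstoD(2)[OF this, of "r / 2"] r
    have e3: "\<forall>\<^sub>F n in sequentially. \<bar>t\<bar> powr q * C * real n powr (1 - q / 2) < r / 2" by simp
    \<comment> \<open>Ensures \<open>s\<^sup>2 * V \<le> 1\<close>, so the factor of the recursion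
      has modulus at most 1 and the step errors are not amplified.\<close>
    have e2: "\<forall>\<^sub>F n in sequentially. \<bar>t / sqrt n\<bar> < 1 / (V + 1)" using V by (intro small) auto
    from small[OF \<delta>(1)] e2 e3 eventually_gt_at_top[of 0]
    show "\<forall>\<^sub>F n in sequentially. dist (\<phi> (t / sqrt n) n - (1 - (t / sqrt n)\<^sup>2 * V / 2) ^ n) 0 < r"
    proof eventually_elim
      case (elim n)
      define s where "s = t / sqrt n"
      define z where "z = complex_of_real (1 - s\<^sup>2 * V / 2)"
      have s2: "s\<^sup>2 = t\<^sup>2 / n" by (simp add: s_def power_divide)
      have "s\<^sup>2 * V \<le> 1"
      proof -
        have "\<bar>s\<bar> * \<bar>s\<bar> \<le> 1 * (1 / (V + 1))"
        proof (rule mult_mono)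
          have "1 / (V + 1) \<le> 1" using V by simp
          then show "\<bar>s\<bar> \<le> 1" using elim(2) unfolding s_def by linarith
          show "\<bar>s\<bar> \<le> 1 / (V + 1)" using elim(2) unfolding s_def by simp
        qed auto
        then have "s\<^sup>2 * V \<le> 1 / (V + 1) * V" using V by (intro mult_right_mono) (auto simp: power2_eq_square)
        also have "\<dots> \<le> 1" using V by simp
        finally show ?thesis .
      qed
      then have z: "norm z \<le> 1" using V unfolding z_def norm_of_real by (simp add: abs_le_iff)
      have st: "norm (\<phi> s (Suc k) - z * \<phi> s k) \<le> s\<^sup>2 * \<eta> + \<bar>s\<bar> powr q * C" for k
        unfolding z_def using step[of \<eta> s k] \<delta>(2)[of s k] elim(1) \<eta>(1) by (simp add: s_def)
      have "norm (\<phi> s k - z ^ k) \<le> real k * (s\<^sup>2 * \<eta> + \<bar>s\<bar> powr q * C)" for k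
      proof (induction k)
        case 0
        then show ?case by (simp add: \<phi>_def S_def prob_space)
      next
        case (Suc k)
        have "\<phi> s (Suc k) - z ^ Suc k = (\<phi> s (Suc k) - z * \<phi> s k) + z * (\<phi> s k - z ^ k)"
          by (simp add: algebra_simps)
        also have "norm \<dots> \<le> norm (\<phi> s (Suc k) - z * \<phi> s k) + norm (z * (\<phi> s k - z ^ k))"
          by (rule norm_triangle_ineq)
        also have "norm (z * (\<phi> s k - z ^ k)) \<le> 1 * norm (\<phi> s k - z ^ k)"
          unfolding norm_mult using z by (intro mult_right_mono) auto
        finally show ?case using st[of k] Suc by (simp add: algebra_simps)
      qed
      then have "norm (\<phi> s n - z ^ n) \<le> real n * (s\<^sup>2 * \<eta> + \<bar>s\<bar> powr q * C)" .
      also have "\<dots> = t\<^sup>2 * \<eta> + \<bar>t\<bar> powr q * C * real n powr (1 - q / 2)"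
      proof -
        have "\<bar>s\<bar> powr q = \<bar>t\<bar> powr q / (real n powr (1/2)) powr q"
          by (simp add: s_def abs_divide powr_divide powr_half_sqrt)
        also have "(real n powr (1/2)) powr q = real n powr (q / 2)" by (simp add: powr_powr)
        finally have "real n * \<bar>s\<bar> powr q = \<bar>t\<bar> powr q * (real n powr 1 / real n powr (q / 2))"
          using elim(4) by simp
        then show ?thesis using elim(4) by (simp add: s2 algebra_simps powr_diff)
      qed
      also have "\<dots> < r" using \<eta>(2) elim(3) by simp
      finally show ?case by (simp add: s_def z_def)
    qed
  qed
  have lim: "(\<lambda>n. complex_of_real ((1 - (t / sqrt n)\<^sup>2 * V / 2) ^ n)) \<longlonglongrightarrow> complex_of_real (exp (- (V * t\<^sup>2 / 2)))"
  proof (rule tendsto_of_real)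
    have "(\<lambda>n. (1 + (- (V * t\<^sup>2 / 2)) / real n) ^ n) \<longlonglongrightarrow> exp (- (V * t\<^sup>2 / 2))"
      by (rule tendsto_exp_limit_sequentially)
    then show "(\<lambda>n. (1 - (t / sqrt n)\<^sup>2 * V / 2) ^ n) \<longlonglongrightarrow> exp (- (V * t\<^sup>2 / 2))"
      by (simp add: power_divide mult.commute)
  qed
  have "(\<lambda>n. \<phi> (t / sqrt n) n) \<longlonglongrightarrow> complex_of_real (exp (- (V * t\<^sup>2 / 2)))"
    using tendsto_add[OF main lim] by simp
  then show ?thesis by (simp add: \<phi>_def)
qed

end

section \<open>Stationary autoregressions of order one\<close>

text \<open>Stolz-Cesaro for the denominators \<open>n\<close>. It will be applied to variances of
  partial sums, whose increments are partial sums of autocovariances.\<close>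

lemma cesaro_differences:
  fixes u :: "nat \<Rightarrow> real"
  assumes "(\<lambda>n. u (Suc n) - u n) \<longlonglongrightarrow> L"
  shows "(\<lambda>n. u n / real n) \<longlonglongrightarrow> L"
proof (rule tendstoI)
  fix r :: real assume r: "r > 0"
  obtain N where N: "\<And>n. n \<ge> N \<Longrightarrow> \<bar>u (Suc n) - u n - L\<bar> < r / 2"
    using LIMSEQ_D[OF assms, of "r / 2"] r by auto
  have bnd: "\<bar>u n - real n * L\<bar> \<le> \<bar>u N - real N * L\<bar> + real (n - N) * (r / 2)" if "n \<ge> N" for n
    using that
  proof (induction n rule: dec_induct)
    case (step n)
    have "real (Suc n - N) * (r / 2) = real (n - N) * (r / 2) + r / 2"
    proof -
      have "real (Suc n - N) = real (n - N) + 1" using step by (simp add: Suc_diff_le)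
      then show ?thesis by (simp only: distrib_right mult_1)
    qed
    moreover have "u (Suc n) - real (Suc n) * L = (u n - real n * L) + (u (Suc n) - u n - L)"
      by (simp add: algebra_simps)
    ultimately show ?case using step N[of n] by linarith
  qed simp
  have "(\<lambda>n. \<bar>u N - real N * L\<bar> / real n) \<longlonglongrightarrow> 0"
    by (rule lim_const_over_n)
  from order_tendstoD(2)[OF this, of "r / 2"] r
  have "\<forall>\<^sub>F n in sequentially. \<bar>u N - real N * L\<bar> / real n < r / 2" by simp
  with eventually_ge_at_top[of "max N 1"]
  show "\<forall>\<^sub>F n in sequentially. dist (u n / real n) L < r"
  proof eventually_elim
    case (elim n)
    then have n: "n \<ge> N" "real n > 0" by auto
    have "\<bar>u n - real n * L\<bar> \<le> \<bar>u N - real N * L\<bar> + real n * (r / 2)"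
      by (rule order.trans[OF bnd[OF n(1)]]) (use r in \<open>auto intro!: mult_right_mono\<close>)
    also have "\<bar>u N - real N * L\<bar> < real n * (r / 2)"
      using elim(2) n by (simp add: field_simps)
    finally have "\<bar>u n - real n * L\<bar> < real n * r" by linarith
    moreover have "u n / real n - L = (u n - real n * L) / real n" using n by (simp add: field_simps)
    moreover have "\<bar>u n - real n * L\<bar> / real n < r"
      if "\<bar>u n - real n * L\<bar> < real n * r"
      unfolding pos_divide_less_eq[OF n(2)] using that by (subst mult.commute)
    ultimately show ?case using n by (simp only: dist_real_def abs_divide abs_of_pos)
  qed
qed

text \<open>Independence is a property of the generated sigma-algebras, so it passes to anything
  measurable with respect to them, without exhibiting that thing as a function of \<open>X\<close>
  or \<open>Y\<close>.\<close>

lemma (in prob_space) indep_var_vimage_algebra: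
  assumes "indep_var S X T Y"
    and f: "f \<in> measurable (vimage_algebra (space M) X S) S'"
    and g: "g \<in> measurable (vimage_algebra (space M) Y T) T'"
  shows "indep_var S' f T' g"
proof -
  have rv: "random_variable S X" "random_variable T Y"
    and ind: "indep_set (sets (vimage_algebra (space M) X S)) (sets (vimage_algebra (space M) Y T))"
    using assms(1) unfolding indep_var_eq sets_vimage_algebra by auto
  have sub: "sets (vimage_algebra (space M) X S) \<subseteq> events" "sets (vimage_algebra (space M) Y T) \<subseteq> events"
    by (rule sets_image_in_sets[OF refl]; fact rv)+
  have rv': "f \<in> measurable M S'" "g \<in> measurable M T'"
    using measurable_mono[of S' S' "vimage_algebra (space M) X S" M]
      measurable_mono[of T' T' "vimage_algebra (space M) Y T" M] f g sub by auto
  have 1: "sigma_sets (space M) {f -` A \<inter> space M | A. A \<in> sets S'} \<subseteq> sets (vimage_algebra (space M) X S)"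
    by (rule sets.sigma_sets_subset'[of _ "vimage_algebra (space M) X S", simplified])
       (use measurable_sets[OF f] sets.top[of "vimage_algebra (space M) X S"] in auto)
  have 2: "sigma_sets (space M) {g -` A \<inter> space M | A. A \<in> sets T'} \<subseteq> sets (vimage_algebra (space M) Y T)"
    by (rule sets.sigma_sets_subset'[of _ "vimage_algebra (space M) Y T", simplified])
       (use measurable_sets[OF g] sets.top[of "vimage_algebra (space M) Y T"] in auto)
  show ?thesis unfolding indep_var_eq
    using rv' ind 1 2 unfolding indep_sets2_eq by blast
qed

text \<open>Initial value and innovations form a single independent family: index 0 is
  \<open>y 0\<close>, index \<open>Suc k\<close> is \<open>x k\<close>. The recursion can hold
  pointwise because innovations will be defined by it.\<close>

locale ar1 = prob_space M for M :: "'a measure" +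
  fixes y x :: "nat \<Rightarrow> 'a \<Rightarrow> real" and a :: real
  assumes rec: "\<And>k \<omega>. y (Suc k) \<omega> = a * y k \<omega> + x k \<omega>"
    and indep: "indep_vars (\<lambda>_. borel) (case_nat (y 0) x) UNIV"
begin

lemma innovations_measurable: "case_nat (y 0) x i \<in> borel_measurable M"
  using indep unfolding indep_vars_def by auto

lemma x_measurable[measurable]: "x k \<in> borel_measurable M"
  using innovations_measurable[of "Suc k"] by simp

lemma y_Suc: "y (Suc k) = (\<lambda>\<omega>. a * y k \<omega> + x k \<omega>)"
  by (rule ext) (rule rec)

lemma y_measurable[measurable]: "y k \<in> borel_measurable M"
proof (induction k)
  case 0
  then show ?case using innovations_measurable[of 0] by simp
next
  case (Suc k)
  then have "(\<lambda>\<omega>. a * y k \<omega> + x k \<omega>) \<in> borel_measurable M" by measurable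
  then show ?case by (simp add: y_Suc)
qed

text \<open>Because of the shift in \<open>case_nat\<close>, \<open>past m\<close> knows
  \<open>y 0\<close> and \<open>x 0\<close> up to \<open>x (m - 1)\<close>. Hence \<open>y m\<close>
  belongs to it and \<open>x m\<close> is the first innovation independent of it.\<close>

definition past :: "nat \<Rightarrow> 'a measure" where
  "past m = vimage_algebra (space M) (\<lambda>\<omega>. \<lambda>i\<in>{..m}. case_nat (y 0) x i \<omega>) (Pi\<^sub>M {..m} (\<lambda>_. borel))"

lemma space_past: "space (past m) = space M" by (simp add: past_def)

lemma innovation_past: "i \<le> m \<Longrightarrow> case_nat (y 0) x i \<in> borel_measurable (past m)"
proof -
  assume i: "i \<le> m"
  have "(\<lambda>\<omega>. \<lambda>i\<in>{..m}. case_nat (y 0) x i \<omega>) \<in> measurable (past m) (Pi\<^sub>M {..m} (\<lambda>_. borel))"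
    unfolding past_def by (rule measurable_vimage_algebra1) (auto simp: space_PiM)
  moreover have "(\<lambda>r. r i) \<in> measurable (Pi\<^sub>M {..m} (\<lambda>_. borel)) (borel :: real measure)"
    using i by (intro measurable_component_singleton) auto
  ultimately have "(\<lambda>\<omega>. (\<lambda>i\<in>{..m}. case_nat (y 0) x i \<omega>) i) \<in> borel_measurable (past m)"
    by (rule measurable_compose)
  then show ?thesis using i by simp
qed

lemma past_sub: "f \<in> borel_measurable (past m) \<Longrightarrow> f \<in> borel_measurable M"
proof -
  have "sets (past m) \<subseteq> sets M" unfolding past_def
    by (rule sets_image_in_sets[OF refl]) (rule measurable_restrict, rule innovations_measurable)
  then show "f \<in> borel_measurable (past m) \<Longrightarrow> f \<in> borel_measurable M"
    using measurable_mono[of borel borel "past m" M] by (auto simp: space_past)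
qed

lemma past_mono: "f \<in> borel_measurable (past m) \<Longrightarrow> m \<le> n \<Longrightarrow> f \<in> borel_measurable (past n)"
proof -
  assume mn: "m \<le> n"
  have "sets (past m) \<subseteq> sets (past n)" unfolding past_def[of m]
    by (rule sets_image_in_sets) (auto simp: space_past intro!: measurable_restrict innovation_past order.trans[OF _ mn])
  then show "f \<in> borel_measurable (past m) \<Longrightarrow> f \<in> borel_measurable (past n)"
    using measurable_mono[of borel borel "past m" "past n"] by (auto simp: space_past)
qed

lemma x_past: "i < m \<Longrightarrow> x i \<in> borel_measurable (past m)"
  using innovation_past[of "Suc i" m] by simp

lemma y_past: "i \<le> m \<Longrightarrow> y i \<in> borel_measurable (past m)"
proof (induction i)
  case 0
  then show ?case using innovation_past[of 0 m] by simp
next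
  case (Suc i)
  then have [measurable]: "y i \<in> borel_measurable (past m)" "x i \<in> borel_measurable (past m)"
    by (auto intro: x_past)
  have "(\<lambda>\<omega>. a * y i \<omega> + x i \<omega>) \<in> borel_measurable (past m)" by measurable
  then show ?case by (simp add: y_Suc)
qed

lemma innovation_sigma:
  "x n \<in> borel_measurable (vimage_algebra (space M) (\<lambda>\<omega>. \<lambda>i\<in>{Suc n}. case_nat (y 0) x i \<omega>) (PiM {Suc n} (\<lambda>_. borel)))"
proof -
  have "(\<lambda>\<omega>. \<lambda>i\<in>{Suc n}. case_nat (y 0) x i \<omega>) \<in>
      measurable (vimage_algebra (space M) (\<lambda>\<omega>. \<lambda>i\<in>{Suc n}. case_nat (y 0) x i \<omega>) (PiM {Suc n} (\<lambda>_. borel))) (PiM {Suc n} (\<lambda>_. borel))"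
    by (rule measurable_vimage_algebra1) (auto simp: space_PiM)
  moreover have "(\<lambda>r. r (Suc n)) \<in> measurable (Pi\<^sub>M {Suc n} (\<lambda>_. borel)) (borel :: real measure)"
    by (intro measurable_component_singleton) auto
  ultimately have "(\<lambda>\<omega>. (\<lambda>i\<in>{Suc n}. case_nat (y 0) x i \<omega>) (Suc n)) \<in> borel_measurable
      (vimage_algebra (space M) (\<lambda>\<omega>. \<lambda>i\<in>{Suc n}. case_nat (y 0) x i \<omega>) (PiM {Suc n} (\<lambda>_. borel)))"
    by (rule measurable_compose)
  then show ?thesis by simp
qed

lemma past_indep:
  fixes f :: "'a \<Rightarrow> real"
  assumes f: "f \<in> borel_measurable (past m)" and "m \<le> n"
  shows "indep_var borel f borel (x n)"
proof (rule indep_var_vimage_algebra)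
  show "indep_var (PiM {..m} (\<lambda>_. borel)) (\<lambda>\<omega>. \<lambda>i\<in>{..m}. case_nat (y 0) x i \<omega>)
      (PiM {Suc n} (\<lambda>_. borel)) (\<lambda>\<omega>. \<lambda>i\<in>{Suc n}. case_nat (y 0) x i \<omega>)"
    by (rule indep_var_restrict[OF indep]) (use \<open>m \<le> n\<close> in auto)
  show "f \<in> borel_measurable (vimage_algebra (space M) (\<lambda>\<omega>. \<lambda>i\<in>{..m}. case_nat (y 0) x i \<omega>) (PiM {..m} (\<lambda>_. borel)))"
    using f by (simp add: past_def)
  show "x n \<in> borel_measurable
      (vimage_algebra (space M) (\<lambda>\<omega>. \<lambda>i\<in>{Suc n}. case_nat (y 0) x i \<omega>) (PiM {Suc n} (\<lambda>_. borel)))"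
    by (rule innovation_sigma)
qed

end

text \<open>Only the one-dimensional laws are assumed to be constant in time; joint stationarity
  follows in \<open>joint_stationary\<close> from the recursion.\<close>

locale stationary_ar1 = ar1 +
  fixes p :: real
  assumes a: "0 < a" "a < 1"
    and stat_y: "\<And>k. distr M borel (y k) = distr M borel (y 0)"
    and stat_x: "\<And>k. distr M borel (x k) = distr M borel (x 0)"
    and mean0: "expectation (y 0) = 0"
    and p: "4 < p" "integrable M (\<lambda>\<omega>. \<bar>y 0 \<omega>\<bar> powr p)"
begin

text \<open>The substitute for conditional expectation throughout: conditioning on the past appears
  as factorization of \<open>expectation (\<lambda>\<omega>. f \<omega> * g (x n \<omega>))\<close>
  for test functions \<open>f\<close> of the past.\<close>

lemma innovation_mult:
  fixes f :: "'a \<Rightarrow> real" and g :: "real \<Rightarrow> real"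
  assumes f: "f \<in> borel_measurable (past m)" "integrable M f" and "m \<le> n"
    and g: "g \<in> borel_measurable borel" "integrable M (\<lambda>\<omega>. g (x n \<omega>))"
  shows "integrable M (\<lambda>\<omega>. f \<omega> * g (x n \<omega>))"
    "expectation (\<lambda>\<omega>. f \<omega> * g (x n \<omega>)) = expectation f * expectation (\<lambda>\<omega>. g (x n \<omega>))"
proof -
  have "indep_var borel (id \<circ> f) borel (g \<circ> x n)"
    by (rule indep_var_compose[OF past_indep[OF f(1) \<open>m \<le> n\<close>]]) (use g in auto)
  then have ind: "indep_var borel f borel (\<lambda>\<omega>. g (x n \<omega>))" by (simp add: comp_def)
  show "integrable M (\<lambda>\<omega>. f \<omega> * g (x n \<omega>))"
    by (rule indep_var_integrable[OF ind f(2) g(2)])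
  show "expectation (\<lambda>\<omega>. f \<omega> * g (x n \<omega>)) = expectation f * expectation (\<lambda>\<omega>. g (x n \<omega>))"
    by (rule indep_var_lebesgue_integral[OF ind f(2) g(2)])
qed

lemma stationary_integral:
  fixes g :: "real \<Rightarrow> real"
  assumes [measurable]: "g \<in> borel_measurable borel"
  shows "expectation (\<lambda>\<omega>. g (y k \<omega>)) = expectation (\<lambda>\<omega>. g (y 0 \<omega>))"
    "expectation (\<lambda>\<omega>. g (x k \<omega>)) = expectation (\<lambda>\<omega>. g (x 0 \<omega>))"
    "integrable M (\<lambda>\<omega>. g (y k \<omega>)) \<longleftrightarrow> integrable M (\<lambda>\<omega>. g (y 0 \<omega>))"
  using integral_distr[of "y k" M borel g] integral_distr[of "y 0" M borel g]
    integral_distr[of "x k" M borel g] integral_distr[of "x 0" M borel g]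
    integrable_distr_eq[of "y k" M borel g] integrable_distr_eq[of "y 0" M borel g]
  by (simp_all add: stat_y[of k] stat_x[of k])

lemma bounded_moment_y: "bounded_moment p y"
proof (rule bounded_momentI[where G = "\<lambda>i \<omega>. \<bar>y i \<omega>\<bar> powr p" and C = "expectation (\<lambda>\<omega>. \<bar>y 0 \<omega>\<bar> powr p)"])
  have m: "(\<lambda>z::real. \<bar>z\<bar> powr p) \<in> borel_measurable borel" by measurable
  show "integrable M (\<lambda>\<omega>. \<bar>y i \<omega>\<bar> powr p)" for i
    using stationary_integral(3)[OF m, of i] p(2) by simp
  show "expectation (\<lambda>\<omega>. \<bar>y i \<omega>\<bar> powr p) \<le> expectation (\<lambda>\<omega>. \<bar>y 0 \<omega>\<bar> powr p)" for i
    using stationary_integral(1)[OF m, of i] by simp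
qed auto

lemma bounded_moment_x: "bounded_moment p x"
proof -
  have "bounded_moment p (\<lambda>k \<omega>. y (Suc k) \<omega> - a * y k \<omega>)"
    by (intro bounded_moment_diff bounded_moment_cmult bounded_moment_y bounded_moment_shift[OF bounded_moment_y, of Suc]) (use p in auto)
  then show ?thesis by (simp add: rec)
qed

lemma bounded_moment_shifts: "0 < q \<Longrightarrow> q \<le> p \<Longrightarrow> bounded_moment q (\<lambda>i. y (f i))" "0 < q \<Longrightarrow> q \<le> p \<Longrightarrow> bounded_moment q (\<lambda>i. x (f i))"
  by (auto intro: bounded_moment_mono[OF _ _ bounded_moment_shift] bounded_moment_y bounded_moment_x)

lemma bounded_moment_products:
  assumes "0 < q" "2 * q \<le> p"
  shows "bounded_moment q (\<lambda>i \<omega>. y (f i) \<omega> * y (g i) \<omega>)" "bounded_moment q (\<lambda>i \<omega>. y (f i) \<omega> * x (g i) \<omega>)"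
    "bounded_moment q (\<lambda>i \<omega>. x (f i) \<omega> * x (g i) \<omega>)"
    "bounded_moment q (\<lambda>i \<omega>. (y (f i) \<omega>)\<^sup>2)" "bounded_moment q (\<lambda>i \<omega>. (x (f i) \<omega>)\<^sup>2)"
  unfolding power2_eq_square by (rule bounded_moment_mult; use assms in \<open>auto intro: bounded_moment_shifts\<close>)+

definition \<gamma>0 :: real where "\<gamma>0 = expectation (\<lambda>\<omega>. (y 0 \<omega>)\<^sup>2)"
text \<open>The innovation variance, as forced by stationarity through
  \<open>\<gamma>0 = a\<^sup>2 * \<gamma>0 + v\<close>.\<close>

definition v :: real where "v = (1 - a\<^sup>2) * \<gamma>0"

lemma \<gamma>0_nonneg: "\<gamma>0 \<ge> 0" by (simp add: \<gamma>0_def)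

lemma moments:
  "integrable M (y k)" "integrable M (x k)" "integrable M (\<lambda>\<omega>. (y k \<omega>)\<^sup>2)" "integrable M (\<lambda>\<omega>. (x k \<omega>)\<^sup>2)"
  "expectation (y k) = 0" "expectation (x k) = 0"
  "expectation (\<lambda>\<omega>. (y k \<omega>)\<^sup>2) = \<gamma>0" "expectation (\<lambda>\<omega>. (x k \<omega>)\<^sup>2) = v"
proof -
  show i: "integrable M (y k)" "integrable M (x k)" "integrable M (\<lambda>\<omega>. (y k \<omega>)\<^sup>2)" "integrable M (\<lambda>\<omega>. (x k \<omega>)\<^sup>2)" for k
    using bounded_moment_integrable[OF _ bounded_moment_shifts(1)[of 1 "\<lambda>_. k"]] bounded_moment_integrable[OF _ bounded_moment_shifts(2)[of 1 "\<lambda>_. k"]]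
      bounded_moment_integrable_power2[OF bounded_moment_shifts(1)[of 2 "\<lambda>_. k"]] bounded_moment_integrable_power2[OF bounded_moment_shifts(2)[of 2 "\<lambda>_. k"]] p
    by auto
  show ey: "expectation (y k) = 0" for k using stationary_integral(1)[of "\<lambda>z. z" k] mean0 by simp
  have "expectation (y (Suc k)) = a * expectation (y k) + expectation (x k)"
    unfolding y_Suc using i by simp
  then show ex: "expectation (x k) = 0" by (simp add: ey)
  show ey2: "expectation (\<lambda>\<omega>. (y k \<omega>)\<^sup>2) = \<gamma>0" for k
    unfolding \<gamma>0_def using stationary_integral(1)[of "\<lambda>z. z\<^sup>2" k] by simp
  have yx: "integrable M (\<lambda>\<omega>. y k \<omega> * x k \<omega>)" "expectation (\<lambda>\<omega>. y k \<omega> * x k \<omega>) = 0"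
    using innovation_mult[OF y_past i(1), of k k k "\<lambda>z. z"] i(2)[of k] ex by auto
  have "expectation (\<lambda>\<omega>. (y (Suc k) \<omega>)\<^sup>2) = expectation (\<lambda>\<omega>. a\<^sup>2 * (y k \<omega>)\<^sup>2 + 2 * a * (y k \<omega> * x k \<omega>) + (x k \<omega>)\<^sup>2)"
    by (simp add: rec power2_eq_square algebra_simps)
  also have "\<dots> = a\<^sup>2 * \<gamma>0 + expectation (\<lambda>\<omega>. (x k \<omega>)\<^sup>2)"
    using i yx ey2 by simp
  finally show "expectation (\<lambda>\<omega>. (x k \<omega>)\<^sup>2) = v" unfolding ey2 v_def by (simp add: algebra_simps)
qed

text \<open>The identity function is an eigenfunction of the transition operator with eigenvalue
  \<open>a\<close>, because innovations are centred.\<close>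

lemma decay_linear:
  assumes P: "P \<in> borel_measurable (past l)" "integrable M P" "integrable M (\<lambda>\<omega>. P \<omega> * y l \<omega>)"
  shows "integrable M (\<lambda>\<omega>. P \<omega> * y (l + n) \<omega>) \<and>
     expectation (\<lambda>\<omega>. P \<omega> * y (l + n) \<omega>) = a ^ n * expectation (\<lambda>\<omega>. P \<omega> * y l \<omega>)"
proof (induction n)
  case (Suc n)
  have x: "integrable M (\<lambda>\<omega>. P \<omega> * x (l + n) \<omega>)" "expectation (\<lambda>\<omega>. P \<omega> * x (l + n) \<omega>) = 0"
    using innovation_mult[OF P(1,2), of "l + n" "\<lambda>z. z"] moments(2,6)[of "l + n"] by auto
  have "(\<lambda>\<omega>. P \<omega> * y (l + Suc n) \<omega>) = (\<lambda>\<omega>. a * (P \<omega> * y (l + n) \<omega>) + P \<omega> * x (l + n) \<omega>)"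
    by (simp add: rec algebra_simps)
  then show ?case using Suc x by simp
qed (use P in simp)

text \<open>Likewise \<open>z\<^sup>2 - \<gamma>0\<close> is an eigenfunction, with eigenvalue
  \<open>a\<^sup>2\<close>: the cross term vanishes and \<open>v\<close> balances the
  constant.\<close>

lemma decay_square:
  assumes P: "P \<in> borel_measurable (past l)" "integrable M P" "integrable M (\<lambda>\<omega>. P \<omega> * y l \<omega>)"
    "integrable M (\<lambda>\<omega>. P \<omega> * (y l \<omega>)\<^sup>2)"
  shows "integrable M (\<lambda>\<omega>. P \<omega> * (y (l + n) \<omega>)\<^sup>2) \<and>
     expectation (\<lambda>\<omega>. P \<omega> * (y (l + n) \<omega>)\<^sup>2) - \<gamma>0 * expectation P
       = a ^ (2 * n) * (expectation (\<lambda>\<omega>. P \<omega> * (y l \<omega>)\<^sup>2) - \<gamma>0 * expectation P)"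
proof (induction n)
  case (Suc n)
  have "(\<lambda>\<omega>. P \<omega> * y (l + n) \<omega>) \<in> borel_measurable (past (l + n))"
    by (intro borel_measurable_times y_past past_mono[OF P(1)]) auto
  from innovation_mult[OF this conjunct1[OF decay_linear[OF P(1-3)]] order.refl, of "\<lambda>z. z"]
  have yx: "integrable M (\<lambda>\<omega>. P \<omega> * y (l + n) \<omega> * x (l + n) \<omega>)" "expectation (\<lambda>\<omega>. P \<omega> * y (l + n) \<omega> * x (l + n) \<omega>) = 0"
    using moments(2,6)[of "l + n"] by auto
  have x: "integrable M (\<lambda>\<omega>. P \<omega> * (x (l + n) \<omega>)\<^sup>2)" "expectation (\<lambda>\<omega>. P \<omega> * (x (l + n) \<omega>)\<^sup>2) = expectation P * v"
    using innovation_mult[OF P(1,2), of "l + n" "\<lambda>z. z\<^sup>2"] moments(4,8)[of "l + n"] by auto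
  have eq: "(\<lambda>\<omega>. P \<omega> * (y (l + Suc n) \<omega>)\<^sup>2) =
     (\<lambda>\<omega>. a\<^sup>2 * (P \<omega> * (y (l + n) \<omega>)\<^sup>2) + 2 * a * (P \<omega> * y (l + n) \<omega> * x (l + n) \<omega>) + P \<omega> * (x (l + n) \<omega>)\<^sup>2)"
    by (simp add: rec power2_eq_square algebra_simps)
  have i: "integrable M (\<lambda>\<omega>. P \<omega> * (y (l + n) \<omega>)\<^sup>2)" using Suc by simp
  have "expectation (\<lambda>\<omega>. P \<omega> * (y (l + Suc n) \<omega>)\<^sup>2) - \<gamma>0 * expectation P =
     a\<^sup>2 * (expectation (\<lambda>\<omega>. P \<omega> * (y (l + n) \<omega>)\<^sup>2) - \<gamma>0 * expectation P)"
  proof -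
    have "expectation (\<lambda>\<omega>. P \<omega> * (y (l + Suc n) \<omega>)\<^sup>2) =
        a\<^sup>2 * expectation (\<lambda>\<omega>. P \<omega> * (y (l + n) \<omega>)\<^sup>2) + expectation P * v"
      unfolding eq using i yx x by simp
    then show ?thesis by (simp add: v_def algebra_simps)
  qed
  also have "\<dots> = a ^ (2 * Suc n) * (expectation (\<lambda>\<omega>. P \<omega> * (y l \<omega>)\<^sup>2) - \<gamma>0 * expectation P)"
    using Suc by (simp add: power2_eq_square)
  finally show ?case unfolding eq using i yx x by simp
qed (use P in simp)

text \<open>The vector \<open>Z\<close> after subtraction of its mean, with the component numbering
  of \<open>Z_vec\<close>; its values depend on \<open>y\<close> alone.\<close>

definition \<zeta> :: "nat \<Rightarrow> nat \<Rightarrow> 'a \<Rightarrow> real" where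
  "\<zeta> k i \<omega> = (case k of 0 \<Rightarrow> y i \<omega> | Suc h \<Rightarrow> y (i + h) \<omega> * y i \<omega> - \<gamma>0 * a ^ h)"

lemma bounded_moment_\<zeta>:
  assumes "0 < q" "2 * q \<le> p" shows "bounded_moment q (\<lambda>i. \<zeta> k (f i))"
proof (cases k)
  case 0
  then show ?thesis unfolding \<zeta>_def using bounded_moment_shifts(1)[of q f] assms by simp
next
  case (Suc h)
  then show ?thesis unfolding \<zeta>_def using bounded_moment_diff[OF assms(1) bounded_moment_products(1)[OF assms, of "\<lambda>i. f i + h" f] bounded_moment_const] by simp
qed

lemma bounded_moment_\<zeta>2: "bounded_moment 2 (\<lambda>i. \<zeta> k (f i))"
  by (rule bounded_moment_\<zeta>) (use p in auto)

lemma \<zeta>_past: "i + k \<le> Suc m \<Longrightarrow> i \<le> m \<Longrightarrow> \<zeta> k i \<in> borel_measurable (past m)"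
  by (cases k) (auto simp: \<zeta>_def[abs_def] intro!: borel_measurable_times borel_measurable_diff y_past)

text \<open>A product at lag \<open>h\<close> is handled in two stages: \<open>decay_linear\<close>
  brings the later factor back to time \<open>l + n\<close>, and \<open>decay_square\<close> treats
  the resulting square. All components then share the rate \<open>a ^ n\<close>, although products
  decay faster.\<close>

lemma decay_\<zeta>:
  assumes P: "P \<in> borel_measurable (past l)" "integrable M P" "integrable M (\<lambda>\<omega>. P \<omega> * y l \<omega>)"
    "integrable M (\<lambda>\<omega>. P \<omega> * (y l \<omega>)\<^sup>2)"
  shows "integrable M (\<lambda>\<omega>. P \<omega> * \<zeta> k (l + n) \<omega>)"
    "\<bar>expectation (\<lambda>\<omega>. P \<omega> * \<zeta> k (l + n) \<omega>)\<bar> \<le> a ^ n *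
       (\<bar>expectation (\<lambda>\<omega>. P \<omega> * y l \<omega>)\<bar> + \<bar>expectation (\<lambda>\<omega>. P \<omega> * (y l \<omega>)\<^sup>2) - \<gamma>0 * expectation P\<bar>)"
proof -
  have "integrable M (\<lambda>\<omega>. P \<omega> * \<zeta> k (l + n) \<omega>) \<and> \<bar>expectation (\<lambda>\<omega>. P \<omega> * \<zeta> k (l + n) \<omega>)\<bar> \<le> a ^ n *
       (\<bar>expectation (\<lambda>\<omega>. P \<omega> * y l \<omega>)\<bar> + \<bar>expectation (\<lambda>\<omega>. P \<omega> * (y l \<omega>)\<^sup>2) - \<gamma>0 * expectation P\<bar>)"
  proof (cases k)
    case 0
    have "\<bar>a ^ n * expectation (\<lambda>\<omega>. P \<omega> * y l \<omega>)\<bar> \<le> a ^ n *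
       (\<bar>expectation (\<lambda>\<omega>. P \<omega> * y l \<omega>)\<bar> + \<bar>expectation (\<lambda>\<omega>. P \<omega> * (y l \<omega>)\<^sup>2) - \<gamma>0 * expectation P\<bar>)"
      unfolding abs_mult using a by (intro mult_mono) auto
    then show ?thesis using decay_linear[OF P(1-3), of n] 0 by (simp add: \<zeta>_def)
  next
    case (Suc h)
    define Q where "Q \<omega> = P \<omega> * y (l + n) \<omega>" for \<omega>
    have Q: "Q \<in> borel_measurable (past (l + n))" "integrable M Q" "integrable M (\<lambda>\<omega>. Q \<omega> * y (l + n) \<omega>)"
      unfolding Q_def[abs_def]
      using decay_linear[OF P(1-3), of n] decay_square[OF P, of n]
      by (auto intro!: borel_measurable_times y_past past_mono[OF P(1)] simp: power2_eq_square mult.assoc)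
    have eq: "P \<omega> * \<zeta> k (l + n) \<omega> = Q \<omega> * y (l + n + h) \<omega> - \<gamma>0 * a ^ h * P \<omega>" for \<omega>
      using Suc by (simp add: \<zeta>_def Q_def algebra_simps)
    have i: "integrable M (\<lambda>\<omega>. P \<omega> * \<zeta> k (l + n) \<omega>)"
      unfolding eq using decay_linear[OF Q, of h] P(2) by simp
    have "expectation (\<lambda>\<omega>. P \<omega> * \<zeta> k (l + n) \<omega>) = a ^ h * (expectation (\<lambda>\<omega>. Q \<omega> * y (l + n) \<omega>) - \<gamma>0 * expectation P)"
      unfolding eq using decay_linear[OF Q, of h] P(2) by (simp add: algebra_simps)
    also have "expectation (\<lambda>\<omega>. Q \<omega> * y (l + n) \<omega>) = expectation (\<lambda>\<omega>. P \<omega> * (y (l + n) \<omega>)\<^sup>2)"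
      by (simp add: Q_def power2_eq_square mult.assoc)
    also have "a ^ h * (expectation (\<lambda>\<omega>. P \<omega> * (y (l + n) \<omega>)\<^sup>2) - \<gamma>0 * expectation P) =
      a ^ h * a ^ n * (a ^ n * (expectation (\<lambda>\<omega>. P \<omega> * (y l \<omega>)\<^sup>2) - \<gamma>0 * expectation P))"
      using decay_square[OF P, of n] by (simp add: power_add mult_2)
    finally have e: "expectation (\<lambda>\<omega>. P \<omega> * \<zeta> k (l + n) \<omega>) =
      (a ^ h * a ^ n) * (a ^ n * (expectation (\<lambda>\<omega>. P \<omega> * (y l \<omega>)\<^sup>2) - \<gamma>0 * expectation P))" .
    have ahn: "\<bar>a ^ h * a ^ n\<bar> \<le> 1" using a by (simp add: abs_mult mult_le_one power_le_one)
    have "\<bar>expectation (\<lambda>\<omega>. P \<omega> * \<zeta> k (l + n) \<omega>)\<bar> \<le> 1 * (a ^ n * \<bar>expectation (\<lambda>\<omega>. P \<omega> * (y l \<omega>)\<^sup>2) - \<gamma>0 * expectation P\<bar>)"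
      unfolding e abs_mult[of "a ^ h * a ^ n"] using a ahn by (intro mult_mono) (auto simp: abs_mult)
    also have "\<dots> \<le> a ^ n *
       (\<bar>expectation (\<lambda>\<omega>. P \<omega> * y l \<omega>)\<bar> + \<bar>expectation (\<lambda>\<omega>. P \<omega> * (y l \<omega>)\<^sup>2) - \<gamma>0 * expectation P\<bar>)"
      using a by (simp add: mult_left_mono)
    finally show ?thesis using i by simp
  qed
  then show "integrable M (\<lambda>\<omega>. P \<omega> * \<zeta> k (l + n) \<omega>)"
    "\<bar>expectation (\<lambda>\<omega>. P \<omega> * \<zeta> k (l + n) \<omega>)\<bar> \<le> a ^ n *
       (\<bar>expectation (\<lambda>\<omega>. P \<omega> * y l \<omega>)\<bar> + \<bar>expectation (\<lambda>\<omega>. P \<omega> * (y l \<omega>)\<^sup>2) - \<gamma>0 * expectation P\<bar>)" by auto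
qed

text \<open>With the constant test function 1 both terms of the decay bound vanish, already at
  distance 0.\<close>

lemma expectation_\<zeta>: "expectation (\<zeta> k i) = 0"
proof -
  have "\<bar>expectation (\<lambda>\<omega>. 1 * \<zeta> k (i + 0) \<omega>)\<bar> \<le> a ^ 0 *
       (\<bar>expectation (\<lambda>\<omega>. 1 * y i \<omega>)\<bar> + \<bar>expectation (\<lambda>\<omega>. 1 * (y i \<omega>)\<^sup>2) - \<gamma>0 * expectation (\<lambda>_. 1)\<bar>)"
    by (rule decay_\<zeta>) (use moments in auto)
  then show ?thesis by (simp add: moments prob_space)
qed

lemma expectation_yy: "expectation (\<lambda>\<omega>. y (i + h) \<omega> * y i \<omega>) = \<gamma>0 * a ^ h"
proof -
  have "integrable M (\<lambda>\<omega>. y (i + h) \<omega> * y i \<omega>)"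
    using bounded_moment_integrable_mult[OF bounded_moment_shifts(1)[of 2 "\<lambda>i. i"] bounded_moment_shifts(1)[of 2 "\<lambda>i. i"]] p by simp
  then show ?thesis using expectation_\<zeta>[of "Suc h" i] by (simp add: \<zeta>_def[abs_def] prob_space)
qed

text \<open>A window of length \<open>Suc K\<close> is a fixed function of the shorter window and
  one fresh innovation. These are independent, and by induction neither law depends on the starting
  time.\<close>

lemma joint_stationary:
  "distr M (PiM {..K} (\<lambda>_. borel)) (\<lambda>\<omega>. \<lambda>m\<in>{..K}. y (i + m) \<omega>) =
   distr M (PiM {..K} (\<lambda>_. borel)) (\<lambda>\<omega>. \<lambda>m\<in>{..K}. y m \<omega>)"
proof (induction K)
  case 0
  have "distr M (PiM {..0::nat} (\<lambda>_. borel)) (\<lambda>\<omega>. \<lambda>m\<in>{..0}. y (i + m) \<omega>) =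
     distr (distr M borel (y i)) (PiM {..0::nat} (\<lambda>_. borel)) (\<lambda>r. \<lambda>m\<in>{..0}. r)" for i
    by (subst distr_distr) (auto simp: comp_def intro!: measurable_restrict distr_cong restrict_ext)
  note e = this
  show ?case using e[of i] e[of 0] unfolding stat_y[of i] add_0 by (rule trans[OF _ sym])
next
  case (Suc K)
  define T where "T i \<omega> = (\<lambda>m\<in>{..K}. y (i + m) \<omega>)" for i \<omega>
  \<comment> \<open>The innovation becomes a family with a single coordinate, so that both arguments
    of \<open>indep_var\<close> take values in the same type.\<close>
  define X where "X n \<omega> = (\<lambda>m\<in>{0::nat}. x n \<omega>)" for n \<omega>
  define \<Phi> where "\<Phi> r = (\<lambda>m\<in>{..Suc K}. if m = Suc K then a * fst r K + snd r 0 else fst r m)"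
    for r :: "(nat \<Rightarrow> real) \<times> (nat \<Rightarrow> real)"
  have \<Phi>: "\<Phi> \<in> measurable (PiM {..K} (\<lambda>_. borel) \<Otimes>\<^sub>M PiM {0} (\<lambda>_. borel)) (PiM {..Suc K} (\<lambda>_. borel))"
    unfolding \<Phi>_def
  proof (rule measurable_restrict)
    fix m assume "m \<in> {..Suc K}"
    then show "(\<lambda>r. if m = Suc K then a * fst r K + snd r 0 else fst r m) \<in>
        borel_measurable (PiM {..K} (\<lambda>_. borel) \<Otimes>\<^sub>M PiM {0} (\<lambda>_. borel))"
      by (cases "m = Suc K") auto
  qed
  have X_law: "distr M (PiM {0} (\<lambda>_. borel)) (X n) = distr M (PiM {0} (\<lambda>_. borel)) (X 0)" for n
  proof -
    have "distr M (PiM {0} (\<lambda>_. borel)) (X n) = distr (distr M borel (x n)) (PiM {0} (\<lambda>_. borel)) (\<lambda>r. \<lambda>m\<in>{0}. r)" for n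
      unfolding X_def[abs_def] by (subst distr_distr) (auto simp: comp_def intro!: measurable_restrict)
    note e = this
    show ?thesis using e[of n] e[of 0] unfolding stat_x[of n] by (rule trans[OF _ sym])
  qed
  have T_past: "T i \<in> measurable (past (i + K)) (PiM {..K} (\<lambda>_. borel))" for i
    unfolding T_def[abs_def] by (rule measurable_restrict) (auto intro: y_past)
  have law: "distr M (PiM {..Suc K} (\<lambda>_. borel)) (\<lambda>\<omega>. \<lambda>m\<in>{..Suc K}. y (i + m) \<omega>) =
     distr (distr M (PiM {..K} (\<lambda>_. borel)) (T i) \<Otimes>\<^sub>M distr M (PiM {0} (\<lambda>_. borel)) (X 0)) (PiM {..Suc K} (\<lambda>_. borel)) \<Phi>" for i
  proof -
    have "indep_var (PiM {..K} (\<lambda>_. borel)) (T i) (PiM {0} (\<lambda>_. borel)) (X (i + K))"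
    proof (rule indep_var_vimage_algebra)
      show "indep_var (PiM {..i + K} (\<lambda>_. borel)) (\<lambda>\<omega>. \<lambda>i\<in>{..i + K}. case_nat (y 0) x i \<omega>)
         (PiM {Suc (i + K)} (\<lambda>_. borel)) (\<lambda>\<omega>. \<lambda>i\<in>{Suc (i + K)}. case_nat (y 0) x i \<omega>)"
        by (rule indep_var_restrict[OF indep]) auto
      show "T i \<in> measurable (vimage_algebra (space M) (\<lambda>\<omega>. \<lambda>i\<in>{..i + K}. case_nat (y 0) x i \<omega>) (PiM {..i + K} (\<lambda>_. borel))) (PiM {..K} (\<lambda>_. borel))"
        using T_past[of i] by (simp add: past_def)
      show "X (i + K) \<in> measurable (vimage_algebra (space M) (\<lambda>\<omega>. \<lambda>i\<in>{Suc (i + K)}. case_nat (y 0) x i \<omega>) (PiM {Suc (i + K)} (\<lambda>_. borel))) (PiM {0} (\<lambda>_. borel))"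
        unfolding X_def[abs_def] by (rule measurable_restrict) (rule innovation_sigma)
    qed
    then have ind: "distr M (PiM {..K} (\<lambda>_. borel)) (T i) \<Otimes>\<^sub>M distr M (PiM {0} (\<lambda>_. borel)) (X (i + K)) =
        distr M (PiM {..K} (\<lambda>_. borel) \<Otimes>\<^sub>M PiM {0} (\<lambda>_. borel)) (\<lambda>\<omega>. (T i \<omega>, X (i + K) \<omega>))"
      and [measurable]: "T i \<in> measurable M (PiM {..K} (\<lambda>_. borel))" "X (i + K) \<in> measurable M (PiM {0} (\<lambda>_. borel))"
      by (auto simp: indep_var_distribution_eq)
    have eq: "\<Phi> (T i \<omega>, X (i + K) \<omega>) = (\<lambda>m\<in>{..Suc K}. y (i + m) \<omega>)" for \<omega>
      by (auto simp: \<Phi>_def T_def X_def rec)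
    have "distr M (PiM {..Suc K} (\<lambda>_. borel)) (\<lambda>\<omega>. \<lambda>m\<in>{..Suc K}. y (i + m) \<omega>) =
        distr (distr M (PiM {..K} (\<lambda>_. borel) \<Otimes>\<^sub>M PiM {0} (\<lambda>_. borel)) (\<lambda>\<omega>. (T i \<omega>, X (i + K) \<omega>))) (PiM {..Suc K} (\<lambda>_. borel)) \<Phi>"
      by (subst distr_distr[OF \<Phi>]) (measurable, simp only: comp_def eq)
    then show ?thesis unfolding ind[symmetric] X_law[of "i + K"] .
  qed
  have "distr M (PiM {..K} (\<lambda>_. borel)) (T i) = distr M (PiM {..K} (\<lambda>_. borel)) (T 0)"
    using Suc unfolding T_def[abs_def] add_0 .
  then show ?case using law[of i] law[of 0] by (simp only: add_0)
qed

lemma stationary_\<zeta>: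
  "expectation (\<lambda>\<omega>. \<zeta> k i \<omega> * \<zeta> l (i + j) \<omega>) = expectation (\<lambda>\<omega>. \<zeta> k 0 \<omega> * \<zeta> l j \<omega>)"
proof -
  define K where "K = j + k + l"
  define z where "z k i r = (case k of 0 \<Rightarrow> r i | Suc h \<Rightarrow> r (i + h) * r i - \<gamma>0 * a ^ h)" for k i and r :: "nat \<Rightarrow> real"
  have z: "z k' i' \<in> borel_measurable (PiM {..K} (\<lambda>_. borel))" if "i' + k' \<le> K" for k' i'
    using that by (cases k') (auto simp: z_def[abs_def] intro!: borel_measurable_times borel_measurable_diff measurable_component_singleton)
  have m[measurable]: "(\<lambda>r. z k 0 r * z l j r) \<in> borel_measurable (PiM {..K} (\<lambda>_. borel))"
    by (intro borel_measurable_times z) (auto simp: K_def)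
  have T[measurable]: "(\<lambda>\<omega>. \<lambda>m\<in>{..K}. y (i + m) \<omega>) \<in> measurable M (PiM {..K} (\<lambda>_. borel))" for i
    by (rule measurable_restrict) auto
  have zz: "z k' i' (\<lambda>m\<in>{..K}. y (i + m) \<omega>) = \<zeta> k' (i + i') \<omega>" if "i' + k' \<le> K" for k' i' i \<omega>
    using that by (cases k') (auto simp: z_def \<zeta>_def add.assoc)
  have "expectation (\<lambda>\<omega>. \<zeta> k (i + 0) \<omega> * \<zeta> l (i + j) \<omega>) =
      (\<integral>r. z k 0 r * z l j r \<partial>distr M (PiM {..K} (\<lambda>_. borel)) (\<lambda>\<omega>. \<lambda>m\<in>{..K}. y (i + m) \<omega>))" for i
    by (subst integral_distr[OF T m], subst zz, simp add: K_def, subst zz, simp add: K_def, rule refl)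
  from this[of i] this[of 0] show ?thesis by (simp add: joint_stationary[of K i])
qed

text \<open>Component \<open>k\<close> at time \<open>i\<close> looks ahead, but by time
  \<open>i + k\<close> it belongs to the past. From there on correlations are bounded by a geometric
  sequence; finitely many initial terms are split off.\<close>

lemma summable_\<zeta>: "summable (\<lambda>j. expectation (\<lambda>\<omega>. \<zeta> k i \<omega> * \<zeta> l (i + j) \<omega>))"
proof -
  have i: "integrable M (\<lambda>\<omega>. \<zeta> k i \<omega> * y (i + k) \<omega>)" "integrable M (\<lambda>\<omega>. \<zeta> k i \<omega> * (y (i + k) \<omega>)\<^sup>2)" "integrable M (\<zeta> k i)"
    using bounded_moment_integrable_mult[OF bounded_moment_\<zeta>2[of k "\<lambda>_. i"] bounded_moment_shifts(1)[of 2 "\<lambda>_. i + k"]]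
      bounded_moment_integrable_mult[OF bounded_moment_\<zeta>2[of k "\<lambda>_. i"] bounded_moment_products(4)[of 2 "\<lambda>_. i + k"]]
      bounded_moment_integrable[OF _ bounded_moment_\<zeta>2[of k "\<lambda>_. i"]] p
    by auto
  define C where "C = \<bar>expectation (\<lambda>\<omega>. \<zeta> k i \<omega> * y (i + k) \<omega>)\<bar> + \<bar>expectation (\<lambda>\<omega>. \<zeta> k i \<omega> * (y (i + k) \<omega>)\<^sup>2) - \<gamma>0 * expectation (\<zeta> k i)\<bar>"
  have "summable (\<lambda>n. expectation (\<lambda>\<omega>. \<zeta> k i \<omega> * \<zeta> l (i + (n + k)) \<omega>))"
  proof (rule summable_comparison_test')
    show "summable (\<lambda>n. C * a ^ n)" using a by (intro summable_mult summable_geometric) auto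
    show "norm (expectation (\<lambda>\<omega>. \<zeta> k i \<omega> * \<zeta> l (i + (n + k)) \<omega>)) \<le> C * a ^ n" for n
      using decay_\<zeta>(2)[OF _ i(3,1,2), of l n] \<zeta>_past[of i k "i + k"]
      by (simp add: C_def ac_simps)
  qed
  then show ?thesis by (simp add: summable_iff_shift[where f = "\<lambda>j. expectation (\<lambda>\<omega>. \<zeta> k i \<omega> * \<zeta> l (i + j) \<omega>)" and k = k])
qed

end

section \<open>Reduction of the partial sums to martingales\<close>

context stationary_ar1
begin

text \<open>The notion of a negligible sequence: partial sums bounded in \<open>L^2\<close>
  disappear after division by \<open>sqrt n\<close>. Telescoping differences are the typical
  case.\<close>

definition bounded_sums :: "(nat \<Rightarrow> 'a \<Rightarrow> real) \<Rightarrow> bool" where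
  "bounded_sums X \<longleftrightarrow> bounded_moment 2 (\<lambda>n \<omega>. \<Sum>i<n. X i \<omega>)"

lemma bounded_sums_add: "bounded_sums X \<Longrightarrow> bounded_sums Y \<Longrightarrow> bounded_sums (\<lambda>i \<omega>. X i \<omega> + Y i \<omega>)"
  unfolding bounded_sums_def sum.distrib by (rule bounded_moment_add) auto

lemma bounded_sums_cmult: "bounded_sums X \<Longrightarrow> bounded_sums (\<lambda>i \<omega>. c * X i \<omega>)"
  unfolding bounded_sums_def sum_distrib_left[symmetric] by (rule bounded_moment_cmult)

lemma bounded_sums_telescope: "bounded_moment 2 G \<Longrightarrow> bounded_sums (\<lambda>i \<omega>. G i \<omega> - G (Suc i) \<omega>)"
proof -
  assume G: "bounded_moment 2 G"
  have "(\<Sum>i<n. G i \<omega> - G (Suc i) \<omega>) = G 0 \<omega> - G n \<omega>" for n \<omega>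
    by (rule sum_lessThan_telescope')
  then show ?thesis unfolding bounded_sums_def
    using G by (simp only:) (intro bounded_moment_diff bounded_moment_shift[of _ _ "\<lambda>_. 0"]; simp)
qed

lemma bounded_sums_shift: "bounded_moment 2 G \<Longrightarrow> bounded_sums (\<lambda>i \<omega>. G i \<omega> - G (i + r) \<omega>)"
proof (induction r)
  case 0
  then show ?case by (simp add: bounded_sums_def bounded_moment_const)
next
  case (Suc r)
  from bounded_sums_add[OF Suc.IH[OF Suc.prems] bounded_sums_telescope[OF bounded_moment_shift[OF Suc.prems, of "\<lambda>i. i + r"]]]
  show ?case by simp
qed

text \<open>All terms use the one innovation \<open>x (i + d)\<close>, while the factors
  \<open>y (i + m)\<close> with \<open>m\<close> at most \<open>d\<close> are known before it.
  Delaying by \<open>d\<close> lets all lags up to \<open>d\<close> be aligned on the same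
  innovation.\<close>

definition martingale_difference :: "nat \<Rightarrow> real \<Rightarrow> real \<Rightarrow> (nat \<Rightarrow> real) \<Rightarrow> nat \<Rightarrow> 'a \<Rightarrow> real" where
  "martingale_difference d c1 c2 w i \<omega> =
     x (i + d) \<omega> * (c1 + (\<Sum>m\<le>d. w m * y (i + m) \<omega>)) + c2 * ((x (i + d) \<omega>)\<^sup>2 - v)"

definition representable :: "nat \<Rightarrow> (nat \<Rightarrow> 'a \<Rightarrow> real) \<Rightarrow> bool" where
  "representable d f \<longleftrightarrow> (\<exists>c1 c2 w. bounded_sums (\<lambda>i \<omega>. f i \<omega> - martingale_difference d c1 c2 w i \<omega>))"

lemma representable_equiv:
  assumes "representable d g" "bounded_sums (\<lambda>i \<omega>. f i \<omega> - g i \<omega>)"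
  shows "representable d f"
proof -
  obtain c1 c2 w where "bounded_sums (\<lambda>i \<omega>. g i \<omega> - martingale_difference d c1 c2 w i \<omega>)"
    using assms(1) by (auto simp: representable_def)
  from bounded_sums_add[OF assms(2) this] show ?thesis unfolding representable_def by auto
qed

lemma representable_add:
  assumes "representable d f" "representable d g"
  shows "representable d (\<lambda>i \<omega>. f i \<omega> + g i \<omega>)"
proof -
  obtain c1 c2 w c1' c2' w' where "bounded_sums (\<lambda>i \<omega>. f i \<omega> - martingale_difference d c1 c2 w i \<omega>)"
    "bounded_sums (\<lambda>i \<omega>. g i \<omega> - martingale_difference d c1' c2' w' i \<omega>)"
    using assms by (auto simp: representable_def)
  from bounded_sums_add[OF this]
  have "bounded_sums (\<lambda>i \<omega>. f i \<omega> + g i \<omega> - martingale_difference d (c1 + c1') (c2 + c2') (\<lambda>m. w m + w' m) i \<omega>)"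
    by (simp add: martingale_difference_def algebra_simps sum.distrib)
  then show ?thesis unfolding representable_def by blast
qed

lemma representable_cmult:
  assumes "representable d f"
  shows "representable d (\<lambda>i \<omega>. c * f i \<omega>)"
proof -
  obtain c1 c2 w where "bounded_sums (\<lambda>i \<omega>. f i \<omega> - martingale_difference d c1 c2 w i \<omega>)"
    using assms by (auto simp: representable_def)
  from bounded_sums_cmult[OF this, of c]
  have "bounded_sums (\<lambda>i \<omega>. c * f i \<omega> - martingale_difference d (c * c1) (c * c2) (\<lambda>m. c * w m) i \<omega>)"
    by (simp add: martingale_difference_def algebra_simps sum_distrib_left)
  then show ?thesis unfolding representable_def by blast
qed

lemma representable_sum:
  "(\<And>k. k \<in> K \<Longrightarrow> representable d (f k)) \<Longrightarrow> representable d (\<lambda>i \<omega>. \<Sum>k\<in>K. f k i \<omega>)"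
proof (induction K rule: infinite_finite_induct)
  have "bounded_sums (\<lambda>i \<omega>. 0 - martingale_difference d 0 0 (\<lambda>_. 0) i \<omega>)"
    by (simp add: martingale_difference_def bounded_sums_def bounded_moment_const)
  then have z: "representable d (\<lambda>i \<omega>. 0)" unfolding representable_def by blast
  { case (infinite A) show ?case using infinite z by simp }
  { case empty show ?case using z by simp }
  { case (insert k F) then show ?case using representable_add[of d "f k"] by simp }
qed

text \<open>Replacing \<open>x i\<close> by \<open>x (i + d)\<close> changes the partial sums by at
  most \<open>2 * d\<close> boundary terms.\<close>

lemma representable_x: "representable d (\<lambda>i \<omega>. x i \<omega>)"
proof -
  have "bounded_sums (\<lambda>i \<omega>. x i \<omega> - martingale_difference d 1 0 (\<lambda>_. 0) i \<omega>)"
    using bounded_sums_shift[OF bounded_moment_shifts(2)[of 2 "\<lambda>i. i"], of d] p by (simp add: martingale_difference_def)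
  then show ?thesis unfolding representable_def by blast
qed

lemma representable_x2: "representable d (\<lambda>i \<omega>. (x i \<omega>)\<^sup>2 - v)"
proof -
  have "bounded_sums (\<lambda>i \<omega>. (x i \<omega>)\<^sup>2 - v - martingale_difference d 0 1 (\<lambda>_. 0) i \<omega>)"
    using bounded_sums_shift[OF bounded_moment_products(5)[of 2 "\<lambda>i. i"], of d] p by (simp add: martingale_difference_def)
  then show ?thesis unfolding representable_def by blast
qed

lemma representable_yx:
  assumes "j \<le> d" shows "representable d (\<lambda>i \<omega>. y i \<omega> * x (i + j) \<omega>)"
proof -
  \<comment> \<open>Shifting time by \<open>d - j\<close> moves the innovation to
    \<open>i + d\<close> and the factor \<open>y\<close> to \<open>i + (d - j)\<close>, hence the
    unit weight at \<open>d - j\<close>.\<close>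
  have "bounded_sums (\<lambda>i \<omega>. y i \<omega> * x (i + j) \<omega> - martingale_difference d 0 0 (\<lambda>m. if m = d - j then 1 else 0) i \<omega>)"
  proof -
    have "(\<Sum>m\<le>d. (if m = d - j then 1 else 0) * y (i + m) \<omega>) = (\<Sum>m\<le>d. if m = d - j then y (i + m) \<omega> else 0)" for i \<omega>
      by (rule sum.cong) auto
    then show ?thesis
      using bounded_sums_shift[OF bounded_moment_products(2)[of 2 "\<lambda>i. i" "\<lambda>i. i + j"], of "d - j"] p assms
      by (simp add: martingale_difference_def mult.commute)
  qed
  then show ?thesis unfolding representable_def by blast
qed

text \<open>The recursion solved for \<open>y i\<close>: up to the factor \<open>1 - a\<close> it is
  \<open>x i\<close> plus the telescoping difference of \<open>y\<close>, the solution of a Poisson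
  equation.\<close>

lemma representable_y: "representable d (\<lambda>i \<omega>. y i \<omega>)"
proof (rule representable_equiv[OF representable_cmult[OF representable_x, of d "1 / (1 - a)"]])
  have "(\<lambda>i \<omega>. y i \<omega> - 1 / (1 - a) * x i \<omega>) = (\<lambda>i \<omega>. 1 / (1 - a) * (y i \<omega> - y (Suc i) \<omega>))"
    using a by (intro ext) (simp add: rec field_simps)
  then show "bounded_sums (\<lambda>i \<omega>. y i \<omega> - 1 / (1 - a) * x i \<omega>)"
    using bounded_sums_cmult[OF bounded_sums_telescope[OF bounded_moment_shifts(1)[of 2 "\<lambda>i. i"]], of "1 / (1 - a)"] p by simp
qed

text \<open>The same for the squared recursion: \<open>1 - a\<^sup>2\<close> times the centred
  square is the telescoping difference of squares plus the cross term and the centred squared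
  innovation.\<close>

lemma representable_y2: "representable d (\<lambda>i \<omega>. (y i \<omega>)\<^sup>2 - \<gamma>0)"
proof (rule representable_equiv)
  let ?g = "\<lambda>i \<omega>. 1 / (1 - a\<^sup>2) * (2 * a * (y i \<omega> * x (i + 0) \<omega>) + ((x i \<omega>)\<^sup>2 - v))"
  show "representable d ?g"
    by (intro representable_cmult representable_add representable_yx representable_x2) simp
  have "a\<^sup>2 \<noteq> 1" using a power_strict_mono[of a 1 2] by simp
  then have "(\<lambda>i \<omega>. (y i \<omega>)\<^sup>2 - \<gamma>0 - ?g i \<omega>) = (\<lambda>i \<omega>. 1 / (1 - a\<^sup>2) * ((y i \<omega>)\<^sup>2 - (y (Suc i) \<omega>)\<^sup>2))"
    by (intro ext) (simp add: rec v_def divide_simps, simp add: algebra_simps power2_eq_square)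
  then show "bounded_sums (\<lambda>i \<omega>. (y i \<omega>)\<^sup>2 - \<gamma>0 - ?g i \<omega>)"
    using bounded_sums_cmult[OF bounded_sums_telescope[OF bounded_moment_products(4)[of 2 "\<lambda>i. i"]], of "1 / (1 - a\<^sup>2)"] p by simp
qed

lemma y_expand: "y (i + h) \<omega> = a ^ h * y i \<omega> + (\<Sum>j<h. a ^ (h - 1 - j) * x (i + j) \<omega>)"
proof (induction h)
  case (Suc h)
  have "(\<Sum>j<h. a ^ (h - j) * x (i + j) \<omega>) = a * (\<Sum>j<h. a ^ (h - 1 - j) * x (i + j) \<omega>)"
    unfolding sum_distrib_left
  proof (rule sum.cong[OF refl])
    fix j assume "j \<in> {..<h}"
    then have "h - j = Suc (h - 1 - j)" by auto
    then show "a ^ (h - j) * x (i + j) \<omega> = a * (a ^ (h - 1 - j) * x (i + j) \<omega>)" by simp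
  qed
  then show ?case using Suc by (simp add: rec algebra_simps)
qed simp

text \<open>Expanding \<open>y (i + h)\<close> from time \<open>i\<close> leaves the square of
  \<open>y i\<close> and products with innovations at distance below \<open>h\<close>. As
  \<open>k < d + 2\<close> means \<open>h \<le> d\<close>, all of them are representable.\<close>

lemma representable_\<zeta>:
  assumes "k < d + 2" shows "representable d (\<zeta> k)"
proof (cases k)
  case 0
  then show ?thesis using representable_y[of d] by (simp add: \<zeta>_def[abs_def])
next
  case (Suc h)
  have "\<zeta> k = (\<lambda>i \<omega>. a ^ h * ((y i \<omega>)\<^sup>2 - \<gamma>0) + (\<Sum>j<h. a ^ (h - 1 - j) * (y i \<omega> * x (i + j) \<omega>)))"
    using Suc by (intro ext) (simp add: \<zeta>_def y_expand algebra_simps power2_eq_square sum_distrib_left sum_distrib_right)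
  moreover have "representable d (\<lambda>i \<omega>. a ^ h * ((y i \<omega>)\<^sup>2 - \<gamma>0) + (\<Sum>j<h. a ^ (h - 1 - j) * (y i \<omega> * x (i + j) \<omega>)))"
    by (intro representable_add representable_cmult representable_sum representable_y2 representable_yx)
       (use assms Suc in auto)
  ultimately show ?thesis by simp
qed

text \<open>Geometric decorrelation from the past, tested only against functions bounded by 1. That
  suffices because the central limit theorem tests with cosine and sine, and it makes the class
  closed under linear combinations.\<close>

definition mixing :: "(nat \<Rightarrow> 'a \<Rightarrow> real) \<Rightarrow> bool" where
  "mixing Q \<longleftrightarrow> bounded_moment 2 Q \<and> (\<forall>k. expectation (Q k) = 0) \<and>
     (\<exists>C\<ge>0. \<forall>l k P. l \<le> k \<longrightarrow> P \<in> borel_measurable (past l) \<longrightarrow> (\<forall>\<omega>. \<bar>P \<omega>\<bar> \<le> 1) \<longrightarrow>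
        \<bar>expectation (\<lambda>\<omega>. P \<omega> * Q k \<omega>)\<bar> \<le> C * a ^ (k - l))"

lemma mixing_integrable:
  "mixing Q \<Longrightarrow> integrable M (Q k)"
  using bounded_moment_integrable[of 2 Q] by (simp add: mixing_def)

lemma mixing_mult_integrable:
  "mixing Q \<Longrightarrow> P \<in> borel_measurable (past l) \<Longrightarrow> (\<And>\<omega>. \<bar>P \<omega>\<bar> \<le> 1) \<Longrightarrow> integrable M (\<lambda>\<omega>. P \<omega> * Q k \<omega>)"
  by (rule integrable_bounded_mult[OF past_sub]) (auto intro: mixing_integrable)

lemma mixing_zero: "mixing (\<lambda>k \<omega>. 0)"
  unfolding mixing_def using a by (auto intro!: exI[of _ 0] bounded_moment_const)

lemma mixing_add:
  assumes Q: "mixing Q" and R: "mixing R" shows "mixing (\<lambda>k \<omega>. Q k \<omega> + R k \<omega>)"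
proof -
  obtain C where C: "C \<ge> 0" "\<And>l k P. l \<le> k \<Longrightarrow> P \<in> borel_measurable (past l) \<Longrightarrow> (\<forall>\<omega>. \<bar>P \<omega>\<bar> \<le> 1) \<Longrightarrow>
        \<bar>expectation (\<lambda>\<omega>. P \<omega> * Q k \<omega>)\<bar> \<le> C * a ^ (k - l)" using Q unfolding mixing_def by meson
  obtain D where D: "D \<ge> 0" "\<And>l k P. l \<le> k \<Longrightarrow> P \<in> borel_measurable (past l) \<Longrightarrow> (\<forall>\<omega>. \<bar>P \<omega>\<bar> \<le> 1) \<Longrightarrow>
        \<bar>expectation (\<lambda>\<omega>. P \<omega> * R k \<omega>)\<bar> \<le> D * a ^ (k - l)" using R unfolding mixing_def by meson
  show ?thesis unfolding mixing_def
  proof (intro conjI allI exI[of _ "C + D"] impI)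
    show "bounded_moment 2 (\<lambda>k \<omega>. Q k \<omega> + R k \<omega>)"
      using Q R by (intro bounded_moment_add) (auto simp: mixing_def)
    show "expectation (\<lambda>\<omega>. Q k \<omega> + R k \<omega>) = 0" for k
      using Q R mixing_integrable[OF Q, of k] mixing_integrable[OF R, of k] by (simp add: mixing_def)
    fix l k and P :: "'a \<Rightarrow> real" assume *: "l \<le> k" "P \<in> borel_measurable (past l)" "\<forall>\<omega>. \<bar>P \<omega>\<bar> \<le> 1"
    have "expectation (\<lambda>\<omega>. P \<omega> * (Q k \<omega> + R k \<omega>)) = expectation (\<lambda>\<omega>. P \<omega> * Q k \<omega>) + expectation (\<lambda>\<omega>. P \<omega> * R k \<omega>)"
      using mixing_mult_integrable[OF Q *(2)] mixing_mult_integrable[OF R *(2)] * by (simp add: distrib_left)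
    then show "\<bar>expectation (\<lambda>\<omega>. P \<omega> * (Q k \<omega> + R k \<omega>))\<bar> \<le> (C + D) * a ^ (k - l)"
      using C(2)[OF *] D(2)[OF *] by (simp add: distrib_right)
  qed (use C D in auto)
qed

lemma mixing_cmult:
  assumes Q: "mixing Q" shows "mixing (\<lambda>k \<omega>. c * Q k \<omega>)"
proof -
  obtain C where C: "C \<ge> 0" "\<And>l k P. l \<le> k \<Longrightarrow> P \<in> borel_measurable (past l) \<Longrightarrow> (\<forall>\<omega>. \<bar>P \<omega>\<bar> \<le> 1) \<Longrightarrow>
        \<bar>expectation (\<lambda>\<omega>. P \<omega> * Q k \<omega>)\<bar> \<le> C * a ^ (k - l)" using Q unfolding mixing_def by meson
  show ?thesis unfolding mixing_def
  proof (intro conjI allI exI[of _ "\<bar>c\<bar> * C"] impI)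
    show "bounded_moment 2 (\<lambda>k \<omega>. c * Q k \<omega>)"
      using Q by (intro bounded_moment_cmult) (auto simp: mixing_def)
    show "expectation (\<lambda>\<omega>. c * Q k \<omega>) = 0" for k using Q by (simp add: mixing_def)
    fix l k and P :: "'a \<Rightarrow> real" assume *: "l \<le> k" "P \<in> borel_measurable (past l)" "\<forall>\<omega>. \<bar>P \<omega>\<bar> \<le> 1"
    have "expectation (\<lambda>\<omega>. P \<omega> * (c * Q k \<omega>)) = c * expectation (\<lambda>\<omega>. P \<omega> * Q k \<omega>)"
      by (simp add: mult.left_commute[of _ c])
    then show "\<bar>expectation (\<lambda>\<omega>. P \<omega> * (c * Q k \<omega>))\<bar> \<le> \<bar>c\<bar> * C * a ^ (k - l)"
      using mult_left_mono[OF C(2)[OF *], of "\<bar>c\<bar>"] by (simp add: abs_mult mult.assoc)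
  qed (use C in auto)
qed

lemma mixing_sum: "(\<And>j. j \<in> J \<Longrightarrow> mixing (Q j)) \<Longrightarrow> mixing (\<lambda>k \<omega>. \<Sum>j\<in>J. Q j k \<omega>)"
  by (induction J rule: infinite_finite_induct) (auto intro: mixing_zero mixing_add)

lemma mixing_\<zeta>: "mixing (\<lambda>k. \<zeta> \<kappa> (k + m))"
  unfolding mixing_def
\<comment> \<open>The witness bounds the bracket in \<open>decay_\<zeta>\<close> for test functions
  bounded by 1: one absolute moment of \<open>y\<close>, and \<open>\<gamma>0\<close> twice.\<close>
proof (intro conjI allI exI[of _ "expectation (\<lambda>\<omega>. \<bar>y 0 \<omega>\<bar>) + 2 * \<gamma>0"] impI)
  show "bounded_moment 2 (\<lambda>k. \<zeta> \<kappa> (k + m))" by (rule bounded_moment_\<zeta>2)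
  show "0 \<le> expectation (\<lambda>\<omega>. \<bar>y 0 \<omega>\<bar>) + 2 * \<gamma>0" using \<gamma>0_nonneg by (simp add: integral_nonneg)
  fix l k and P :: "'a \<Rightarrow> real" assume *: "l \<le> k" "P \<in> borel_measurable (past l)" "\<forall>\<omega>. \<bar>P \<omega>\<bar> \<le> 1"
  have P: "P \<in> borel_measurable M" by (rule past_sub[OF *(2)])
  have ib: "integrable M (\<lambda>\<omega>. P \<omega> * X \<omega>)" "\<bar>expectation (\<lambda>\<omega>. P \<omega> * X \<omega>)\<bar> \<le> expectation (\<lambda>\<omega>. \<bar>X \<omega>\<bar>)"
    if "integrable M X" for X
    using integrable_bounded_mult[OF P _ that] expectation_bounded_mult_le[OF P _ that] * by auto
  have iP: "integrable M P" "\<bar>expectation P\<bar> \<le> 1" using ib[of "\<lambda>_. 1"] by (auto simp: prob_space)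
  have "\<bar>expectation (\<lambda>\<omega>. P \<omega> * \<zeta> \<kappa> (l + (k + m - l)) \<omega>)\<bar> \<le> a ^ (k + m - l) *
     (\<bar>expectation (\<lambda>\<omega>. P \<omega> * y l \<omega>)\<bar> + \<bar>expectation (\<lambda>\<omega>. P \<omega> * (y l \<omega>)\<^sup>2) - \<gamma>0 * expectation P\<bar>)"
    by (rule decay_\<zeta>(2)[OF *(2)]) (use iP ib moments in auto)
  also have "\<dots> \<le> a ^ (k - l) * (expectation (\<lambda>\<omega>. \<bar>y 0 \<omega>\<bar>) + 2 * \<gamma>0)"
  proof (rule mult_mono)
    show "a ^ (k + m - l) \<le> a ^ (k - l)" using a by (intro power_decreasing) auto
    have "\<bar>expectation (\<lambda>\<omega>. P \<omega> * y l \<omega>)\<bar> \<le> expectation (\<lambda>\<omega>. \<bar>y 0 \<omega>\<bar>)"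
      using ib(2)[OF moments(1)[of l]] stationary_integral(1)[of abs l] by simp
    moreover have "\<bar>expectation (\<lambda>\<omega>. P \<omega> * (y l \<omega>)\<^sup>2)\<bar> \<le> \<gamma>0"
      using ib(2)[OF moments(3)[of l]] moments(7)[of l] by simp
    moreover have "\<bar>\<gamma>0 * expectation P\<bar> \<le> \<gamma>0"
      using iP \<gamma>0_nonneg by (simp add: abs_mult mult_left_le)
    ultimately show "\<bar>expectation (\<lambda>\<omega>. P \<omega> * y l \<omega>)\<bar> + \<bar>expectation (\<lambda>\<omega>. P \<omega> * (y l \<omega>)\<^sup>2) - \<gamma>0 * expectation P\<bar>
      \<le> expectation (\<lambda>\<omega>. \<bar>y 0 \<omega>\<bar>) + 2 * \<gamma>0" by linarith
  qed (use a in auto)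
  finally show "\<bar>expectation (\<lambda>\<omega>. P \<omega> * \<zeta> \<kappa> (k + m) \<omega>)\<bar> \<le> (expectation (\<lambda>\<omega>. \<bar>y 0 \<omega>\<bar>) + 2 * \<gamma>0) * a ^ (k - l)"
    using * by (simp add: mult.commute)
qed (rule expectation_\<zeta>)

end

section \<open>Central limit theorem for the approximating martingale\<close>

locale ar1_martingale = stationary_ar1 +
  fixes d :: nat and c1 c2 :: real and w :: "nat \<Rightarrow> real"
begin

definition W :: "nat \<Rightarrow> 'a \<Rightarrow> real" where "W k \<omega> = c1 + (\<Sum>m\<le>d. w m * y (k + m) \<omega>)"
definition U :: "nat \<Rightarrow> 'a \<Rightarrow> real" where "U k \<omega> = (x (k + d) \<omega>)\<^sup>2 - v"
abbreviation D :: "nat \<Rightarrow> 'a \<Rightarrow> real" where "D \<equiv> martingale_difference d c1 c2 w"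
definition S :: "nat \<Rightarrow> 'a \<Rightarrow> real" where "S n \<omega> = (\<Sum>i<n. D i \<omega>)"
definition \<kappa>3 :: real where "\<kappa>3 = expectation (\<lambda>\<omega>. x 0 \<omega> * ((x 0 \<omega>)\<^sup>2 - v))"
definition \<kappa>4 :: real where "\<kappa>4 = expectation (\<lambda>\<omega>. ((x 0 \<omega>)\<^sup>2 - v)\<^sup>2)"
definition W2 :: real where
  "W2 = c1\<^sup>2 + (\<Sum>m\<le>d. \<Sum>n\<le>d. w m * w n * (\<gamma>0 * a ^ (max m n - min m n)))"
text \<open>The mean of the conditional variance: \<open>W2\<close> is the second moment of
  \<open>W\<close> and \<open>c1\<close> its mean, while \<open>\<kappa>3\<close> and
  \<open>\<kappa>4\<close> are the covariance of an innovation with its square and the variance of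
  the square.\<close>

definition V :: real where "V = v * W2 + 2 * c2 * \<kappa>3 * c1 + c2\<^sup>2 * \<kappa>4"

lemma D_eq: "D k \<omega> = W k \<omega> * x (k + d) \<omega> + c2 * U k \<omega>"
  by (simp add: martingale_difference_def W_def U_def)

lemma bounded_moment_W: "0 < q \<Longrightarrow> q \<le> p \<Longrightarrow> bounded_moment q W"
  unfolding W_def[abs_def] by (intro bounded_moment_add bounded_moment_const bounded_moment_sum bounded_moment_cmult bounded_moment_shifts)

lemma bounded_moment_U: "0 < q \<Longrightarrow> 2 * q \<le> p \<Longrightarrow> bounded_moment q U"
  unfolding U_def[abs_def] by (intro bounded_moment_diff bounded_moment_const bounded_moment_products)

lemma bounded_moment_D: assumes "0 < q" "2 * q \<le> p" shows "bounded_moment q D"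
proof -
  have "bounded_moment q (\<lambda>k \<omega>. W k \<omega> * x (k + d) \<omega> + c2 * U k \<omega>)"
    by (intro bounded_moment_add bounded_moment_cmult bounded_moment_U bounded_moment_mult bounded_moment_W bounded_moment_shifts) (use assms in auto)
  then show ?thesis by (simp add: D_eq[abs_def])
qed

lemma bounded_moment_2: "bounded_moment 2 W" "bounded_moment 2 U" "bounded_moment 2 D" "bounded_moment 2 (\<lambda>k. x (k + d))"
  using p by (auto intro: bounded_moment_W bounded_moment_U bounded_moment_D bounded_moment_shifts)

lemma W_past: "W k \<in> borel_measurable (past (k + d))"
proof -
  have [measurable]: "y (k + m) \<in> borel_measurable (past (k + d))" if "m \<in> {..d}" for m
    using that by (intro y_past) auto
  show ?thesis unfolding W_def[abs_def] by measurable
qed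

lemma D_past: "D k \<in> borel_measurable (past (Suc (k + d)))"
proof -
  have [measurable]: "W k \<in> borel_measurable (past (Suc (k + d)))" "x (k + d) \<in> borel_measurable (past (Suc (k + d)))"
    using past_mono[OF W_past] by (auto intro: x_past)
  show ?thesis unfolding D_eq[abs_def] U_def by measurable
qed

lemma S_past: "S n \<in> borel_measurable (past (n + d))"
  unfolding S_def[abs_def]
  by (rule borel_measurable_sum) (rule past_mono[OF D_past], auto)

lemma D_measurable[measurable]: "D k \<in> borel_measurable M" by (rule past_sub[OF D_past])
lemma S_measurable[measurable]: "S n \<in> borel_measurable M" by (rule past_sub[OF S_past])

lemma x_functions:
  "integrable M (U k)" "expectation (U k) = 0"
  "integrable M (\<lambda>\<omega>. x (k + d) \<omega> * U k \<omega>)" "expectation (\<lambda>\<omega>. x (k + d) \<omega> * U k \<omega>) = \<kappa>3"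
  "integrable M (\<lambda>\<omega>. (U k \<omega>)\<^sup>2)" "expectation (\<lambda>\<omega>. (U k \<omega>)\<^sup>2) = \<kappa>4"
proof -
  show "integrable M (U k)" using bounded_moment_integrable[OF _ bounded_moment_2(2)] by simp
  show "expectation (U k) = 0" unfolding U_def[abs_def] using moments(4,8)[of "k + d"] by (simp add: prob_space)
  show "integrable M (\<lambda>\<omega>. x (k + d) \<omega> * U k \<omega>)" by (rule bounded_moment_integrable_mult[OF bounded_moment_2(4,2)])
  show "integrable M (\<lambda>\<omega>. (U k \<omega>)\<^sup>2)" by (rule bounded_moment_integrable_power2[OF bounded_moment_2(2)])
  show "expectation (\<lambda>\<omega>. x (k + d) \<omega> * U k \<omega>) = \<kappa>3"
    unfolding \<kappa>3_def U_def using stationary_integral(2)[of "\<lambda>z. z * (z\<^sup>2 - v)" "k + d"] by simp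
  show "expectation (\<lambda>\<omega>. (U k \<omega>)\<^sup>2) = \<kappa>4"
    unfolding \<kappa>4_def U_def using stationary_integral(2)[of "\<lambda>z. (z\<^sup>2 - v)\<^sup>2" "k + d"] by simp
qed

lemma martingale_property:
  fixes P :: "'a \<Rightarrow> real"
  assumes P: "P \<in> borel_measurable (past (k + d))" and bm: "bounded_moment 2 (\<lambda>_::nat. P)"
  shows "expectation (\<lambda>\<omega>. P \<omega> * D k \<omega>) = 0"
proof -
  have iP: "integrable M P" using bounded_moment_integrable[OF _ bm] by simp
  have iPW: "integrable M (\<lambda>\<omega>. P \<omega> * W k \<omega>)" by (rule bounded_moment_integrable_mult[OF bm bounded_moment_2(1)])
  have "(\<lambda>\<omega>. P \<omega> * W k \<omega>) \<in> borel_measurable (past (k + d))"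
    by (intro borel_measurable_times P W_past)
  note 1 = innovation_mult[OF this iPW order.refl, of "\<lambda>z. z"]
  note 2 = innovation_mult[OF P iP order.refl, of "\<lambda>z. z\<^sup>2 - v"]
  have U: "integrable M (\<lambda>\<omega>. (x (k + d) \<omega>)\<^sup>2 - v)" "expectation (\<lambda>\<omega>. (x (k + d) \<omega>)\<^sup>2 - v) = 0"
    using x_functions(1,2)[of k] by (simp_all add: U_def[abs_def])
  have "expectation (\<lambda>\<omega>. P \<omega> * D k \<omega>) =
     expectation (\<lambda>\<omega>. P \<omega> * W k \<omega> * x (k + d) \<omega> + c2 * (P \<omega> * ((x (k + d) \<omega>)\<^sup>2 - v)))"
    by (simp add: D_eq U_def algebra_simps)
  also have "\<dots> = 0" using 1 2 U moments(2,6)[of "k + d"] by simp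
  finally show ?thesis .
qed

text \<open>After expanding the square, the innovation \<open>x (k + d)\<close> is independent of
  \<open>P\<close> and \<open>W k\<close>, and integrating it out leaves a quadratic polynomial in
  \<open>W k\<close>.\<close>

lemma conditional_square:
  fixes P :: "'a \<Rightarrow> real"
  assumes P: "P \<in> borel_measurable (past (k + d))" "\<And>\<omega>. \<bar>P \<omega>\<bar> \<le> 1"
  shows "expectation (\<lambda>\<omega>. P \<omega> * (D k \<omega>)\<^sup>2) =
     expectation (\<lambda>\<omega>. P \<omega> * (v * (W k \<omega>)\<^sup>2 + 2 * c2 * \<kappa>3 * W k \<omega> + c2\<^sup>2 * \<kappa>4))"
proof -
  have PM: "P \<in> borel_measurable M" by (rule past_sub[OF P(1)])
  note ib = integrable_bounded_mult[OF PM P(2)]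
  have iP: "integrable M P" using ib[of "\<lambda>_. 1"] by simp
  have iW: "integrable M (\<lambda>\<omega>. P \<omega> * W k \<omega>)" "integrable M (\<lambda>\<omega>. P \<omega> * (W k \<omega>)\<^sup>2)"
    using ib bounded_moment_integrable[OF _ bounded_moment_2(1)] bounded_moment_integrable_power2[OF bounded_moment_2(1)] by auto
  have m: "(\<lambda>\<omega>. P \<omega> * W k \<omega>) \<in> borel_measurable (past (k + d))" "(\<lambda>\<omega>. P \<omega> * (W k \<omega>)\<^sup>2) \<in> borel_measurable (past (k + d))"
    by (intro borel_measurable_times borel_measurable_power P W_past)+
  note 1 = innovation_mult[OF m(2) iW(2) order.refl, of "\<lambda>z. z\<^sup>2"]
  note 2 = innovation_mult[OF m(1) iW(1) order.refl, of "\<lambda>z. z * (z\<^sup>2 - v)"]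
  note 3 = innovation_mult[OF P(1) iP order.refl, of "\<lambda>z. (z\<^sup>2 - v)\<^sup>2"]
  note u = x_functions[of k, unfolded U_def]
  have "expectation (\<lambda>\<omega>. P \<omega> * (D k \<omega>)\<^sup>2) =
     expectation (\<lambda>\<omega>. P \<omega> * (W k \<omega>)\<^sup>2 * (x (k + d) \<omega>)\<^sup>2 + 2 * c2 * (P \<omega> * W k \<omega> * (x (k + d) \<omega> * ((x (k + d) \<omega>)\<^sup>2 - v)))
       + c2\<^sup>2 * (P \<omega> * ((x (k + d) \<omega>)\<^sup>2 - v)\<^sup>2))"
    by (rule Bochner_Integration.integral_cong[OF refl]) (simp add: D_eq U_def algebra_simps power2_eq_square)
  also have "\<dots> = v * expectation (\<lambda>\<omega>. P \<omega> * (W k \<omega>)\<^sup>2) + 2 * c2 * \<kappa>3 * expectation (\<lambda>\<omega>. P \<omega> * W k \<omega>) + c2\<^sup>2 * \<kappa>4 * expectation P"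
    using 1 2 3 u moments(4,8)[of "k + d"] by simp
  also have "\<dots> = expectation (\<lambda>\<omega>. v * (P \<omega> * (W k \<omega>)\<^sup>2) + 2 * c2 * \<kappa>3 * (P \<omega> * W k \<omega>) + c2\<^sup>2 * \<kappa>4 * P \<omega>)"
    using iW iP by simp
  finally show ?thesis by (simp add: algebra_simps)
qed

definition Q :: "nat \<Rightarrow> 'a \<Rightarrow> real" where
  "Q k \<omega> = v * (W k \<omega>)\<^sup>2 + 2 * c2 * \<kappa>3 * W k \<omega> + c2\<^sup>2 * \<kappa>4 - V"

text \<open>The centred conditional variance is a quadratic polynomial in recent values of
  \<open>y\<close>, so it is a linear combination of components of \<open>\<zeta>\<close>: each
  product of two values is one of them, with lag the distance of the times and anchored at the
  earlier time.\<close>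

lemma mixing_Q: "mixing Q"
proof -
  have W2: "(W k \<omega>)\<^sup>2 - W2 = 2 * c1 * (\<Sum>m\<le>d. w m * \<zeta> 0 (k + m) \<omega>) +
      (\<Sum>m\<le>d. \<Sum>n\<le>d. w m * w n * \<zeta> (Suc (max m n - min m n)) (k + min m n) \<omega>)" for k \<omega>
  proof -
    have zeq: "\<zeta> (Suc (max m n - min m n)) (k + min m n) \<omega> = y (k + m) \<omega> * y (k + n) \<omega> - \<gamma>0 * a ^ (max m n - min m n)" for m n
      by (simp add: \<zeta>_def max_def min_def mult.commute)
    have "(\<Sum>m\<le>d. \<Sum>n\<le>d. w m * w n * \<zeta> (Suc (max m n - min m n)) (k + min m n) \<omega>) =
      (\<Sum>m\<le>d. w m * y (k + m) \<omega>) * (\<Sum>n\<le>d. w n * y (k + n) \<omega>) - (\<Sum>m\<le>d. \<Sum>n\<le>d. w m * w n * (\<gamma>0 * a ^ (max m n - min m n)))"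
      unfolding sum_product sum_subtractf[symmetric] zeq by (intro sum.cong refl) (simp add: algebra_simps)
    then show ?thesis by (simp add: W_def W2_def \<zeta>_def power2_eq_square algebra_simps)
  qed
  have "Q k \<omega> = v * (2 * c1 * (\<Sum>m\<le>d. w m * \<zeta> 0 (k + m) \<omega>) +
      (\<Sum>m\<le>d. \<Sum>n\<le>d. w m * w n * \<zeta> (Suc (max m n - min m n)) (k + min m n) \<omega>)) + 2 * c2 * \<kappa>3 * (\<Sum>m\<le>d. w m * \<zeta> 0 (k + m) \<omega>)" for k \<omega>
    unfolding W2[symmetric] by (simp add: Q_def V_def W_def \<zeta>_def algebra_simps)
  then have "Q = (\<lambda>k \<omega>. v * (2 * c1 * (\<Sum>m\<le>d. w m * \<zeta> 0 (k + m) \<omega>) +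
      (\<Sum>m\<le>d. \<Sum>n\<le>d. w m * w n * \<zeta> (Suc (max m n - min m n)) (k + min m n) \<omega>)) + 2 * c2 * \<kappa>3 * (\<Sum>m\<le>d. w m * \<zeta> 0 (k + m) \<omega>))"
    by (intro ext)
  then show ?thesis by (simp only:) (intro mixing_add mixing_cmult mixing_sum mixing_\<zeta>)
qed

lemma conditional_variance:
  fixes P :: "'a \<Rightarrow> real"
  assumes P: "P \<in> borel_measurable (past (k + d))" "\<And>\<omega>. \<bar>P \<omega>\<bar> \<le> 1"
  shows "expectation (\<lambda>\<omega>. P \<omega> * (D k \<omega>)\<^sup>2) - V * expectation P = expectation (\<lambda>\<omega>. P \<omega> * Q k \<omega>)"
proof -
  have iP: "integrable M P" using integrable_bounded_mult[OF past_sub[OF P(1)] P(2), of "\<lambda>_. 1"] by simp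
  have "expectation (\<lambda>\<omega>. P \<omega> * (v * (W k \<omega>)\<^sup>2 + 2 * c2 * \<kappa>3 * W k \<omega> + c2\<^sup>2 * \<kappa>4)) =
     expectation (\<lambda>\<omega>. P \<omega> * Q k \<omega> + V * P \<omega>)"
    by (simp add: Q_def algebra_simps)
  also have "\<dots> = expectation (\<lambda>\<omega>. P \<omega> * Q k \<omega>) + V * expectation P"
    using mixing_mult_integrable[OF mixing_Q P] iP by simp
  finally show ?thesis unfolding conditional_square[OF P] by simp
qed

lemma expectation_D2: "expectation (\<lambda>\<omega>. (D k \<omega>)\<^sup>2) = V"
  using conditional_variance[of "\<lambda>_. 1" k] mixing_Q by (simp add: mixing_def prob_space)

lemma V_nonneg: "V \<ge> 0" unfolding expectation_D2[of 0, symmetric] by simp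

lemma bounded_moment_S: "bounded_moment 2 (\<lambda>_::nat. S n)"
  unfolding S_def[abs_def]
  by (intro bounded_moment_sum) (auto intro: bounded_moment_shift[OF bounded_moment_2(3), of "\<lambda>_. i" for i])

text \<open>Orthogonality of martingale increments, from \<open>martingale_property\<close> with
  \<open>P\<close> the previous sum.\<close>

lemma expectation_S2: "integrable M (\<lambda>\<omega>. (S n \<omega>)\<^sup>2)" "expectation (\<lambda>\<omega>. (S n \<omega>)\<^sup>2) = real n * V"
proof -
  show i: "integrable M (\<lambda>\<omega>. (S n \<omega>)\<^sup>2)" for n by (rule bounded_moment_integrable_power2[OF bounded_moment_S])
  show "expectation (\<lambda>\<omega>. (S n \<omega>)\<^sup>2) = real n * V"
  proof (induction n)
    case (Suc n)
    have "expectation (\<lambda>\<omega>. (S (Suc n) \<omega>)\<^sup>2) = expectation (\<lambda>\<omega>. (S n \<omega>)\<^sup>2 + 2 * (S n \<omega> * D n \<omega>) + (D n \<omega>)\<^sup>2)"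
      by (simp add: S_def power2_eq_square algebra_simps)
    also have "\<dots> = real n * V + V"
      using i[of n] bounded_moment_integrable_mult[OF bounded_moment_S bounded_moment_2(3), of n n] bounded_moment_integrable_power2[OF bounded_moment_2(3), of n]
        martingale_property[OF S_past bounded_moment_S, of n] Suc expectation_D2[of n] by simp
    finally show ?case by (simp add: algebra_simps)
  qed (simp add: S_def)
qed

text \<open>\<open>S k\<close> is too recent for \<open>mixing\<close> to yield anything at distance
  0. For small \<open>s\<close> the last \<open>r'\<close> summands hardly affect
  \<open>F (s * S k \<omega>)\<close>, and without them the sum lies far enough in the past.\<close>

lemma lipschitz_mixing:
  fixes F :: "real \<Rightarrow> real"
  assumes F: "F \<in> borel_measurable borel" "\<And>u. \<bar>F u\<bar> \<le> 1" "\<And>u v. \<bar>F u - F v\<bar> \<le> \<bar>u - v\<bar>"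
    and "\<eta> > 0"
  shows "\<exists>\<delta>>0. \<forall>s k. \<bar>s\<bar> < \<delta> \<longrightarrow> \<bar>expectation (\<lambda>\<omega>. F (s * S k \<omega>) * Q k \<omega>)\<bar> \<le> \<eta>"
proof -
  obtain C where C: "C \<ge> 0" "\<And>l k P. l \<le> k \<Longrightarrow> P \<in> borel_measurable (past l) \<Longrightarrow> (\<forall>\<omega>. \<bar>P \<omega>\<bar> \<le> 1) \<Longrightarrow>
        \<bar>expectation (\<lambda>\<omega>. P \<omega> * Q k \<omega>)\<bar> \<le> C * a ^ (k - l)" using mixing_Q unfolding mixing_def by meson
  have bmQ: "bounded_moment 2 Q" using mixing_Q by (simp add: mixing_def)
  obtain A where A: "A \<ge> 0" "\<And>i. integrable M (\<lambda>\<omega>. (D i \<omega>)\<^sup>2)" "\<And>i. expectation (\<lambda>\<omega>. (D i \<omega>)\<^sup>2) \<le> A"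
    using bounded_moment_2D[OF bounded_moment_2(3)] by blast
  obtain B where B: "B \<ge> 0" "\<And>i. integrable M (\<lambda>\<omega>. (Q i \<omega>)\<^sup>2)" "\<And>i. expectation (\<lambda>\<omega>. (Q i \<omega>)\<^sup>2) \<le> B"
    using bounded_moment_2D[OF bmQ] by blast
  have iDQ: "integrable M (\<lambda>\<omega>. \<bar>D i \<omega> * Q k \<omega>\<bar>)" for i k
    by (intro integrable_abs bounded_moment_integrable_mult[OF bounded_moment_2(3) bmQ])
  have DQ: "expectation (\<lambda>\<omega>. \<bar>D i \<omega> * Q k \<omega>\<bar>) \<le> A + B" for i k
  proof -
    have "expectation (\<lambda>\<omega>. \<bar>D i \<omega> * Q k \<omega>\<bar>) \<le> expectation (\<lambda>\<omega>. (D i \<omega>)\<^sup>2 + (Q k \<omega>)\<^sup>2)"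
    proof (rule integral_mono[OF iDQ])
      show "integrable M (\<lambda>\<omega>. (D i \<omega>)\<^sup>2 + (Q k \<omega>)\<^sup>2)" using A B by simp
      fix \<omega>
      have "2 * (\<bar>D i \<omega>\<bar> * \<bar>Q k \<omega>\<bar>) \<le> (D i \<omega>)\<^sup>2 + (Q k \<omega>)\<^sup>2"
        using sum_squares_bound[of "\<bar>D i \<omega>\<bar>" "\<bar>Q k \<omega>\<bar>"] by (simp add: mult.assoc)
      moreover have "0 \<le> \<bar>D i \<omega>\<bar> * \<bar>Q k \<omega>\<bar>" by simp
      ultimately show "\<bar>D i \<omega> * Q k \<omega>\<bar> \<le> (D i \<omega>)\<^sup>2 + (Q k \<omega>)\<^sup>2" unfolding abs_mult by linarith
    qed
    also have "\<dots> \<le> A + B" using A(2,3)[of i] B(2,3)[of k] by simp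
    finally show ?thesis .
  qed
  have "(\<lambda>r. C * a ^ r) \<longlonglongrightarrow> C * 0" using a by (intro tendsto_mult tendsto_const LIMSEQ_power_zero) auto
  from order_tendstoD(2)[OF this, of "\<eta> / 2"] \<open>\<eta> > 0\<close> obtain r where r: "C * a ^ r < \<eta> / 2"
    by (auto simp: eventually_sequentially)
  \<comment> \<open>\<open>S n\<close> is known only at time \<open>n + d\<close>, so dropping
    \<open>r + d\<close> summands leaves a gap of \<open>r\<close>.\<close>
  define r' where "r' = r + d"
  \<comment> \<open>The added 1 keeps the denominator of \<open>\<delta>\<close> positive.\<close>
  define K where "K = real r' * (A + B) + 1"
  have K: "K > 0" "real r' * (A + B) \<le> K" using A B by (auto simp: K_def add_nonneg_pos)
  define \<delta> where "\<delta> = \<eta> / (2 * K)"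
  have "\<bar>expectation (\<lambda>\<omega>. F (s * S k \<omega>) * Q k \<omega>)\<bar> \<le> \<eta>" if s: "\<bar>s\<bar> < \<delta>" for s k
  proof -
    define P where "P n \<omega> = F (s * S n \<omega>)" for n \<omega>
    have P_past: "P n \<in> borel_measurable (past (n + d))" for n
      unfolding P_def[abs_def] by (intro measurable_compose[OF _ F(1)] borel_measurable_times S_past) auto
    have P1: "\<bar>P n \<omega>\<bar> \<le> 1" for n \<omega> unfolding P_def by (rule F(2))
    note iPQ = mixing_mult_integrable[OF mixing_Q P_past P1]
    have old: "\<bar>expectation (\<lambda>\<omega>. P (k - r') \<omega> * Q k \<omega>)\<bar> \<le> \<eta> / 2"
    proof (cases "r' \<le> k")
      case True
      then have "k - r' + d \<le> k" "k - (k - r' + d) = r" by (auto simp: r'_def)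
      then show ?thesis using C(2)[OF _ P_past, of "k - r'" k] P1 r by fastforce
    next
      \<comment> \<open>Truncated subtraction makes \<open>k - r'\<close> equal to 0. The sum is
        then empty, the test function constant, and \<open>Q k\<close> has mean 0.\<close>
      case False
      then have "P (k - r') \<omega> = F 0" for \<omega> by (simp add: P_def S_def)
      then show ?thesis using mixing_Q \<open>\<eta> > 0\<close> by (simp add: mixing_def)
    qed
    have "\<bar>expectation (\<lambda>\<omega>. P k \<omega> * Q k \<omega>) - expectation (\<lambda>\<omega>. P (k - r') \<omega> * Q k \<omega>)\<bar> =
        \<bar>expectation (\<lambda>\<omega>. P k \<omega> * Q k \<omega> - P (k - r') \<omega> * Q k \<omega>)\<bar>"
      using iPQ by simp
    also have "\<dots> \<le> expectation (\<lambda>\<omega>. \<bar>P k \<omega> * Q k \<omega> - P (k - r') \<omega> * Q k \<omega>\<bar>)" by (rule integral_abs_bound)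
    also have "\<dots> \<le> expectation (\<lambda>\<omega>. \<bar>s\<bar> * (\<Sum>i\<in>{k - r'..<k}. \<bar>D i \<omega> * Q k \<omega>\<bar>))"
    proof (rule integral_mono)
      show "integrable M (\<lambda>\<omega>. \<bar>P k \<omega> * Q k \<omega> - P (k - r') \<omega> * Q k \<omega>\<bar>)" using iPQ by (intro integrable_abs Bochner_Integration.integrable_diff)
      show "integrable M (\<lambda>\<omega>. \<bar>s\<bar> * (\<Sum>i\<in>{k - r'..<k}. \<bar>D i \<omega> * Q k \<omega>\<bar>))"
        by (intro integrable_mult_right Bochner_Integration.integrable_sum iDQ)
      fix \<omega>
      have "{..<k} = {..<k - r'} \<union> {k - r'..<k}" by auto
      then have "S k \<omega> = S (k - r') \<omega> + (\<Sum>i\<in>{k - r'..<k}. D i \<omega>)"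
        unfolding S_def by (simp add: sum.union_disjoint[symmetric] ivl_disj_int)
      then have "\<bar>P k \<omega> - P (k - r') \<omega>\<bar> \<le> \<bar>s * (\<Sum>i\<in>{k - r'..<k}. D i \<omega>)\<bar>"
        unfolding P_def using F(3)[of "s * S k \<omega>" "s * S (k - r') \<omega>"] by (simp add: algebra_simps)
      also have "\<dots> \<le> \<bar>s\<bar> * (\<Sum>i\<in>{k - r'..<k}. \<bar>D i \<omega>\<bar>)"
        unfolding abs_mult by (intro mult_left_mono sum_abs) auto
      finally have "\<bar>P k \<omega> - P (k - r') \<omega>\<bar> * \<bar>Q k \<omega>\<bar> \<le> \<bar>s\<bar> * (\<Sum>i\<in>{k - r'..<k}. \<bar>D i \<omega>\<bar>) * \<bar>Q k \<omega>\<bar>"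
        by (intro mult_right_mono) auto
      then show "\<bar>P k \<omega> * Q k \<omega> - P (k - r') \<omega> * Q k \<omega>\<bar> \<le> \<bar>s\<bar> * (\<Sum>i\<in>{k - r'..<k}. \<bar>D i \<omega> * Q k \<omega>\<bar>)"
        by (simp add: abs_mult left_diff_distrib[symmetric] sum_distrib_right mult.assoc)
    qed
    also have "\<dots> = \<bar>s\<bar> * (\<Sum>i\<in>{k - r'..<k}. expectation (\<lambda>\<omega>. \<bar>D i \<omega> * Q k \<omega>\<bar>))"
      using iDQ by simp
    also have "\<dots> \<le> \<bar>s\<bar> * K"
    proof (rule mult_left_mono)
      have "(\<Sum>i\<in>{k - r'..<k}. expectation (\<lambda>\<omega>. \<bar>D i \<omega> * Q k \<omega>\<bar>)) \<le> (\<Sum>i\<in>{k - r'..<k}. A + B)"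
        by (intro sum_mono DQ)
      also have "\<dots> = real (k - (k - r')) * (A + B)" by simp
      also have "\<dots> \<le> real r' * (A + B)" using A B by (intro mult_right_mono) auto
      finally show "(\<Sum>i\<in>{k - r'..<k}. expectation (\<lambda>\<omega>. \<bar>D i \<omega> * Q k \<omega>\<bar>)) \<le> K" using K by simp
    qed auto
    also have "\<dots> \<le> \<delta> * K" using s K by (intro mult_right_mono) auto
    also have "\<dots> = \<eta> / 2" using K by (simp add: \<delta>_def)
    finally show ?thesis using old unfolding P_def by linarith
  qed
  moreover have "\<delta> > 0" using K \<open>\<eta> > 0\<close> by (simp add: \<delta>_def)
  ultimately show ?thesis by blast
qed

lemma CLT: "(\<lambda>n. CLINT \<omega>|M. iexp (t * (S n \<omega> / sqrt n))) \<longlonglongrightarrow> complex_of_real (exp (- (V * t\<^sup>2 / 2)))"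
proof -
  \<comment> \<open>Half of \<open>p\<close>, because differences contain products, and above 2
    since \<open>p > 4\<close>; capped at 3 for \<open>iexp_taylor2\<close>.\<close>
  define q where "q = min 3 (p / 2)"
  have q: "2 < q" "q \<le> 3" "2 * q \<le> p" using p by (auto simp: q_def)
  have trig_past: "(\<lambda>\<omega>. f (s * S k \<omega>)) \<in> borel_measurable (past (k + d))" if "f \<in> borel_measurable borel" for f :: "real \<Rightarrow> real" and s k
    by (intro measurable_compose[OF _ that] borel_measurable_times S_past) auto
  have bm1: "bounded_moment 2 (\<lambda>_::nat. P)" if "P \<in> borel_measurable M" "\<And>\<omega>. \<bar>P \<omega>\<bar> \<le> 1" for P :: "'a \<Rightarrow> real"
    by (rule bounded_momentI[where G = "\<lambda>_ _. 1" and C = 1])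
       (use that in \<open>auto simp: prob_space abs_square_le_1\<close>)
  have lip: "\<bar>cos u - cos v\<bar> \<le> \<bar>u - v\<bar>" "\<bar>sin u - sin v\<bar> \<le> \<bar>u - v\<bar>" for u v :: real
  proof -
    have "norm (iexp u - iexp v) \<le> \<bar>u - v\<bar>" using norm_iexp_diff[of u v] by simp
    moreover have "\<bar>cos u - cos v\<bar> \<le> norm (iexp u - iexp v)" "\<bar>sin u - sin v\<bar> \<le> norm (iexp u - iexp v)"
      using abs_Re_le_cmod[of "iexp u - iexp v"] abs_Im_le_cmod[of "iexp u - iexp v"] by (auto simp: Re_exp Im_exp)
    ultimately show "\<bar>cos u - cos v\<bar> \<le> \<bar>u - v\<bar>" "\<bar>sin u - sin v\<bar> \<le> \<bar>u - v\<bar>" by auto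
  qed
  have zero: "expectation (\<lambda>\<omega>. f (s * S k \<omega>) * D k \<omega>) = 0"
    if "f \<in> borel_measurable borel" "\<And>u. \<bar>f u\<bar> \<le> 1" for f :: "real \<Rightarrow> real" and s k
    by (rule martingale_property[OF trig_past[OF that(1)] bm1[OF past_sub[OF trig_past[OF that(1)]]]]) (rule that(2))
  have cv: "expectation (\<lambda>\<omega>. f (s * S k \<omega>) * (D k \<omega>)\<^sup>2) - V * expectation (\<lambda>\<omega>. f (s * S k \<omega>)) =
      expectation (\<lambda>\<omega>. f (s * S k \<omega>) * Q k \<omega>)"
    if "f \<in> borel_measurable borel" "\<And>u. \<bar>f u\<bar> \<le> 1" for f :: "real \<Rightarrow> real" and s k
    by (rule conditional_variance[OF trig_past[OF that(1)]]) (rule that(2))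
  show ?thesis unfolding S_def
  proof (rule martingale_difference_CLT[OF q(1,2) _ V_nonneg])
    show "bounded_moment q D" using q by (intro bounded_moment_D) auto
    show "expectation (\<lambda>\<omega>. cos (s * (\<Sum>i<k. D i \<omega>)) * D k \<omega>) = 0" for s k
      using zero[of cos s k] by (simp add: S_def)
    show "expectation (\<lambda>\<omega>. sin (s * (\<Sum>i<k. D i \<omega>)) * D k \<omega>) = 0" for s k
      using zero[of sin s k] by (simp add: S_def)
    fix \<eta> :: real assume \<eta>: "\<eta> > 0"
    obtain \<delta>1 where 1: "\<delta>1 > 0" "\<And>s k. \<bar>s\<bar> < \<delta>1 \<Longrightarrow> \<bar>expectation (\<lambda>\<omega>. cos (s * S k \<omega>) * Q k \<omega>)\<bar> \<le> \<eta>"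
      using lipschitz_mixing[of cos \<eta>] lip \<eta> by auto
    obtain \<delta>2 where 2: "\<delta>2 > 0" "\<And>s k. \<bar>s\<bar> < \<delta>2 \<Longrightarrow> \<bar>expectation (\<lambda>\<omega>. sin (s * S k \<omega>) * Q k \<omega>)\<bar> \<le> \<eta>"
      using lipschitz_mixing[of sin \<eta>] lip \<eta> by auto
    have "min \<delta>1 \<delta>2 > 0 \<and> (\<forall>s k. \<bar>s\<bar> < min \<delta>1 \<delta>2 \<longrightarrow>
      \<bar>expectation (\<lambda>\<omega>. cos (s * S k \<omega>) * (D k \<omega>)\<^sup>2) - V * expectation (\<lambda>\<omega>. cos (s * S k \<omega>))\<bar> \<le> \<eta> \<and>
      \<bar>expectation (\<lambda>\<omega>. sin (s * S k \<omega>) * (D k \<omega>)\<^sup>2) - V * expectation (\<lambda>\<omega>. sin (s * S k \<omega>))\<bar> \<le> \<eta>)"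
      using 1 2 cv[of cos] cv[of sin] by auto
    then show "\<exists>\<delta>>0. \<forall>s k. \<bar>s\<bar> < \<delta> \<longrightarrow>
      \<bar>expectation (\<lambda>\<omega>. cos (s * (\<Sum>i<k. D i \<omega>)) * (D k \<omega>)\<^sup>2) - V * expectation (\<lambda>\<omega>. cos (s * (\<Sum>i<k. D i \<omega>)))\<bar> \<le> \<eta> \<and>
      \<bar>expectation (\<lambda>\<omega>. sin (s * (\<Sum>i<k. D i \<omega>)) * (D k \<omega>)\<^sup>2) - V * expectation (\<lambda>\<omega>. sin (s * (\<Sum>i<k. D i \<omega>)))\<bar> \<le> \<eta>"
      unfolding S_def by blast
  qed
qed

end

section \<open>Identification of the limit variance\<close>

context stationary_ar1
begin

text \<open>Has the one-sided form of \<open>Sigma_mat\<close> and need not be symmetric. Doubling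
  the one-sided sum is legitimate in the quadratic form, where only a scalar stationary sequence is
  involved.\<close>

definition long_run_cov :: "nat \<Rightarrow> nat \<Rightarrow> real" where
  "long_run_cov k l = expectation (\<lambda>\<omega>. \<zeta> k 1 \<omega> * \<zeta> l 1 \<omega>)
     + 2 * (\<Sum>i. expectation (\<lambda>\<omega>. \<zeta> k 1 \<omega> * \<zeta> l (Suc i + 1) \<omega>))"

text \<open>The vector enters only through the scalar sequence \<open>F\<close>, whose
  autocovariances \<open>c j\<close> depend on the lag alone. Their one-sided sums produce the
  quadratic form of \<open>long_run_cov\<close>.\<close>

lemma lag_covariance_sums:
  fixes b :: "nat \<Rightarrow> real" and m :: nat
  defines "F \<equiv> (\<lambda>i \<omega>. \<Sum>k<m. b k * \<zeta> k i \<omega>)"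
  defines "c \<equiv> (\<lambda>j. expectation (\<lambda>\<omega>. F 0 \<omega> * F j \<omega>))"
  shows "expectation (\<lambda>\<omega>. F i \<omega> * F (i + j) \<omega>) = c j"
    and "(\<lambda>n. c 0 + 2 * (\<Sum>j<n. c (Suc j))) \<longlonglongrightarrow> (\<Sum>k<m. \<Sum>l<m. b k * long_run_cov k l * b l)"
proof -
  define C where "C k l j = expectation (\<lambda>\<omega>. \<zeta> k 0 \<omega> * \<zeta> l j \<omega>)" for k l j
  have FF: "expectation (\<lambda>\<omega>. F i \<omega> * F (i + j) \<omega>) = (\<Sum>k<m. \<Sum>l<m. b k * b l * C k l j)" for i j
  proof -
    have i: "integrable M (\<lambda>\<omega>. \<zeta> k i \<omega> * \<zeta> l (i + j) \<omega>)" for k l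
      using bounded_moment_integrable_mult[OF bounded_moment_\<zeta>2[of k "\<lambda>i. i"] bounded_moment_\<zeta>2[of l "\<lambda>i. i"]] by simp
    have "expectation (\<lambda>\<omega>. F i \<omega> * F (i + j) \<omega>) =
       expectation (\<lambda>\<omega>. \<Sum>k<m. \<Sum>l<m. b k * b l * (\<zeta> k i \<omega> * \<zeta> l (i + j) \<omega>))"
      unfolding F_def sum_product by (intro Bochner_Integration.integral_cong sum.cong refl) simp
    also have "\<dots> = (\<Sum>k<m. \<Sum>l<m. b k * b l * expectation (\<lambda>\<omega>. \<zeta> k i \<omega> * \<zeta> l (i + j) \<omega>))"
      using i by (subst Bochner_Integration.integral_sum, simp, intro sum.cong refl, subst Bochner_Integration.integral_sum, simp, simp)
    finally show ?thesis by (simp add: stationary_\<zeta> C_def)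
  qed
  have c: "c j = (\<Sum>k<m. \<Sum>l<m. b k * b l * C k l j)" for j
    using FF[of 0 j] by (simp add: c_def)
  show "expectation (\<lambda>\<omega>. F i \<omega> * F (i + j) \<omega>) = c j" unfolding FF c ..
  have sm: "(\<lambda>j. C k l (Suc j)) sums (\<Sum>j. C k l (Suc j))" for k l
  proof -
    have "summable (C k l)" using summable_\<zeta>[of k 0 l] by (simp add: C_def[abs_def])
    then show ?thesis by (intro summable_sums) (simp add: summable_Suc_iff)
  qed
  have lr: "long_run_cov k l = C k l 0 + 2 * (\<Sum>j. C k l (Suc j))" for k l
  proof -
    have "expectation (\<lambda>\<omega>. \<zeta> k 1 \<omega> * \<zeta> l (Suc i + 1) \<omega>) = C k l (Suc i)" for i
      using stationary_\<zeta>[of k 1 l "Suc i"] by (simp add: C_def)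
    moreover have "expectation (\<lambda>\<omega>. \<zeta> k 1 \<omega> * \<zeta> l 1 \<omega>) = C k l 0"
      using stationary_\<zeta>[of k 1 l 0] by (simp add: C_def)
    ultimately show ?thesis unfolding long_run_cov_def by simp
  qed
  have "(\<lambda>j. \<Sum>k<m. \<Sum>l<m. b k * b l * C k l (Suc j)) sums (\<Sum>k<m. \<Sum>l<m. b k * b l * (\<Sum>j. C k l (Suc j)))"
    by (intro sums_sum sums_mult sm)
  then have "(\<lambda>n. \<Sum>j<n. c (Suc j)) \<longlonglongrightarrow> (\<Sum>k<m. \<Sum>l<m. b k * b l * (\<Sum>j. C k l (Suc j)))"
    by (simp add: sums_def c)
  then have "(\<lambda>n. c 0 + 2 * (\<Sum>j<n. c (Suc j))) \<longlonglongrightarrow> c 0 + 2 * (\<Sum>k<m. \<Sum>l<m. b k * b l * (\<Sum>j. C k l (Suc j)))"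
    by (intro tendsto_intros)
  also have "c 0 + 2 * (\<Sum>k<m. \<Sum>l<m. b k * b l * (\<Sum>j. C k l (Suc j))) = (\<Sum>k<m. \<Sum>l<m. b k * long_run_cov k l * b l)"
    unfolding c lr sum_distrib_left sum.distrib[symmetric] by (intro sum.cong refl) (simp add: algebra_simps)
  finally show "(\<lambda>n. c 0 + 2 * (\<Sum>j<n. c (Suc j))) \<longlonglongrightarrow> (\<Sum>k<m. \<Sum>l<m. b k * long_run_cov k l * b l)" .
qed

text \<open>Adding the \<open>n\<close>-th summand raises the second moment of the sum by
  \<open>c 0\<close> plus twice the covariances with all earlier summands. These increments
  converge, hence so do the averages.\<close>

lemma variance_rate:
  fixes b :: "nat \<Rightarrow> real" and m :: nat
  defines "F \<equiv> (\<lambda>i \<omega>. \<Sum>k<m. b k * \<zeta> k i \<omega>)"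
  shows "(\<lambda>n. expectation (\<lambda>\<omega>. (\<Sum>i<n. F i \<omega>)\<^sup>2) / real n) \<longlonglongrightarrow> (\<Sum>k<m. \<Sum>l<m. b k * long_run_cov k l * b l)"
proof (rule cesaro_differences)
  define c where "c j = expectation (\<lambda>\<omega>. F 0 \<omega> * F j \<omega>)" for j
  have bmF: "bounded_moment 2 F"
    unfolding F_def by (intro bounded_moment_sum bounded_moment_cmult bounded_moment_\<zeta>2[where f = "\<lambda>i. i"]) simp
  have bmS: "bounded_moment 2 (\<lambda>_::nat. \<lambda>\<omega>. \<Sum>i<n. F i \<omega>)" for n
    by (intro bounded_moment_sum) (auto intro: bounded_moment_shift[OF bmF, of "\<lambda>_. i" for i])
  have "expectation (\<lambda>\<omega>. (\<Sum>i<Suc n. F i \<omega>)\<^sup>2) - expectation (\<lambda>\<omega>. (\<Sum>i<n. F i \<omega>)\<^sup>2) =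
      c 0 + 2 * (\<Sum>j<n. c (Suc j))" for n
  proof -
    have i: "integrable M (\<lambda>\<omega>. F i \<omega> * F n \<omega>)" for i by (rule bounded_moment_integrable_mult[OF bmF bmF])
    have "expectation (\<lambda>\<omega>. (\<Sum>i<Suc n. F i \<omega>)\<^sup>2) =
        expectation (\<lambda>\<omega>. (\<Sum>i<n. F i \<omega>)\<^sup>2 + F n \<omega> * F n \<omega> + 2 * (\<Sum>i<n. F i \<omega> * F n \<omega>))"
      by (simp add: power2_eq_square algebra_simps sum_distrib_left sum_distrib_right)
    also have "\<dots> = expectation (\<lambda>\<omega>. (\<Sum>i<n. F i \<omega>)\<^sup>2) + expectation (\<lambda>\<omega>. F n \<omega> * F n \<omega>)
        + 2 * (\<Sum>i<n. expectation (\<lambda>\<omega>. F i \<omega> * F n \<omega>))"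
      using i bounded_moment_integrable_power2[OF bmS, of n] by simp
    also have "expectation (\<lambda>\<omega>. F n \<omega> * F n \<omega>) = c 0"
      using lag_covariance_sums(1)[where m = m and b = b and i = n and j = 0] by (simp add: F_def c_def)
    also have "(\<Sum>i<n. expectation (\<lambda>\<omega>. F i \<omega> * F n \<omega>)) = (\<Sum>i<n. c (n - i))"
    proof (rule sum.cong[OF refl])
      fix i assume "i \<in> {..<n}"
      then show "expectation (\<lambda>\<omega>. F i \<omega> * F n \<omega>) = c (n - i)"
        using lag_covariance_sums(1)[where m = m and b = b and i = i and j = "n - i"] by (simp add: F_def c_def)
    qed
    also have "\<dots> = (\<Sum>j<n. c (Suc j))"
      by (rule sum.reindex_bij_witness[of _ "\<lambda>j. n - Suc j" "\<lambda>i. n - Suc i"]) (auto simp: Suc_diff_Suc)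
    finally show ?thesis by simp
  qed
  then show "(\<lambda>n. expectation (\<lambda>\<omega>. (\<Sum>i<Suc n. F i \<omega>)\<^sup>2) - expectation (\<lambda>\<omega>. (\<Sum>i<n. F i \<omega>)\<^sup>2)) \<longlonglongrightarrow>
      (\<Sum>k<m. \<Sum>l<m. b k * long_run_cov k l * b l)"
    using lag_covariance_sums(2)[where m = m and b = b] by (simp add: F_def c_def)
qed

text \<open>The coefficients of the representing martingale stay unknown. Its variance is identified
  by uniqueness of limits: the second moment of the sums divided by \<open>n\<close> tends to
  \<open>A.V\<close> by the representation and to the quadratic form by
  \<open>variance_rate\<close>.\<close>

lemma linear_combination_CLT:
  fixes b :: "nat \<Rightarrow> real" and d :: nat
  defines "T \<equiv> (\<lambda>n \<omega>. \<Sum>i=1..n. \<Sum>k<d + 2. b k * \<zeta> k i \<omega>)"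
  defines "V \<equiv> (\<Sum>k<d + 2. \<Sum>l<d + 2. b k * long_run_cov k l * b l)"
  shows "V \<ge> 0"
    and "(\<lambda>n. CLINT \<omega>|M. iexp (T n \<omega> / sqrt n)) \<longlonglongrightarrow> complex_of_real (exp (- (V / 2)))"
    and "bounded_moment 2 (\<lambda>n \<omega>. T n \<omega> / sqrt n)"
proof -
  define F where "F i \<omega> = (\<Sum>k<d + 2. b k * \<zeta> k i \<omega>)" for i \<omega>
  have bmF: "bounded_moment 2 F"
    unfolding F_def[abs_def] by (intro bounded_moment_sum bounded_moment_cmult bounded_moment_\<zeta>2[where f = "\<lambda>i. i"]) simp
  have "representable d F"
    unfolding F_def[abs_def] by (intro representable_sum representable_cmult representable_\<zeta>) simp
  then obtain c1 c2 w where "bounded_sums (\<lambda>i \<omega>. F i \<omega> - martingale_difference d c1 c2 w i \<omega>)"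
    by (auto simp: representable_def)
  then have bmR: "bounded_moment 2 (\<lambda>n \<omega>. \<Sum>i<n. F i \<omega> - martingale_difference d c1 c2 w i \<omega>)"
    by (simp only: bounded_sums_def)
  interpret A: ar1_martingale M y x a p d c1 c2 w ..
  define R where "R n \<omega> = (\<Sum>i<n. F i \<omega> - martingale_difference d c1 c2 w i \<omega>)" for n \<omega>
  have bmR: "bounded_moment 2 R" using bmR by (simp add: R_def[abs_def])
  have SR: "(\<Sum>i<n. F i \<omega>) = A.S n \<omega> + R n \<omega>" for n \<omega>
    by (simp add: R_def A.S_def sum_subtractf)
  obtain C where C: "C \<ge> 0" "\<And>n. integrable M (\<lambda>\<omega>. (R n \<omega>)\<^sup>2)" "\<And>n. expectation (\<lambda>\<omega>. (R n \<omega>)\<^sup>2) \<le> C"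
    using bounded_moment_2D[OF bmR] by blast
  have inv_sqrt: "(\<lambda>n. K / sqrt (real n)) \<longlonglongrightarrow> 0" for K
    by (intro tendsto_divide_0[OF tendsto_const] filterlim_at_top_imp_at_infinity
          filterlim_compose[OF sqrt_at_top] filterlim_real_sequentially)
  have "(\<lambda>n. expectation (\<lambda>\<omega>. (\<Sum>i<n. F i \<omega>)\<^sup>2) / real n - A.V) \<longlonglongrightarrow> 0"
  proof (rule Lim_null_comparison)
    show "(\<lambda>n. A.V / sqrt n + C / sqrt n + C / n) \<longlonglongrightarrow> 0"
      using tendsto_add[OF tendsto_add[OF inv_sqrt[of A.V] inv_sqrt[of C]] lim_const_over_n[of C]] by simp
    show "\<forall>\<^sub>F n in sequentially. norm (expectation (\<lambda>\<omega>. (\<Sum>i<n. F i \<omega>)\<^sup>2) / real n - A.V) \<le> A.V / sqrt n + C / sqrt n + C / n"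
      using eventually_gt_at_top[of 0]
    proof eventually_elim
      case (elim n)
      \<comment> \<open>The weight in the inequality for the cross term: with second moments of
        order \<open>n\<close> for \<open>A.S n\<close> and of order 1 for \<open>R n\<close>, both
        parts become of order \<open>sqrt n\<close>, which is negligible against
        \<open>n\<close>.\<close>
      define r where "r = sqrt n"
      have r: "r > 0" "real n = r * r" using elim by (auto simp: r_def)
      have iSR: "integrable M (\<lambda>\<omega>. A.S n \<omega> * R n \<omega>)"
        by (rule bounded_moment_integrable_mult[OF A.bounded_moment_S bmR])
      have "expectation (\<lambda>\<omega>. (\<Sum>i<n. F i \<omega>)\<^sup>2) = expectation (\<lambda>\<omega>. (A.S n \<omega>)\<^sup>2 + 2 * (A.S n \<omega> * R n \<omega>) + (R n \<omega>)\<^sup>2)"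
        unfolding SR by (simp add: power2_eq_square algebra_simps)
      also have "\<dots> = real n * A.V + 2 * expectation (\<lambda>\<omega>. A.S n \<omega> * R n \<omega>) + expectation (\<lambda>\<omega>. (R n \<omega>)\<^sup>2)"
        using iSR A.expectation_S2[of n] C(2)[of n] by simp
      finally have eq: "expectation (\<lambda>\<omega>. (\<Sum>i<n. F i \<omega>)\<^sup>2) - real n * A.V =
        2 * expectation (\<lambda>\<omega>. A.S n \<omega> * R n \<omega>) + expectation (\<lambda>\<omega>. (R n \<omega>)\<^sup>2)" by simp
      have "\<bar>2 * expectation (\<lambda>\<omega>. A.S n \<omega> * R n \<omega>)\<bar> = \<bar>expectation (\<lambda>\<omega>. 2 * (A.S n \<omega> * R n \<omega>))\<bar>" by simp
      also have "\<dots> \<le> expectation (\<lambda>\<omega>. \<bar>2 * (A.S n \<omega> * R n \<omega>)\<bar>)" by (rule integral_abs_bound)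
      also have "\<dots> \<le> expectation (\<lambda>\<omega>. (A.S n \<omega>)\<^sup>2 / r + r * (R n \<omega>)\<^sup>2)"
      proof (rule integral_mono)
        show "integrable M (\<lambda>\<omega>. \<bar>2 * (A.S n \<omega> * R n \<omega>)\<bar>)" using iSR by (intro integrable_abs) simp
        show "integrable M (\<lambda>\<omega>. (A.S n \<omega>)\<^sup>2 / r + r * (R n \<omega>)\<^sup>2)" using A.expectation_S2(1)[of n] C(2)[of n] by simp
        fix \<omega>
        have "r * (2 * (\<bar>A.S n \<omega>\<bar> * \<bar>R n \<omega>\<bar>)) \<le> (A.S n \<omega>)\<^sup>2 + (r * R n \<omega>)\<^sup>2"
          using sum_squares_bound[of "\<bar>A.S n \<omega>\<bar>" "\<bar>r * R n \<omega>\<bar>"] r by (simp add: abs_mult power_mult_distrib mult_ac)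
        then have "2 * (\<bar>A.S n \<omega>\<bar> * \<bar>R n \<omega>\<bar>) \<le> ((A.S n \<omega>)\<^sup>2 + (r * R n \<omega>)\<^sup>2) / r"
          using r by (simp add: pos_le_divide_eq mult.commute)
        also have "\<dots> = (A.S n \<omega>)\<^sup>2 / r + r * (R n \<omega>)\<^sup>2"
          using r by (simp add: add_divide_distrib power_mult_distrib power2_eq_square)
        finally show "\<bar>2 * (A.S n \<omega> * R n \<omega>)\<bar> \<le> (A.S n \<omega>)\<^sup>2 / r + r * (R n \<omega>)\<^sup>2" by (simp add: abs_mult)
      qed
      also have "\<dots> = r * A.V + r * expectation (\<lambda>\<omega>. (R n \<omega>)\<^sup>2)"
        using A.expectation_S2[of n] C(2)[of n] r by simp
      also have "\<dots> \<le> r * A.V + r * C" using C(3)[of n] r by (intro add_left_mono mult_left_mono) auto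
      finally have SR_le: "\<bar>2 * expectation (\<lambda>\<omega>. A.S n \<omega> * R n \<omega>)\<bar> \<le> r * A.V + r * C" .
      have "\<bar>expectation (\<lambda>\<omega>. (\<Sum>i<n. F i \<omega>)\<^sup>2) - real n * A.V\<bar> \<le> r * A.V + r * C + C"
      proof -
        have "0 \<le> expectation (\<lambda>\<omega>. (R n \<omega>)\<^sup>2)" by simp
        with SR_le show ?thesis unfolding eq using C(3)[of n] by linarith
      qed
      then have "\<bar>expectation (\<lambda>\<omega>. (\<Sum>i<n. F i \<omega>)\<^sup>2) - real n * A.V\<bar> / real n \<le> (r * A.V + r * C + C) / real n"
        by (intro divide_right_mono) auto
      moreover have "(r * A.V + r * C + C) / real n = A.V / r + C / r + C / n"
        using r by (simp add: add_divide_distrib)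
      moreover have "expectation (\<lambda>\<omega>. (\<Sum>i<n. F i \<omega>)\<^sup>2) / real n - A.V =
         (expectation (\<lambda>\<omega>. (\<Sum>i<n. F i \<omega>)\<^sup>2) - real n * A.V) / real n"
        using elim by (simp add: field_simps)
      ultimately show ?case by (simp add: r_def abs_divide)
    qed
  qed
  then have "(\<lambda>n. expectation (\<lambda>\<omega>. (\<Sum>i<n. F i \<omega>)\<^sup>2) / real n) \<longlonglongrightarrow> A.V" by (simp add: LIM_zero_iff)
  moreover have "(\<lambda>n. expectation (\<lambda>\<omega>. (\<Sum>i<n. F i \<omega>)\<^sup>2) / real n) \<longlonglongrightarrow> V"
    unfolding F_def V_def by (rule variance_rate)
  ultimately have VV: "V = A.V" using LIMSEQ_unique by blast
  show "V \<ge> 0" unfolding VV by (rule A.V_nonneg)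
  \<comment> \<open>The statistics sum over 1 to \<open>n\<close>, the martingale over 0 to
    \<open>n - 1\<close>; the difference is two boundary terms.\<close>
  define R' where "R' n \<omega> = R n \<omega> - F 0 \<omega> + F n \<omega>" for n \<omega>
  have bmR': "bounded_moment 2 R'"
    unfolding R'_def[abs_def]
    by (intro bounded_moment_add bounded_moment_diff bmR bmF bounded_moment_shift[OF bmF, of "\<lambda>_. 0"]) auto
  have T: "T n \<omega> = A.S n \<omega> + R' n \<omega>" for n \<omega>
  proof -
    have "T n \<omega> = (\<Sum>i<n. F (Suc i) \<omega>)"
      unfolding T_def F_def[symmetric] by (rule sum.reindex_bij_witness[of _ Suc "\<lambda>i. i - 1"]) auto
    also have "\<dots> = (\<Sum>i<n. F i \<omega>) + (\<Sum>i<n. F (Suc i) \<omega> - F i \<omega>)" by (simp add: sum_subtractf)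
    also have "(\<Sum>i<n. F (Suc i) \<omega> - F i \<omega>) = F n \<omega> - F 0 \<omega>" by (rule sum_lessThan_telescope)
    finally show ?thesis by (simp add: SR R'_def)
  qed
  note m[measurable] = bounded_moment_measurable[OF bmR'] A.S_measurable
  have Tm[measurable]: "T n \<in> borel_measurable M" for n unfolding T[abs_def] by measurable
  obtain C' where C': "C' \<ge> 0" "\<And>n. integrable M (\<lambda>\<omega>. (R' n \<omega>)\<^sup>2)" "\<And>n. expectation (\<lambda>\<omega>. (R' n \<omega>)\<^sup>2) \<le> C'"
    using bounded_moment_2D[OF bmR'] by blast
  have "small_in_prob (\<lambda>n \<omega>. 1 / sqrt n * R' n \<omega>)"
    by (rule small_in_prob_scale[OF bounded_in_prob_L2[OF m(1) C'(2,3)] inv_sqrt])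
  then have small: "small_in_prob (\<lambda>n \<omega>. T n \<omega> / sqrt n - 1 * (A.S n \<omega> / sqrt n))"
    by (simp add: T add_divide_distrib)
  have "(\<lambda>n. (CLINT \<omega>|M. iexp (T n \<omega> / sqrt n)) - (CLINT \<omega>|M. iexp (1 * (A.S n \<omega> / sqrt n)))) \<longlonglongrightarrow> 0"
    by (rule char_small_perturb[OF _ small]) measurable
  from tendsto_add[OF this A.CLT[of 1]]
  show "(\<lambda>n. CLINT \<omega>|M. iexp (T n \<omega> / sqrt n)) \<longlonglongrightarrow> complex_of_real (exp (- (V / 2)))"
    by (simp add: VV)
  have "bounded_moment 2 (\<lambda>n \<omega>. A.S n \<omega> / sqrt n)"
  proof (rule bounded_momentI[where G = "\<lambda>n \<omega>. (A.S n \<omega>)\<^sup>2 / n" and C = "A.V"])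
    show "integrable M (\<lambda>\<omega>. (A.S n \<omega>)\<^sup>2 / real n)" for n using A.expectation_S2(1)[of n] by simp
    show "expectation (\<lambda>\<omega>. (A.S n \<omega>)\<^sup>2 / real n) \<le> A.V" for n using A.expectation_S2[of n] A.V_nonneg by simp
  qed (auto simp: power_divide)
  moreover have "bounded_moment 2 (\<lambda>n \<omega>. R' n \<omega> / sqrt n)"
  proof (rule bounded_momentI[where G = "\<lambda>n \<omega>. (R' n \<omega>)\<^sup>2" and C = C'])
    fix n \<omega>
    have "(R' n \<omega>)\<^sup>2 / real n \<le> (R' n \<omega>)\<^sup>2"
    proof (cases "n = 0")
      case False
      then have "(R' n \<omega>)\<^sup>2 * 1 \<le> (R' n \<omega>)\<^sup>2 * real n" by (intro mult_left_mono) auto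
      then show ?thesis using False by (simp add: pos_divide_le_eq)
    qed simp
    then show "\<bar>R' n \<omega> / sqrt n\<bar> powr 2 \<le> (R' n \<omega>)\<^sup>2" by (simp add: power_divide)
  qed (use C' in auto)
  ultimately have "bounded_moment 2 (\<lambda>n \<omega>. A.S n \<omega> / sqrt n + R' n \<omega> / sqrt n)"
    by (intro bounded_moment_add) auto
  then show "bounded_moment 2 (\<lambda>n \<omega>. T n \<omega> / sqrt n)" by (simp add: T add_divide_distrib)
qed

end

section \<open>Innovations of the Ornstein-Uhlenbeck process\<close>

context prob_space
begin

lemma char_limit:
  assumes Z: "Z \<in> borel_measurable M" and D: "small_in_prob (\<lambda>n \<omega>. X n \<omega> - Z \<omega>)"
  shows "(\<lambda>n. CLINT \<omega>|M. iexp (u * X n \<omega>)) \<longlonglongrightarrow> (CLINT \<omega>|M. iexp (u * Z \<omega>))"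
proof -
  have "small_in_prob (\<lambda>n \<omega>. u * X n \<omega> - u * Z \<omega>)"
    using small_in_prob_cmult[OF D, of u] by (simp add: right_diff_distrib)
  from char_small_perturb[OF _ this] Z
  have "(\<lambda>n. (CLINT \<omega>|M. iexp (u * X n \<omega>)) - (CLINT \<omega>|M. iexp (u * Z \<omega>))) \<longlonglongrightarrow> 0" by simp
  then show ?thesis by (simp add: LIM_zero_iff)
qed

lemma lipschitz_limit_L1:
  fixes f :: "real \<Rightarrow> real"
  assumes Z: "Z \<in> borel_measurable M" and D: "small_in_prob (\<lambda>n \<omega>. X n \<omega> - Z \<omega>)"
    and m: "\<And>n. X n \<in> borel_measurable M"
    and f[measurable]: "f \<in> borel_measurable borel" and f1: "\<And>u. \<bar>f u\<bar> \<le> 1"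
    and lip: "\<And>u v. \<bar>f u - f v\<bar> \<le> K * \<bar>u - v\<bar>"
  shows "(\<lambda>n. expectation (\<lambda>\<omega>. \<bar>f (X n \<omega>) - f (Z \<omega>)\<bar>)) \<longlonglongrightarrow> 0"
proof (rule tendsto_sandwich[OF always_eventually always_eventually tendsto_const])
  note [measurable] = m Z
  show "(\<lambda>n. expectation (\<lambda>\<omega>. min 2 \<bar>K * (X n \<omega> - Z \<omega>)\<bar>)) \<longlonglongrightarrow> 0"
    by (rule expectation_truncated_tendsto_0[OF small_in_prob_cmult[OF D], of "\<lambda>x. min 2 \<bar>x\<bar>"]) auto
  show "\<forall>n. 0 \<le> expectation (\<lambda>\<omega>. \<bar>f (X n \<omega>) - f (Z \<omega>)\<bar>)" by simp
  show "\<forall>n. expectation (\<lambda>\<omega>. \<bar>f (X n \<omega>) - f (Z \<omega>)\<bar>) \<le> expectation (\<lambda>\<omega>. min 2 \<bar>K * (X n \<omega> - Z \<omega>)\<bar>)"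
  proof (rule allI, rule integral_mono)
    fix n
    have b: "\<bar>f u - f v\<bar> \<le> 2" for u v using f1[of u] f1[of v] by linarith
    show "integrable M (\<lambda>\<omega>. \<bar>f (X n \<omega>) - f (Z \<omega>)\<bar>)"
      by (rule integrable_const_bound[of _ 2]) (use b in auto)
    show "integrable M (\<lambda>\<omega>. min 2 \<bar>K * (X n \<omega> - Z \<omega>)\<bar>)"
      by (rule integrable_const_bound[of _ 2]) auto
    fix \<omega>
    have "\<bar>f (X n \<omega>) - f (Z \<omega>)\<bar> \<le> \<bar>K * (X n \<omega> - Z \<omega>)\<bar>"
      using lip[of "X n \<omega>" "Z \<omega>"] mult_right_mono[OF abs_ge_self[of K], of "\<bar>X n \<omega> - Z \<omega>\<bar>"] by (simp add: abs_mult)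
    then show "\<bar>f (X n \<omega>) - f (Z \<omega>)\<bar> \<le> min 2 \<bar>K * (X n \<omega> - Z \<omega>)\<bar>" using b by simp
  qed
qed

text \<open>Products of factors bounded by 1 differ by at most the sum of the differences of the
  factors, and each of these tends to 0 in mean for a Lipschitz function of a sequence converging in
  probability.\<close>

lemma indep_vars_limit_product:
  fixes X :: "nat \<Rightarrow> 'i \<Rightarrow> 'a \<Rightarrow> real" and f :: "'i \<Rightarrow> real \<Rightarrow> real"
  assumes I: "finite I" and ind: "\<And>m. indep_vars (\<lambda>_. borel) (X m) I"
    and Z: "\<And>i. i \<in> I \<Longrightarrow> Z i \<in> borel_measurable M"
    and D: "\<And>i. i \<in> I \<Longrightarrow> small_in_prob (\<lambda>m \<omega>. X m i \<omega> - Z i \<omega>)"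
    and f[measurable]: "\<And>i. f i \<in> borel_measurable borel" and f1: "\<And>i u. \<bar>f i u\<bar> \<le> 1"
    and lip: "\<And>i u v. \<bar>f i u - f i v\<bar> \<le> K * \<bar>u - v\<bar>"
  shows "expectation (\<lambda>\<omega>. \<Prod>i\<in>I. f i (Z i \<omega>)) = (\<Prod>i\<in>I. expectation (\<lambda>\<omega>. f i (Z i \<omega>)))"
proof -
  have Xm: "X m i \<in> borel_measurable M" if "i \<in> I" for m i
    using ind[of m] that by (auto simp: indep_vars_def)
  have int: "integrable M (\<lambda>\<omega>. f i (V \<omega>))" if [measurable]: "V \<in> borel_measurable M" for V i
    by (rule integrable_const_bound[of _ 1]) (use f1 in auto)
  have intP: "integrable M (\<lambda>\<omega>. \<Prod>i\<in>I. f i (V i \<omega>))" if "\<And>i. i \<in> I \<Longrightarrow> V i \<in> borel_measurable M" for V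
  proof (rule integrable_const_bound[of _ 1])
    show "AE \<omega> in M. norm (\<Prod>i\<in>I. f i (V i \<omega>)) \<le> 1"
      using f1 by (intro always_eventually allI) (simp add: abs_prod prod_le_1)
    show "(\<lambda>\<omega>. \<Prod>i\<in>I. f i (V i \<omega>)) \<in> borel_measurable M"
      by (intro borel_measurable_prod measurable_compose[OF that f])
  qed
  have L1: "(\<lambda>m. expectation (\<lambda>\<omega>. \<bar>f i (X m i \<omega>) - f i (Z i \<omega>)\<bar>)) \<longlonglongrightarrow> 0" if "i \<in> I" for i
    by (rule lipschitz_limit_L1[OF Z[OF that] D[OF that] Xm[OF that] f f1 lip])
  have prod_eq: "expectation (\<lambda>\<omega>. \<Prod>i\<in>I. f i (X m i \<omega>)) = (\<Prod>i\<in>I. expectation (\<lambda>\<omega>. f i (X m i \<omega>)))" for m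
  proof (rule indep_vars_lebesgue_integral[OF I])
    show "indep_vars (\<lambda>_. borel) (\<lambda>i \<omega>. f i (X m i \<omega>)) I"
      by (rule indep_vars_compose2[OF ind]) (rule f)
  qed (use int Xm in auto)
  have "(\<lambda>m. \<Prod>i\<in>I. expectation (\<lambda>\<omega>. f i (X m i \<omega>))) \<longlonglongrightarrow> (\<Prod>i\<in>I. expectation (\<lambda>\<omega>. f i (Z i \<omega>)))"
  proof (rule tendsto_prod)
    fix i assume i: "i \<in> I"
    have "(\<lambda>m. expectation (\<lambda>\<omega>. f i (X m i \<omega>)) - expectation (\<lambda>\<omega>. f i (Z i \<omega>))) \<longlonglongrightarrow> 0"
    proof (rule Lim_null_comparison[OF always_eventually L1[OF i]], rule allI)
      fix m
      have "norm (expectation (\<lambda>\<omega>. f i (X m i \<omega>)) - expectation (\<lambda>\<omega>. f i (Z i \<omega>))) =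
        \<bar>expectation (\<lambda>\<omega>. f i (X m i \<omega>) - f i (Z i \<omega>))\<bar>"
        using int[OF Xm[OF i]] int[OF Z[OF i]] by simp
      also have "\<dots> \<le> expectation (\<lambda>\<omega>. \<bar>f i (X m i \<omega>) - f i (Z i \<omega>)\<bar>)" by (rule integral_abs_bound)
      finally show "norm (expectation (\<lambda>\<omega>. f i (X m i \<omega>)) - expectation (\<lambda>\<omega>. f i (Z i \<omega>))) \<le> expectation (\<lambda>\<omega>. \<bar>f i (X m i \<omega>) - f i (Z i \<omega>)\<bar>)" .
    qed
    then show "(\<lambda>m. expectation (\<lambda>\<omega>. f i (X m i \<omega>))) \<longlonglongrightarrow> expectation (\<lambda>\<omega>. f i (Z i \<omega>))"
      by (simp add: LIM_zero_iff)
  qed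
  moreover have "(\<lambda>m. expectation (\<lambda>\<omega>. \<Prod>i\<in>I. f i (X m i \<omega>))) \<longlonglongrightarrow> expectation (\<lambda>\<omega>. \<Prod>i\<in>I. f i (Z i \<omega>))"
  proof -
    have "(\<lambda>m. expectation (\<lambda>\<omega>. \<Prod>i\<in>I. f i (X m i \<omega>)) - expectation (\<lambda>\<omega>. \<Prod>i\<in>I. f i (Z i \<omega>))) \<longlonglongrightarrow> 0"
    proof (rule Lim_null_comparison[OF always_eventually], rule allI)
      show "(\<lambda>m. \<Sum>i\<in>I. expectation (\<lambda>\<omega>. \<bar>f i (X m i \<omega>) - f i (Z i \<omega>)\<bar>)) \<longlonglongrightarrow> 0"
        using tendsto_sum[OF L1, of I] by simp
      fix m
      have iabs: "integrable M (\<lambda>\<omega>. \<bar>f i (X m i \<omega>) - f i (Z i \<omega>)\<bar>)" if "i \<in> I" for i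
        using int[OF Xm[OF that]] int[OF Z[OF that]] by (intro integrable_abs Bochner_Integration.integrable_diff)
      have "norm (expectation (\<lambda>\<omega>. \<Prod>i\<in>I. f i (X m i \<omega>)) - expectation (\<lambda>\<omega>. \<Prod>i\<in>I. f i (Z i \<omega>))) =
        \<bar>expectation (\<lambda>\<omega>. (\<Prod>i\<in>I. f i (X m i \<omega>)) - (\<Prod>i\<in>I. f i (Z i \<omega>)))\<bar>"
        using intP[of "X m", OF Xm] intP[of Z, OF Z] by simp
      also have "\<dots> \<le> expectation (\<lambda>\<omega>. \<bar>(\<Prod>i\<in>I. f i (X m i \<omega>)) - (\<Prod>i\<in>I. f i (Z i \<omega>))\<bar>)" by (rule integral_abs_bound)
      also have "\<dots> \<le> expectation (\<lambda>\<omega>. \<Sum>i\<in>I. \<bar>f i (X m i \<omega>) - f i (Z i \<omega>)\<bar>)"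
      proof (rule integral_mono)
        show "integrable M (\<lambda>\<omega>. \<bar>(\<Prod>i\<in>I. f i (X m i \<omega>)) - (\<Prod>i\<in>I. f i (Z i \<omega>))\<bar>)"
          using intP[of "X m", OF Xm] intP[of Z, OF Z] by (intro integrable_abs Bochner_Integration.integrable_diff)
        show "integrable M (\<lambda>\<omega>. \<Sum>i\<in>I. \<bar>f i (X m i \<omega>) - f i (Z i \<omega>)\<bar>)"
          by (intro Bochner_Integration.integrable_sum iabs)
        show "\<bar>(\<Prod>i\<in>I. f i (X m i \<omega>)) - (\<Prod>i\<in>I. f i (Z i \<omega>))\<bar> \<le> (\<Sum>i\<in>I. \<bar>f i (X m i \<omega>) - f i (Z i \<omega>)\<bar>)" for \<omega>
          using norm_prod_diff[of I "\<lambda>i. f i (X m i \<omega>)" "\<lambda>i. f i (Z i \<omega>)"] f1 by simp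
      qed
      also have "\<dots> = (\<Sum>i\<in>I. expectation (\<lambda>\<omega>. \<bar>f i (X m i \<omega>) - f i (Z i \<omega>)\<bar>))"
        by (rule Bochner_Integration.integral_sum) (rule iabs)
      finally show "norm (expectation (\<lambda>\<omega>. \<Prod>i\<in>I. f i (X m i \<omega>)) - expectation (\<lambda>\<omega>. \<Prod>i\<in>I. f i (Z i \<omega>))) \<le>
        (\<Sum>i\<in>I. expectation (\<lambda>\<omega>. \<bar>f i (X m i \<omega>) - f i (Z i \<omega>)\<bar>))" .
    qed
    then show ?thesis by (simp add: LIM_zero_iff)
  qed
  ultimately show ?thesis unfolding prod_eq using LIMSEQ_unique by blast
qed

text \<open>Indicators do not commute with limits in probability, so half-lines are first replaced
  by Lipschitz ramps. Once the limit variables satisfy the product formula for ramps, dominated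
  convergence gives it for half-lines.\<close>

lemma indep_vars_limit:
  fixes X :: "nat \<Rightarrow> 'i \<Rightarrow> 'a \<Rightarrow> real"
  assumes I: "finite I" "I \<noteq> {}" and ind: "\<And>m. indep_vars (\<lambda>_. borel) (X m) I"
    and Z: "\<And>i. i \<in> I \<Longrightarrow> Z i \<in> borel_measurable M"
    and D: "\<And>i. i \<in> I \<Longrightarrow> small_in_prob (\<lambda>m \<omega>. X m i \<omega> - Z i \<omega>)"
  shows "indep_vars (\<lambda>_. borel) Z I"
proof -
  \<comment> \<open>The whole line is added to the half-lines because the generator in
    \<open>indep_vars_finite\<close> has to contain the whole space.\<close>
  define E :: "real set set" where "E = insert UNIV (range atMost)"
  have gen: "sets borel = sigma_sets (space borel) E"
  proof -
    have "sets (borel :: real measure) = sigma_sets UNIV (range atMost)"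
      by (simp add: borel_eq_atMost)
    also have "\<dots> = sigma_sets UNIV E"
      unfolding E_def
    proof (rule sigma_sets_eqI)
      show "\<And>a. a \<in> insert UNIV (range atMost) \<Longrightarrow> a \<in> sigma_sets UNIV (range atMost :: real set set)"
        by (auto intro: sigma_sets_top)
    qed auto
    finally show ?thesis by simp
  qed
  have stable: "Int_stable E"
    by (auto simp: Int_stable_def E_def intro: Int_atMost[symmetric] image_eqI)
  show ?thesis
  proof (subst indep_vars_finite[OF I(2,1), where E = "\<lambda>_. E"])
    show "\<forall>A\<in>I \<rightarrow> E. prob (\<Inter>j\<in>I. Z j -` A j \<inter> space M) = (\<Prod>j\<in>I. prob (Z j -` A j \<inter> space M))"
    proof
      fix A assume A: "A \<in> I \<rightarrow> E"
      \<comment> \<open>Equal to 1 up to the end point of the half-line and falling to 0 within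
        distance \<open>1 / r\<close>. The whole line is treated apart since its supremum is
        meaningless.\<close>
      define f where "f r j u = (if A j = UNIV then 1 else max 0 (1 - real r * max 0 (u - Sup (A j))))" for r :: nat and j and u :: real
      have fm[measurable]: "f r j \<in> borel_measurable borel" for r j unfolding f_def by measurable
      have f1: "\<bar>f r j u\<bar> \<le> 1" for r j u by (auto simp: f_def)
      have lip: "\<bar>f r j u - f r j v\<bar> \<le> real r * \<bar>u - v\<bar>" for r j u v
      proof -
        have "\<bar>f r j u - f r j v\<bar> \<le> \<bar>real r * max 0 (u - Sup (A j)) - real r * max 0 (v - Sup (A j))\<bar>"
          by (auto simp: f_def max_def)
        also have "\<dots> = real r * \<bar>max 0 (u - Sup (A j)) - max 0 (v - Sup (A j))\<bar>"
          by (simp add: abs_mult flip: right_diff_distrib)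
        also have "\<dots> \<le> real r * \<bar>u - v\<bar>" by (intro mult_left_mono) (auto simp: max_def)
        finally show ?thesis .
      qed
      have flim: "(\<lambda>r. f r j u) \<longlonglongrightarrow> indicator (A j) u" if "j \<in> I" for j u
      proof (cases "A j = UNIV")
        case True
        then show ?thesis by (simp add: f_def)
      next
        case False
        moreover have "A j \<in> E" using A that by auto
        ultimately obtain s where s: "A j = {..s}" by (auto simp: E_def)
        then have S: "Sup (A j) = s" by simp
        show ?thesis
        proof (cases "u \<le> s")
          case True
          then show ?thesis using False by (simp add: f_def S s)
        next
          case F: False
          obtain N where N: "1 < real N * (u - s)" using F reals_Archimedean3[of "u - s"] by auto
          have "\<forall>\<^sub>F r in sequentially. f r j u = 0"
            using eventually_ge_at_top[of N]
          proof eventually_elim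
            case (elim r)
            have "real N * (u - s) \<le> real r * (u - s)" using elim F by (intro mult_right_mono) auto
            then have "1 - real r * (u - s) \<le> 0" using N by linarith
            then show ?case using F False by (simp add: f_def S max_absorb1)
          qed
          then show ?thesis using F s by (simp add: tendsto_eventually)
        qed
      qed
      have eq: "expectation (\<lambda>\<omega>. \<Prod>i\<in>I. f r i (Z i \<omega>)) = (\<Prod>i\<in>I. expectation (\<lambda>\<omega>. f r i (Z i \<omega>)))" for r
        by (rule indep_vars_limit_product[OF I(1) ind Z D fm f1 lip])
      have Aset: "A j \<in> sets borel" if "j \<in> I" for j
      proof -
        have "A j \<in> E" using A that by auto
        then show ?thesis by (auto simp: E_def)
      qed
      have l: "(\<lambda>r. expectation (\<lambda>\<omega>. \<Prod>i\<in>I. f r i (Z i \<omega>))) \<longlonglongrightarrow> expectation (\<lambda>\<omega>. \<Prod>i\<in>I. indicator (A i) (Z i \<omega>))"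
      proof (rule integral_dominated_convergence[where w = "\<lambda>_. 1"])
        show "(\<lambda>\<omega>. \<Prod>i\<in>I. indicator (A i) (Z i \<omega>) :: real) \<in> borel_measurable M"
        proof (rule borel_measurable_prod)
          fix i assume i: "i \<in> I"
          show "(\<lambda>\<omega>. indicator (A i) (Z i \<omega>) :: real) \<in> borel_measurable M"
            by (rule measurable_compose[OF Z[OF i] borel_measurable_indicator[OF Aset[OF i]]])
        qed
        show "(\<lambda>\<omega>. \<Prod>i\<in>I. f r i (Z i \<omega>)) \<in> borel_measurable M" for r
          by (intro borel_measurable_prod measurable_compose[OF Z fm])
        show "AE \<omega> in M. (\<lambda>r. \<Prod>i\<in>I. f r i (Z i \<omega>)) \<longlonglongrightarrow> (\<Prod>i\<in>I. indicator (A i) (Z i \<omega>))"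
          by (intro always_eventually allI tendsto_prod flim)
        show "AE \<omega> in M. norm (\<Prod>i\<in>I. f r i (Z i \<omega>)) \<le> 1" for r
          using f1 by (intro always_eventually allI) (simp add: abs_prod prod_le_1)
      qed simp
      have r: "(\<lambda>r. \<Prod>i\<in>I. expectation (\<lambda>\<omega>. f r i (Z i \<omega>))) \<longlonglongrightarrow> (\<Prod>i\<in>I. expectation (\<lambda>\<omega>. indicator (A i) (Z i \<omega>)))"
      proof (rule tendsto_prod)
        fix i assume i: "i \<in> I"
        show "(\<lambda>r. expectation (\<lambda>\<omega>. f r i (Z i \<omega>))) \<longlonglongrightarrow> expectation (\<lambda>\<omega>. indicator (A i) (Z i \<omega>))"
        proof (rule integral_dominated_convergence[where w = "\<lambda>_. 1"])
          show "(\<lambda>\<omega>. indicator (A i) (Z i \<omega>) :: real) \<in> borel_measurable M"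
            by (rule measurable_compose[OF Z[OF i] borel_measurable_indicator[OF Aset[OF i]]])
          show "(\<lambda>\<omega>. f r i (Z i \<omega>)) \<in> borel_measurable M" for r
            by (intro measurable_compose[OF Z fm] i)
        qed (use f1 flim[OF i] in auto)
      qed
      have ind_eq: "expectation (\<lambda>\<omega>. indicator (A i) (Z i \<omega>) :: real) = prob (Z i -` A i \<inter> space M)" if "i \<in> I" for i
      proof -
        have "Z i -` A i \<inter> space M \<in> events" using Z[OF that] Aset[OF that] by (rule measurable_sets)
        moreover have "expectation (\<lambda>\<omega>. indicator (A i) (Z i \<omega>) :: real) = expectation (indicator (Z i -` A i \<inter> space M))"
          by (rule Bochner_Integration.integral_cong[OF refl]) (auto simp: indicator_def)
        ultimately show ?thesis by simp
      qed
      have Int_eq: "expectation (\<lambda>\<omega>. \<Prod>i\<in>I. indicator (A i) (Z i \<omega>) :: real) = prob (\<Inter>j\<in>I. Z j -` A j \<inter> space M)"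
      proof -
        have "(\<Inter>j\<in>I. Z j -` A j \<inter> space M) \<in> events"
          using I measurable_sets[OF Z Aset] by (intro sets.finite_INT) auto
        moreover have "expectation (\<lambda>\<omega>. \<Prod>i\<in>I. indicator (A i) (Z i \<omega>) :: real) = expectation (indicator (\<Inter>j\<in>I. Z j -` A j \<inter> space M))"
        proof (rule Bochner_Integration.integral_cong[OF refl])
          fix \<omega> assume "\<omega> \<in> space M"
          show "(\<Prod>i\<in>I. indicator (A i) (Z i \<omega>)) = (indicator (\<Inter>j\<in>I. Z j -` A j \<inter> space M) \<omega> :: real)"
          proof (cases "\<forall>i\<in>I. Z i \<omega> \<in> A i")
            case True
            then show ?thesis using \<open>\<omega> \<in> space M\<close> by (simp add: indicator_def)
          next
            case False
            then obtain i where "i \<in> I" "Z i \<omega> \<notin> A i" by auto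
            then show ?thesis using I(1) by (auto simp: indicator_def intro!: prod_zero bexI[of _ i])
          qed
        qed
        ultimately show ?thesis by simp
      qed
      have "expectation (\<lambda>\<omega>. \<Prod>i\<in>I. indicator (A i) (Z i \<omega>)) = (\<Prod>i\<in>I. expectation (\<lambda>\<omega>. indicator (A i) (Z i \<omega>) :: real))"
        using l r unfolding eq by (rule LIMSEQ_unique)
      then show "prob (\<Inter>j\<in>I. Z j -` A j \<inter> space M) = (\<Prod>j\<in>I. prob (Z j -` A j \<inter> space M))"
        unfolding Int_eq using ind_eq by simp
    qed
  qed (use gen stable Z in \<open>auto simp: E_def\<close>)
qed

text \<open>Brings the hypothesis on \<open>Y 0\<close>, which is independent of the sigma-algebra
  of the whole path of \<open>L\<close>, into one independent family with the increments.\<close>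

lemma indep_vars_prepend:
  fixes X :: "nat \<Rightarrow> 'a \<Rightarrow> real"
  assumes ind: "indep_vars (\<lambda>_. borel) X {..<K}" and Z: "Z \<in> borel_measurable M"
    and sub: "\<And>i. i < K \<Longrightarrow> X i \<in> borel_measurable H" and H: "space H = space M"
    and indep: "indep_set (sets (vimage_algebra (space M) Z borel)) (sets H)"
  shows "indep_vars (\<lambda>_. borel) (case_nat Z X) {..K}"
  unfolding indep_vars_def2
proof
  have Xm: "X i \<in> borel_measurable M" if "i < K" for i using ind that by (auto simp: indep_vars_def)
  show "\<forall>i\<in>{..K}. case_nat Z X i \<in> borel_measurable M"
    using Z Xm by (auto split: nat.split)
  let ?F = "\<lambda>i. {case_nat Z X i -` A \<inter> space M |A. A \<in> sets borel}"
  show "indep_sets ?F {..K}"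
  proof (rule indep_setsI)
    fix i assume "i \<in> {..K}"
    then show "?F i \<subseteq> events" using Z Xm by (auto split: nat.splits intro!: measurable_sets[of _ M borel])
  next
    fix A J assume J: "J \<noteq> {}" "J \<subseteq> {..K}" "finite J" and A: "\<forall>j\<in>J. A j \<in> ?F j"
    \<comment> \<open>The indices of \<open>J\<close> that refer to \<open>X\<close>, undoing the
      shift of \<open>case_nat\<close>; index 0 stands for \<open>Z\<close>.\<close>
    define J' where "J' = {i. Suc i \<in> J}"
    have J': "J' \<subseteq> {..<K}" "finite J'" using J finite_vimageI[of J Suc] by (auto simp: J'_def vimage_def)
    have AX: "A (Suc i) \<in> {X i -` B \<inter> space M |B. B \<in> sets borel}" if "i \<in> J'" for i
      using A that by (force simp: J'_def)
    have prodX: "prob (\<Inter>i\<in>J'. A (Suc i)) = (\<Prod>i\<in>J'. prob (A (Suc i)))" if "J' \<noteq> {}"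
    proof -
      have "indep_sets (\<lambda>i. {X i -` A \<inter> space M |A. A \<in> sets borel}) {..<K}"
        using ind unfolding indep_vars_def2 by simp
      then show ?thesis by (rule indep_setsD) (use J' that AX in auto)
    qed
    have J_eq: "J = (if 0 \<in> J then {0} else {}) \<union> Suc ` J'"
    proof -
      have "j \<in> Suc ` J'" if "j \<in> J" "j \<noteq> 0" for j
        using that by (cases j) (auto simp: J'_def)
      then show ?thesis by (auto simp: J'_def)
    qed
    have prodJ: "(\<Prod>j\<in>Suc ` J'. prob (A j)) = (\<Prod>i\<in>J'. prob (A (Suc i)))"
      by (simp add: prod.reindex)
    show "prob (\<Inter>j\<in>J. A j) = (\<Prod>j\<in>J. prob (A j))"
    proof (cases "0 \<in> J")
      case False
      then have J1: "J = Suc ` J'" using J_eq by simp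
      then have "J' \<noteq> {}" using J by auto
      then show ?thesis using prodX prodJ by (subst (1 2) J1) (simp add: image_comp)
    next
      case True
      then have J1: "J = insert 0 (Suc ` J')" using J_eq by simp
      have A0: "A 0 \<in> sets (vimage_algebra (space M) Z borel)"
        using A True by (force simp: sets_vimage_algebra)
      have pr: "(\<Prod>j\<in>J. prob (A j)) = prob (A 0) * (\<Prod>i\<in>J'. prob (A (Suc i)))"
        using J' by (subst J1) (simp add: prodJ)
      show ?thesis
      proof (cases "J' = {}")
        case True
        then show ?thesis using J1 by simp
      next
        case False
        have "(\<Inter>i\<in>J'. A (Suc i)) \<in> sets H"
        proof (rule sets.finite_INT[OF J'(2) False])
          fix i assume i: "i \<in> J'"
          then obtain B where B: "B \<in> sets borel" "A (Suc i) = X i -` B \<inter> space M" using AX[OF i] by auto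
          have "X i -` B \<inter> space H \<in> sets H"
            using J' i by (intro measurable_sets[OF sub B(1)]) auto
          then show "A (Suc i) \<in> sets H" using B H by simp
        qed
        then have "prob (A 0 \<inter> (\<Inter>i\<in>J'. A (Suc i))) = prob (A 0) * prob (\<Inter>i\<in>J'. A (Suc i))"
          using indep A0 unfolding indep_sets2_eq by blast
        moreover have "(\<Inter>j\<in>J. A j) = A 0 \<inter> (\<Inter>i\<in>J'. A (Suc i))" by (subst J1) auto
        ultimately show ?thesis using pr prodX[OF False] by simp
      qed
    qed
  qed
qed

end

section \<open>Second-order behaviour of characteristic functions at 0\<close>

lemma exp_difference_quotient: "((\<lambda>z::complex. (exp z - 1) / z) \<longlongrightarrow> 1) (at 0)"
  using DERIV_exp[of "0::complex"] by (simp add: has_field_derivative_iff)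

text \<open>Takes a logarithm without choosing a branch: \<open>z\<close> is given and tends to 0,
  where \<open>exp w - 1\<close> and \<open>w\<close> are equivalent.\<close>

lemma log_quotient_limit:
  fixes z :: "real \<Rightarrow> complex"
  assumes z: "(z \<longlongrightarrow> 0) (at 0)" and L: "((\<lambda>u. (exp (z u) - 1) / complex_of_real (u\<^sup>2)) \<longlongrightarrow> L) (at 0)"
  shows "((\<lambda>u. z u / complex_of_real (u\<^sup>2)) \<longlongrightarrow> L) (at 0)"
proof -
  define h where "h w = (if w = 0 then 1 else (exp w - 1) / w)" for w :: complex
  have "isCont h 0"
    unfolding isCont_def
  proof (rule Lim_transform_eventually)
    show "((\<lambda>z. (exp z - 1) / z) \<longlongrightarrow> h 0) (at 0)" using exp_difference_quotient by (simp add: h_def)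
    show "\<forall>\<^sub>F w in at 0. (exp w - 1) / w = h w"
      by (auto simp: h_def eventually_at_filter)
  qed
  then have h: "((\<lambda>u. h (z u)) \<longlongrightarrow> h 0) (at 0)" by (rule isCont_tendsto_compose[OF _ z])
  have h0: "h 0 = 1" by (simp add: h_def)
  have "((\<lambda>u. (exp (z u) - 1) / complex_of_real (u\<^sup>2) / h (z u)) \<longlongrightarrow> L / h 0) (at 0)"
    by (intro tendsto_divide L h) (simp add: h0)
  then have lim: "((\<lambda>u. (exp (z u) - 1) / complex_of_real (u\<^sup>2) / h (z u)) \<longlongrightarrow> L) (at 0)"
    unfolding h0 div_by_1 .
  have "\<forall>\<^sub>F u in at 0. h (z u) \<noteq> 0"
    by (rule tendsto_imp_eventually_ne[OF h]) (simp add: h0)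
  then have "\<forall>\<^sub>F u in at 0. (exp (z u) - 1) / complex_of_real (u\<^sup>2) / h (z u) = z u / complex_of_real (u\<^sup>2)"
    by eventually_elim (auto simp: h_def)
  from Lim_transform_eventually[OF lim this] show ?thesis .
qed

context prob_space
begin

text \<open>Only second moments are available, so the Taylor remainder is a minimum of a quadratic
  and a cubic term; it tends to 0 by domination with the quadratic one.\<close>

lemma char_quotient_centred:
  assumes X[measurable]: "X \<in> borel_measurable M" and i: "integrable M (\<lambda>\<omega>. (X \<omega>)\<^sup>2)" and m: "expectation X = 0"
  shows "((\<lambda>u. ((CLINT \<omega>|M. iexp (u * X \<omega>)) - 1) / complex_of_real (u\<^sup>2)) \<longlongrightarrow>
     complex_of_real (- (expectation (\<lambda>\<omega>. (X \<omega>)\<^sup>2) / 2))) (at 0)"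
proof -
  have iX: "integrable M X" by (rule square_integrable_imp_integrable[OF X i])
  define E where "E = expectation (\<lambda>\<omega>. (X \<omega>)\<^sup>2)"
  define g where "g t = expectation (\<lambda>x. min (6 * (X x)\<^sup>2) (\<bar>t\<bar> * \<bar>X x\<bar>^3))" for t
  have var: "variance X = E" by (simp add: m E_def)
  have ch: "char (distr M borel X) u = (CLINT \<omega>|M. iexp (u * X \<omega>))" for u
    unfolding char_def by (rule integral_distr) measurable
  have le: "norm ((CLINT \<omega>|M. iexp (u * X \<omega>)) - (1 - u\<^sup>2 * E / 2)) \<le> u\<^sup>2 / 6 * g u" for u
    using char_approx3'[OF X iX i m var refl, of u] by (simp add: ch g_def)
  have g0: "(g \<longlongrightarrow> 0) (at 0)"
    unfolding tendsto_at_iff_sequentially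
  proof (intro allI impI)
    fix t :: "nat \<Rightarrow> real" assume t: "t \<longlonglongrightarrow> 0"
    have "(\<lambda>n. expectation (\<lambda>x. min (6 * (X x)\<^sup>2) (\<bar>t n\<bar> * \<bar>X x\<bar>^3))) \<longlonglongrightarrow> expectation (\<lambda>x. 0)"
    proof (rule integral_dominated_convergence[where w = "\<lambda>x. 6 * (X x)\<^sup>2"])
      show "AE x in M. (\<lambda>n. min (6 * (X x)\<^sup>2) (\<bar>t n\<bar> * \<bar>X x\<bar>^3)) \<longlonglongrightarrow> 0"
      proof (rule AE_I2)
        fix x
        have "(\<lambda>n. min (6 * (X x)\<^sup>2) (\<bar>t n\<bar> * \<bar>X x\<bar>^3)) \<longlonglongrightarrow> min (6 * (X x)\<^sup>2) (\<bar>0\<bar> * \<bar>X x\<bar>^3)"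
          by (intro tendsto_intros t)
        then show "(\<lambda>n. min (6 * (X x)\<^sup>2) (\<bar>t n\<bar> * \<bar>X x\<bar>^3)) \<longlonglongrightarrow> 0" by simp
      qed
    qed (use i in auto)
    then show "(g \<circ> t) \<longlonglongrightarrow> 0" by (simp add: g_def comp_def)
  qed
  have "((\<lambda>u. ((CLINT \<omega>|M. iexp (u * X \<omega>)) - 1) / complex_of_real (u\<^sup>2) - complex_of_real (- (E / 2))) \<longlongrightarrow> 0) (at 0)"
  proof (rule Lim_null_comparison)
    show "((\<lambda>u. g u / 6) \<longlongrightarrow> 0) (at 0)" using tendsto_divide[OF g0 tendsto_const, of 6] by simp
    show "\<forall>\<^sub>F u in at 0. norm (((CLINT \<omega>|M. iexp (u * X \<omega>)) - 1) / complex_of_real (u\<^sup>2) - complex_of_real (- (E / 2))) \<le> g u / 6"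
      unfolding eventually_at_filter
    proof (rule always_eventually, intro allI impI)
      fix u :: real assume u: "u \<noteq> 0"
      have "((CLINT \<omega>|M. iexp (u * X \<omega>)) - 1) / complex_of_real (u\<^sup>2) - complex_of_real (- (E / 2)) =
         ((CLINT \<omega>|M. iexp (u * X \<omega>)) - (1 - u\<^sup>2 * E / 2)) / complex_of_real (u\<^sup>2)"
        using u by (simp add: field_simps)
      also have "norm \<dots> = norm ((CLINT \<omega>|M. iexp (u * X \<omega>)) - (1 - u\<^sup>2 * E / 2)) / u\<^sup>2"
        by (simp add: norm_divide norm_power)
      also have "\<dots> \<le> (u\<^sup>2 / 6 * g u) / u\<^sup>2" by (intro divide_right_mono le) auto
      also have "\<dots> = g u / 6" using u by simp
      finally show "norm (((CLINT \<omega>|M. iexp (u * X \<omega>)) - 1) / complex_of_real (u\<^sup>2) - complex_of_real (- (E / 2))) \<le> g u / 6" .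
    qed
  qed
  then show ?thesis unfolding E_def by (rule LIM_zero_cancel)
qed

text \<open>The imaginary part of the characteristic function divided by \<open>u\<close> tends to
  the mean, while a finite limit after division by \<open>u\<^sup>2\<close> forces it to tend to
  0.\<close>

lemma mean_zero_from_char:
  assumes X[measurable]: "X \<in> borel_measurable M" and i: "integrable M (\<lambda>\<omega>. (X \<omega>)\<^sup>2)"
    and L: "((\<lambda>u. ((CLINT \<omega>|M. iexp (u * X \<omega>)) - 1) / complex_of_real (u\<^sup>2)) \<longlongrightarrow> L) (at 0)"
  shows "expectation X = 0"
proof -
  have iX: "integrable M X" by (rule square_integrable_imp_integrable[OF X i])
  have sin_lim: "((\<lambda>u. expectation (\<lambda>\<omega>. sin (u * X \<omega>) / u)) \<longlongrightarrow> expectation X) (at 0)"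
    unfolding tendsto_at_iff_sequentially
  proof (intro allI impI)
    fix t :: "nat \<Rightarrow> real" assume tn: "\<forall>i. t i \<in> UNIV - {0}" and t: "t \<longlonglongrightarrow> 0"
    have "(\<lambda>n. expectation (\<lambda>\<omega>. sin (t n * X \<omega>) / t n)) \<longlonglongrightarrow> expectation X"
    proof (rule integral_dominated_convergence[where w = "\<lambda>x. \<bar>X x\<bar>"])
      show "AE x in M. (\<lambda>n. sin (t n * X x) / t n) \<longlonglongrightarrow> X x"
      proof (rule AE_I2)
        fix x
        have "((\<lambda>u. sin (u * X x)) has_real_derivative X x) (at 0)"
          by (auto intro!: derivative_eq_intros)
        then have "((\<lambda>u. sin (u * X x) / u) \<longlongrightarrow> X x) (at 0)" by (simp add: has_field_derivative_iff)
        then show "(\<lambda>n. sin (t n * X x) / t n) \<longlonglongrightarrow> X x"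
          using tn t unfolding tendsto_at_iff_sequentially comp_def by blast
      qed
      show "AE x in M. norm (sin (t n * X x) / t n) \<le> \<bar>X x\<bar>" for n
      proof (rule AE_I2)
        fix x
        have "\<bar>sin (t n * X x)\<bar> \<le> \<bar>t n * X x\<bar>" by (rule abs_sin_x_le_abs_x)
        then show "norm (sin (t n * X x) / t n) \<le> \<bar>X x\<bar>"
          using tn by (auto simp: abs_mult abs_divide divide_le_eq mult.commute)
      qed
    qed (use iX in auto)
    then show "((\<lambda>u. expectation (\<lambda>\<omega>. sin (u * X \<omega>) / u)) \<circ> t) \<longlonglongrightarrow> expectation X" by (simp add: comp_def)
  qed
  have "((\<lambda>u. u * Im (((CLINT \<omega>|M. iexp (u * X \<omega>)) - 1) / complex_of_real (u\<^sup>2))) \<longlongrightarrow> 0 * Im L) (at 0)"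
    by (intro tendsto_mult tendsto_Im L) (rule tendsto_ident_at)
  moreover have "u * Im (((CLINT \<omega>|M. iexp (u * X \<omega>)) - 1) / complex_of_real (u\<^sup>2)) = expectation (\<lambda>\<omega>. sin (u * X \<omega>) / u)" for u
  proof -
    have "integrable M (\<lambda>\<omega>. iexp (u * X \<omega>))" by (rule integrable_const_bound[of _ 1]) auto
    then have "Im (CLINT \<omega>|M. iexp (u * X \<omega>)) = expectation (\<lambda>\<omega>. sin (u * X \<omega>))"
      by (simp add: integral_Im[symmetric] Im_exp del: integral_Im)
    then have "Im (((CLINT \<omega>|M. iexp (u * X \<omega>)) - 1) / complex_of_real (u\<^sup>2)) = expectation (\<lambda>\<omega>. sin (u * X \<omega>)) / u\<^sup>2"
      by (simp only: Im_divide_of_real minus_complex.sel one_complex.sel diff_0_right)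
    then show ?thesis by (auto simp: power2_eq_square)
  qed
  ultimately have "((\<lambda>u. expectation (\<lambda>\<omega>. sin (u * X \<omega>) / u)) \<longlongrightarrow> 0) (at 0)" by simp
  from tendsto_unique[OF _ sin_lim this] show ?thesis by simp
qed

end

lemma levy_exponent_tendsto_0:
  assumes F: "sets F = sets borel" "integrable F (\<lambda>x. min 1 (x\<^sup>2))"
  shows "(levy_exponent b c F \<longlongrightarrow> 0) (at 0)"
proof -
  define k where "k u x = iexp (u * x) - 1 - \<i> * complex_of_real (u * x * indicator {-1..1} x)" for u x :: real
  have km: "k u \<in> borel_measurable F" for u
  proof -
    have "k u \<in> borel_measurable borel" unfolding k_def by measurable
    then show ?thesis using F(1) measurable_cong_sets by blast
  qed
  \<comment> \<open>Small jumps are bounded by the second-order Taylor remainder, large ones by the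
    trivial bound 2; together this is integrable against a Levy measure.\<close>
  have kle: "norm (k u x) \<le> 2 * min 1 (x\<^sup>2)" if "\<bar>u\<bar> \<le> 1" for u x
  proof (cases "\<bar>x\<bar> \<le> 1")
    case True
    then have x: "x \<in> {-1..1}" by auto
    have ux: "(u * x)\<^sup>2 \<le> x\<^sup>2"
    proof -
      have "u\<^sup>2 \<le> 1" using that by (simp add: abs_square_le_1)
      then have "u\<^sup>2 * x\<^sup>2 \<le> 1 * x\<^sup>2" by (intro mult_right_mono) auto
      then show ?thesis by (simp add: power_mult_distrib)
    qed
    have "x\<^sup>2 \<le> 1" using True by (simp add: abs_square_le_1)
    have "norm (iexp (u * x) - (\<Sum>k\<le>1. (\<i> * complex_of_real (u * x)) ^ k / fact k)) \<le> \<bar>u * x\<bar> ^ Suc 1 / fact (Suc 1)"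
      by (rule iexp_approx1)
    moreover have "k u x = iexp (u * x) - (\<Sum>k\<le>1. (\<i> * complex_of_real (u * x)) ^ k / fact k)"
      using x by (simp add: k_def)
    moreover have "\<bar>u * x\<bar> ^ Suc 1 / fact (Suc 1) = (u * x)\<^sup>2 / 2"
      by (simp only: power2_abs[of "u * x", symmetric]) (simp add: power2_eq_square)
    ultimately have "norm (k u x) \<le> (u * x)\<^sup>2 / 2" by simp
    also have "\<dots> \<le> x\<^sup>2" using ux zero_le_power2[of x] by linarith
    finally have "norm (k u x) \<le> x\<^sup>2" .
    moreover have "min 1 (x\<^sup>2) = x\<^sup>2" using \<open>x\<^sup>2 \<le> 1\<close> by simp
    ultimately show ?thesis using zero_le_power2[of x] by linarith
  next
    case False
    then have "1 \<le> x\<^sup>2" by (simp add: abs_square_le_1 not_le[symmetric] abs_square_less_1 less_imp_le)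
    moreover have "norm (k u x) \<le> 2"
      using False norm_triangle_ineq4[of "iexp (u * x)" 1] by (auto simp: k_def indicator_def abs_le_iff)
    ultimately show ?thesis by (simp add: min_def)
  qed
  have "((\<lambda>u. CLINT x|F. k u x) \<longlongrightarrow> 0) (at 0)"
    unfolding tendsto_at_iff_sequentially
  proof (intro allI impI)
    fix t :: "nat \<Rightarrow> real" assume t: "t \<longlonglongrightarrow> 0"
    \<comment> \<open>The dominating function is valid only for arguments of size at most 1, hence
      the initial part of the sequence is skipped.\<close>
    obtain N where N: "\<And>n. n \<ge> N \<Longrightarrow> \<bar>t n\<bar> \<le> 1" using LIMSEQ_D[OF t, of 1] by fastforce
    have "(\<lambda>n. CLINT x|F. k (t (n + N)) x) \<longlonglongrightarrow> (CLINT x|F. 0)"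
    proof (rule integral_dominated_convergence[where w = "\<lambda>x. 2 * min 1 (x\<^sup>2)"])
      show "AE x in F. (\<lambda>n. k (t (n + N)) x) \<longlonglongrightarrow> 0"
      proof (rule AE_I2)
        fix x
        have "isCont (\<lambda>u. k u x) 0" unfolding k_def by (intro continuous_intros)
        from isCont_tendsto_compose[OF this LIMSEQ_ignore_initial_segment[OF t, of N]]
        show "(\<lambda>n. k (t (n + N)) x) \<longlonglongrightarrow> 0" by (simp add: k_def)
      qed
      show "AE x in F. norm (k (t (n + N)) x) \<le> 2 * min 1 (x\<^sup>2)" for n
        using kle N by simp
    qed (use km F in auto)
    then show "((\<lambda>u. CLINT x|F. k u x) \<circ> t) \<longlonglongrightarrow> 0"
      by (simp add: comp_def LIMSEQ_offset[of "\<lambda>n. CLINT x|F. k (t n) x" N])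
  qed
  moreover have "((\<lambda>u. \<i> * complex_of_real (b * u) - complex_of_real (c * u\<^sup>2 / 2)) \<longlongrightarrow> \<i> * complex_of_real (b * 0) - complex_of_real (c * 0\<^sup>2 / 2)) (at 0)"
    by (intro tendsto_intros) simp
  ultimately have "((\<lambda>u. \<i> * complex_of_real (b * u) - complex_of_real (c * u\<^sup>2 / 2) + (CLINT x|F. k u x)) \<longlongrightarrow> 0 + 0) (at 0)"
    by (intro tendsto_add) simp_all
  then show ?thesis by (simp add: levy_exponent_def[abs_def] k_def)
qed

lemma levy_exponent_0: "levy_exponent b c F 0 = 0"
  by (simp add: levy_exponent_def)

text \<open>The exponential of the exponent is the characteristic function of \<open>L 1\<close>, so
  the moments of \<open>L 1\<close> determine it up to second order. Continuity at 0 from the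
  Levy-Khintchine form selects the right branch of the logarithm.\<close>

lemma levy_exponent_expansion:
  assumes "prob_space M" and L1: "L 1 \<in> borel_measurable M" and trip: "has_levy_triplet M L b c F"
    and \<mu>: "\<mu> = mean M (L 1)" and \<sigma>: "\<sigma>2 = cov M (L 1) (L 1)" "\<sigma>2 > 0"
  shows "((\<lambda>u. (levy_exponent b c F u - \<i> * complex_of_real (\<mu> * u)) / complex_of_real (u\<^sup>2)) \<longlongrightarrow> complex_of_real (- (\<sigma>2 / 2))) (at 0)"
proof -
  interpret prob_space M by fact
  note [measurable] = L1
  define X where "X \<omega> = L 1 \<omega> - \<mu>" for \<omega>
  have [measurable]: "X \<in> borel_measurable M" unfolding X_def by measurable
  have cov: "\<sigma>2 = expectation (\<lambda>\<omega>. (X \<omega>)\<^sup>2)" using \<sigma>(1) by (simp add: cov_def \<mu> X_def power2_eq_square)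
  \<comment> \<open>Integrability comes from \<open>\<sigma>2 > 0\<close>: the integral of a
    function that is not integrable is 0 by convention.\<close>
  then have i: "integrable M (\<lambda>\<omega>. (X \<omega>)\<^sup>2)" using \<sigma>(2) not_integrable_integral_eq by fastforce
  have "integrable M X" by (rule square_integrable_imp_integrable[OF _ i]) measurable
  then have "integrable M (\<lambda>\<omega>. X \<omega> + \<mu>)" by simp
  then have "integrable M (L 1)" by (simp add: X_def)
  then have m: "expectation X = 0" by (simp add: X_def[abs_def] \<mu> mean_def prob_space)
  define z where "z u = levy_exponent b c F u - \<i> * complex_of_real (\<mu> * u)" for u
  have ez: "exp (z u) = (CLINT \<omega>|M. iexp (u * X \<omega>))" for u
  proof -
    have "char (distr M borel (L 1)) u = exp (levy_exponent b c F u)"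
      using trip by (auto simp: has_levy_triplet_def)
    then have "exp (levy_exponent b c F u) = (CLINT \<omega>|M. iexp (u * L 1 \<omega>))"
      unfolding char_def by (subst (asm) integral_distr) auto
    then have "exp (z u) = exp (- (\<i> * complex_of_real (\<mu> * u))) * (CLINT \<omega>|M. iexp (u * L 1 \<omega>))"
      by (simp add: z_def exp_diff exp_minus divide_inverse)
    also have "\<dots> = (CLINT \<omega>|M. exp (- (\<i> * complex_of_real (\<mu> * u))) * iexp (u * L 1 \<omega>))" by simp
    also have "\<dots> = (CLINT \<omega>|M. iexp (u * X \<omega>))"
      by (intro Bochner_Integration.integral_cong refl) (simp add: X_def algebra_simps flip: exp_add)
    finally show ?thesis .
  qed
  have "(z \<longlongrightarrow> 0 - \<i> * complex_of_real (\<mu> * 0)) (at 0)"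
    unfolding z_def using trip
    by (intro tendsto_diff levy_exponent_tendsto_0 tendsto_intros) (auto simp: has_levy_triplet_def)
  then have z0: "(z \<longlongrightarrow> 0) (at 0)" by simp
  show ?thesis using log_quotient_limit[OF z0, of "complex_of_real (- (\<sigma>2 / 2))"]
      char_quotient_centred[OF _ i m] unfolding ez cov[symmetric] by (simp add: z_def)
qed

text \<open>Left-endpoint sums for the integral of \<open>exp (\<kappa> * t)\<close> over
  \<open>[-lam, 0]\<close>, summed exactly as a geometric series. The values 1 and 2 of
  \<open>\<kappa>\<close> serve the mean and the variance.\<close>

lemma geometric_riemann_sum:
  fixes lam \<kappa> :: real
  assumes "lam > 0" "\<kappa> > 0"
  shows "(\<lambda>m. \<Sum>j<Suc m. lam / real (Suc m) * exp (\<kappa> * (- lam + real j * (lam / real (Suc m))))) \<longlonglongrightarrow> (1 - exp (- \<kappa> * lam)) / \<kappa>"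
proof -
  define \<delta> where "\<delta> m = lam / real (Suc m)" for m
  have \<delta>: "\<delta> m > 0" for m using assms by (simp add: \<delta>_def)
  have \<delta>0: "\<delta> \<longlonglongrightarrow> 0" unfolding \<delta>_def[abs_def] by (rule LIMSEQ_Suc[OF lim_const_over_n])
  have eq: "(\<Sum>j<Suc m. \<delta> m * exp (\<kappa> * (- lam + real j * \<delta> m))) = (1 - exp (- \<kappa> * lam)) * (1 / ((exp (\<kappa> * \<delta> m) - 1) / \<delta> m))" for m
  proof -
    have ne: "exp (\<kappa> * \<delta> m) \<noteq> 1" using \<delta>[of m] assms by simp
    have "(\<Sum>j<Suc m. \<delta> m * exp (\<kappa> * (- lam + real j * \<delta> m))) = (\<Sum>j<Suc m. \<delta> m * exp (- \<kappa> * lam) * exp (\<kappa> * \<delta> m) ^ j)"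
      by (intro sum.cong refl) (simp add: algebra_simps exp_of_nat_mult[symmetric] flip: exp_add)
    also have "\<dots> = \<delta> m * exp (- \<kappa> * lam) * ((exp (\<kappa> * \<delta> m) ^ Suc m - 1) / (exp (\<kappa> * \<delta> m) - 1))"
      unfolding sum_distrib_left[symmetric] using geometric_sum[OF ne, of "Suc m"] by simp
    also have "exp (\<kappa> * \<delta> m) ^ Suc m = exp (\<kappa> * lam)"
      by (simp only: exp_of_nat_mult[symmetric]) (simp add: \<delta>_def field_simps)
    also have "\<delta> m * exp (- \<kappa> * lam) * ((exp (\<kappa> * lam) - 1) / (exp (\<kappa> * \<delta> m) - 1)) = (exp (- \<kappa> * lam) * (exp (\<kappa> * lam) - 1)) * (1 / ((exp (\<kappa> * \<delta> m) - 1) / \<delta> m))"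
      by simp
    also have "exp (- \<kappa> * lam) * (exp (\<kappa> * lam) - 1) = 1 - exp (- \<kappa> * lam)"
      by (simp add: right_diff_distrib flip: exp_add)
    finally show ?thesis .
  qed
  have "((\<lambda>t. exp (\<kappa> * t)) has_real_derivative \<kappa>) (at 0)"
    by (auto intro!: derivative_eq_intros)
  then have "((\<lambda>t. (exp (\<kappa> * t) - 1) / t) \<longlongrightarrow> \<kappa>) (at 0)" by (simp add: has_field_derivative_iff)
  then have "(\<lambda>m. (exp (\<kappa> * \<delta> m) - 1) / \<delta> m) \<longlonglongrightarrow> \<kappa>"
    unfolding tendsto_at_iff_sequentially comp_def using \<delta>0 \<delta> by (metis DiffI UNIV_I empty_iff insert_iff less_irrefl)
  then have "(\<lambda>m. (1 - exp (- \<kappa> * lam)) * (1 / ((exp (\<kappa> * \<delta> m) - 1) / \<delta> m))) \<longlonglongrightarrow> (1 - exp (- \<kappa> * lam)) * (1 / \<kappa>)"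
    using assms by (intro tendsto_intros) auto
  then show ?thesis unfolding eq[symmetric] by (simp only: \<delta>_def times_divide_eq_right mult_1_right)
qed

text \<open>Moments of the Riemann sums need not converge to those of \<open>Z\<close>. Instead the
  limiting characteristic function is expanded at 0, using the expansion of \<open>\<psi>\<close>
  uniformly over the mesh, and the moments are read off from it.\<close>

lemma (in prob_space) innovation_moments:
  fixes \<psi> :: "real \<Rightarrow> complex" and lam \<mu> \<sigma>2 :: real
  assumes lam: "lam > 0" and \<sigma>: "\<sigma>2 > 0"
    and \<psi>: "((\<lambda>u. (\<psi> u - \<i> * complex_of_real (\<mu> * u)) / complex_of_real (u\<^sup>2)) \<longlongrightarrow> complex_of_real (- (\<sigma>2 / 2))) (at 0)" "\<psi> 0 = 0"
    and Z[measurable]: "Z \<in> borel_measurable M" and i: "integrable M (\<lambda>\<omega>. (Z \<omega>)\<^sup>2)"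
    and lim: "\<And>u. (\<lambda>m. \<Prod>j<Suc m. exp (complex_of_real (lam / real (Suc m)) * \<psi> (u * exp (- lam + real j * (lam / real (Suc m))))))
       \<longlonglongrightarrow> (CLINT \<omega>|M. iexp (u * Z \<omega>))"
  shows "expectation Z = \<mu> * (1 - exp (- lam))"
    and "expectation (\<lambda>\<omega>. (Z \<omega> - \<mu> * (1 - exp (- lam)))\<^sup>2) = \<sigma>2 * (1 - exp (- 2 * lam)) / 2"
proof -
  define \<delta> where "\<delta> m = lam / real (Suc m)" for m
  define s where "s m j = exp (- lam + real j * \<delta> m)" for m j
  have \<delta>: "\<delta> m > 0" for m using lam by (simp add: \<delta>_def)
  have s: "0 < s m j" "s m j \<le> 1" if "j < Suc m" for m j
  proof -
    have "real j * \<delta> m \<le> real (Suc m) * \<delta> m" using that \<delta>[of m] by (intro mult_right_mono) auto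
    also have "\<dots> = lam" by (simp add: \<delta>_def)
    finally show "0 < s m j" "s m j \<le> 1" by (auto simp: s_def)
  qed
  define A where "A = 1 - exp (- lam)"
  define B where "B = (1 - exp (- 2 * lam)) / 2"
  define Am where "Am m = (\<Sum>j<Suc m. \<delta> m * s m j)" for m
  define Bm where "Bm m = (\<Sum>j<Suc m. \<delta> m * (s m j)\<^sup>2)" for m
  have Am: "Am \<longlonglongrightarrow> A" using geometric_riemann_sum[OF lam, of 1] unfolding Am_def A_def s_def \<delta>_def by simp
  have Bm: "Bm \<longlonglongrightarrow> B"
    using geometric_riemann_sum[OF lam, of 2] unfolding Bm_def B_def s_def \<delta>_def by (simp add: exp_double[symmetric])
  \<comment> \<open>The remainder of the exponent beyond its mean and variance terms, of smaller
    order than \<open>u\<^sup>2\<close>.\<close>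
  define \<psi>0 where "\<psi>0 u = \<psi> u - \<i> * complex_of_real (\<mu> * u) + complex_of_real (\<sigma>2 / 2 * u\<^sup>2)" for u
  have \<psi>0: "\<exists>r>0. \<forall>u. \<bar>u\<bar> < r \<longrightarrow> norm (\<psi>0 u) \<le> \<eta> * u\<^sup>2" if \<eta>: "\<eta> > 0" for \<eta>
  proof -
    obtain r where r: "r > 0" "\<And>u. u \<noteq> 0 \<Longrightarrow> \<bar>u\<bar> < r \<Longrightarrow>
        norm ((\<psi> u - \<i> * complex_of_real (\<mu> * u)) / complex_of_real (u\<^sup>2) - complex_of_real (- (\<sigma>2 / 2))) < \<eta>"
      using tendstoD[OF \<psi>(1) \<eta>] unfolding eventually_at dist_norm by auto
    have "norm (\<psi>0 u) \<le> \<eta> * u\<^sup>2" if u: "\<bar>u\<bar> < r" for u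
    proof (cases "u = 0")
      case False
      have "\<psi>0 u = ((\<psi> u - \<i> * complex_of_real (\<mu> * u)) / complex_of_real (u\<^sup>2) - complex_of_real (- (\<sigma>2 / 2))) * complex_of_real (u\<^sup>2)"
        using False by (simp add: \<psi>0_def field_simps)
      then have "norm (\<psi>0 u) = norm ((\<psi> u - \<i> * complex_of_real (\<mu> * u)) / complex_of_real (u\<^sup>2) - complex_of_real (- (\<sigma>2 / 2))) * u\<^sup>2"
        by (simp only: norm_mult norm_of_real) simp
      also have "\<dots> \<le> \<eta> * u\<^sup>2" using r(2)[OF False u] by (intro mult_right_mono) auto
      finally show ?thesis .
    qed (simp add: \<psi>0_def \<psi>(2))
    then show ?thesis using r by blast
  qed
  obtain r1 where r1: "r1 > 0" "\<And>z::complex. norm z < r1 \<Longrightarrow> norm (exp z - 1) \<le> 2 * norm z"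
  proof -
    obtain r where r: "r > 0" "\<And>z::complex. z \<noteq> 0 \<Longrightarrow> norm z < r \<Longrightarrow> norm ((exp z - 1) / z - 1) < 1"
      using tendstoD[OF exp_difference_quotient, of 1] unfolding eventually_at dist_norm by auto
    have "norm (exp z - 1) \<le> 2 * norm z" if "norm z < r" for z :: complex
    proof (cases "z = 0")
      case False
      have "norm ((exp z - 1) / z) \<le> norm ((exp z - 1) / z - 1) + norm (1::complex)"
        using norm_triangle_ineq[of "(exp z - 1) / z - 1" 1] by simp
      also have "\<dots> \<le> 2" using r(2)[OF False that] by simp
      finally show ?thesis using False by (simp add: norm_divide divide_le_eq)
    qed simp
    then show thesis using r that by blast
  qed
  define ch where "ch u = (CLINT \<omega>|M. iexp (u * (Z \<omega> - \<mu> * A)))" for u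
  \<comment> \<open>Half of the variance to be established, the coefficient of
    \<open>u\<^sup>2\<close> in the exponent of the centred law.\<close>
  define \<kappa> where "\<kappa> = \<sigma>2 * B / 2"
  have chi: "ch u = exp (- (\<i> * complex_of_real (\<mu> * A * u))) * (CLINT \<omega>|M. iexp (u * Z \<omega>))" for u
  proof -
    have "ch u = (CLINT \<omega>|M. exp (- (\<i> * complex_of_real (\<mu> * A * u))) * iexp (u * Z \<omega>))"
      unfolding ch_def by (intro Bochner_Integration.integral_cong refl) (simp add: algebra_simps flip: exp_add)
    then show ?thesis by simp
  qed
  \<comment> \<open>The exponent of the discretized law after centring and removal of the expected
    Gaussian factor. It contains only discretization errors of the two Riemann sums and the
    remainders \<open>\<psi>0\<close>.\<close>
  define z where "z u m = \<i> * complex_of_real (\<mu> * u * (Am m - A)) - complex_of_real (\<sigma>2 / 2 * u\<^sup>2 * (Bm m - B))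
     + (\<Sum>j<Suc m. complex_of_real (\<delta> m) * \<psi>0 (u * s m j))" for u m
  have zlim: "(\<lambda>m. exp (z u m)) \<longlonglongrightarrow> ch u * exp (complex_of_real (\<kappa> * u\<^sup>2))" for u
  proof -
    have "(\<Prod>j<Suc m. exp (complex_of_real (\<delta> m) * \<psi> (u * s m j))) * (exp (- (\<i> * complex_of_real (\<mu> * A * u))) * exp (complex_of_real (\<kappa> * u\<^sup>2))) = exp (z u m)" for m
    proof -
      have "(\<Sum>j<Suc m. complex_of_real (\<delta> m) * \<psi> (u * s m j)) =
        (\<Sum>j<Suc m. \<i> * complex_of_real (\<mu> * u) * complex_of_real (\<delta> m * s m j) - complex_of_real (\<sigma>2 / 2 * u\<^sup>2) * complex_of_real (\<delta> m * (s m j)\<^sup>2) + complex_of_real (\<delta> m) * \<psi>0 (u * s m j))"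
        by (intro sum.cong refl) (simp add: \<psi>0_def algebra_simps power_mult_distrib)
      also have "\<dots> = \<i> * complex_of_real (\<mu> * u * Am m) - complex_of_real (\<sigma>2 / 2 * u\<^sup>2 * Bm m) + (\<Sum>j<Suc m. complex_of_real (\<delta> m) * \<psi>0 (u * s m j))"
        by (simp only: sum.distrib sum_subtractf sum_distrib_left[symmetric] of_real_sum[symmetric] Am_def Bm_def of_real_mult mult.assoc)
      finally have "(\<Sum>j<Suc m. complex_of_real (\<delta> m) * \<psi> (u * s m j)) - \<i> * complex_of_real (\<mu> * A * u) + complex_of_real (\<kappa> * u\<^sup>2) = z u m"
        by (simp add: z_def \<kappa>_def algebra_simps diff_divide_distrib)
      then have "exp (z u m) = exp (\<Sum>j<Suc m. complex_of_real (\<delta> m) * \<psi> (u * s m j)) * (exp (- (\<i> * complex_of_real (\<mu> * A * u))) * exp (complex_of_real (\<kappa> * u\<^sup>2)))"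
        by (simp only: exp_add[symmetric]) (simp add: algebra_simps)
      then show ?thesis by (simp only: exp_sum[OF finite_lessThan])
    qed
    moreover have "(\<lambda>m. (\<Prod>j<Suc m. exp (complex_of_real (\<delta> m) * \<psi> (u * s m j))) * (exp (- (\<i> * complex_of_real (\<mu> * A * u))) * exp (complex_of_real (\<kappa> * u\<^sup>2))))
       \<longlonglongrightarrow> (CLINT \<omega>|M. iexp (u * Z \<omega>)) * (exp (- (\<i> * complex_of_real (\<mu> * A * u))) * exp (complex_of_real (\<kappa> * u\<^sup>2)))"
      using lim[of u] unfolding \<delta>_def s_def by (intro tendsto_mult tendsto_const)
    ultimately show ?thesis by (simp add: chi mult_ac)
  qed
  have q0: "((\<lambda>u. (ch u * exp (complex_of_real (\<kappa> * u\<^sup>2)) - 1) / complex_of_real (u\<^sup>2)) \<longlongrightarrow> 0) (at 0)"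
  proof (rule tendstoI)
    fix r :: real assume r: "r > 0"
    \<comment> \<open>The exponent is at most \<open>2 * \<eta> * lam * u\<^sup>2\<close>, the
      exponential doubles this, and the quotient by \<open>u\<^sup>2\<close> should not exceed
      \<open>r / 2\<close>.\<close>
    define \<eta> where "\<eta> = r / (8 * lam)"
    have \<eta>: "\<eta> > 0" "4 * \<eta> * lam = r / 2" using r lam by (auto simp: \<eta>_def)
    obtain r0 where r0: "r0 > 0" "\<And>u. \<bar>u\<bar> < r0 \<Longrightarrow> norm (\<psi>0 u) \<le> \<eta> * u\<^sup>2" using \<psi>0[OF \<eta>(1)] by blast
    \<comment> \<open>The second bound keeps the exponent inside the disc of radius
      \<open>r1\<close>, where the exponential is compared with its argument.\<close>
    define r2 where "r2 = min r0 (sqrt (r1 / (2 * \<eta> * lam)))"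
    have r2: "r2 > 0" using r0 r1 \<eta> lam by (simp add: r2_def)
    have "norm ((ch u * exp (complex_of_real (\<kappa> * u\<^sup>2)) - 1) / complex_of_real (u\<^sup>2)) < r" if u: "u \<noteq> 0" "\<bar>u\<bar> < r2" for u
    proof -
      have u2: "2 * \<eta> * lam * u\<^sup>2 < r1"
      proof -
        have "\<bar>u\<bar> < sqrt (r1 / (2 * \<eta> * lam))" using u by (simp add: r2_def)
        then have "u\<^sup>2 < r1 / (2 * \<eta> * lam)" using real_sqrt_less_iff[of "u\<^sup>2"] by simp
        then show ?thesis using \<eta> lam by (simp add: pos_less_divide_eq mult_ac)
      qed
      have rho: "norm (\<Sum>j<Suc m. complex_of_real (\<delta> m) * \<psi>0 (u * s m j)) \<le> \<eta> * u\<^sup>2 * lam" for m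
      proof -
        have "norm (\<Sum>j<Suc m. complex_of_real (\<delta> m) * \<psi>0 (u * s m j)) \<le> (\<Sum>j<Suc m. norm (complex_of_real (\<delta> m) * \<psi>0 (u * s m j)))"
          by (rule norm_sum)
        also have "\<dots> \<le> (\<Sum>j<Suc m. \<delta> m * (\<eta> * u\<^sup>2))"
        proof (rule sum_mono)
          fix j assume "j \<in> {..<Suc m}"
          then have sj: "0 < s m j" "s m j \<le> 1" using s by auto
          have us: "\<bar>u * s m j\<bar> \<le> \<bar>u\<bar>" using sj by (simp add: abs_mult mult_left_le)
          then have "norm (\<psi>0 (u * s m j)) \<le> \<eta> * (u * s m j)\<^sup>2" using u by (intro r0(2)) (auto simp: r2_def)
          also have "\<dots> \<le> \<eta> * u\<^sup>2" using us \<eta> by (intro mult_left_mono) (auto simp: abs_le_square_iff)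
          finally show "norm (complex_of_real (\<delta> m) * \<psi>0 (u * s m j)) \<le> \<delta> m * (\<eta> * u\<^sup>2)"
            using \<delta>[of m] by (simp add: norm_mult mult_left_mono)
        qed
        also have "\<dots> = \<eta> * u\<^sup>2 * lam" by (simp add: \<delta>_def)
        finally show ?thesis .
      qed
      have "(\<lambda>m. \<bar>\<mu> * u * (Am m - A)\<bar> + \<bar>\<sigma>2 / 2 * u\<^sup>2 * (Bm m - B)\<bar>) \<longlonglongrightarrow> \<bar>\<mu> * u * (A - A)\<bar> + \<bar>\<sigma>2 / 2 * u\<^sup>2 * (B - B)\<bar>"
        by (intro tendsto_intros Am Bm)
      then have "(\<lambda>m. \<bar>\<mu> * u * (Am m - A)\<bar> + \<bar>\<sigma>2 / 2 * u\<^sup>2 * (Bm m - B)\<bar>) \<longlonglongrightarrow> 0" by simp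
      from order_tendstoD(2)[OF this, of "\<eta> * u\<^sup>2 * lam"] u \<eta> lam
      have "\<forall>\<^sub>F m in sequentially. \<bar>\<mu> * u * (Am m - A)\<bar> + \<bar>\<sigma>2 / 2 * u\<^sup>2 * (Bm m - B)\<bar> < \<eta> * u\<^sup>2 * lam" by simp
      then have "\<forall>\<^sub>F m in sequentially. norm (exp (z u m) - 1) \<le> 4 * \<eta> * lam * u\<^sup>2"
      proof eventually_elim
        case (elim m)
        have "norm (z u m) \<le> (\<bar>\<mu> * u * (Am m - A)\<bar> + \<bar>\<sigma>2 / 2 * u\<^sup>2 * (Bm m - B)\<bar>) + \<eta> * u\<^sup>2 * lam"
          unfolding z_def
          by (rule order.trans[OF norm_triangle_ineq add_mono[OF order.trans[OF norm_triangle_ineq4] rho]])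
             (simp only: norm_mult norm_ii norm_of_real mult_1 order.refl)
        also have "\<dots> \<le> \<eta> * u\<^sup>2 * lam + \<eta> * u\<^sup>2 * lam" using elim by (intro add_right_mono) simp
        also have "\<dots> = 2 * \<eta> * lam * u\<^sup>2" by simp
        finally have zle: "norm (z u m) \<le> 2 * \<eta> * lam * u\<^sup>2" .
        then have "norm (exp (z u m) - 1) \<le> 2 * norm (z u m)" using u2 by (intro r1(2)) simp
        then show ?case using zle by simp
      qed
      moreover have "(\<lambda>m. norm (exp (z u m) - 1)) \<longlonglongrightarrow> norm (ch u * exp (complex_of_real (\<kappa> * u\<^sup>2)) - 1)"
        by (intro tendsto_intros zlim)
      ultimately have "norm (ch u * exp (complex_of_real (\<kappa> * u\<^sup>2)) - 1) \<le> 4 * \<eta> * lam * u\<^sup>2"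
        by (intro tendsto_upperbound[where F = sequentially]) auto
      then have "norm (ch u * exp (complex_of_real (\<kappa> * u\<^sup>2)) - 1) / u\<^sup>2 \<le> r / 2"
        using u \<eta> by (simp add: divide_le_eq)
      moreover have "norm ((ch u * exp (complex_of_real (\<kappa> * u\<^sup>2)) - 1) / complex_of_real (u\<^sup>2)) = norm (ch u * exp (complex_of_real (\<kappa> * u\<^sup>2)) - 1) / u\<^sup>2"
        by (simp add: norm_divide norm_power)
      ultimately show ?thesis using r by linarith
    qed
    then show "\<forall>\<^sub>F u in at 0. dist ((ch u * exp (complex_of_real (\<kappa> * u\<^sup>2)) - 1) / complex_of_real (u\<^sup>2)) 0 < r"
      unfolding eventually_at using r2 by (intro exI[of _ r2]) (auto simp: dist_norm)
  qed
  have e1: "((\<lambda>u. exp (- complex_of_real (\<kappa> * u\<^sup>2))) \<longlongrightarrow> exp (- complex_of_real (\<kappa> * 0\<^sup>2))) (at 0)"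
    by (intro tendsto_intros)
  have e2: "((\<lambda>u. (exp (- complex_of_real (\<kappa> * u\<^sup>2)) - 1) / complex_of_real (u\<^sup>2)) \<longlongrightarrow> complex_of_real (- \<kappa>)) (at 0)"
  proof -
    have "((\<lambda>t. exp (- \<kappa> * t)) has_real_derivative - \<kappa>) (at 0)" by (auto intro!: derivative_eq_intros)
    then have d: "((\<lambda>t. (exp (- \<kappa> * t) - 1) / t) \<longlongrightarrow> - \<kappa>) (at 0)" by (simp add: has_field_derivative_iff)
    have f: "filterlim (\<lambda>u::real. u\<^sup>2) (at 0) (at 0)"
      unfolding filterlim_at by (auto intro!: tendsto_eq_intros simp: eventually_at_filter)
    have "((\<lambda>u. (exp (- \<kappa> * u\<^sup>2) - 1) / u\<^sup>2) \<longlongrightarrow> - \<kappa>) (at 0)" by (rule filterlim_compose[OF d f])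
    then have "((\<lambda>u. complex_of_real ((exp (- \<kappa> * u\<^sup>2) - 1) / u\<^sup>2)) \<longlongrightarrow> complex_of_real (- \<kappa>)) (at 0)"
      by (rule tendsto_of_real)
    then show ?thesis by (simp add: exp_of_real[symmetric])
  qed
  \<comment> \<open>Divides the Gaussian factor out again, at the level of difference
    quotients.\<close>
  have eq: "(ch u * exp (complex_of_real (\<kappa> * u\<^sup>2)) - 1) / complex_of_real (u\<^sup>2) * exp (- complex_of_real (\<kappa> * u\<^sup>2))
      + (exp (- complex_of_real (\<kappa> * u\<^sup>2)) - 1) / complex_of_real (u\<^sup>2) = (ch u - 1) / complex_of_real (u\<^sup>2)" for u
  proof -
    have "exp (complex_of_real (\<kappa> * u\<^sup>2)) * exp (- complex_of_real (\<kappa> * u\<^sup>2)) = 1" by (simp flip: exp_add)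
    then have "(ch u * exp (complex_of_real (\<kappa> * u\<^sup>2)) - 1) * exp (- complex_of_real (\<kappa> * u\<^sup>2)) + (exp (- complex_of_real (\<kappa> * u\<^sup>2)) - 1) = ch u - 1"
      by (simp add: left_diff_distrib mult.assoc)
    then show ?thesis by (metis add_divide_distrib times_divide_eq_left)
  qed
  have chi_lim: "((\<lambda>u. (ch u - 1) / complex_of_real (u\<^sup>2)) \<longlongrightarrow> complex_of_real (- \<kappa>)) (at 0)"
    using tendsto_add[OF tendsto_mult[OF q0 e1] e2] unfolding eq by simp
  have iZ: "integrable M Z" by (rule square_integrable_imp_integrable[OF Z i])
  define X where "X \<omega> = Z \<omega> - \<mu> * A" for \<omega>
  have [measurable]: "X \<in> borel_measurable M" unfolding X_def by measurable
  have iX: "integrable M (\<lambda>\<omega>. (X \<omega>)\<^sup>2)"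
    unfolding X_def power2_diff using i iZ by simp
  have lim': "((\<lambda>u. ((CLINT \<omega>|M. iexp (u * X \<omega>)) - 1) / complex_of_real (u\<^sup>2)) \<longlongrightarrow> complex_of_real (- \<kappa>)) (at 0)"
    using chi_lim unfolding ch_def X_def .
  have m: "expectation X = 0" by (rule mean_zero_from_char[OF _ iX lim']) measurable
  then show "expectation Z = \<mu> * (1 - exp (- lam))" using iZ by (simp add: X_def[abs_def] A_def prob_space)
  have "complex_of_real (- \<kappa>) = complex_of_real (- (expectation (\<lambda>\<omega>. (X \<omega>)\<^sup>2) / 2))"
    by (rule tendsto_unique[OF _ lim' char_quotient_centred[OF _ iX m]]) auto
  then have "expectation (\<lambda>\<omega>. (X \<omega>)\<^sup>2) = 2 * \<kappa>" unfolding of_real_eq_iff by simp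
  then show "expectation (\<lambda>\<omega>. (Z \<omega> - \<mu> * (1 - exp (- lam)))\<^sup>2) = \<sigma>2 * (1 - exp (- 2 * lam)) / 2"
    by (simp add: X_def A_def \<kappa>_def B_def)
qed

context prob_space
begin

lemma bounded_in_prob_single:
  assumes [measurable]: "Z \<in> borel_measurable M"
  shows "bounded_in_prob (\<lambda>n. Z)"
  unfolding bounded_in_prob_def
proof (intro conjI allI impI)
  fix \<eta> :: real assume "\<eta> > 0"
  have "(\<lambda>i. prob {\<omega> \<in> space M. real i < \<bar>Z \<omega>\<bar>}) \<longlonglongrightarrow> prob (\<Inter>i. {\<omega> \<in> space M. real i < \<bar>Z \<omega>\<bar>})"
    by (rule finite_Lim_measure_decseq) (auto simp: decseq_def)
  moreover have "(\<Inter>i. {\<omega> \<in> space M. real i < \<bar>Z \<omega>\<bar>}) = {}"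
  proof -
    have "\<exists>i. \<not> real i < z" for z by (meson reals_Archimedean2 less_asym)
    then show ?thesis by auto
  qed
  ultimately have "(\<lambda>i. prob {\<omega> \<in> space M. real i < \<bar>Z \<omega>\<bar>}) \<longlonglongrightarrow> 0" by simp
  from order_tendstoD(2)[OF this \<open>\<eta> > 0\<close>] obtain N where N: "\<And>i. i \<ge> N \<Longrightarrow> prob {\<omega> \<in> space M. real i < \<bar>Z \<omega>\<bar>} < \<eta>"
    by (auto simp: eventually_sequentially)
  show "\<exists>R>0. \<forall>\<^sub>F n in sequentially. prob {\<omega> \<in> space M. R < \<bar>Z \<omega>\<bar>} \<le> \<eta>"
    using N[of "Suc N"] by (intro exI[of _ "real (Suc N)"]) auto
qed auto

lemma small_in_prob_AE:
  assumes X: "small_in_prob X" and Y: "\<And>n. Y n \<in> borel_measurable M" and eq: "\<And>n. AE \<omega> in M. X n \<omega> = Y n \<omega>"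
  shows "small_in_prob Y"
  unfolding small_in_prob_def
proof (intro conjI allI impI)
  note [measurable] = small_in_prob_measurable[OF X] Y
  fix \<epsilon> :: real assume "\<epsilon> > 0"
  have "prob {\<omega> \<in> space M. \<epsilon> < \<bar>Y n \<omega>\<bar>} = prob {\<omega> \<in> space M. \<epsilon> < \<bar>X n \<omega>\<bar>}" for n
    by (rule finite_measure_eq_AE) (use eq[of n] in \<open>auto elim: AE_mp\<close>)
  then show "(\<lambda>n. prob {\<omega> \<in> space M. \<epsilon> < \<bar>Y n \<omega>\<bar>}) \<longlonglongrightarrow> 0"
    using X \<open>\<epsilon> > 0\<close> by (simp add: small_in_prob_def)
qed (rule Y)

lemma char_distr_eq:
  assumes "X \<in> borel_measurable M"
  shows "char (distr M borel X) u = (CLINT \<omega>|M. iexp (u * X \<omega>))"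
  unfolding char_def using assms by (subst integral_distr) auto

lemma distr_eqI_char:
  assumes X: "X \<in> borel_measurable M" and Y: "Y \<in> borel_measurable M"
    and "\<And>u. (CLINT \<omega>|M. iexp (u * X \<omega>)) = (CLINT \<omega>|M. iexp (u * Y \<omega>))"
  shows "distr M borel X = distr M borel Y"
proof (rule Levy_uniqueness)
  show "real_distribution (distr M borel X)" "real_distribution (distr M borel Y)"
    using X Y by (auto intro!: real_distribution_distr)
  show "char (distr M borel X) = char (distr M borel Y)"
    by (rule ext) (simp only: char_distr_eq[OF X] char_distr_eq[OF Y] assms(3))
qed

lemma distr_shift:
  assumes [measurable]: "X \<in> borel_measurable M" "Y \<in> borel_measurable M" and "distr M borel X = distr M borel Y"
  shows "distr M borel (\<lambda>\<omega>. X \<omega> - c) = distr M borel (\<lambda>\<omega>. Y \<omega> - (c::real))"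
proof -
  have e: "distr M borel (\<lambda>\<omega>. Z \<omega> - c) = distr (distr M borel Z) borel (\<lambda>r. r - c)"
    if [measurable]: "Z \<in> borel_measurable M" for Z
    by (subst distr_distr) (auto simp: comp_def)
  show ?thesis using assms(3) by (simp add: e[OF assms(1)] e[OF assms(2)])
qed

end

section \<open>The Ornstein-Uhlenbeck process on a uniform mesh\<close>

locale levy_OU = prob_space M for M :: "'a measure" +
  fixes L Y :: "real \<Rightarrow> 'a \<Rightarrow> real" and lam :: real
  assumes levy: "levy_process M L" and OU: "stationary_levy_OU M L lam Y" and lam: "lam > 0"
begin

text \<open>One unit of time for \<open>Y\<close> is an interval of length \<open>lam\<close> for
  \<open>L\<close>. Dividing it into \<open>Suc m\<close> equal cells puts every block boundary on
  the mesh and makes all increments identically distributed.\<close>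

definition mesh :: "nat \<Rightarrow> real" where "mesh m = lam / real (Suc m)"
definition inc :: "nat \<Rightarrow> nat \<Rightarrow> 'a \<Rightarrow> real" where
  "inc m i \<omega> = L (real (Suc i) * mesh m) \<omega> - L (real i * mesh m) \<omega>"
definition riemann :: "(real \<Rightarrow> real) \<Rightarrow> nat \<Rightarrow> nat \<Rightarrow> 'a \<Rightarrow> real" where
  "riemann f m k \<omega> = (\<Sum>i<k * Suc m. f (real i * mesh m) * inc m i \<omega>)"
definition \<phi> :: "nat \<Rightarrow> real \<Rightarrow> complex" where "\<phi> m = char (distr M borel (L (mesh m)))"

lemma mesh_pos: "mesh m > 0" using lam by (simp add: mesh_def)
lemma mesh_block: "real (k * Suc m) * mesh m = real k * lam"
  unfolding mesh_def of_nat_mult by (simp del: of_nat_Suc)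
lemma mesh_0: "mesh \<longlonglongrightarrow> 0" unfolding mesh_def[abs_def] by (rule LIMSEQ_Suc[OF lim_const_over_n])

lemma L_measurable: "t \<ge> 0 \<Longrightarrow> L t \<in> borel_measurable M"
  using levy by (simp add: levy_process_def)

lemma inc_measurable[measurable]: "inc m i \<in> borel_measurable M"
  unfolding inc_def[abs_def] using mesh_pos[of m] by (intro borel_measurable_diff L_measurable) auto

lemma inc_indep: "indep_vars (\<lambda>_. borel) (inc m) {..<K}"
proof -
  define t where "t i = real i * mesh m" for i :: nat
  have t: "0 \<le> t 0 \<and> (\<forall>i<K. t i \<le> t (Suc i))"
    using mesh_pos[of m] by (auto simp: t_def intro!: mult_right_mono)
  have "\<forall>n t. 0 \<le> t 0 \<and> (\<forall>i<n. t i \<le> t (Suc i)) \<longrightarrow>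
        indep_vars (\<lambda>_. borel) (\<lambda>i \<omega>. L (t (Suc i)) \<omega> - L (t i) \<omega>) {..<n::nat}"
    using levy unfolding levy_process_def by blast
  from this[rule_format, OF t] show ?thesis by (simp add: t_def inc_def[abs_def])
qed

lemma inc_distr: "distr M borel (inc m i) = distr M borel (L (mesh m))"
proof -
  have "\<forall>s\<ge>0. \<forall>t\<ge>0. distr M borel (\<lambda>\<omega>. L (s + t) \<omega> - L s \<omega>) = distr M borel (L t)"
    using levy unfolding levy_process_def by blast
  from this[rule_format, of "real i * mesh m" "mesh m"] mesh_pos[of m]
  show ?thesis by (simp add: inc_def[abs_def] distrib_right add.commute)
qed

lemma char_lin_inc:
  assumes "finite A"
  shows "(CLINT \<omega>|M. iexp (u * (\<Sum>i\<in>A. c i * inc m i \<omega>))) = (\<Prod>i\<in>A. \<phi> m (u * c i))"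
proof -
  obtain K where K: "A \<subseteq> {..<K}" using finite_nat_bounded[OF assms] by blast
  have ind: "indep_vars (\<lambda>_. borel) (\<lambda>i \<omega>. c i * inc m i \<omega>) A"
    by (rule indep_vars_compose2[OF indep_vars_subset[OF inc_indep K]]) auto
  have "char (distr M borel (\<lambda>\<omega>. \<Sum>i\<in>A. c i * inc m i \<omega>)) u = (\<Prod>i\<in>A. char (distr M borel (\<lambda>\<omega>. c i * inc m i \<omega>)) u)"
    by (rule char_distr_sum[OF ind])
  moreover have "char (distr M borel (\<lambda>\<omega>. c i * inc m i \<omega>)) u = \<phi> m (u * c i)" for i
    unfolding \<phi>_def inc_distr[of m i, symmetric] by (simp add: char_distr_eq mult_ac)
  moreover have "char (distr M borel (\<lambda>\<omega>. \<Sum>i\<in>A. c i * inc m i \<omega>)) u = (CLINT \<omega>|M. iexp (u * (\<Sum>i\<in>A. c i * inc m i \<omega>)))"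
    by (rule char_distr_eq) measurable
  ultimately show ?thesis by simp
qed

lemma riemann_measurable[measurable]: "riemann f m k \<in> borel_measurable M"
  unfolding riemann_def[abs_def] by measurable

lemma riemann_converges:
  assumes J: "has_levy_integral M L f 0 (lam * real k) J"
  shows "small_in_prob (\<lambda>m \<omega>. riemann f m k \<omega> - J \<omega>)"
proof (rule small_in_probI)
  have [measurable]: "J \<in> borel_measurable M" using J by (simp add: has_levy_integral_def)
  show "(\<lambda>\<omega>. riemann f m k \<omega> - J \<omega>) \<in> borel_measurable M" for m by measurable
  fix \<epsilon> \<eta> :: real assume *: "\<epsilon> > 0" "\<eta> > 0"
  \<comment> \<open>In \<open>has_levy_integral\<close> one number is both tolerance and bound on
    the probability, so the smaller of the two is used.\<close>
  define e where "e = min \<epsilon> \<eta>"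
  have e: "e > 0" "e \<le> \<epsilon>" "e \<le> \<eta>" using * by (auto simp: e_def)
  have "\<forall>\<epsilon>>0. \<exists>\<eta>>0. \<forall>(n::nat) t. t 0 = 0 \<and> t n = lam * real k \<and> (\<forall>i<n. t i \<le> t (Suc i) \<and> t (Suc i) - t i < \<eta>) \<longrightarrow>
        prob {\<omega> \<in> space M. \<bar>(\<Sum>i<n. f (t i) * (L (t (Suc i)) \<omega> - L (t i) \<omega>)) - J \<omega>\<bar> > \<epsilon>} < \<epsilon>"
    using J unfolding has_levy_integral_def by blast
  from this[rule_format, OF e(1)] obtain \<delta> where \<delta>: "\<delta> > 0"
    "\<forall>(n::nat) t. t 0 = 0 \<and> t n = lam * real k \<and> (\<forall>i<n. t i \<le> t (Suc i) \<and> t (Suc i) - t i < \<delta>) \<longrightarrow>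
        prob {\<omega> \<in> space M. \<bar>(\<Sum>i<n. f (t i) * (L (t (Suc i)) \<omega> - L (t i) \<omega>)) - J \<omega>\<bar> > e} < e"
    by (elim exE conjE) (rule that)
  from order_tendstoD(2)[OF mesh_0 \<delta>(1)]
  show "\<forall>\<^sub>F m in sequentially. prob {\<omega> \<in> space M. \<epsilon> < \<bar>riemann f m k \<omega> - J \<omega>\<bar>} \<le> \<eta>"
  proof eventually_elim
    case (elim m)
    have "prob {\<omega> \<in> space M. \<bar>(\<Sum>i<k * Suc m. f (real i * mesh m) * (L (real (Suc i) * mesh m) \<omega> - L (real i * mesh m) \<omega>)) - J \<omega>\<bar> > e} < e"
    proof (rule mp[OF spec[OF spec[OF \<delta>(2), of "k * Suc m"], of "\<lambda>i. real i * mesh m"]], intro conjI allI impI)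
      show "real (k * Suc m) * mesh m = lam * real k" unfolding mesh_block by simp
      show "real i * mesh m \<le> real (Suc i) * mesh m" "real (Suc i) * mesh m - real i * mesh m < \<delta>" for i
        using mesh_pos[of m] elim by (simp_all add: algebra_simps)
    qed simp
    then have "prob {\<omega> \<in> space M. \<bar>riemann f m k \<omega> - J \<omega>\<bar> > e} < e"
      unfolding riemann_def inc_def .
    moreover have "prob {\<omega> \<in> space M. \<epsilon> < \<bar>riemann f m k \<omega> - J \<omega>\<bar>} \<le> prob {\<omega> \<in> space M. \<bar>riemann f m k \<omega> - J \<omega>\<bar> > e}"
      by (rule finite_measure_mono) (use e in auto)
    ultimately show ?case using e by simp
  qed
qed

lemma Y_measurable[measurable]: "Y (real k) \<in> borel_measurable M" "Y 0 \<in> borel_measurable M"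
  using OU by (auto simp: stationary_levy_OU_def)

definition innov :: "nat \<Rightarrow> 'a \<Rightarrow> real" where
  "innov k \<omega> = Y (real (Suc k)) \<omega> - exp (- lam) * Y (real k) \<omega>"
text \<open>The part of the Riemann sum for the integral of \<open>exp\<close> that falls into block
  \<open>k\<close>, discounted to the end of that block.\<close>

definition approx_innov :: "nat \<Rightarrow> nat \<Rightarrow> 'a \<Rightarrow> real" where
  "approx_innov m k \<omega> = (\<Sum>i\<in>{k * Suc m..<k * Suc m + Suc m}. exp (- lam * real (Suc k)) * exp (real i * mesh m) * inc m i \<omega>)"

lemma innov_measurable[measurable]: "innov k \<in> borel_measurable M" unfolding innov_def[abs_def] by measurable
lemma approx_innov_measurable[measurable]: "approx_innov m k \<in> borel_measurable M"
  unfolding approx_innov_def[abs_def] by measurable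

text \<open>No integral over a single block is formed: a block sum is the difference of two Riemann
  sums started at 0, and each of these converges to the integral occurring in the definition of
  \<open>Y\<close>.\<close>

lemma approx_innov_small: "small_in_prob (\<lambda>m \<omega>. approx_innov m k \<omega> - innov k \<omega>)"
proof -
  have "\<forall>t\<ge>0. \<exists>I. has_levy_integral M L exp 0 (lam * t) I \<and>
        (AE \<omega> in M. Y t \<omega> = exp (- lam * t) * Y 0 \<omega> + exp (- lam * t) * I \<omega>)"
    using OU unfolding stationary_levy_OU_def by blast
  then have "\<forall>k. \<exists>I. has_levy_integral M L exp 0 (lam * real k) I \<and>
        (AE \<omega> in M. Y (real k) \<omega> = exp (- lam * real k) * Y 0 \<omega> + exp (- lam * real k) * I \<omega>)" by simp
  then obtain I where I: "\<And>k. has_levy_integral M L exp 0 (lam * real k) (I k)"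
      "\<And>k. AE \<omega> in M. Y (real k) \<omega> = exp (- lam * real k) * Y 0 \<omega> + exp (- lam * real k) * I k \<omega>"
    by metis
  have [measurable]: "I k \<in> borel_measurable M" for k using I(1)[of k] by (simp add: has_levy_integral_def)
  have blk: "approx_innov m k \<omega> = exp (- lam * real (Suc k)) * (riemann exp m (Suc k) \<omega> - riemann exp m k \<omega>)" for m \<omega>
  proof -
    have e: "Suc k * Suc m = k * Suc m + Suc m" by simp
    have "riemann exp m (Suc k) \<omega> = riemann exp m k \<omega> + (\<Sum>i\<in>{k * Suc m..<k * Suc m + Suc m}. exp (real i * mesh m) * inc m i \<omega>)"
      unfolding riemann_def e lessThan_atLeast0 by (rule sum.atLeastLessThan_concat[symmetric]) simp_all
    then show ?thesis by (simp add: approx_innov_def sum_distrib_left mult.assoc del: sum.op_ivl_Suc of_nat_Suc)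
  qed
  have "small_in_prob (\<lambda>m \<omega>. exp (- lam * real (Suc k)) * ((riemann exp m (Suc k) \<omega> - I (Suc k) \<omega>) - (riemann exp m k \<omega> - I k \<omega>)))"
    by (intro small_in_prob_cmult small_in_prob_diff riemann_converges I)
  then show ?thesis
  proof (rule small_in_prob_AE)
    fix m
    show "AE \<omega> in M. exp (- lam * real (Suc k)) * ((riemann exp m (Suc k) \<omega> - I (Suc k) \<omega>) - (riemann exp m k \<omega> - I k \<omega>))
       = approx_innov m k \<omega> - innov k \<omega>"
      using I(2)[of k] I(2)[of "Suc k"]
    proof eventually_elim
      case (elim \<omega>)
      have "exp (- lam * real (Suc k)) = exp (- lam) * exp (- lam * real k)"
        by (simp add: algebra_simps flip: exp_add)
      then show ?case unfolding blk innov_def elim by (simp add: algebra_simps)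
    qed
  qed measurable
qed

text \<open>Independence of \<open>Y 0\<close> from the path of \<open>L\<close> makes
  \<open>Y 0\<close> and the mesh increments one independent family. The blocks use disjoint sets of
  increments.\<close>

lemma approx_innov_indep: "indep_vars (\<lambda>_. borel) (case_nat (Y 0) (approx_innov m)) {..N}"
proof -
  define H where "H = vimage_algebra (space M) (\<lambda>\<omega>. \<lambda>t\<in>{0..}. L t \<omega>) (Pi\<^sub>M {0..} (\<lambda>_. borel :: real measure))"
  have LH: "L t \<in> borel_measurable H" if "t \<ge> 0" for t
  proof -
    have "(\<lambda>\<omega>. \<lambda>t\<in>{0..}. L t \<omega>) \<in> measurable H (Pi\<^sub>M {0..} (\<lambda>_. borel))"
      unfolding H_def by (rule measurable_vimage_algebra1) (auto simp: space_PiM)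
    moreover have "(\<lambda>r. r t) \<in> measurable (Pi\<^sub>M {0..} (\<lambda>_. borel)) (borel :: real measure)"
      using that by (intro measurable_component_singleton) auto
    ultimately have "(\<lambda>\<omega>. (\<lambda>t\<in>{0..}. L t \<omega>) t) \<in> borel_measurable H" by (rule measurable_compose)
    then show ?thesis using that by simp
  qed
  let ?K = "N * Suc m"
  have 1: "indep_vars (\<lambda>_. borel) (case_nat (Y 0) (inc m)) {..?K}"
  proof (rule indep_vars_prepend[OF inc_indep])
    show "inc m i \<in> borel_measurable H" for i
      unfolding inc_def[abs_def] using mesh_pos[of m] by (intro borel_measurable_diff LH) auto
    show "indep_set (sets (vimage_algebra (space M) (Y 0) borel)) (sets H)"
      using OU unfolding stationary_levy_OU_def H_def by blast
  qed (simp_all add: H_def)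
  \<comment> \<open>Index 0 is occupied by \<open>Y 0\<close>, so increment \<open>i\<close> has
    index \<open>Suc i\<close>.\<close>
  define B where "B j = (case j of 0 \<Rightarrow> {0} | Suc k \<Rightarrow> Suc ` {k * Suc m..<k * Suc m + Suc m})" for j
  define g where "g j r = (case j of 0 \<Rightarrow> r 0
     | Suc k \<Rightarrow> \<Sum>i\<in>{k * Suc m..<k * Suc m + Suc m}. exp (- lam * real (Suc k)) * exp (real i * mesh m) * r (Suc i))"
    for j and r :: "nat \<Rightarrow> real"
  have "indep_vars (\<lambda>j. PiM (B j) (\<lambda>_. borel)) (\<lambda>j \<omega>. restrict (\<lambda>i. case_nat (Y 0) (inc m) i \<omega>) (B j)) {..N}"
  proof (rule indep_vars_restrict[OF 1])
    fix j assume "j \<in> {..N}"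
    show "B j \<subseteq> {..?K}"
    proof (cases j)
      case (Suc k)
      then have "Suc k * Suc m \<le> ?K" using \<open>j \<in> {..N}\<close> by (intro mult_le_mono1) auto
      then show ?thesis using Suc by (auto simp: B_def)
    qed (simp add: B_def)
  next
    have disj: "{k * Suc m..<k * Suc m + Suc m} \<inter> {l * Suc m..<l * Suc m + Suc m} = {}" if "k < l" for k l
    proof -
      have "Suc k * Suc m \<le> l * Suc m" using that by (intro mult_le_mono1) auto
      then show ?thesis by auto
    qed
    have "B i \<inter> B j = {}" if "i \<noteq> j" for i j
    proof (cases i; cases j)
      fix k l assume ij: "i = Suc k" "j = Suc l"
      then have "k < l \<or> l < k" using that by auto
      then have "{k * Suc m..<k * Suc m + Suc m} \<inter> {l * Suc m..<l * Suc m + Suc m} = {}"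
        using disj[of k l] disj[of l k] by blast
      then show ?thesis using ij by (simp only: B_def nat.case) (auto simp del: mult_Suc_right)
    qed (use that in \<open>auto simp: B_def\<close>)
    then show "disjoint_family_on B {..N}" by (auto simp: disjoint_family_on_def)
  qed
  then have "indep_vars (\<lambda>_. borel) (\<lambda>j \<omega>. g j (restrict (\<lambda>i. case_nat (Y 0) (inc m) i \<omega>) (B j))) {..N}"
  proof (rule indep_vars_compose2)
    fix j
    show "g j \<in> measurable (PiM (B j) (\<lambda>_. borel)) borel"
    proof (cases j)
      case 0
      then show ?thesis by (simp add: g_def[abs_def] B_def)
    next
      case (Suc k)
      then show ?thesis unfolding g_def[abs_def] B_def
        by (simp only: nat.case) (intro borel_measurable_sum borel_measurable_times borel_measurable_const measurable_component_singleton, auto)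
    qed
  qed
  moreover have "(\<lambda>j \<omega>. g j (restrict (\<lambda>i. case_nat (Y 0) (inc m) i \<omega>) (B j))) = case_nat (Y 0) (approx_innov m)"
    by (intro ext) (auto simp: g_def B_def approx_innov_def split: nat.split intro!: sum.cong simp del: mult_Suc_right of_nat_Suc)
  ultimately show ?thesis by simp
qed

lemma innov_indep: "indep_vars (\<lambda>_. borel) (case_nat (Y 0) innov) UNIV"
proof -
  have N: "indep_vars (\<lambda>_. borel) (case_nat (Y 0) innov) {..N}" for N
  proof (rule indep_vars_limit[OF _ _ approx_innov_indep])
    fix i
    show "case_nat (Y 0) innov i \<in> borel_measurable M" by (cases i) auto
    show "small_in_prob (\<lambda>m \<omega>. case_nat (Y 0) (approx_innov m) i \<omega> - case_nat (Y 0) innov i \<omega>)"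
      by (cases i) (simp_all add: small_in_prob_zero approx_innov_small)
  qed auto
  show ?thesis unfolding indep_vars_def2
  proof (intro conjI ballI)
    show "case_nat (Y 0) innov i \<in> borel_measurable M" for i by (cases i) auto
    show "indep_sets (\<lambda>i. {case_nat (Y 0) innov i -` A \<inter> space M |A. A \<in> sets borel}) UNIV"
      unfolding indep_sets_finite_index_sets[of _ UNIV]
    proof (intro allI impI)
      fix J :: "nat set" assume "finite J"
      then obtain N' where "J \<subseteq> {..<N'}" using finite_nat_bounded by blast
      then have "J \<subseteq> {..N'}" by auto
      then show "indep_sets (\<lambda>i. {case_nat (Y 0) innov i -` A \<inter> space M |A. A \<in> sets borel}) J"
        using N[of N'] unfolding indep_vars_def2 by (blast intro: indep_sets_mono_index)
    qed
  qed
qed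

text \<open>The block number drops out of the right side: the discount factor cancels the offset of
  the block, and increments have the same law everywhere.\<close>

lemma char_approx_innov:
  "(CLINT \<omega>|M. iexp (u * approx_innov m k \<omega>)) = (\<Prod>j<Suc m. \<phi> m (u * exp (- lam + real j * mesh m)))"
proof -
  have "(CLINT \<omega>|M. iexp (u * approx_innov m k \<omega>)) =
     (\<Prod>i\<in>{k * Suc m..<k * Suc m + Suc m}. \<phi> m (u * (exp (- lam * real (Suc k)) * exp (real i * mesh m))))"
    unfolding approx_innov_def by (rule char_lin_inc) simp
  also have "\<dots> = (\<Prod>j<Suc m. \<phi> m (u * exp (- lam + real j * mesh m)))"
  proof (rule prod.reindex_bij_witness[of _ "\<lambda>j. k * Suc m + j" "\<lambda>i. i - k * Suc m"])
    fix i assume "i \<in> {k * Suc m..<k * Suc m + Suc m}"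
    then have "real i * mesh m = real (k * Suc m) * mesh m + real (i - k * Suc m) * mesh m"
      by (simp add: of_nat_diff algebra_simps)
    then have "exp (- lam * real (Suc k)) * exp (real i * mesh m) = exp (- lam + real (i - k * Suc m) * mesh m)"
      unfolding mesh_block by (simp add: algebra_simps flip: exp_add)
    then show "\<phi> m (u * exp (- lam + real (i - k * Suc m) * mesh m)) = \<phi> m (u * (exp (- lam * real (Suc k)) * exp (real i * mesh m)))"
      by simp
  qed auto
  finally show ?thesis .
qed

lemma char_innov_limit:
  "(\<lambda>m. \<Prod>j<Suc m. \<phi> m (u * exp (- lam + real j * mesh m))) \<longlonglongrightarrow> (CLINT \<omega>|M. iexp (u * innov k \<omega>))"
  using char_limit[OF innov_measurable approx_innov_small, of u k] unfolding char_approx_innov .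

lemma char_innov: "(CLINT \<omega>|M. iexp (u * innov k \<omega>)) = (CLINT \<omega>|M. iexp (u * innov 0 \<omega>))"
  by (rule LIMSEQ_unique[OF char_innov_limit char_innov_limit])

text \<open>Within a block the increments are exchangeable in law, so their order may be reversed;
  this turns the decreasing integrand into the increasing one. Both sums use left endpoints, so
  reversal misses by one cell, hence the factor \<open>exp (mesh m)\<close>, which tends to
  1.\<close>

lemma char_backward_riemann:
  "(\<lambda>m. CLINT \<omega>|M. iexp (u * riemann (\<lambda>s. exp (- s)) m N \<omega>)) \<longlonglongrightarrow>
     (\<Prod>k<N. CLINT \<omega>|M. iexp (u * exp (- lam * real k) * innov 0 \<omega>))"
proof -
  have "(CLINT \<omega>|M. iexp (u * riemann (\<lambda>s. exp (- s)) m N \<omega>)) =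
     (\<Prod>k<N. CLINT \<omega>|M. iexp (u * exp (- lam * real k) * (exp (mesh m) * approx_innov m 0 \<omega>)))" for m
  proof -
    have "(CLINT \<omega>|M. iexp (u * riemann (\<lambda>s. exp (- s)) m N \<omega>)) = (\<Prod>i<N * Suc m. \<phi> m (u * exp (- (real i * mesh m))))"
      unfolding riemann_def by (rule char_lin_inc) simp
    also have "\<dots> = (\<Prod>k<N. \<Prod>i\<in>{k * Suc m..<k * Suc m + Suc m}. \<phi> m (u * exp (- (real i * mesh m))))"
      by (rule prod.nat_group[symmetric])
    also have "\<dots> = (\<Prod>k<N. CLINT \<omega>|M. iexp (u * exp (- lam * real k) * (exp (mesh m) * approx_innov m 0 \<omega>)))"
    proof (rule prod.cong[OF refl])
      fix k
      have "(\<Prod>i\<in>{k * Suc m..<k * Suc m + Suc m}. \<phi> m (u * exp (- (real i * mesh m)))) =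
          (\<Prod>j<Suc m. \<phi> m (u * exp (- lam * real k) * exp (mesh m) * exp (- lam + real j * mesh m)))"
      \<comment> \<open>Time reversal inside block \<open>k\<close>: offset \<open>j\<close> is
        exchanged with offset \<open>m - j\<close>.\<close>
      proof (rule prod.reindex_bij_witness[of _ "\<lambda>j. k * Suc m + (m - j)" "\<lambda>i. m - (i - k * Suc m)"])
        fix i assume i: "i \<in> {k * Suc m..<k * Suc m + Suc m}"
        define j where "j = m - (i - k * Suc m)"
        have "real i = real (k * Suc m) + real m - real j"
          using i by (simp add: j_def of_nat_diff algebra_simps)
        then have "real i * mesh m = (real (k * Suc m) + real m - real j) * mesh m" by (simp only:)
        also have "\<dots> = real (k * Suc m) * mesh m + real (Suc m) * mesh m - mesh m - real j * mesh m"
          by (simp add: distrib_right left_diff_distrib del: mult_Suc_right of_nat_mult)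
        also have "real (Suc m) * mesh m = lam" by (simp add: mesh_def)
        finally have "exp (- lam * real k) * exp (mesh m) * exp (- lam + real j * mesh m) = exp (- (real i * mesh m))"
          unfolding mesh_block by (simp add: algebra_simps flip: exp_add)
        then show "\<phi> m (u * exp (- lam * real k) * exp (mesh m) * exp (- lam + real (m - (i - k * Suc m)) * mesh m)) = \<phi> m (u * exp (- (real i * mesh m)))"
          by (simp add: j_def mult.assoc)
      qed auto
      also have "\<dots> = (CLINT \<omega>|M. iexp (u * exp (- lam * real k) * exp (mesh m) * approx_innov m 0 \<omega>))"
        by (rule char_approx_innov[symmetric])
      finally show "(\<Prod>i\<in>{k * Suc m..<k * Suc m + Suc m}. \<phi> m (u * exp (- (real i * mesh m)))) =
          (CLINT \<omega>|M. iexp (u * exp (- lam * real k) * (exp (mesh m) * approx_innov m 0 \<omega>)))"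
        by (simp add: mult.assoc)
    qed
    finally show ?thesis .
  qed
  moreover have "(\<lambda>m. \<Prod>k<N. CLINT \<omega>|M. iexp (u * exp (- lam * real k) * (exp (mesh m) * approx_innov m 0 \<omega>))) \<longlonglongrightarrow>
     (\<Prod>k<N. CLINT \<omega>|M. iexp (u * exp (- lam * real k) * innov 0 \<omega>))"
  proof (intro tendsto_prod char_limit innov_measurable)
    \<comment> \<open>The correction factor is treated in two pieces: applied to the error, where it
      is at most \<open>exp lam\<close>, and its deviation from 1 applied to the innovation.\<close>
    have "small_in_prob (\<lambda>m \<omega>. exp lam * (approx_innov m 0 \<omega> - innov 0 \<omega>))"
      by (intro small_in_prob_cmult approx_innov_small)
    then have 1: "small_in_prob (\<lambda>m \<omega>. exp (mesh m) * (approx_innov m 0 \<omega> - innov 0 \<omega>))"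
    proof (rule small_in_prob_mono)
      fix m \<omega>
      have "mesh m \<le> lam" using lam by (simp add: mesh_def divide_le_eq)
      then show "\<bar>exp (mesh m) * (approx_innov m 0 \<omega> - innov 0 \<omega>)\<bar> \<le> \<bar>exp lam * (approx_innov m 0 \<omega> - innov 0 \<omega>)\<bar>"
        by (simp add: abs_mult mult_right_mono)
    qed measurable
    have "(\<lambda>m. exp (mesh m) - 1) \<longlonglongrightarrow> exp 0 - 1" by (intro tendsto_intros mesh_0)
    then have 2: "small_in_prob (\<lambda>m \<omega>. (exp (mesh m) - 1) * innov 0 \<omega>)"
      by (intro small_in_prob_scale bounded_in_prob_single) auto
    show "small_in_prob (\<lambda>m \<omega>. exp (mesh m) * approx_innov m 0 \<omega> - innov 0 \<omega>)"
      using small_in_prob_add[OF 1 2] by (simp add: algebra_simps)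
  qed
  ultimately show ?thesis by simp
qed

text \<open>The integral up to \<open>lam * N\<close> has two descriptions of its characteristic
  function as a limit of Riemann sums, which identifies it with the finite product. Then
  \<open>N\<close> grows along the integers.\<close>

lemma char_Y0_product:
  "(\<lambda>N. \<Prod>k<N. CLINT \<omega>|M. iexp (u * exp (- lam * real k) * innov 0 \<omega>)) \<longlonglongrightarrow> (CLINT \<omega>|M. iexp (u * Y 0 \<omega>))"
proof -
  obtain X where "has_levy_integral_inf M L (\<lambda>s. exp (- s)) 0 X" and eq: "distr M borel (Y 0) = distr M borel X"
    using OU unfolding stationary_levy_OU_def by blast
  then obtain I where [measurable]: "X \<in> borel_measurable M"
    and I: "\<And>T. T \<ge> 0 \<Longrightarrow> has_levy_integral M L (\<lambda>s. exp (- s)) 0 T (I T)"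
    and lim: "\<And>\<epsilon>. \<epsilon> > 0 \<Longrightarrow> ((\<lambda>T. prob {\<omega> \<in> space M. \<bar>I T \<omega> - X \<omega>\<bar> > \<epsilon>}) \<longlongrightarrow> 0) at_top"
    unfolding has_levy_integral_inf_def by blast
  define J where "J N = I (lam * real N)" for N
  have J: "has_levy_integral M L (\<lambda>s. exp (- s)) 0 (lam * real N) (J N)" for N
    unfolding J_def using lam by (intro I) auto
  have [measurable]: "J N \<in> borel_measurable M" for N using J[of N] by (simp add: has_levy_integral_def)
  have chJ: "(CLINT \<omega>|M. iexp (u * J N \<omega>)) = (\<Prod>k<N. CLINT \<omega>|M. iexp (u * exp (- lam * real k) * innov 0 \<omega>))" for N
    by (rule LIMSEQ_unique[OF char_limit[OF _ riemann_converges[OF J]] char_backward_riemann]) measurable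
  have "small_in_prob (\<lambda>N \<omega>. J N \<omega> - X \<omega>)"
    unfolding small_in_prob_def
  proof (intro conjI allI impI)
    fix \<epsilon> :: real assume "\<epsilon> > 0"
    have "filterlim (\<lambda>N. lam * real N) at_top sequentially"
      by (rule filterlim_tendsto_pos_mult_at_top[OF tendsto_const lam filterlim_real_sequentially])
    from filterlim_compose[OF lim[OF \<open>\<epsilon> > 0\<close>] this]
    show "(\<lambda>N. prob {\<omega> \<in> space M. \<epsilon> < \<bar>J N \<omega> - X \<omega>\<bar>}) \<longlonglongrightarrow> 0" by (simp add: J_def)
  qed measurable
  from char_limit[OF _ this, of u]
  have "(\<lambda>N. CLINT \<omega>|M. iexp (u * J N \<omega>)) \<longlonglongrightarrow> (CLINT \<omega>|M. iexp (u * X \<omega>))" by simp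
  also have "(CLINT \<omega>|M. iexp (u * X \<omega>)) = (CLINT \<omega>|M. iexp (u * Y 0 \<omega>))"
    using arg_cong[OF eq, of "\<lambda>N. char N u"] by (simp add: char_distr_eq)
  finally show ?thesis unfolding chJ .
qed

text \<open>Removing the factor \<open>k = 0\<close> from the infinite product leaves the same
  product at the argument \<open>u * exp (- lam)\<close>.\<close>

lemma char_Y0: "(CLINT \<omega>|M. iexp (u * Y 0 \<omega>)) =
   (CLINT \<omega>|M. iexp (u * innov 0 \<omega>)) * (CLINT \<omega>|M. iexp (u * exp (- lam) * Y 0 \<omega>))"
proof (rule LIMSEQ_unique)
  show "(\<lambda>N. \<Prod>k<Suc N. CLINT \<omega>|M. iexp (u * exp (- lam * real k) * innov 0 \<omega>)) \<longlonglongrightarrow> (CLINT \<omega>|M. iexp (u * Y 0 \<omega>))"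
    by (rule LIMSEQ_Suc[OF char_Y0_product])
  have "(\<Prod>k<Suc N. CLINT \<omega>|M. iexp (u * exp (- lam * real k) * innov 0 \<omega>)) =
    (CLINT \<omega>|M. iexp (u * innov 0 \<omega>)) * (\<Prod>k<N. CLINT \<omega>|M. iexp (u * exp (- lam) * exp (- lam * real k) * innov 0 \<omega>))" for N
    unfolding prod.lessThan_Suc_shift by (simp add: algebra_simps flip: exp_add)
  then show "(\<lambda>N. \<Prod>k<Suc N. CLINT \<omega>|M. iexp (u * exp (- lam * real k) * innov 0 \<omega>)) \<longlonglongrightarrow>
      (CLINT \<omega>|M. iexp (u * innov 0 \<omega>)) * (CLINT \<omega>|M. iexp (u * exp (- lam) * Y 0 \<omega>))"
    using tendsto_mult[OF tendsto_const char_Y0_product[of "u * exp (- lam)"]] by simp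
qed

sublocale chain: ar1 M "\<lambda>k. Y (real k)" innov "exp (- lam)"
  by unfold_locales (simp_all add: innov_def innov_indep)

text \<open>The law of \<open>Y 0\<close> is a fixed point of one step of the recursion by
  \<open>char_Y0\<close>. The induction varies \<open>u\<close> because a step rescales the
  argument.\<close>

lemma Y_stationary: "distr M borel (Y (real k)) = distr M borel (Y 0)"
proof (rule distr_eqI_char)
  show "(CLINT \<omega>|M. iexp (u * Y (real k) \<omega>)) = (CLINT \<omega>|M. iexp (u * Y 0 \<omega>))" for u
  proof (induction k arbitrary: u)
    case (Suc k)
    have "indep_var borel ((\<lambda>r. exp (- lam) * r) \<circ> Y (real k)) borel (id \<circ> innov k)"
      by (rule indep_var_compose[OF chain.past_indep[OF chain.y_past[OF order.refl] order.refl]]) auto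
    then have "indep_var borel (\<lambda>\<omega>. exp (- lam) * Y (real k) \<omega>) borel (innov k)" by (simp add: comp_def)
    from char_distr_add[OF this, of u]
    have "char (distr M borel (\<lambda>\<omega>. exp (- lam) * Y (real k) \<omega> + innov k \<omega>)) u =
       char (distr M borel (\<lambda>\<omega>. exp (- lam) * Y (real k) \<omega>)) u * char (distr M borel (innov k)) u" .
    also have "(\<lambda>\<omega>. exp (- lam) * Y (real k) \<omega> + innov k \<omega>) = Y (real (Suc k))"
      by (simp add: innov_def fun_eq_iff)
    finally have "(CLINT \<omega>|M. iexp (u * Y (real (Suc k)) \<omega>)) =
       (CLINT \<omega>|M. iexp (u * exp (- lam) * Y (real k) \<omega>)) * (CLINT \<omega>|M. iexp (u * innov k \<omega>))"
      by (simp add: char_distr_eq mult.assoc del: of_nat_Suc)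
    then show ?case unfolding Suc.IH[of "u * exp (- lam)"] char_innov[of u k] char_Y0[of u] by (simp add: mult.commute)
  qed simp
qed measurable

lemma innov_stationary: "distr M borel (innov k) = distr M borel (innov 0)"
  by (rule distr_eqI_char) (measurable, rule char_innov)

text \<open>Moments of the innovation become moments of \<open>Y 0\<close> by solving the
  stationarity equations for mean and variance. Square integrability of the innovation is inherited
  from the assumed moment of \<open>Y 0\<close>.\<close>

lemma stationary_ar1:
  assumes trip: "has_levy_triplet M L b c F" and \<mu>: "\<mu> = mean M (L 1)" and \<sigma>: "\<sigma>2 = cov M (L 1) (L 1)" "\<sigma>2 > 0"
    and p: "p > 4" "integrable M (\<lambda>\<omega>. \<bar>Y 0 \<omega>\<bar> powr p)"
  defines "y \<equiv> (\<lambda>k \<omega>. Y (real k) \<omega> - \<mu>)"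
  defines "x \<equiv> (\<lambda>k \<omega>. innov k \<omega> - (1 - exp (- lam)) * \<mu>)"
  shows "stationary_ar1 M y x (exp (- lam)) p" and "expectation (\<lambda>\<omega>. (y 0 \<omega>)\<^sup>2) = \<sigma>2 / 2"
proof -
  have bmY: "bounded_moment p (\<lambda>k. Y (real k))"
  proof (rule bounded_momentI[where G = "\<lambda>k \<omega>. \<bar>Y (real k) \<omega>\<bar> powr p" and C = "expectation (\<lambda>\<omega>. \<bar>Y 0 \<omega>\<bar> powr p)"])
    fix k
    have m[measurable]: "(\<lambda>z::real. \<bar>z\<bar> powr p) \<in> borel_measurable borel" by measurable
    show "integrable M (\<lambda>\<omega>. \<bar>Y (real k) \<omega>\<bar> powr p)"
      using integrable_distr_eq[of "Y (real k)" M borel "\<lambda>z. \<bar>z\<bar> powr p"] integrable_distr_eq[of "Y 0" M borel "\<lambda>z. \<bar>z\<bar> powr p"] p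
      by (simp add: Y_stationary[of k])
    show "expectation (\<lambda>\<omega>. \<bar>Y (real k) \<omega>\<bar> powr p) \<le> expectation (\<lambda>\<omega>. \<bar>Y 0 \<omega>\<bar> powr p)"
      using integral_distr[of "Y (real k)" M borel "\<lambda>z. \<bar>z\<bar> powr p"] integral_distr[of "Y 0" M borel "\<lambda>z. \<bar>z\<bar> powr p"]
      by (simp add: Y_stationary[of k])
  qed auto
  have bounded_moment_2: "bounded_moment 2 (\<lambda>k. Y (real k))" by (rule bounded_moment_mono[OF _ _ bmY]) (use p in auto)
  have iY: "integrable M (Y (real k))" for k using bounded_moment_integrable[OF _ bounded_moment_2, of k] by simp
  have bmi: "bounded_moment 2 innov"
    unfolding innov_def[abs_def]
    by (intro bounded_moment_diff bounded_moment_cmult bounded_moment_2 bounded_moment_shift[OF bounded_moment_2, where f = Suc]) simp_all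
  have lim: "(\<lambda>m. \<Prod>j<Suc m. exp (complex_of_real (lam / real (Suc m)) * levy_exponent b c F (u * exp (- lam + real j * (lam / real (Suc m))))))
       \<longlonglongrightarrow> (CLINT \<omega>|M. iexp (u * innov 0 \<omega>))" for u
  proof -
    have "\<phi> m w = exp (complex_of_real (mesh m) * levy_exponent b c F w)" for m w
      using trip mesh_pos[of m] by (simp add: \<phi>_def has_levy_triplet_def)
    then show ?thesis using char_innov_limit[of u 0] unfolding mesh_def by simp
  qed
  have L1: "L 1 \<in> borel_measurable M" by (rule L_measurable) simp
  have exp: "((\<lambda>u. (levy_exponent b c F u - \<i> * complex_of_real (\<mu> * u)) / complex_of_real (u\<^sup>2)) \<longlongrightarrow> complex_of_real (- (\<sigma>2 / 2))) (at 0)"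
    by (rule levy_exponent_expansion[OF prob_space_axioms L1 trip \<mu> \<sigma>])
  have i2: "integrable M (\<lambda>\<omega>. (innov 0 \<omega>)\<^sup>2)" by (rule bounded_moment_integrable_power2[OF bmi])
  have im: "expectation (innov 0) = \<mu> * (1 - exp (- lam))"
    "expectation (\<lambda>\<omega>. (innov 0 \<omega> - \<mu> * (1 - exp (- lam)))\<^sup>2) = \<sigma>2 * (1 - exp (- 2 * lam)) / 2"
    by (rule innovation_moments[where \<psi> = "levy_exponent b c F", OF lam \<sigma>(2) exp levy_exponent_0 innov_measurable i2 lim])+
  have EY: "expectation (Y (real k)) = expectation (Y 0)" for k
  proof -
    have "expectation (Y (real k)) = (\<integral>z. z \<partial>distr M borel (Y (real k)))"
      by (rule integral_distr[symmetric]) auto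
    also have "\<dots> = (\<integral>z. z \<partial>distr M borel (Y 0))" unfolding Y_stationary ..
    also have "\<dots> = expectation (Y 0)" by (rule integral_distr) auto
    finally show ?thesis .
  qed
  \<comment> \<open>Stationarity turns this into a linear equation for the mean with nonzero
    coefficient \<open>1 - exp (- lam)\<close>.\<close>
  have "expectation (innov 0) = expectation (Y (real 1)) - exp (- lam) * expectation (Y (real 0))"
    unfolding innov_def[abs_def] using iY[of 0] iY[of 1] by simp
  then have "expectation (Y 0) * (1 - exp (- lam)) = \<mu> * (1 - exp (- lam))"
    unfolding im(1) EY by (simp add: algebra_simps)
  then have EY0: "expectation (Y 0) = \<mu>" using lam by simp
  show ar: "stationary_ar1 M y x (exp (- lam)) p"
  proof
    show "y (Suc k) \<omega> = exp (- lam) * y k \<omega> + x k \<omega>" for k \<omega>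
      by (simp add: y_def x_def innov_def algebra_simps)
    define sh where "sh i = (case i of 0 \<Rightarrow> \<mu> | Suc _ \<Rightarrow> (1 - exp (- lam)) * \<mu>)" for i :: nat
    have "indep_vars (\<lambda>_. borel) (\<lambda>i \<omega>. case_nat (Y 0) innov i \<omega> - sh i) UNIV"
      by (rule indep_vars_compose2[OF innov_indep, where Y = "\<lambda>i r. r - sh i"]) simp
    moreover have "(\<lambda>i \<omega>. case_nat (Y 0) innov i \<omega> - sh i) = case_nat (y 0) x"
      by (intro ext) (auto simp: y_def x_def sh_def split: nat.split)
    ultimately show "indep_vars (\<lambda>_. borel) (case_nat (y 0) x) UNIV" by simp
    show "distr M borel (y k) = distr M borel (y 0)" for k
      unfolding y_def using Y_stationary[of k] by (intro distr_shift) simp_all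
    show "distr M borel (x k) = distr M borel (x 0)" for k
      unfolding x_def by (intro distr_shift innov_stationary innov_measurable)
    show "expectation (y 0) = 0" using iY[of 0] EY0 by (simp add: y_def prob_space)
    have "bounded_moment p (\<lambda>k \<omega>. Y (real k) \<omega> - \<mu>)"
      by (intro bounded_moment_diff bmY bounded_moment_const) (use p in simp)
    then show "integrable M (\<lambda>\<omega>. \<bar>y 0 \<omega>\<bar> powr p)" unfolding bounded_moment_def y_def by blast
  qed (use p lam in auto)
  interpret S: stationary_ar1 M y x "exp (- lam)" p by (rule ar)
  \<comment> \<open>The same for the variance: the innovation variance equals
    \<open>1 - exp (- 2 * lam)\<close> times the stationary one.\<close>
  have "S.v = expectation (\<lambda>\<omega>. (x 0 \<omega>)\<^sup>2)" using S.moments(8)[of 0] by simp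
  also have "\<dots> = \<sigma>2 * (1 - exp (- 2 * lam)) / 2" using im(2) by (simp add: x_def mult.commute)
  finally have "(1 - exp (- 2 * lam)) * S.\<gamma>0 = (1 - exp (- 2 * lam)) * (\<sigma>2 / 2)"
    unfolding S.v_def by (simp add: exp_double[symmetric])
  then show "expectation (\<lambda>\<omega>. (y 0 \<omega>)\<^sup>2) = \<sigma>2 / 2" using lam by (simp add: S.\<gamma>0_def)
qed

end

section \<open>The delta method\<close>

lemma vec3_measurable:
  fixes f :: "'a \<Rightarrow> real^3"
  assumes "\<And>j. (\<lambda>\<omega>. f \<omega> $ j) \<in> borel_measurable N"
  shows "f \<in> borel_measurable N"
  unfolding borel_measurable_euclidean_space[of f]
proof
  fix b :: "real^3" assume "b \<in> Basis"
  then obtain j where "b = axis j 1" by (auto simp: Basis_vec_def)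
  then show "(\<lambda>\<omega>. f \<omega> \<bullet> b) \<in> borel_measurable N" using assms[of j] by (simp add: inner_axis)
qed

context prob_space
begin

lemma bounded_in_prob_mono:
  assumes X: "bounded_in_prob X" and m: "\<And>n. Y n \<in> borel_measurable M"
    and le: "\<And>n \<omega>. \<omega> \<in> space M \<Longrightarrow> \<bar>Y n \<omega>\<bar> \<le> \<bar>X n \<omega>\<bar>"
  shows "bounded_in_prob Y"
  unfolding bounded_in_prob_def
proof (intro conjI allI impI m)
  note [measurable] = bounded_in_prob_measurable[OF X] m
  fix \<eta> :: real assume "\<eta> > 0"
  then obtain R where R: "R > 0" "\<forall>\<^sub>F n in sequentially. prob {\<omega> \<in> space M. R < \<bar>X n \<omega>\<bar>} \<le> \<eta>"
    using X unfolding bounded_in_prob_def by blast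
  have "prob {\<omega> \<in> space M. R < \<bar>Y n \<omega>\<bar>} \<le> prob {\<omega> \<in> space M. R < \<bar>X n \<omega>\<bar>}" for n
  proof (rule finite_measure_mono)
    show "{\<omega> \<in> space M. R < \<bar>Y n \<omega>\<bar>} \<subseteq> {\<omega> \<in> space M. R < \<bar>X n \<omega>\<bar>}"
      using le[of _ n] by (auto intro: less_le_trans)
  qed measurable
  with R show "\<exists>R>0. \<forall>\<^sub>F n in sequentially. prob {\<omega> \<in> space M. R < \<bar>Y n \<omega>\<bar>} \<le> \<eta>"
    by (intro exI[of _ R]) (auto elim!: eventually_mono intro: order.trans)
qed

lemma bounded_in_prob_abs: "bounded_in_prob X \<Longrightarrow> bounded_in_prob (\<lambda>n \<omega>. \<bar>X n \<omega>\<bar>)"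
  by (rule bounded_in_prob_mono[of X], assumption, rule borel_measurable_abs, erule bounded_in_prob_measurable, simp)

lemma small_in_prob_abs: "small_in_prob X \<Longrightarrow> small_in_prob (\<lambda>n \<omega>. \<bar>X n \<omega>\<bar>)"
  by (rule small_in_prob_mono[of X _ 0], assumption, rule borel_measurable_abs, erule small_in_prob_measurable, simp)

lemma bounded_in_prob_bounded_moment: "bounded_moment 2 X \<Longrightarrow> bounded_in_prob X"
  using bounded_moment_2D[of X] by (auto intro!: bounded_in_prob_L2 bounded_moment_measurable)

end

locale levy_OU_estimation = levy_OU +
  fixes \<mu> \<sigma>2 p :: real and d :: nat and lamhat :: "nat \<Rightarrow> 'a \<Rightarrow> real" and y x :: "nat \<Rightarrow> 'a \<Rightarrow> real"
  assumes ar: "stationary_ar1 M y x (exp (- lam)) p"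
    and y: "y = (\<lambda>k \<omega>. Y (real k) \<omega> - \<mu>)"
    and var: "expectation (\<lambda>\<omega>. (y 0 \<omega>)\<^sup>2) = \<sigma>2 / 2"
    and \<sigma>2: "\<sigma>2 > 0" and d: "d \<ge> 1" and lamhat: "is_lambda2_hat M Y d lamhat"
begin

sublocale S: stationary_ar1 M y x "exp (- lam)" p by (rule ar)

lemma y_fun: "y k = (\<lambda>\<omega>. Y (real k) \<omega> - \<mu>)" and y_app: "y k \<omega> = Y (real k) \<omega> - \<mu>"
  by (simp_all add: y)

lemma \<gamma>0: "S.\<gamma>0 = \<sigma>2 / 2" "S.\<gamma>0 > 0" using var \<sigma>2 by (auto simp: S.\<gamma>0_def)

lemma exp_power: "exp (- lam) ^ h = exp (- lam * real h)"
  by (simp add: exp_of_nat_mult[symmetric] mult.commute)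

lemma mean_Y: "mean M (Y (real k)) = \<mu>"
proof -
  have "expectation (\<lambda>\<omega>. Y (real k) \<omega> - \<mu>) = 0" "integrable M (\<lambda>\<omega>. Y (real k) \<omega> - \<mu>)"
    using S.moments(1,5)[of k] by (simp_all add: y_fun)
  moreover have "integrable M (\<lambda>\<omega>. (Y (real k) \<omega> - \<mu>) + \<mu>)" using calculation(2) by (intro Bochner_Integration.integrable_add) simp_all
  ultimately show ?thesis by (simp add: mean_def prob_space)
qed

lemma OU_point_Suc: "OU_point M Y \<mu> (Suc h) = \<sigma>2 / 2 * exp (- lam * real h)"
proof -
  have "cov M (Y (real h)) (Y 0) = expectation (\<lambda>\<omega>. y (0 + h) \<omega> * y 0 \<omega>)"
    unfolding cov_def mean_Y using mean_Y[of 0] by (simp add: y_app)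
  also have "\<dots> = \<sigma>2 / 2 * exp (- lam * real h)" unfolding S.expectation_yy \<gamma>0 exp_power ..
  finally show ?thesis by (simp add: OU_point_def)
qed

lemma Z_vec_centred: "Z_vec Y \<mu> i k \<omega> - mean M (Z_vec Y \<mu> i k) = S.\<zeta> k i \<omega>"
proof (cases k)
  case 0
  then have "Z_vec Y \<mu> i k = Y (real i)" by (simp add: Z_vec_def fun_eq_iff)
  then show ?thesis using mean_Y[of i] 0 by (simp add: S.\<zeta>_def y_app)
next
  case (Suc h)
  then have Z: "Z_vec Y \<mu> i k = (\<lambda>\<omega>. y (i + h) \<omega> * y i \<omega>)" by (simp add: Z_vec_def y_app fun_eq_iff)
  show ?thesis unfolding Z mean_def S.expectation_yy using Suc by (simp add: S.\<zeta>_def)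
qed

lemma Sigma_mat_eq: "Sigma_mat M Y \<mu> k l = S.long_run_cov k l"
  unfolding Sigma_mat_def S.long_run_cov_def cov_def Z_vec_centred by simp

definition T :: "nat \<Rightarrow> nat \<Rightarrow> 'a \<Rightarrow> real" where "T k n \<omega> = (\<Sum>i=1..n. S.\<zeta> k i \<omega>) / sqrt n"

lemma linear_combination_T:
  "(\<Sum>k<m. b k * T k n \<omega>) = (\<Sum>i=1..n. \<Sum>k<m. b k * S.\<zeta> k i \<omega>) / sqrt n"
  unfolding T_def by (subst sum.swap) (simp add: sum_distrib_left sum_divide_distrib)

text \<open>A single component is a linear combination with unit weight; the central limit theorem
  is used with maximal lag \<open>k\<close>, so no bound on \<open>k\<close> is needed.\<close>

lemma T_bounded: "bounded_in_prob (T k)"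
proof -
  define b where "b l = (if l = k then 1 else 0 :: real)" for l
  have e: "(\<Sum>l<k + 2. b l * f l) = f k" for f :: "nat \<Rightarrow> real"
  proof -
    have "(\<Sum>l<k + 2. b l * f l) = (\<Sum>l<k + 2. if l = k then f l else 0)" by (rule sum.cong) (auto simp: b_def)
    then show ?thesis by simp
  qed
  have "bounded_moment 2 (\<lambda>n \<omega>. \<Sum>l<k + 2. b l * T l n \<omega>)"
    unfolding linear_combination_T by (rule S.linear_combination_CLT(3))
  then have "bounded_moment 2 (T k)" by (simp only: e)
  then show ?thesis by (rule bounded_in_prob_bounded_moment)
qed

lemma T_measurable[measurable]: "T k n \<in> borel_measurable M"
  by (rule bounded_in_prob_measurable[OF T_bounded])

lemma mu_hat_measurable[measurable]: "mu_hat Y n \<in> borel_measurable M"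
  unfolding mu_hat_def[abs_def] by measurable

lemma gamma_hat_measurable[measurable]: "gamma_hat Y n h \<in> borel_measurable M"
  unfolding gamma_hat_def[abs_def] by measurable

lemma rho_hat_measurable[measurable]: "rho_hat Y n h \<in> borel_measurable M"
  unfolding rho_hat_def[abs_def] by measurable

lemma mu_hat_T: "sqrt n * (mu_hat Y n \<omega> - \<mu>) = T 0 n \<omega>"
proof (cases "n = 0")
  case False
  have "mu_hat Y n \<omega> - \<mu> = (\<Sum>i=1..n. y i \<omega>) / n"
    using False by (simp add: mu_hat_def y_app sum_subtractf field_simps)
  then have "sqrt n * (mu_hat Y n \<omega> - \<mu>) = (sqrt n / n) * (\<Sum>i=1..n. y i \<omega>)" by simp
  also have "sqrt n / n = 1 / sqrt n" using False by (simp add: real_div_sqrt field_simps)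
  finally show ?thesis by (simp add: T_def S.\<zeta>_def)
qed (simp add: T_def)

definition G :: "nat \<Rightarrow> nat \<Rightarrow> 'a \<Rightarrow> real" where
  "G h n \<omega> = sqrt n * (gamma_hat Y n h \<omega> - S.\<gamma>0 * exp (- lam * real h))"

lemma inv_sqrt: "(\<lambda>n. 1 / sqrt (real n)) \<longlonglongrightarrow> 0"
  by (intro tendsto_divide_0[OF tendsto_const] filterlim_at_top_imp_at_infinity
      filterlim_compose[OF sqrt_at_top] filterlim_real_sequentially)

text \<open>An exact identity. Replacing the sample mean by \<open>\<mu>\<close> and completing the
  sum to \<open>n\<close> products costs only edge sums of \<open>h\<close> terms and multiples of
  the squared sample mean error.\<close>

lemma G_expand:
  assumes n: "n \<ge> h" "n \<ge> 1"
  shows "G h n \<omega> - T (Suc h) n \<omega> =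
     (T 0 n \<omega> * (1 / n * ((\<Sum>m<h. y (n - m) \<omega>) + (\<Sum>i=1..h. y i \<omega>))) - real h * (1 / n * (1 / sqrt n * (T 0 n \<omega>)\<^sup>2)))
      - (1 / sqrt n * (\<Sum>m<h. y (n - m + h) \<omega> * y (n - m) \<omega>) + 1 / sqrt n * (T 0 n \<omega>)\<^sup>2)"
proof -
  define r where "r = sqrt n"
  have r: "r > 0" "real n = r * r" using n by (auto simp: r_def)
  then have rr: "sqrt (r * r) = r" by simp
  define s where "s = mu_hat Y n \<omega> - \<mu>"
  have T0: "T 0 n \<omega> = r * s" using mu_hat_T[of n \<omega>] by (simp add: r_def s_def)
  have split: "(\<Sum>i=1..n. f i) = (\<Sum>i=1..n-h. f i) + (\<Sum>m<h. f (n - m))" for f :: "nat \<Rightarrow> real"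
  proof -
    have "{1..n} = {1..n-h} \<union> {n-h<..n}" using n by auto
    moreover have "{1..n-h} \<inter> {n-h<..n} = {}" by auto
    ultimately have "(\<Sum>i=1..n. f i) = (\<Sum>i=1..n-h. f i) + (\<Sum>i\<in>{n-h<..n}. f i)"
      by (simp add: sum.union_disjoint)
    also have "(\<Sum>i\<in>{n-h<..n}. f i) = (\<Sum>m<h. f (n - m))"
      by (rule sum.reindex_bij_witness[of _ "\<lambda>m. n - m" "\<lambda>i. n - i"]) (use n in auto)
    finally show ?thesis .
  qed
  have shift: "(\<Sum>i=1..n-h. y (i + h) \<omega>) = (\<Sum>i=1..n. y i \<omega>) - (\<Sum>i=1..h. y i \<omega>)"
  proof -
    have "{1..n} = {1..h} \<union> {h<..n}" "{1..h} \<inter> {h<..n} = {}" using n by auto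
    then have "(\<Sum>i=1..n. y i \<omega>) = (\<Sum>i=1..h. y i \<omega>) + (\<Sum>i\<in>{h<..n}. y i \<omega>)"
      by (simp add: sum.union_disjoint)
    also have "(\<Sum>i\<in>{h<..n}. y i \<omega>) = (\<Sum>i=1..n-h. y (i + h) \<omega>)"
      by (rule sum.reindex_bij_witness[of _ "\<lambda>i. i + h" "\<lambda>i. i - h"]) (use n in auto)
    finally show ?thesis by simp
  qed
  have tot: "(\<Sum>i=1..n. y i \<omega>) = real n * s"
    using n by (simp add: s_def mu_hat_def y_app sum_subtractf field_simps)
  have tot': "(\<Sum>i=1..n-h. y i \<omega>) = real n * s - (\<Sum>m<h. y (n - m) \<omega>)"
    using split[of "\<lambda>i. y i \<omega>"] tot by simp
  have "real n * gamma_hat Y n h \<omega> = (\<Sum>i=1..n-h. (y (i + h) \<omega> - s) * (y i \<omega> - s))"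
    using n by (simp add: gamma_hat_def y_app s_def)
  also have "\<dots> = (\<Sum>i=1..n-h. y (i + h) \<omega> * y i \<omega>) - s * ((\<Sum>i=1..n-h. y (i + h) \<omega>) + (\<Sum>i=1..n-h. y i \<omega>)) + real (n - h) * (s * s)"
    by (simp add: algebra_simps sum.distrib sum_subtractf sum_distrib_left sum_distrib_right)
  also have "(\<Sum>i=1..n-h. y (i + h) \<omega> * y i \<omega>) = (\<Sum>i=1..n. y (i + h) \<omega> * y i \<omega>) - (\<Sum>m<h. y (n - m + h) \<omega> * y (n - m) \<omega>)"
    using split[of "\<lambda>i. y (i + h) \<omega> * y i \<omega>"] by simp
  also have "(\<Sum>i=1..n. y (i + h) \<omega> * y i \<omega>) = r * T (Suc h) n \<omega> + real n * (S.\<gamma>0 * exp (- lam * real h))"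
    using r by (simp add: T_def r_def[symmetric] S.\<zeta>_def sum_subtractf exp_power)
  finally have key: "real n * gamma_hat Y n h \<omega> = r * T (Suc h) n \<omega> + real n * (S.\<gamma>0 * exp (- lam * real h))
     - (\<Sum>m<h. y (n - m + h) \<omega> * y (n - m) \<omega>)
     - s * (2 * (real n * s) - ((\<Sum>m<h. y (n - m) \<omega>) + (\<Sum>i=1..h. y i \<omega>))) + (real n - real h) * (s * s)"
    unfolding shift tot tot' using n by (simp add: of_nat_diff algebra_simps)
  define E where "E = (\<Sum>m<h. y (n - m) \<omega>) + (\<Sum>i=1..h. y i \<omega>)"
  define P where "P = (\<Sum>m<h. y (n - m + h) \<omega> * y (n - m) \<omega>)"
  define g where "g = gamma_hat Y n h \<omega> - S.\<gamma>0 * exp (- lam * real h)"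
  define t where "t = T (Suc h) n \<omega>"
  have "r * r * g = r * t - P - s * (2 * (r * r * s) - E) + (r * r - real h) * (s * s)"
    using key unfolding E_def[symmetric] P_def[symmetric] t_def[symmetric] r(2) g_def by (simp add: algebra_simps)
  then have "r * (r * g - t) = s * E - real h * (s * s) - P - r * r * (s * s)"
    by (simp add: algebra_simps)
  then have "r * g - t = (s * E - real h * (s * s) - P - r * r * (s * s)) / r"
    using r by (simp add: field_simps)
  also have "\<dots> = (r * s * (1 / (r * r) * E) - real h * (1 / (r * r) * (1 / r * (r * s)\<^sup>2))) - (1 / r * P + 1 / r * (r * s)\<^sup>2)"
    using r(1) by (simp add: field_simps power2_eq_square)
  finally show ?thesis
    unfolding G_def T0 E_def[symmetric] P_def[symmetric] g_def[symmetric] t_def[symmetric] r(2) rr .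
qed

text \<open>Every term of \<open>G_expand\<close> is a tight sequence times \<open>1 / n\<close> or
  \<open>1 / sqrt n\<close>; the edge sums are tight because their number of terms does not
  grow.\<close>

lemma G_T_small: "small_in_prob (\<lambda>n \<omega>. G h n \<omega> - T (Suc h) n \<omega>)"
proof -
  have bE: "bounded_in_prob (\<lambda>n \<omega>. (\<Sum>m<h. y (n - m) \<omega>) + (\<Sum>i=1..h. y i \<omega>))"
    by (intro bounded_in_prob_bounded_moment bounded_moment_add bounded_moment_sum S.bounded_moment_shifts) (use S.p in auto)
  have bP: "bounded_in_prob (\<lambda>n \<omega>. \<Sum>m<h. y (n - m + h) \<omega> * y (n - m) \<omega>)"
    by (intro bounded_in_prob_bounded_moment bounded_moment_sum S.bounded_moment_products) (use S.p in auto)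
  have bT2: "bounded_in_prob (\<lambda>n \<omega>. (T 0 n \<omega>)\<^sup>2)"
    unfolding power2_eq_square by (intro bounded_in_prob_mult T_bounded)
  have inv_n: "(\<lambda>n. 1 / real n) \<longlonglongrightarrow> 0" by (rule lim_const_over_n)
  have s1: "small_in_prob (\<lambda>n \<omega>. T 0 n \<omega> * (1 / n * ((\<Sum>m<h. y (n - m) \<omega>) + (\<Sum>i=1..h. y i \<omega>))))"
    using small_in_prob_mult[OF small_in_prob_scale[OF bE inv_n] T_bounded[of 0]] by (simp only: mult.commute)
  have s2: "small_in_prob (\<lambda>n \<omega>. real h * (1 / n * (1 / sqrt n * (T 0 n \<omega>)\<^sup>2)))"
    by (intro small_in_prob_cmult small_in_prob_scale[OF small_imp_bounded_in_prob inv_n] small_in_prob_scale[OF bT2 inv_sqrt])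
  have s3: "small_in_prob (\<lambda>n \<omega>. 1 / sqrt n * (\<Sum>m<h. y (n - m + h) \<omega> * y (n - m) \<omega>) + 1 / sqrt n * (T 0 n \<omega>)\<^sup>2)"
    by (intro small_in_prob_add small_in_prob_scale[OF bP inv_sqrt] small_in_prob_scale[OF bT2 inv_sqrt])
  have [measurable]: "G h n \<in> borel_measurable M" for n unfolding G_def[abs_def] by measurable
  show ?thesis
    by (rule small_in_prob_mono[OF small_in_prob_diff[OF small_in_prob_diff[OF s1 s2] s3], of _ "max h 1"])
       (measurable, simp add: G_expand)
qed

lemma G_bounded: "bounded_in_prob (G h)"
  using bounded_in_prob_add[OF small_imp_bounded_in_prob[OF G_T_small[of h]] T_bounded[of "Suc h"]]
  by (simp add: bounded_in_prob_def)

lemma G_measurable[measurable]: "G h n \<in> borel_measurable M"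
  by (rule bounded_in_prob_measurable[OF G_bounded])

lemma gamma_hat_consistent: "small_in_prob (\<lambda>n \<omega>. gamma_hat Y n 0 \<omega> - S.\<gamma>0)"
  by (rule small_in_prob_mono[OF small_in_prob_scale[OF G_bounded[of 0] inv_sqrt], of _ 1])
     (measurable, simp add: G_def)

definition R :: "nat \<Rightarrow> nat \<Rightarrow> 'a \<Rightarrow> real" where
  "R h n \<omega> = sqrt n * (rho_hat Y n h \<omega> - exp (- lam * real h))"

lemma R_measurable[measurable]: "R h n \<in> borel_measurable M"
  unfolding R_def[abs_def] by measurable

text \<open>While the sample variance stays positive, \<open>R\<close> is exactly the linear
  numerator divided by the sample variance. Replacing that divisor by its limit costs a small factor
  times a tight one.\<close>

lemma R_G_small: "small_in_prob (\<lambda>n \<omega>. R h n \<omega> - (G h n \<omega> - exp (- lam * real h) * G 0 n \<omega>) / S.\<gamma>0)"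
proof (rule small_in_prob_dominated[OF _ gamma_hat_consistent, where r = "S.\<gamma>0 / 2"])
  have "bounded_in_prob (\<lambda>n \<omega>. G h n \<omega> + (- exp (- lam * real h)) * G 0 n \<omega>)"
    by (intro bounded_in_prob_add bounded_in_prob_mult[OF bounded_in_prob_const] G_bounded)
  then have "bounded_in_prob (\<lambda>n \<omega>. G h n \<omega> - exp (- lam * real h) * G 0 n \<omega>)" by simp
  then show "small_in_prob (\<lambda>n \<omega>. (1 / gamma_hat Y n 0 \<omega> - 1 / S.\<gamma>0) * (G h n \<omega> - exp (- lam * real h) * G 0 n \<omega>))"
    by (intro small_in_prob_mult small_in_prob_inverse gamma_hat_consistent \<gamma>0)
next
  fix n \<omega> assume "\<bar>gamma_hat Y n 0 \<omega> - S.\<gamma>0\<bar> \<le> S.\<gamma>0 / 2"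
  then have g: "gamma_hat Y n 0 \<omega> > 0" using \<gamma>0(2) by linarith
  have q: "rho_hat Y n h \<omega> - exp (- lam * real h) =
     ((gamma_hat Y n h \<omega> - S.\<gamma>0 * exp (- lam * real h)) - exp (- lam * real h) * (gamma_hat Y n 0 \<omega> - S.\<gamma>0)) * (1 / gamma_hat Y n 0 \<omega>)"
    using g by (simp add: rho_hat_def field_simps)
  have Req: "R h n \<omega> = (G h n \<omega> - exp (- lam * real h) * G 0 n \<omega>) * (1 / gamma_hat Y n 0 \<omega>)"
    unfolding R_def q G_def by (simp add: algebra_simps)
  have factor: "z * (1 / t) - z / c = (1 / t - 1 / c) * z" for z t c :: real
    by (simp add: left_diff_distrib)
  show "\<bar>R h n \<omega> - (G h n \<omega> - exp (- lam * real h) * G 0 n \<omega>) / S.\<gamma>0\<bar> \<le>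
     \<bar>(1 / gamma_hat Y n 0 \<omega> - 1 / S.\<gamma>0) * (G h n \<omega> - exp (- lam * real h) * G 0 n \<omega>)\<bar>"
    unfolding Req factor ..
qed (use \<gamma>0 in \<open>simp_all\<close>)

lemma R_T_small: "small_in_prob (\<lambda>n \<omega>. R h n \<omega> - (T (Suc h) n \<omega> - exp (- lam * real h) * T 1 n \<omega>) / S.\<gamma>0)"
proof -
  have "small_in_prob (\<lambda>n \<omega>. 1 / S.\<gamma>0 * ((G h n \<omega> - T (Suc h) n \<omega>) - exp (- lam * real h) * (G 0 n \<omega> - T (Suc 0) n \<omega>)))"
    by (intro small_in_prob_cmult small_in_prob_diff G_T_small)
  from small_in_prob_add[OF R_G_small[of h] this] show ?thesis
    by (simp add: algebra_simps diff_divide_distrib add_divide_distrib)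
qed

lemma R_bounded: "bounded_in_prob (R h)"
proof -
  have "bounded_in_prob (\<lambda>n \<omega>. (R h n \<omega> - (T (Suc h) n \<omega> - exp (- lam * real h) * T 1 n \<omega>) / S.\<gamma>0)
     + 1 / S.\<gamma>0 * (T (Suc h) n \<omega> + (- exp (- lam * real h)) * T 1 n \<omega>))"
    by (intro bounded_in_prob_add small_imp_bounded_in_prob[OF R_T_small] bounded_in_prob_mult[OF bounded_in_prob_const] T_bounded)
  then show ?thesis by (simp add: bounded_in_prob_def)
qed

lemma lamhat_measurable[measurable]: "lamhat n \<in> borel_measurable M"
  using lamhat by (simp add: is_lambda2_hat_def)

text \<open>With small deviations a minimizer exists and is positive, so \<open>lamhat\<close> is
  one of the minimizers covered by the expansion; elsewhere its value is arbitrary, on an event of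
  vanishing probability. The quadratic remainder times \<open>sqrt n\<close> is one small and one
  tight factor.\<close>

lemma lamhat_R_small:
  "small_in_prob (\<lambda>n \<omega>. sqrt n * (lamhat n \<omega> - lam) - (\<Sum>h=1..d. acf_weight lam d h * R h n \<omega>))"
proof -
  obtain r C where r: "r > 0" and C: "C \<ge> 0" and
    exp': "\<forall>\<rho> \<eta>. (\<forall>h\<in>{1..d}. \<bar>\<rho> h - exp (- lam * real h)\<bar> \<le> \<eta>) \<longrightarrow> \<eta> \<le> r \<longrightarrow>
    (\<exists>l. is_arg_min (acf_error d \<rho>) (\<lambda>_. True) l) \<and>
    (\<forall>l. is_arg_min (acf_error d \<rho>) (\<lambda>_. True) l \<longrightarrow> l > 0 \<and>
       \<bar>l - lam - (\<Sum>h=1..d. acf_weight lam d h * (\<rho> h - exp (- lam * real h)))\<bar> \<le> C * \<eta>\<^sup>2)"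
    using acf_error_argmin_expansion[OF lam d] by (elim exE conjE) (rule that)
  note exp = exp'[THEN spec, THEN spec, THEN mp, THEN mp]
  define \<eta> where "\<eta> n \<omega> = (\<Sum>h=1..d. \<bar>rho_hat Y n h \<omega> - exp (- lam * real h)\<bar>)" for n \<omega>
  have bnd: "bounded_in_prob (\<lambda>n \<omega>. \<Sum>h=1..d. \<bar>R h n \<omega>\<bar>)"
    by (intro bounded_in_prob_sum bounded_in_prob_abs R_bounded)
  have sq: "(\<Sum>h=1..d. \<bar>R h n \<omega>\<bar>) = sqrt n * \<eta> n \<omega>" for n \<omega>
    by (simp add: R_def \<eta>_def abs_mult sum_distrib_left)
  have \<eta>: "small_in_prob \<eta>"
  proof (rule small_in_prob_mono[OF small_in_prob_scale[OF bnd inv_sqrt], of _ 1])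
    show "\<eta> n \<in> borel_measurable M" for n unfolding \<eta>_def[abs_def] by measurable
  qed (unfold sq, simp)
  show ?thesis
  proof (rule small_in_prob_dominated[OF _ \<eta> r])
    show "small_in_prob (\<lambda>n \<omega>. C * (\<eta> n \<omega> * (\<Sum>h=1..d. \<bar>R h n \<omega>\<bar>)))"
      by (intro small_in_prob_cmult small_in_prob_mult \<eta> bnd)
    fix n \<omega> assume "\<omega> \<in> space M" "\<bar>\<eta> n \<omega>\<bar> \<le> r"
    have *: "\<forall>h\<in>{1..d}. \<bar>rho_hat Y n h \<omega> - exp (- lam * real h)\<bar> \<le> \<eta> n \<omega>"
    proof
      fix h assume h: "h \<in> {1..d}"
      show "\<bar>rho_hat Y n h \<omega> - exp (- lam * real h)\<bar> \<le> \<eta> n \<omega>"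
        unfolding \<eta>_def by (rule member_le_sum[of h _ "\<lambda>h. \<bar>rho_hat Y n h \<omega> - exp (- lam * real h)\<bar>"]) (use h in auto)
    qed
    have "\<eta> n \<omega> \<le> r" using \<open>\<bar>\<eta> n \<omega>\<bar> \<le> r\<close> by simp
    note e = exp[OF * this]
    have "(\<exists>l. is_arg_min (acf_error d (\<lambda>h. rho_hat Y n h \<omega>)) (\<lambda>_. True) l) \<longrightarrow>
        (\<exists>l. is_arg_min (acf_error d (\<lambda>h. rho_hat Y n h \<omega>)) (\<lambda>_. True) l \<and> lamhat n \<omega> = (if l < 0 then 0 else l))"
      using lamhat \<open>\<omega> \<in> space M\<close> unfolding is_lambda2_hat_def Let_def acf_error_def[abs_def] by blast
    then obtain l where l: "is_arg_min (acf_error d (\<lambda>h. rho_hat Y n h \<omega>)) (\<lambda>_. True) l" "lamhat n \<omega> = (if l < 0 then 0 else l)"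
      using e by blast
    then have "l > 0" using e by blast
    then have "lamhat n \<omega> = l" using l by simp
    then have le: "\<bar>lamhat n \<omega> - lam - (\<Sum>h=1..d. acf_weight lam d h * (rho_hat Y n h \<omega> - exp (- lam * real h)))\<bar> \<le> C * (\<eta> n \<omega>)\<^sup>2"
      using e l(1) by blast
    have "sqrt n * (lamhat n \<omega> - lam) - (\<Sum>h=1..d. acf_weight lam d h * R h n \<omega>) =
       sqrt n * (lamhat n \<omega> - lam - (\<Sum>h=1..d. acf_weight lam d h * (rho_hat Y n h \<omega> - exp (- lam * real h))))"
      by (simp add: R_def right_diff_distrib sum_distrib_left mult.left_commute)
    also have "\<bar>\<dots>\<bar> \<le> sqrt n * (C * (\<eta> n \<omega>)\<^sup>2)"
      unfolding abs_mult using le by (intro mult_mono) auto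
    also have "\<dots> = C * (\<eta> n \<omega> * (\<Sum>h=1..d. \<bar>R h n \<omega>\<bar>))" unfolding sq by (simp add: power2_eq_square)
    also have "\<dots> \<le> \<bar>\<dots>\<bar>" by (rule abs_ge_self)
    finally show "\<bar>sqrt n * (lamhat n \<omega> - lam) - (\<Sum>h=1..d. acf_weight lam d h * R h n \<omega>)\<bar> \<le> \<bar>C * (\<eta> n \<omega> * (\<Sum>h=1..d. \<bar>R h n \<omega>\<bar>))\<bar>" .
  qed measurable
qed

abbreviation J :: "3 \<Rightarrow> nat \<Rightarrow> real" where "J \<equiv> H_jacobian lam d (\<sigma>2 / 2)"

definition limit_vec :: "nat \<Rightarrow> 'a \<Rightarrow> real^3" where
  "limit_vec n \<omega> = (\<chi> j. \<Sum>k<d + 2. J j k * T k n \<omega>)"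

definition error_vec :: "nat \<Rightarrow> 'a \<Rightarrow> real^3" where
  "error_vec n \<omega> = sqrt (real n) *\<^sub>R
     (vector [mu_hat Y n \<omega>, sigma2_hat Y n \<omega>, lamhat n \<omega>] - vector [\<mu>, \<sigma>2, lam])"

lemma limit_vec_component:
  "limit_vec n \<omega> $ 1 = T 0 n \<omega>" "limit_vec n \<omega> $ 2 = 2 * T 1 n \<omega>"
  "limit_vec n \<omega> $ 3 = (\<Sum>h=1..d. acf_weight lam d h * ((T (Suc h) n \<omega> - exp (- lam * real h) * T 1 n \<omega>) / S.\<gamma>0))"
proof -
  have "(\<Sum>k<d + 2. J 1 k * T k n \<omega>) = (\<Sum>k<d + 2. if k = 0 then T k n \<omega> else 0)"
    by (rule sum.cong) (auto simp: H_jacobian_def)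
  then show "limit_vec n \<omega> $ 1 = T 0 n \<omega>" by (simp add: limit_vec_def)
  have "(\<Sum>k<d + 2. J 2 k * T k n \<omega>) = (\<Sum>k<d + 2. if k = 1 then 2 * T k n \<omega> else 0)"
    by (rule sum.cong) (auto simp: H_jacobian_def)
  then show "limit_vec n \<omega> $ 2 = 2 * T 1 n \<omega>" by (simp add: limit_vec_def)
  have set_eq: "{..<d + 2} = insert 0 (insert 1 (Suc ` {1..d}))"
  proof -
    have "k \<in> insert 0 (insert 1 (Suc ` {1..d}))" if "k < d + 2" for k
      using that by (cases k) (auto simp: image_iff)
    then show ?thesis by auto
  qed
  have "(\<Sum>k<d + 2. J 3 k * T k n \<omega>) = J 3 0 * T 0 n \<omega> + (J 3 1 * T 1 n \<omega> + (\<Sum>h=1..d. J 3 (Suc h) * T (Suc h) n \<omega>))"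
    unfolding set_eq by (simp add: sum.reindex image_iff del: image_Suc_atLeastAtMost)
  also have "J 3 0 = 0" by (simp add: H_jacobian_def)
  also have "J 3 1 = - (\<Sum>h=1..d. acf_weight lam d h * exp (- lam * real h)) / S.\<gamma>0"
    by (simp add: H_jacobian_def \<gamma>0)
  also have "(\<Sum>h=1..d. J 3 (Suc h) * T (Suc h) n \<omega>) = (\<Sum>h=1..d. acf_weight lam d h / S.\<gamma>0 * T (Suc h) n \<omega>)"
    by (rule sum.cong) (auto simp: H_jacobian_def \<gamma>0)
  finally have "(\<Sum>k<d + 2. J 3 k * T k n \<omega>) = - (\<Sum>h=1..d. acf_weight lam d h * exp (- lam * real h)) / S.\<gamma>0 * T 1 n \<omega>
      + (\<Sum>h=1..d. acf_weight lam d h / S.\<gamma>0 * T (Suc h) n \<omega>)" by simp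
  also have "\<dots> = (\<Sum>h=1..d. acf_weight lam d h * ((T (Suc h) n \<omega> - exp (- lam * real h) * T 1 n \<omega>) / S.\<gamma>0))"
    unfolding sum_negf[symmetric] sum_divide_distrib sum_distrib_right sum.distrib[symmetric]
    by (intro sum.cong refl) (simp add: diff_divide_distrib algebra_simps)
  finally show "limit_vec n \<omega> $ 3 = (\<Sum>h=1..d. acf_weight lam d h * ((T (Suc h) n \<omega> - exp (- lam * real h) * T 1 n \<omega>) / S.\<gamma>0))"
    by (simp add: limit_vec_def)
qed

lemma sigma2_hat_measurable[measurable]: "sigma2_hat Y n \<in> borel_measurable M"
  unfolding sigma2_hat_def[abs_def] by measurable

lemma error_vec_component:
  "error_vec n \<omega> $ 1 = T 0 n \<omega>" "error_vec n \<omega> $ 2 = 2 * G 0 n \<omega>"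
  "error_vec n \<omega> $ 3 = sqrt n * (lamhat n \<omega> - lam)"
proof -
  show "error_vec n \<omega> $ 1 = T 0 n \<omega>" by (simp add: error_vec_def mu_hat_T)
  have "sigma2_hat Y n \<omega> = 2 * gamma_hat Y n 0 \<omega>"
    by (simp add: sigma2_hat_def gamma_hat_def power2_eq_square)
  then show "error_vec n \<omega> $ 2 = 2 * G 0 n \<omega>" by (simp add: error_vec_def G_def \<gamma>0 algebra_simps)
  show "error_vec n \<omega> $ 3 = sqrt n * (lamhat n \<omega> - lam)" by (simp add: error_vec_def)
qed

lemma component_small: "small_in_prob (\<lambda>n \<omega>. error_vec n \<omega> $ j - limit_vec n \<omega> $ j)"
proof -
  consider "j = 1" | "j = 2" | "j = 3" using exhaust_3[of j] by blast
  then show ?thesis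
  proof cases
    case 1
    then show ?thesis by (simp add: error_vec_component limit_vec_component small_in_prob_zero)
  next
    case 2
    then show ?thesis using small_in_prob_cmult[OF G_T_small[of 0], of 2]
      by (simp add: error_vec_component limit_vec_component right_diff_distrib)
  next
    case 3
    have "small_in_prob (\<lambda>n \<omega>. \<Sum>h=1..d. acf_weight lam d h * (R h n \<omega> - (T (Suc h) n \<omega> - exp (- lam * real h) * T 1 n \<omega>) / S.\<gamma>0))"
      by (intro small_in_prob_sum small_in_prob_cmult R_T_small)
    from small_in_prob_add[OF lamhat_R_small this] show ?thesis
      unfolding 3 error_vec_component limit_vec_component right_diff_distrib[of "acf_weight lam d _"] sum_subtractf
      by simp
  qed
qed

lemma limit_vec_measurable[measurable]: "limit_vec n \<in> borel_measurable M"
  by (rule vec3_measurable) (simp add: limit_vec_def)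

lemma error_vec_measurable[measurable]: "error_vec n \<in> borel_measurable M"
proof (rule vec3_measurable)
  fix j :: 3
  consider "j = 1" | "j = 2" | "j = 3" using exhaust_3[of j] by blast
  then show "(\<lambda>\<omega>. error_vec n \<omega> $ j) \<in> borel_measurable M"
    by cases (simp_all add: error_vec_component)
qed

text \<open>The Cramer-Wold device: each scalar projection of the linearized error is a linear
  combination of the sums \<open>T\<close>, whose limit has the same quadratic form as the projected
  normal law. The actual error differs by something small in probability.\<close>

theorem estimator_limit:
  "\<exists>J N. has_jacobian (d + 2) (H_map d) (OU_point M Y \<mu>) J \<and>
    multivariate_normal {..<d + 2} (\<lambda>_. 0) (Sigma_mat M Y \<mu>) N \<and>
    weak_converges (\<lambda>n. distr M borel (error_vec n)) (distr N borel (\<lambda>x. \<chi> j. \<Sum>k<d + 2. J j k * x k))"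
proof -
  have jac: "has_jacobian (d + 2) (H_map d) (OU_point M Y \<mu>) J"
    by (rule H_map_has_jacobian[OF lam d]) (use \<sigma>2 OU_point_Suc in auto)
  have "\<exists>N. multivariate_normal {..<d + 2} (\<lambda>_. 0) (Sigma_mat M Y \<mu>) N"
    unfolding Sigma_mat_eq[abs_def] by (rule multivariate_normal_exists[OF finite_lessThan]) (rule S.linear_combination_CLT(1))
  then obtain N where N: "multivariate_normal {..<d + 2} (\<lambda>_. 0) (Sigma_mat M Y \<mu>) N" by blast
  interpret N: prob_space N using N by (simp add: multivariate_normal_def)
  have setsN: "sets N = sets (Pi\<^sub>M {..<d + 2} (\<lambda>_. borel))" using N by (simp add: multivariate_normal_def)
  have comp[measurable]: "(\<lambda>x. x k) \<in> borel_measurable N" if "k < d + 2" for k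
  proof -
    have "(\<lambda>x. x k) \<in> borel_measurable (Pi\<^sub>M {..<d + 2} (\<lambda>_. borel))"
      using that by (intro measurable_component_singleton) auto
    then show ?thesis using setsN measurable_cong_sets by blast
  qed
  have sum_meas: "(\<lambda>x. \<Sum>k<d + 2. c k * x k) \<in> borel_measurable N" for c :: "nat \<Rightarrow> real"
    by (intro borel_measurable_sum borel_measurable_times borel_measurable_const comp) auto
  have f: "(\<lambda>x. \<chi> j. \<Sum>k<d + 2. J j k * x k) \<in> measurable N borel"
    by (rule vec3_measurable) (simp add: sum_meas del: sum.lessThan_Suc add_2_eq_Suc')
  have "weak_converges (\<lambda>n. distr M borel (error_vec n)) (distr N borel (\<lambda>x. \<chi> j. \<Sum>k<d + 2. J j k * x k))"
  proof (rule weak_converges_distr[where X = limit_vec])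
    show "prob_space (distr N borel (\<lambda>x. \<chi> j. \<Sum>k<d + 2. J j k * x k))" by (rule N.prob_space_distr[OF f])
    have "bounded_in_prob (\<lambda>n \<omega>. \<Sum>j\<in>UNIV. \<bar>\<Sum>k<d + 2. J j k * T k n \<omega>\<bar>)"
      by (intro bounded_in_prob_sum bounded_in_prob_abs bounded_in_prob_mult[OF bounded_in_prob_const] T_bounded)
    then show "bounded_in_prob (\<lambda>n \<omega>. norm (limit_vec n \<omega>))"
    proof (rule bounded_in_prob_mono)
      fix n \<omega>
      have "norm (limit_vec n \<omega>) \<le> (\<Sum>j\<in>UNIV. \<bar>limit_vec n \<omega> $ j\<bar>)" by (rule norm_le_l1_cart)
      also have "\<dots> = (\<Sum>j\<in>UNIV. \<bar>\<Sum>k<d + 2. J j k * T k n \<omega>\<bar>)" by (simp add: limit_vec_def)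
      finally show "\<bar>norm (limit_vec n \<omega>)\<bar> \<le> \<bar>\<Sum>j\<in>UNIV. \<bar>\<Sum>k<d + 2. J j k * T k n \<omega>\<bar>\<bar>" by simp
    qed measurable
    have "small_in_prob (\<lambda>n \<omega>. \<Sum>j\<in>UNIV. \<bar>error_vec n \<omega> $ j - limit_vec n \<omega> $ j\<bar>)"
      by (intro small_in_prob_sum small_in_prob_abs component_small)
    then show "small_in_prob (\<lambda>n \<omega>. norm (error_vec n \<omega> - limit_vec n \<omega>))"
    proof (rule small_in_prob_mono)
      fix n \<omega>
      show "\<bar>norm (error_vec n \<omega> - limit_vec n \<omega>)\<bar> \<le> \<bar>\<Sum>j\<in>UNIV. \<bar>error_vec n \<omega> $ j - limit_vec n \<omega> $ j\<bar>\<bar>"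
        using norm_le_l1_cart[of "error_vec n \<omega> - limit_vec n \<omega>"] by simp
    qed measurable
    fix u :: "real^3"
    \<comment> \<open>The transposed Jacobian applied to \<open>u\<close>.\<close>
    define b where "b k = (\<Sum>j\<in>UNIV. u $ j * J j k)" for k
    have dot: "u \<bullet> (\<chi> j. \<Sum>k<d + 2. J j k * z k) = (\<Sum>k<d + 2. b k * z k)" for z
      unfolding inner_vec_def b_def sum_distrib_right inner_real_def vec_lambda_beta sum_distrib_left
      by (subst sum.swap) (simp add: mult.assoc)
    define V where "V = (\<Sum>k<d + 2. \<Sum>l<d + 2. b k * S.long_run_cov k l * b l)"
    have "(\<lambda>n. CLINT \<omega>|M. iexp (u \<bullet> limit_vec n \<omega>)) \<longlonglongrightarrow> complex_of_real (exp (- (V / 2)))"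
      unfolding limit_vec_def dot unfolding linear_combination_T V_def by (rule S.linear_combination_CLT(2))
    moreover have "(CLINT x|distr N borel (\<lambda>x. \<chi> j. \<Sum>k<d + 2. J j k * x k). iexp (u \<bullet> x)) = complex_of_real (exp (- (V / 2)))"
    proof -
      have "(CLINT x|distr N borel (\<lambda>x. \<chi> j. \<Sum>k<d + 2. J j k * x k). iexp (u \<bullet> x)) = (CLINT x|N. iexp (\<Sum>k<d + 2. b k * x k))"
        unfolding dot[symmetric] by (rule integral_distr[OF f]) measurable
      also have "\<dots> = exp (\<i> * complex_of_real (\<Sum>k<d + 2. b k * 0)
             - complex_of_real ((\<Sum>k<d + 2. \<Sum>l<d + 2. b k * Sigma_mat M Y \<mu> k l * b l) / 2))"
        using N unfolding multivariate_normal_def by blast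
      also have "\<dots> = exp (complex_of_real (- (V / 2)))" by (simp add: V_def Sigma_mat_eq)
      finally show ?thesis by (simp only: exp_of_real)
    qed
    ultimately show "(\<lambda>n. CLINT \<omega>|M. iexp (u \<bullet> limit_vec n \<omega>)) \<longlonglongrightarrow>
        (CLINT x|distr N borel (\<lambda>x. \<chi> j. \<Sum>k<d + 2. J j k * x k). iexp (u \<bullet> x))" by simp
  qed auto
  with jac N show ?thesis by blast
qed

end

text \<open>The existential quantifiers lose nothing: the relevant columns of \<open>J\<close> are
  determined as partial derivatives, and \<open>N\<close> by its characteristic function. A positive
  lag is required because for \<open>d = 0\<close> the criterion is an empty sum, minimized
  everywhere; a positive variance makes the ratios to lag 0 meaningful at the limit point.\<close>

theorem theorem4p3:
  fixes M :: "'a measure" and L Y :: "real \<Rightarrow> 'a \<Rightarrow> real"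
    and b c :: real and F_L :: "real measure"
    and lam \<mu> \<sigma>2 :: real and d :: nat and lamhat :: "nat \<Rightarrow> 'a \<Rightarrow> real"
  assumes "prob_space M"
    and "levy_process M L"
    and "has_levy_triplet M L b c F_L"
    and "\<exists>K>0. \<forall>v. \<bar>v\<bar> \<le> K \<longrightarrow> set_integrable F_L {x. \<bar>x\<bar> > 1} (\<lambda>x. exp (v * x))"
    and "\<mu> = mean M (L 1)"
    and "\<sigma>2 = cov M (L 1) (L 1)"
    and "\<sigma>2 > 0"
    and "lam > 0"
    and "stationary_levy_OU M L lam Y"
    and "\<exists>\<delta>>0. integrable M (\<lambda>\<omega>. \<bar>Y 0 \<omega>\<bar> powr (4 + \<delta>))"
    and "d \<ge> 1"
    and "is_lambda2_hat M Y d lamhat"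
  shows "\<exists>J N.
    has_jacobian (d + 2) (H_map d) (OU_point M Y \<mu>) J \<and>
    multivariate_normal {..<d + 2} (\<lambda>_. 0) (Sigma_mat M Y \<mu>) N \<and>
    weak_converges
      (\<lambda>n. distr M borel (\<lambda>\<omega>. sqrt (real n) *\<^sub>R
         (vector [mu_hat Y n \<omega>, sigma2_hat Y n \<omega>, lamhat n \<omega>] - vector [\<mu>, \<sigma>2, lam] :: real^3)))
      (distr N borel (\<lambda>x. \<chi> j. \<Sum>k<d + 2. J j k * x k))"
proof -
  interpret prob_space M by fact
  interpret O: levy_OU M L Y lam by unfold_locales (use assms in auto)
  obtain \<delta> where "\<delta> > 0" "integrable M (\<lambda>\<omega>. \<bar>Y 0 \<omega>\<bar> powr (4 + \<delta>))" using assms(10) by blast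
  then have p: "4 + \<delta> > 4" "integrable M (\<lambda>\<omega>. \<bar>Y 0 \<omega>\<bar> powr (4 + \<delta>))" by auto
  note ar = O.stationary_ar1[OF assms(3,5,6,7) p]
  interpret E: levy_OU_estimation M L Y lam \<mu> \<sigma>2 "4 + \<delta>" d lamhat
      "\<lambda>k \<omega>. Y (real k) \<omega> - \<mu>" "\<lambda>k \<omega>. O.innov k \<omega> - (1 - exp (- lam)) * \<mu>"
    by (intro levy_OU_estimation.intro levy_OU_estimation_axioms.intro O.levy_OU_axioms ar assms refl)
  show ?thesis using E.estimator_limit unfolding E.error_vec_def[abs_def] .
qed

end
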